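(* Let $\mathbb P$ be a forcing notion and $\pi:\mathbb{M}[\vec{U}]\rightarrow \mathbb{P}$ a projection, let $G\subseteq\mathbb{M}[\vec{U}]$ be $V$-generic and let $H=\pi_*(G)$ be the induced $V$-generic filter for $\mathbb{P}$. Then, in $V[G]$, the quotient forcing $\mathbb{M}[\vec{U}]/H$ is $\kappa^+$-cc.
   Context: $\vec U=\langle U(\alpha,\beta)\mid \alpha\le\kappa,\ \beta<o^{\vec U}(\alpha)\rangle$ is a coherent sequence of normal measures (for $j=j_{U(\alpha,\beta)}$, $j(\vec U)\restriction(\alpha+1)=\langle U(\alpha',\beta')\mid \alpha'<\alpha,\beta'<o^{\vec U}(\alpha')\text{ or }\alpha'=\alpha,\beta'<\beta\rangle$) with maximal measurable $\kappa$; $\bigcap\vec U(\alpha)=\bigcap_{i<o^{\vec U}(\alpha)}U(\alpha,i)$. Magidor forcing $\mathbb M[\vec U]$: conditions $p=\langle t_1,\dots,t_n,\langle\kappa,B\rangle\rangle$, each $t_i$ an ordinal $\kappa_i$ with $o^{\vec U}(\kappa_i)=0$ or a pair $\langle\kappa_i,B_i\rangle$ with $o^{\vec U}(\kappa_i)>0$, $\kappa_1<\dots<\kappa_n<\kappa$, $B_i\in\bigcap\vec U(\kappa_i)$, $\min B_i>\kappa_{i-1}$, $B\in\bigcap\vec U(\kappa)$, $\min B>\kappa_n$; with $\kappa(t_i)=\kappa_i$, $B(t_i)=B_i$ ($\emptyset$ for ordinals), $t_{n+1}=\langle\kappa,B\rangle$, for $q=\langle s_1,\dots,s_m,\langle\kappa,C\rangle\rangle$,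 $p\le q$ ($q$ stronger) iff $n\le m$, $C\subseteq B$, and there are $i_1<\dots<i_n$ with $\kappa(s_{i_r})=\kappa(t_r)$, $B(s_{i_r})\subseteq B(t_r)$, and for other $j$ with $i_{r-1}<j<i_r$ ($i_0=0,i_{n+1}=m+1$), $\kappa(s_j)\in B(t_r)$, $B(s_j)\subseteq B(t_r)\cap\kappa(s_j)$. Larger means stronger in all forcings. A map $\tau:\mathbb P_1\to\mathbb Q$ is a projection if it is order preserving, its image is dense, and for every $p\in\mathbb P_1$ and $q\ge\tau(p)$ there is $p'\ge p$ with $\tau(p')\ge q$. For $G$ generic, $\pi_*(G)=\{q\in\mathbb P\mid \exists p\in G\ (q\le\pi(p))\}$, and the quotient is $\mathbb M[\vec U]/H=\pi^{-1}[H]$ with the order inherited from $\mathbb M[\vec U]$. $\kappa^+$-cc means every antichain has size $<\kappa^+$. *)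

theory Defs
  imports Main
begin

section \<open>The ambient universe\<close>

text \<open>
  A type with a well-founded extensional membership relation.  No closure property is assumed
  of it: it only has to be large enough to contain the ground model and its generic extension
  as transitive subclasses.  (Every well-founded extensional structure is of this form, up to
  isomorphism.)
\<close>

class set_universe =
  fixes mem :: "'a \<Rightarrow> 'a \<Rightarrow> bool"  (infix "\<epsilon>" 50)
  assumes wf_mem: "wf {(x, y). x \<epsilon> y}"
    and mem_ext: "(\<And>z. z \<epsilon> x \<longleftrightarrow> z \<epsilon> y) \<Longrightarrow> x = y"

definition elts :: "'s::set_universe \<Rightarrow> 's set" where
  "elts x = {y. y \<epsilon> x}"

text \<open>Kuratowski pairs.\<close>

definition is_pair :: "'s::set_universe \<Rightarrow> 's \<Rightarrow> 's \<Rightarrow> bool" where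
  "is_pair z a b \<longleftrightarrow> (\<exists>s t. elts z = {s, t} \<and> elts s = {a} \<and> elts t = {a, b})"

definition rel_of :: "'s::set_universe \<Rightarrow> ('s \<times> 's) set" where
  "rel_of r = {(a, b). \<exists>z \<in> elts r. is_pair z a b}"

definition is_function :: "'s::set_universe \<Rightarrow> 's set \<Rightarrow> bool" where
  "is_function f A \<longleftrightarrow>
     (\<forall>z \<in> elts f. \<exists>x y. is_pair z x y) \<and> single_valued (rel_of f) \<and> Domain (rel_of f) = A"

definition app :: "'s::set_universe \<Rightarrow> 's \<Rightarrow> 's" where
  "app f x = (THE y. (x, y) \<in> rel_of f)"

text \<open>Von Neumann ordinals; the order between ordinals is \<open>\<epsilon>\<close>.\<close>

definition Ord :: "'s::set_universe \<Rightarrow> bool" where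
  "Ord \<alpha> \<longleftrightarrow> (\<forall>x \<in> elts \<alpha>. elts x \<subseteq> elts \<alpha> \<and> (\<forall>y \<in> elts x. elts y \<subseteq> elts x))"

fun is_numeral :: "nat \<Rightarrow> 's::set_universe \<Rightarrow> bool" where
  "is_numeral 0 x \<longleftrightarrow> elts x = {}"
| "is_numeral (Suc n) x \<longleftrightarrow> (\<exists>y. is_numeral n y \<and> elts x = insert y (elts y))"

text \<open>\<open>is_seq s xs\<close>: the set \<open>s\<close> is the finite sequence \<open>xs\<close>, that is, the function
  \<open>i \<mapsto> xs ! i\<close> on the natural number \<open>length xs\<close>.\<close>

definition is_seq :: "'s::set_universe \<Rightarrow> 's list \<Rightarrow> bool" where
  "is_seq s xs \<longleftrightarrow>
     (\<forall>z \<in> elts s. \<exists>i < length xs. \<exists>k. is_numeral i k \<and> is_pair z k (xs ! i)) \<and>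
     (\<forall>i < length xs. \<exists>z \<in> elts s. \<exists>k. is_numeral i k \<and> is_pair z k (xs ! i))"

section \<open>Transitive models of ZFC\<close>

datatype fm = FMem nat nat | FEq nat nat | FNeg fm | FConj fm fm | FAll nat fm

primrec sat :: "'s::set_universe set \<Rightarrow> (nat \<Rightarrow> 's) \<Rightarrow> fm \<Rightarrow> bool" where
  "sat M e (FMem i j) \<longleftrightarrow> e i \<epsilon> e j"
| "sat M e (FEq i j) \<longleftrightarrow> e i = e j"
| "sat M e (FNeg \<phi>) \<longleftrightarrow> \<not> sat M e \<phi>"
| "sat M e (FConj \<phi> \<psi>) \<longleftrightarrow> sat M e \<phi> \<and> sat M e \<psi>"
| "sat M e (FAll i \<phi>) \<longleftrightarrow> (\<forall>x \<in> M. sat M (e(i := x)) \<phi>)"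

text \<open>
  Extensionality and Foundation hold in every transitive subclass of the universe.  The other
  axioms are written as their relativisations to the transitive class \<open>M\<close>; Separation and
  Replacement are first-order schemes, with the values of \<open>e\<close> as parameters.
\<close>

definition transitive_class :: "'s::set_universe set \<Rightarrow> bool" where
  "transitive_class M \<longleftrightarrow> (\<forall>x \<in> M. elts x \<subseteq> M)"

definition model_ZFC :: "'s::set_universe set \<Rightarrow> bool" where
  "model_ZFC M \<longleftrightarrow>
     transitive_class M \<and>
     \<comment> \<open>Pairing, Union, Power set, Infinity\<close>
     (\<forall>a \<in> M. \<forall>b \<in> M. \<exists>c \<in> M. elts c = {a, b}) \<and>
     (\<forall>a \<in> M. \<exists>u \<in> M. elts u = \<Union> (elts ` elts a)) \<and>
     (\<forall>a \<in> M. \<exists>p \<in> M. elts p = {x \<in> M. elts x \<subseteq> elts a}) \<and>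
     (\<exists>w \<in> M. (\<exists>z \<in> elts w. elts z = {}) \<and>
        (\<forall>x \<in> elts w. \<exists>s \<in> elts w. elts s = insert x (elts x))) \<and>
     \<comment> \<open>Separation\<close>
     (\<forall>\<phi> e. \<forall>a \<in> M. (\<forall>i. e i \<in> M) \<longrightarrow>
        (\<exists>b \<in> M. elts b = {x \<in> elts a. sat M (e(0 := x)) \<phi>})) \<and>
     \<comment> \<open>Replacement\<close>
     (\<forall>\<phi> e. \<forall>a \<in> M. (\<forall>i. e i \<in> M) \<and>
        (\<forall>x \<in> elts a. \<exists>!y. y \<in> M \<and> sat M (e(0 := x, 1 := y)) \<phi>) \<longrightarrow>
        (\<exists>b \<in> M. elts b = {y \<in> M. \<exists>x \<in> elts a. sat M (e(0 := x, 1 := y)) \<phi>})) \<and>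
     \<comment> \<open>Choice\<close>
     (\<forall>a \<in> M. (\<forall>x \<in> elts a. elts x \<noteq> {}) \<and>
        (\<forall>x \<in> elts a. \<forall>y \<in> elts a. x \<noteq> y \<longrightarrow> elts x \<inter> elts y = {}) \<longrightarrow>
        (\<exists>c \<in> M. \<forall>x \<in> elts a. \<exists>z. elts c \<inter> elts x = {z}))"

subsection \<open>Cardinals of a transitive model\<close>

definition equipotent :: "'s::set_universe set \<Rightarrow> 's \<Rightarrow> 's \<Rightarrow> bool" where
  "equipotent M a b \<longleftrightarrow> (\<exists>f \<in> M. is_function f (elts a) \<and> bij_betw (app f) (elts a) (elts b))"

definition has_card :: "'s::set_universe set \<Rightarrow> 's \<Rightarrow> 's \<Rightarrow> bool" where
  "has_card M a \<mu> \<longleftrightarrow>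
     \<mu> \<in> M \<and> Ord \<mu> \<and> equipotent M a \<mu> \<and> (\<forall>\<nu> \<in> elts \<mu>. \<not> equipotent M a \<nu>)"

definition is_cardinal :: "'s::set_universe set \<Rightarrow> 's \<Rightarrow> bool" where
  "is_cardinal M \<mu> \<longleftrightarrow> \<mu> \<in> M \<and> Ord \<mu> \<and> (\<forall>\<nu> \<in> elts \<mu>. \<not> equipotent M \<mu> \<nu>)"

definition is_succ_card :: "'s::set_universe set \<Rightarrow> 's \<Rightarrow> 's \<Rightarrow> bool" where
  "is_succ_card M \<kappa> \<nu> \<longleftrightarrow>
     is_cardinal M \<nu> \<and> \<kappa> \<epsilon> \<nu> \<and> (\<forall>\<mu>. is_cardinal M \<mu> \<and> \<kappa> \<epsilon> \<mu> \<longrightarrow> \<nu> = \<mu> \<or> \<nu> \<epsilon> \<mu>)"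

section \<open>Coherent sequences of normal measures\<close>

text \<open>
  \<open>W\<close> is, in \<open>V\<close>, a normal measure on \<open>\<alpha>\<close>: a nonprincipal \<open>\<alpha>\<close>-complete ultrafilter on the
  uncountable cardinal \<open>\<alpha>\<close> that is closed under diagonal intersections.  As \<open>V\<close> is
  well-founded, its infinite ordinals are the ordinals with infinitely many elements.
\<close>

definition normal_measure :: "'s::set_universe set \<Rightarrow> 's \<Rightarrow> 's \<Rightarrow> bool" where
  "normal_measure V \<alpha> W \<longleftrightarrow>
     is_cardinal V \<alpha> \<and> (\<exists>w \<in> elts \<alpha>. infinite (elts w)) \<and>
     W \<in> V \<and> (\<forall>X \<in> elts W. elts X \<subseteq> elts \<alpha> \<and> elts X \<noteq> {}) \<and>
     (\<forall>X \<in> elts W. \<forall>Y \<in> V. elts X \<subseteq> elts Y \<and> elts Y \<subseteq> elts \<alpha> \<longrightarrow> Y \<epsilon> W) \<and>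
     (\<forall>X \<in> V. \<forall>Y \<in> V. elts X \<subseteq> elts \<alpha> \<and> elts Y = elts \<alpha> - elts X \<longrightarrow> X \<epsilon> W \<or> Y \<epsilon> W) \<and>
     (\<forall>\<xi> \<in> elts \<alpha>. \<forall>X \<in> elts W. elts X \<noteq> {\<xi>}) \<and>
     (\<forall>\<delta> \<in> elts \<alpha>. \<forall>f \<in> V. is_function f (elts \<delta>) \<and> (\<forall>\<xi> \<in> elts \<delta>. app f \<xi> \<epsilon> W) \<longrightarrow>
        (\<exists>X \<in> elts W. elts X = {\<eta> \<in> elts \<alpha>. \<forall>\<xi> \<in> elts \<delta>. \<eta> \<epsilon> app f \<xi>})) \<and>
     (\<forall>f \<in> V. is_function f (elts \<alpha>) \<and> (\<forall>\<xi> \<in> elts \<alpha>. app f \<xi> \<epsilon> W) \<longrightarrow>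
        (\<exists>X \<in> elts W. elts X = {\<eta> \<in> elts \<alpha>. \<forall>\<xi> \<in> elts \<eta>. \<eta> \<epsilon> app f \<xi>}))"

text \<open>
  \<open>j\<close> is the ultrapower embedding \<open>j\<^sub>W : V \<rightarrow> Ult(V, W)\<close>.  Here \<open>cl f\<close> is the image of the class
  of \<open>f\<close> under the transitive collapse of the ultrapower, and \<open>j x\<close> is the image of the class of
  the constant function with value \<open>x\<close>.
\<close>

definition ultrapower_embedding ::
    "'s::set_universe set \<Rightarrow> 's \<Rightarrow> 's \<Rightarrow> ('s \<Rightarrow> 's) \<Rightarrow> bool" where
  "ultrapower_embedding V \<alpha> W j \<longleftrightarrow>
     (\<exists>cl.
       (\<forall>f \<in> V. is_function f (elts \<alpha>) \<longrightarrow>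
          elts (cl f) =
            {cl g | g. g \<in> V \<and> is_function g (elts \<alpha>) \<and>
               (\<exists>X \<in> elts W. elts X = {\<xi> \<in> elts \<alpha>. app g \<xi> \<epsilon> app f \<xi>})}) \<and>
       (\<forall>x \<in> V. \<forall>c \<in> V. is_function c (elts \<alpha>) \<and> (\<forall>\<xi> \<in> elts \<alpha>. app c \<xi> = x) \<longrightarrow> j x = cl c))"

text \<open>A doubly indexed sequence \<open>U\<close> is a function on a set of ordered pairs;
  \<open>((\<alpha>, \<beta>), X) \<in> entries U\<close> says that \<open>U(\<alpha>, \<beta>)\<close> is defined and equals \<open>X\<close>.\<close>

definition entries :: "'s::set_universe \<Rightarrow> (('s \<times> 's) \<times> 's) set" where
  "entries U = {((\<alpha>, \<beta>), X). \<exists>i. is_pair i \<alpha> \<beta> \<and> (i, X) \<in> rel_of U}"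

definition o_len :: "'s::set_universe \<Rightarrow> 's \<Rightarrow> 's" where
  "o_len U \<alpha> = (THE \<gamma>. Ord \<gamma> \<and> elts \<gamma> = {\<beta>. \<exists>X. ((\<alpha>, \<beta>), X) \<in> entries U})"

definition index_shape :: "'s::set_universe set \<Rightarrow> 's \<Rightarrow> 's \<Rightarrow> bool" where
  "index_shape V \<kappa> U \<longleftrightarrow>
     U \<in> V \<and> is_function U (Domain (rel_of U)) \<and>
     (\<forall>i \<in> Domain (rel_of U). \<exists>\<alpha> \<beta>. is_pair i \<alpha> \<beta> \<and> (\<alpha> \<epsilon> \<kappa> \<or> \<alpha> = \<kappa>)) \<and>
     (\<forall>\<alpha>. \<alpha> \<epsilon> \<kappa> \<or> \<alpha> = \<kappa> \<longrightarrow>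
        (\<exists>\<gamma> \<in> V. Ord \<gamma> \<and> elts \<gamma> = {\<beta>. \<exists>X. ((\<alpha>, \<beta>), X) \<in> entries U}))"

text \<open>\<open>\<kappa>\<close> is the maximal measurable of the sequence: the sequence is indexed by \<open>\<alpha> \<le> \<kappa>\<close>
  and there is at least one measure on \<open>\<kappa>\<close>.\<close>

definition coherent_sequence :: "'s::set_universe set \<Rightarrow> 's \<Rightarrow> 's \<Rightarrow> bool" where
  "coherent_sequence V \<kappa> U \<longleftrightarrow>
     \<kappa> \<in> V \<and> Ord \<kappa> \<and> index_shape V \<kappa> U \<and> elts (o_len U \<kappa>) \<noteq> {} \<and>
     (\<forall>\<alpha> \<beta> W. ((\<alpha>, \<beta>), W) \<in> entries U \<longrightarrow>
        normal_measure V \<alpha> W \<and>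
        (\<exists>j. ultrapower_embedding V \<alpha> W j \<and>
           {((\<alpha>', \<beta>'), X) \<in> entries (j U). \<alpha>' \<epsilon> \<alpha> \<or> \<alpha>' = \<alpha>} =
           {((\<alpha>', \<beta>'), X) \<in> entries U. \<alpha>' \<epsilon> \<alpha> \<or> \<alpha>' = \<alpha> \<and> \<beta>' \<epsilon> \<beta>}))"

text \<open>\<open>B \<in> \<Inter>U(\<alpha>)\<close>; only used when \<open>o_len U \<alpha>\<close> is nonzero.\<close>

definition in_all_measures :: "'s::set_universe \<Rightarrow> 's \<Rightarrow> 's \<Rightarrow> bool" where
  "in_all_measures U \<alpha> B \<longleftrightarrow> (\<forall>\<beta> X. ((\<alpha>, \<beta>), X) \<in> entries U \<longrightarrow> B \<epsilon> X)"

section \<open>Magidor forcing\<close>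

text \<open>An entry of a condition is an ordinal or a pair; a Kuratowski pair is never an ordinal,
  since it is nonempty and does not contain the empty set.\<close>

definition kap :: "'s::set_universe \<Rightarrow> 's" where
  "kap t = (if Ord t then t else (THE k. \<exists>B. is_pair t k B))"

definition bset :: "'s::set_universe \<Rightarrow> 's set" where
  "bset t = (if Ord t then {} else elts (THE B. \<exists>k. is_pair t k B))"

text \<open>A condition \<open>\<langle>t\<^sub>1, \<dots>, t\<^sub>n, \<langle>\<kappa>, B\<rangle>\<rangle>\<close> is the list \<open>ts\<close> of length \<open>n + 1\<close>, indexed from \<open>0\<close>;
  its last entry is \<open>t\<^sub>n\<^sub>+\<^sub>1 = \<langle>\<kappa>, B\<rangle>\<close>.  There is no lower bound on the first of the sets.\<close>

definition magidor_list :: "'s::set_universe \<Rightarrow> 's \<Rightarrow> 's list \<Rightarrow> bool" where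
  "magidor_list U \<kappa> ts \<longleftrightarrow>
     ts \<noteq> [] \<and>
     (\<exists>B. is_pair (last ts) \<kappa> B \<and> in_all_measures U \<kappa> B) \<and>
     (\<forall>t \<in> set (butlast ts).
        (Ord t \<and> t \<epsilon> \<kappa> \<and> elts (o_len U t) = {}) \<or>
        (\<exists>k B. is_pair t k B \<and> k \<epsilon> \<kappa> \<and> elts (o_len U k) \<noteq> {} \<and> in_all_measures U k B)) \<and>
     (\<forall>i. Suc i < length ts \<longrightarrow>
        kap (ts ! i) \<epsilon> kap (ts ! Suc i) \<and> (\<forall>\<xi> \<in> bset (ts ! Suc i). kap (ts ! i) \<epsilon> \<xi>))"

definition magidor_list_le :: "'s::set_universe list \<Rightarrow> 's list \<Rightarrow> bool" where
  "magidor_list_le ts ss \<longleftrightarrow>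
     (\<exists>h. strict_mono_on {..<length ts} h \<and> h (length ts - 1) = length ss - 1 \<and>
        (\<forall>r < length ts. h r < length ss \<and>
           kap (ss ! h r) = kap (ts ! r) \<and> bset (ss ! h r) \<subseteq> bset (ts ! r) \<and>
           (\<forall>j < h r. (r = 0 \<or> h (r - 1) < j) \<longrightarrow>
              kap (ss ! j) \<in> bset (ts ! r) \<and>
              bset (ss ! j) \<subseteq> bset (ts ! r) \<inter> elts (kap (ss ! j)))))"

definition Magidor :: "'s::set_universe set \<Rightarrow> 's \<Rightarrow> 's \<Rightarrow> 's set" where
  "Magidor V \<kappa> U = {p \<in> V. \<exists>ts. is_seq p ts \<and> magidor_list U \<kappa> ts}"

definition magidor_le :: "'s::set_universe \<Rightarrow> 's \<Rightarrow> bool" where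
  "magidor_le p q \<longleftrightarrow> (\<exists>ts ss. is_seq p ts \<and> is_seq q ss \<and> magidor_list_le ts ss)"

section \<open>Forcing notions, projections and quotients\<close>

text \<open>\<open>le p q\<close> means that \<open>q\<close> is stronger than \<open>p\<close>.\<close>

definition preorder_forcing :: "'p set \<Rightarrow> ('p \<Rightarrow> 'p \<Rightarrow> bool) \<Rightarrow> bool" where
  "preorder_forcing P le \<longleftrightarrow>
     P \<noteq> {} \<and> (\<forall>p \<in> P. le p p) \<and>
     (\<forall>p \<in> P. \<forall>q \<in> P. \<forall>r \<in> P. le p q \<and> le q r \<longrightarrow> le p r)"

definition dense_in :: "'p set \<Rightarrow> ('p \<Rightarrow> 'p \<Rightarrow> bool) \<Rightarrow> 'p set \<Rightarrow> bool" where
  "dense_in P le D \<longleftrightarrow> D \<subseteq> P \<and> (\<forall>p \<in> P. \<exists>d \<in> D. le p d)"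

definition is_projection ::
    "'p set \<Rightarrow> ('p \<Rightarrow> 'p \<Rightarrow> bool) \<Rightarrow> 'q set \<Rightarrow> ('q \<Rightarrow> 'q \<Rightarrow> bool) \<Rightarrow> ('p \<Rightarrow> 'q) \<Rightarrow> bool" where
  "is_projection P leP Q leQ \<pi> \<longleftrightarrow>
     \<pi> ` P \<subseteq> Q \<and>
     (\<forall>p \<in> P. \<forall>p' \<in> P. leP p p' \<longrightarrow> leQ (\<pi> p) (\<pi> p')) \<and>
     dense_in Q leQ (\<pi> ` P) \<and>
     (\<forall>p \<in> P. \<forall>q \<in> Q. leQ (\<pi> p) q \<longrightarrow> (\<exists>p' \<in> P. leP p p' \<and> leQ q (\<pi> p')))"

definition generic_filter ::
    "'s::set_universe set \<Rightarrow> 's set \<Rightarrow> ('s \<Rightarrow> 's \<Rightarrow> bool) \<Rightarrow> 's set \<Rightarrow> bool" where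
  "generic_filter V P le G \<longleftrightarrow>
     G \<subseteq> P \<and> G \<noteq> {} \<and>
     (\<forall>p \<in> G. \<forall>q \<in> P. le q p \<longrightarrow> q \<in> G) \<and>
     (\<forall>p \<in> G. \<forall>q \<in> G. \<exists>r \<in> G. le p r \<and> le q r) \<and>
     (\<forall>d \<in> V. dense_in P le (elts d) \<longrightarrow> G \<inter> elts d \<noteq> {})"

definition induced_filter ::
    "'q set \<Rightarrow> ('q \<Rightarrow> 'q \<Rightarrow> bool) \<Rightarrow> ('p \<Rightarrow> 'q) \<Rightarrow> 'p set \<Rightarrow> 'q set" where
  "induced_filter Q leQ \<pi> G = {q \<in> Q. \<exists>p \<in> G. leQ q (\<pi> p)}"

definition quotient_forcing :: "'p set \<Rightarrow> ('p \<Rightarrow> 'q) \<Rightarrow> 'q set \<Rightarrow> 'p set" where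
  "quotient_forcing P \<pi> H = {p \<in> P. \<pi> p \<in> H}"

section \<open>Generic extensions\<close>

inductive is_name :: "'s::set_universe set \<Rightarrow> 's \<Rightarrow> bool" for P :: "'s set" where
  "(\<forall>z \<in> elts \<tau>. \<exists>\<sigma> p. is_pair z \<sigma> p \<and> is_name P \<sigma> \<and> p \<in> P) \<Longrightarrow> is_name P \<tau>"

text \<open>
  \<open>N = V[G]\<close>, the class of the values \<open>\<tau>\<^sub>G = {\<sigma>\<^sub>G | \<exists>p \<in> G. \<langle>\<sigma>, p\<rangle> \<in> \<tau>}\<close> of the names \<open>\<tau> \<in> V\<close>.  By
  well-foundedness and extensionality, the recursion determines \<open>val\<close> on these names.
\<close>

definition is_generic_extension ::
    "'s::set_universe set \<Rightarrow> 's set \<Rightarrow> 's set \<Rightarrow> 's set \<Rightarrow> bool" where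
  "is_generic_extension V P G N \<longleftrightarrow>
     (\<exists>val. (\<forall>\<tau> \<in> V. is_name P \<tau> \<longrightarrow>
               elts (val \<tau>) = {val \<sigma> | \<sigma>. \<exists>p \<in> G. (\<sigma>, p) \<in> rel_of \<tau>}) \<and>
            N = {val \<tau> | \<tau>. \<tau> \<in> V \<and> is_name P \<tau>})"

text \<open>Antichains of \<open>Q\<close> are taken with incompatibility in \<open>Q\<close> itself; the sizes and \<open>\<kappa>\<^sup>+\<close> are
  those of the model \<open>N\<close>.\<close>

definition antichain :: "'p set \<Rightarrow> ('p \<Rightarrow> 'p \<Rightarrow> bool) \<Rightarrow> 'p set \<Rightarrow> bool" where
  "antichain Q le A \<longleftrightarrow>
     A \<subseteq> Q \<and> (\<forall>p \<in> A. \<forall>q \<in> A. p \<noteq> q \<longrightarrow> \<not> (\<exists>r \<in> Q. le p r \<and> le q r))"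

definition succ_cc_in ::
    "'s::set_universe set \<Rightarrow> 's \<Rightarrow> 's set \<Rightarrow> ('s \<Rightarrow> 's \<Rightarrow> bool) \<Rightarrow> bool" where
  "succ_cc_in N \<kappa> Q le \<longleftrightarrow>
     (\<exists>\<nu>. is_succ_card N \<kappa> \<nu> \<and>
        (\<forall>a \<in> N. antichain Q le (elts a) \<longrightarrow> (\<exists>\<mu>. has_card N a \<mu> \<and> \<mu> \<epsilon> \<nu>)))"

end

theory Submission
  imports Defs
begin

text \<open>
  Call two conditions \<open>r\<close>, \<open>\<zeta>\<close> compatible over \<open>P\<close> if they have extensions \<open>r'\<close>, \<open>\<zeta>'\<close> with
  \<open>\<pi> r'\<close> above \<open>\<pi> \<zeta>'\<close>, and call a pair of stems good if any two conditions with these stems are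
  compatible over \<open>P\<close>.  If \<open>r\<close> forces \<open>\<xi>\<close> into the quotient, then \<open>r\<close> and \<open>\<xi>\<close> have extensions
  whose stems form a good pair: otherwise choose an incompatible pair of conditions for every pair
  of stems that is not good, shrink the top sets of \<open>r\<close> and \<open>\<xi>\<close> to the diagonal intersection of
  the chosen top sets, and cut the extensions that witness compatibility at a common bound of the
  stems involved; they then extend one of the chosen incompatible pairs.

  Conditions with the same stem are compatible and there are only \<open>\<kappa>\<close> stems.  Hence colouring
  \<open>(r, \<xi>)\<close> by a good pair of stems shows, in \<open>V\<close>, that an antichain of the quotient is covered by a
  set of \<open>V\<close> of size at most \<open>\<kappa>\<close>; colouring by stems shows likewise that \<open>\<kappa>\<^sup>+\<close> of \<open>V\<close> remains a
  cardinal.  Of the forcing theorem only the following is needed: a subset of a ground model set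
  that lies in the extension is \<open>{x. \<exists>r \<in> G. (r, x) \<in> S}\<close> for a relation \<open>S\<close> of \<open>V\<close>.
\<close>

text \<open>Two members of the quotient with the same stem have a common extension, but
  \<open>\<pi>\<close> may send every such extension outside \<open>H\<close>; hence the stem of
  \<xi> alone is no usable colour. A good pair of stems repairs this: the two coordinates of equally
  coloured pairs are joined separately, and goodness then yields a common extension of the two
  members of the antichain together with a condition that forces it into the quotient. A stem
  retains the sets of its entries, so the bound \<kappa> on the number of stems rests on \<kappa>
  being a strong limit. Stems are therefore measured by iterated power sets of
  \<open>\<delta> + 1\<close> with \<open>\<delta>\<close> below \<kappa>: a stem has level 4, a
  pair of stems level 6, and diagonal intersections are indexed by such sets in place of ordinals.
  That the extension satisfies ZFC is never established. Its members are reached only as subsets of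
  ground model sets, through the relations \<open>S\<close>; the bijections that compute
  cardinalities in the extension come from collapses of subsets of \<kappa>, named
  explicitly.\<close>

lemma mem_iff_elts [simp]: "x \<epsilon> y \<longleftrightarrow> x \<in> elts y"
  by (simp add: elts_def)

lemma elts_inject: "elts x = elts y \<longleftrightarrow> x = y"
proof
  assume "elts x = elts y"
  then have "z \<epsilon> x \<longleftrightarrow> z \<epsilon> y" for z by (simp add: set_eq_iff)
  then show "x = y" by (rule mem_ext)
qed simp

lemma inj_elts: "inj elts"
  by (simp add: elts_inject inj_def)

lemma mem_induct [case_names step]:
  assumes "\<And>x. (\<And>y. y \<in> elts x \<Longrightarrow> P y) \<Longrightarrow> P x"
  shows "P (x::'s::set_universe)"
  using wf_mem assms by (induction x rule: wf_induct_rule) auto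

lemma mem_irrefl: "x \<notin> elts x"
  using wf_mem wf_not_refl[of _ x] by fastforce

lemma mem_asym: "x \<in> elts y \<Longrightarrow> y \<notin> elts x"
  using wf_mem wf_not_sym[of _ x y] by fastforce

text \<open>Since \<open>elts\<close> is injective, this form reduces injectivity and uniqueness of
  pairs to equations between sets of sets.\<close>

lemma is_pair_elts: "is_pair z a b \<longleftrightarrow> elts ` elts z = {{a}, {a, b}}"
proof
  assume r: "elts ` elts z = {{a}, {a, b}}"
  then have "{a} \<in> elts ` elts z" "{a, b} \<in> elts ` elts z" by auto
  then obtain s t where st: "s \<in> elts z" "t \<in> elts z" "elts s = {a}" "elts t = {a, b}"
    by (metis imageE)
  have "x = s \<or> x = t" if "x \<in> elts z" for x
  proof -
    have "elts x \<in> {{a}, {a, b}}" using r that by blast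
    then have "elts x = elts s \<or> elts x = elts t" using st by auto
    then show ?thesis by (simp add: elts_inject)
  qed
  then have "elts z = {s, t}" using st by blast
  then show "is_pair z a b" using st by (auto simp: is_pair_def)
qed (auto simp: is_pair_def)

lemma is_pair_inj: "is_pair z a b \<Longrightarrow> is_pair z c d \<Longrightarrow> a = c \<and> b = d"
  unfolding is_pair_elts by (auto simp: doubleton_eq_iff)

lemma is_pair_unique: "is_pair z a b \<Longrightarrow> is_pair z' a b \<Longrightarrow> z = z'"
  unfolding is_pair_elts using inj_image_eq_iff[OF inj_elts, of "elts z" "elts z'"]
  by (simp add: elts_inject)

lemma is_pair_mem: "is_pair z a b \<Longrightarrow> \<exists>t \<in> elts z. a \<in> elts t \<and> b \<in> elts t"
  by (auto simp: is_pair_def)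

section \<open>Ordinals of the ambient universe\<close>

lemma Ord_elt: "Ord a \<Longrightarrow> x \<in> elts a \<Longrightarrow> Ord x"
  unfolding Ord_def by blast

lemma Ord_trans: "Ord c \<Longrightarrow> a \<in> elts b \<Longrightarrow> b \<in> elts c \<Longrightarrow> a \<in> elts c"
  unfolding Ord_def by blast

lemma Ord_linear: "Ord a \<Longrightarrow> Ord b \<Longrightarrow> a \<in> elts b \<or> a = b \<or> b \<in> elts a"
proof (induction a arbitrary: b rule: mem_induct)
  case (step a)
  note IHa = step.IH and oa = step.prems(1)
  from \<open>Ord b\<close> show ?case
  proof (induction b rule: mem_induct)
    case (step b)
    show ?case
    proof (rule ccontr)
      assume c: "\<not> ?case"
      have "x \<in> elts b" if "x \<in> elts a" for x
        using IHa[OF that Ord_elt[OF oa that] \<open>Ord b\<close>] c that oa Ord_trans by blast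
      moreover have "x \<in> elts a" if "x \<in> elts b" for x
        using step.IH[OF that Ord_elt[OF \<open>Ord b\<close> that]] c that \<open>Ord b\<close> Ord_trans by blast
      ultimately have "elts a = elts b" by blast
      then show False using c by (simp add: elts_inject)
    qed
  qed
qed

lemma mem_least:
  assumes "P a" obtains b where "P b" "\<And>c. c \<in> elts b \<Longrightarrow> \<not> P c"
  using assms mem_induct[of "\<lambda>x. \<not> P x"] by blast

text \<open>The ambient universe need not realise a given collection as a set. For a transitive
  subset of an ordinal it does: the least element of \<xi> outside \<open>A\<close>, if there is
  one, has exactly \<open>A\<close> as its elements.\<close>

lemma Ord_initial:
  assumes "Ord \<xi>" "A \<subseteq> elts \<xi>" "\<And>x. x \<in> A \<Longrightarrow> elts x \<subseteq> A"
  shows "\<exists>\<beta>. (\<beta> = \<xi> \<or> \<beta> \<in> elts \<xi>) \<and> elts \<beta> = A"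
proof (cases "A = elts \<xi>")
  case False
  then have "\<exists>a. a \<in> elts \<xi> \<and> a \<notin> A" using assms by blast
  then obtain b where b: "b \<in> elts \<xi>" "b \<notin> A" "\<And>c. c \<in> elts b \<Longrightarrow> \<not> (c \<in> elts \<xi> \<and> c \<notin> A)"
    using mem_least[of "\<lambda>a. a \<in> elts \<xi> \<and> a \<notin> A"] by metis
  have "elts b \<subseteq> A" using b assms(1) Ord_trans by blast
  moreover have "A \<subseteq> elts b"
  proof
    fix x assume x: "x \<in> A"
    then have "x \<noteq> b" "b \<notin> elts x" using b(2) assms(3) by auto
    then show "x \<in> elts b"
      using Ord_linear[of x b] x b(1) assms(1,2) Ord_elt by blast
  qed
  ultimately show ?thesis using b by blast
qed auto

lemma OrdI: "(\<And>x. x \<in> elts a \<Longrightarrow> Ord x) \<Longrightarrow> (\<And>x. x \<in> elts a \<Longrightarrow> elts x \<subseteq> elts a) \<Longrightarrow> Ord a"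
  unfolding Ord_def by blast

lemma pair_not_Ord: "is_pair z a b \<Longrightarrow> \<not> Ord z"
proof
  assume p: "is_pair z a b" and o: "Ord z"
  then have ne: "\<exists>x. x \<in> elts z" by (auto simp: is_pair_def)
  obtain m where m: "m \<in> elts z" "\<And>c. c \<in> elts m \<Longrightarrow> c \<notin> elts z"
    using ne mem_least[of "\<lambda>x. x \<in> elts z"] by metis
  have "elts m = {}" using m o Ord_trans by blast
  then show False using p m(1) by (auto simp: is_pair_def)
qed

section \<open>Definability over a transitive model\<close>

text \<open>Even positions of the interleaved environment carry the variables, odd ones the parameters.\<close>

definition mix :: "(nat \<Rightarrow> 'a) \<Rightarrow> (nat \<Rightarrow> 'a) \<Rightarrow> nat \<Rightarrow> 'a" where
  "mix e p i = (if even i then e (i div 2) else p (i div 2))"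

primrec vars :: "fm \<Rightarrow> nat set" where
  "vars (FMem i j) = {i, j}"
| "vars (FEq i j) = {i, j}"
| "vars (FNeg \<phi>) = vars \<phi>"
| "vars (FConj \<phi> \<psi>) = vars \<phi> \<union> vars \<psi>"
| "vars (FAll i \<phi>) = insert i (vars \<phi>)"

lemma finite_vars: "finite (vars \<phi>)"
  by (induction \<phi>) auto

lemma sat_cong: "(\<And>i. i \<in> vars \<phi> \<Longrightarrow> e i = e' i) \<Longrightarrow> sat M e \<phi> \<longleftrightarrow> sat M e' \<phi>"
proof (induction \<phi> arbitrary: e e')
  case (FAll i \<phi>)
  have "sat M (e(i := x)) \<phi> \<longleftrightarrow> sat M (e'(i := x)) \<phi>" for x
    by (rule FAll.IH) (use FAll.prems in auto)
  then show ?case by simp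
next
  case (FNeg \<phi>)
  have "sat M e \<phi> \<longleftrightarrow> sat M e' \<phi>" by (rule FNeg.IH) (use FNeg.prems in auto)
  then show ?case by simp
next
  case (FConj \<phi> \<psi>)
  have "sat M e \<phi> \<longleftrightarrow> sat M e' \<phi>" by (rule FConj.IH(1)) (use FConj.prems in auto)
  moreover have "sat M e \<psi> \<longleftrightarrow> sat M e' \<psi>" by (rule FConj.IH(2)) (use FConj.prems in auto)
  ultimately show ?case by simp
qed auto

text \<open>\<open>\<rho>\<close> need not be injective, so a quantifier could capture a renamed
  variable; the bound variable is therefore moved to an index outside the image of the variables of
  its body.\<close>

lemma sat_rename: "\<exists>\<phi>'. \<forall>e. sat M e \<phi>' \<longleftrightarrow> sat M (\<lambda>i. e (\<rho> i)) \<phi>"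
proof (induction \<phi> arbitrary: \<rho>)
  case (FMem i j)
  show ?case by (rule exI[of _ "FMem (\<rho> i) (\<rho> j)"]) simp
next
  case (FEq i j)
  show ?case by (rule exI[of _ "FEq (\<rho> i) (\<rho> j)"]) simp
next
  case (FNeg \<phi>)
  from FNeg[of \<rho>] obtain \<psi> where "\<forall>e. sat M e \<psi> \<longleftrightarrow> sat M (\<lambda>i. e (\<rho> i)) \<phi>" by blast
  then show ?case by (intro exI[of _ "FNeg \<psi>"]) simp
next
  case (FConj \<phi>1 \<phi>2)
  from FConj.IH(1)[of \<rho>] obtain \<psi>1 where 1: "\<forall>e. sat M e \<psi>1 \<longleftrightarrow> sat M (\<lambda>i. e (\<rho> i)) \<phi>1" by blast
  from FConj.IH(2)[of \<rho>] obtain \<psi>2 where 2: "\<forall>e. sat M e \<psi>2 \<longleftrightarrow> sat M (\<lambda>i. e (\<rho> i)) \<phi>2" by blast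
  show ?case by (intro exI[of _ "FConj \<psi>1 \<psi>2"]) (simp add: 1 2)
next
  case (FAll k \<phi>)
  have "finite (\<rho> ` vars \<phi>)" by (simp add: finite_vars)
  then obtain n where n: "n \<notin> \<rho> ` vars \<phi>"
    using ex_new_if_finite infinite_UNIV_nat by blast
  from FAll[of "\<rho>(k := n)"] obtain \<psi> where
    psi: "\<And>e. sat M e \<psi> \<longleftrightarrow> sat M (\<lambda>i. e ((\<rho>(k := n)) i)) \<phi>" by blast
  have "sat M (e(n := x)) \<psi> \<longleftrightarrow> sat M ((\<lambda>i. e (\<rho> i))(k := x)) \<phi>" for e x
    unfolding psi by (rule sat_cong) (use n in auto)
  then show ?case by (intro exI[of _ "FAll n \<psi>"]) simp
qed

definition scons :: "'a \<Rightarrow> (nat \<Rightarrow> 'a) \<Rightarrow> nat \<Rightarrow> 'a" where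
  "scons x e i = (case i of 0 \<Rightarrow> x | Suc j \<Rightarrow> e j)"

lemma scons_simps [simp]: "scons x e 0 = x" "scons x e (Suc i) = e i"
  by (simp_all add: scons_def)

text \<open>Adapts the quantifier, which updates one index, to environments in which the new value
  is put in front. The shift sends both \<open>0\<close> and \<open>Suc m\<close> to
  \<open>m\<close>, so \<open>m\<close> is chosen with \<open>Suc m\<close> not among the
  variables.\<close>

lemma sat_all_scons: "\<exists>\<psi>. \<forall>e. sat M e \<psi> \<longleftrightarrow> (\<forall>x \<in> M. sat M (scons x e) \<phi>)"
proof -
  obtain k where "k \<notin> insert 0 (vars \<phi>)"
    using ex_new_if_finite[OF infinite_UNIV_nat, of "insert 0 (vars \<phi>)"] finite_vars by blast
  then obtain m where m: "Suc m \<notin> vars \<phi>" by (cases k) auto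
  obtain \<psi> where psi: "\<And>e. sat M e \<psi> \<longleftrightarrow> sat M (\<lambda>i. e (scons m (\<lambda>j. j) i)) \<phi>"
    using sat_rename[of M "scons m (\<lambda>j. j)" \<phi>] by blast
  have "sat M (e(m := x)) \<psi> \<longleftrightarrow> sat M (scons x e) \<phi>" for e x
    unfolding psi
  proof (rule sat_cong)
    fix i assume "i \<in> vars \<phi>"
    then show "(e(m := x)) (scons m (\<lambda>j. j) i) = scons x e i" using m by (cases i) auto
  qed
  then show ?thesis by (intro exI[of _ "FAll m \<psi>"]) simp
qed

text \<open>Definability over \<open>V\<close> with parameters, as a property of HOL predicates on
  environments. Its closure rules build the formula, so that Separation and Replacement are applied
  without writing any syntax.\<close>

definition dfn :: "'s::set_universe set \<Rightarrow> ((nat \<Rightarrow> 's) \<Rightarrow> bool) \<Rightarrow> bool" where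
  "dfn V Q \<longleftrightarrow> (\<exists>\<phi> p. (\<forall>i. p i \<in> V) \<and> (\<forall>e. (\<forall>i. e i \<in> V) \<longrightarrow> (sat V (mix e p) \<phi> \<longleftrightarrow> Q e)))"

text \<open>A term is represented by its graph: index \<open>0\<close> holds the value and the
  arguments are shifted up by one.\<close>

definition dft :: "'s::set_universe set \<Rightarrow> ((nat \<Rightarrow> 's) \<Rightarrow> 's) \<Rightarrow> bool" where
  "dft V t \<longleftrightarrow> (\<forall>e. (\<forall>i. e i \<in> V) \<longrightarrow> t e \<in> V) \<and> dfn V (\<lambda>e. e 0 = t (\<lambda>i. e (Suc i)))"

locale zfc_model =
  fixes V :: "'s::set_universe set"
  assumes ZFC: "model_ZFC V"
begin

abbreviation "df \<equiv> dfn V"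
abbreviation "dt \<equiv> dft V"

lemma trans_V: "transitive_class V"
  and pairing_V: "\<forall>a \<in> V. \<forall>b \<in> V. \<exists>c \<in> V. elts c = {a, b}"
  and union_V: "\<forall>a \<in> V. \<exists>u \<in> V. elts u = \<Union> (elts ` elts a)"
  and power_V: "\<forall>a \<in> V. \<exists>p \<in> V. elts p = {x \<in> V. elts x \<subseteq> elts a}"
  and infinity_V: "\<exists>w \<in> V. (\<exists>z \<in> elts w. elts z = {}) \<and>
        (\<forall>x \<in> elts w. \<exists>s \<in> elts w. elts s = insert x (elts x))"
  and separation_V: "\<forall>\<phi> e. \<forall>a \<in> V. (\<forall>i. e i \<in> V) \<longrightarrow>
        (\<exists>b \<in> V. elts b = {x \<in> elts a. sat V (e(0 := x)) \<phi>})"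
  and replacement_V: "\<forall>\<phi> e. \<forall>a \<in> V. (\<forall>i. e i \<in> V) \<and>
        (\<forall>x \<in> elts a. \<exists>!y. y \<in> V \<and> sat V (e(0 := x, 1 := y)) \<phi>) \<longrightarrow>
        (\<exists>b \<in> V. elts b = {y \<in> V. \<exists>x \<in> elts a. sat V (e(0 := x, 1 := y)) \<phi>})"
  and choice_V: "\<forall>a \<in> V. (\<forall>x \<in> elts a. elts x \<noteq> {}) \<and>
        (\<forall>x \<in> elts a. \<forall>y \<in> elts a. x \<noteq> y \<longrightarrow> elts x \<inter> elts y = {}) \<longrightarrow>
        (\<exists>c \<in> V. \<forall>x \<in> elts a. \<exists>z. elts c \<inter> elts x = {z})"
  by (insert ZFC[unfolded model_ZFC_def]; elim conjE; assumption)+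

lemma V_ne: "\<exists>w. w \<in> V"
  using infinity_V by blast

lemma dfn_cong:
  "(\<And>e. (\<And>i. e i \<in> V) \<Longrightarrow> Q e \<longleftrightarrow> Q' e) \<Longrightarrow> df Q \<longleftrightarrow> df Q'"
  unfolding dfn_def by metis

lemma dfn_rename:
  assumes "df Q" shows "df (\<lambda>e. Q (\<lambda>i. e (\<rho> i)))"
proof -
  obtain \<phi> p where p: "\<forall>i. p i \<in> V"
    and sat: "\<And>e. (\<forall>i. e i \<in> V) \<Longrightarrow> (sat V (mix e p) \<phi> \<longleftrightarrow> Q e)"
    using assms unfolding dfn_def by blast
  obtain \<psi> where psi: "\<And>e. sat V e \<psi> \<longleftrightarrow>
      sat V (\<lambda>i. e (if even i then 2 * \<rho> (i div 2) else i)) \<phi>"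
    using sat_rename[of V "\<lambda>i. if even i then 2 * \<rho> (i div 2) else i" \<phi>] by blast
  have "sat V (mix e p) \<psi> \<longleftrightarrow> Q (\<lambda>i. e (\<rho> i))" if "\<forall>i. e i \<in> V" for e
  proof -
    have "sat V (mix e p) \<psi> \<longleftrightarrow> sat V (mix (\<lambda>i. e (\<rho> i)) p) \<phi>"
      unfolding psi by (rule arg_cong[where f = "\<lambda>u. sat V u \<phi>"]) (auto simp: mix_def)
    then show ?thesis using sat that by simp
  qed
  with p show ?thesis unfolding dfn_def by blast
qed

lemma dfn_atom:
  "df (\<lambda>e. e i \<in> elts (e j))" "df (\<lambda>e. e i = e j)"
proof -
  obtain w where w: "w \<in> V" using V_ne by blast
  show "df (\<lambda>e. e i \<in> elts (e j))" unfolding dfn_def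
    by (rule exI[of _ "FMem (2 * i) (2 * j)"], rule exI[of _ "\<lambda>_. w"]) (simp add: w mix_def)
  show "df (\<lambda>e. e i = e j)" unfolding dfn_def
    by (rule exI[of _ "FEq (2 * i) (2 * j)"], rule exI[of _ "\<lambda>_. w"]) (simp add: w mix_def)
qed

lemma dfn_not: assumes "df Q" shows "df (\<lambda>e. \<not> Q e)"
proof -
  obtain \<phi> p where p: "\<forall>i. p i \<in> V"
    and sat: "\<And>e. (\<forall>i. e i \<in> V) \<Longrightarrow> (sat V (mix e p) \<phi> \<longleftrightarrow> Q e)"
    using assms unfolding dfn_def by blast
  then show ?thesis unfolding dfn_def by (intro exI[of _ "FNeg \<phi>"] exI[of _ p]) simp
qed

lemma dfn_conj: assumes "df Q" "df Q'" shows "df (\<lambda>e. Q e \<and> Q' e)"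
proof -
  obtain \<phi> p where p: "\<forall>i. p i \<in> V"
    and sat: "\<And>e. (\<forall>i. e i \<in> V) \<Longrightarrow> (sat V (mix e p) \<phi> \<longleftrightarrow> Q e)"
    using assms unfolding dfn_def by blast
  obtain \<phi>' p' where p': "\<forall>i. p' i \<in> V"
    and sat': "\<And>e. (\<forall>i. e i \<in> V) \<Longrightarrow> (sat V (mix e p') \<phi>' \<longleftrightarrow> Q' e)"
    using assms unfolding dfn_def by blast
  \<comment> \<open>The two parameter sequences are interleaved by \<open>mix\<close> once more; the
    renamings send each parameter index to its place in the merged sequence.\<close>
  let ?r = "\<lambda>i. if even i then i else 2 * (2 * (i div 2)) + 1"
  let ?r' = "\<lambda>i. if even i then i else 2 * (2 * (i div 2) + 1) + (1::nat)"
  obtain \<psi> where psi: "\<And>e. sat V e \<psi> \<longleftrightarrow> sat V (\<lambda>i. e (?r i)) \<phi>"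
    using sat_rename[of V ?r \<phi>] by blast
  obtain \<psi>' where psi': "\<And>e. sat V e \<psi>' \<longleftrightarrow> sat V (\<lambda>i. e (?r' i)) \<phi>'"
    using sat_rename[of V ?r' \<phi>'] by blast
  have r: "sat V (mix e (mix p p')) \<psi> \<longleftrightarrow> sat V (mix e p) \<phi>" for e
    unfolding psi by (rule arg_cong[where f = "\<lambda>u. sat V u \<phi>"]) (auto simp: mix_def fun_eq_iff elim!: oddE)
  have r': "sat V (mix e (mix p p')) \<psi>' \<longleftrightarrow> sat V (mix e p') \<phi>'" for e
    unfolding psi' by (rule arg_cong[where f = "\<lambda>u. sat V u \<phi>'"]) (auto simp: mix_def)
  show ?thesis unfolding dfn_def
    by (rule exI[of _ "FConj \<psi> \<psi>'"], rule exI[of _ "mix p p'"])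
      (use p p' in \<open>auto simp: r r' sat sat' mix_def\<close>)
qed

lemma dfn_all: assumes "df (\<lambda>e. Q (\<lambda>i. e (Suc i)) (e 0))" shows "df (\<lambda>e. \<forall>x \<in> V. Q e x)"
proof -
  obtain \<phi> p where p: "\<forall>i. p i \<in> V"
    and sat: "\<And>e. (\<forall>i. e i \<in> V) \<Longrightarrow> (sat V (mix e p) \<phi> \<longleftrightarrow> Q (\<lambda>i. e (Suc i)) (e 0))"
    using assms unfolding dfn_def by blast
  \<comment> \<open>In the interleaving a new variable shifts the other variables by two places and
    the parameters by none, whereas prepending a value shifts every index by one; \<open>?r\<close>
    corrects the difference.\<close>
  let ?r = "\<lambda>i. if i = 0 then 0 else if even i then i - 1 else Suc i"
  obtain \<psi> where psi: "\<And>e. sat V e \<psi> \<longleftrightarrow> sat V (\<lambda>i. e (?r i)) \<phi>"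
    using sat_rename[of V ?r \<phi>] by blast
  obtain \<chi> where chi: "\<And>e. sat V e \<chi> \<longleftrightarrow> (\<forall>x \<in> V. sat V (scons x e) \<psi>)"
    using sat_all_scons[of V \<psi>] by blast
  have r: "sat V (scons x (mix e p)) \<psi> \<longleftrightarrow> sat V (mix (scons x e) p) \<phi>" for e x
    unfolding psi by (rule arg_cong[where f = "\<lambda>u. sat V u \<phi>"])
      (auto simp: mix_def scons_def fun_eq_iff split: nat.splits elim!: evenE)
  have "sat V (mix e p) \<chi> \<longleftrightarrow> (\<forall>x \<in> V. Q e x)" if "\<forall>i. e i \<in> V" for e
  proof -
    have "sat V (mix (scons x e) p) \<phi> \<longleftrightarrow> Q e x" if "x \<in> V" for x
      using sat[of "scons x e"] that \<open>\<forall>i. e i \<in> V\<close> by (auto simp: scons_def split: nat.splits)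
    then show ?thesis by (simp add: chi r)
  qed
  with p show ?thesis unfolding dfn_def by blast
qed

lemma dfn_ex: assumes "df (\<lambda>e. Q (\<lambda>i. e (Suc i)) (e 0))" shows "df (\<lambda>e. \<exists>x \<in> V. Q e x)"
proof -
  have "df (\<lambda>e. \<not> (\<forall>x \<in> V. \<not> Q e x))" by (intro dfn_not dfn_all assms)
  then show ?thesis by simp
qed

lemma dfn_disj: "df Q \<Longrightarrow> df Q' \<Longrightarrow> df (\<lambda>e. Q e \<or> Q' e)"
proof -
  assume "df Q" "df Q'"
  then have "df (\<lambda>e. \<not> (\<not> Q e \<and> \<not> Q' e))" by (intro dfn_not dfn_conj)
  then show ?thesis by simp
qed

lemma dfn_imp: "df Q \<Longrightarrow> df Q' \<Longrightarrow> df (\<lambda>e. Q e \<longrightarrow> Q' e)"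
proof -
  assume "df Q" "df Q'"
  then have "df (\<lambda>e. \<not> Q e \<or> Q' e)" by (intro dfn_not dfn_disj)
  then show ?thesis by (simp only: imp_conv_disj)
qed

lemma dfn_iff: "df Q \<Longrightarrow> df Q' \<Longrightarrow> df (\<lambda>e. Q e = Q' e)"
proof -
  assume "df Q" "df Q'"
  then have "df (\<lambda>e. (Q e \<longrightarrow> Q' e) \<and> (Q' e \<longrightarrow> Q e))" by (intro dfn_imp dfn_conj)
  then show ?thesis by (simp add: iff_conv_conj_imp)
qed

lemma dft_in: "dt t \<Longrightarrow> (\<And>i. e i \<in> V) \<Longrightarrow> t e \<in> V"
  by (simp add: dft_def)

lemma dft_var: "dt (\<lambda>e. e i)"
  by (simp add: dft_def dfn_atom)

lemma dft_const: "c \<in> V \<Longrightarrow> dt (\<lambda>e. c)"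
  unfolding dft_def dfn_def by (intro conjI allI impI exI[of _ "FEq 0 1"] exI[of _ "\<lambda>_. c"])
    (auto simp: mix_def)

lemma dft_shift: "dt t \<Longrightarrow> dt (\<lambda>e. t (\<lambda>i. e (\<rho> i)))"
  unfolding dft_def
  using dfn_rename[of "\<lambda>e. e 0 = t (\<lambda>i. e (Suc i))" "scons 0 (\<lambda>i. Suc (\<rho> i))"] by simp

text \<open>Substitution is expressed by an existential quantifier over the value of
  \<open>t\<close>, so only the graph of \<open>t\<close> enters the formula.\<close>

lemma dfn_subst:
  assumes "df (\<lambda>e. Q (\<lambda>i. e (Suc i)) (e 0))" "dt t" shows "df (\<lambda>e. Q e (t e))"
proof -
  have "df (\<lambda>e. \<exists>x \<in> V. x = t e \<and> Q e x)"
    by (intro dfn_ex dfn_conj assms(1)) (use assms(2) dft_def in blast)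
  moreover have "df (\<lambda>e. \<exists>x \<in> V. x = t e \<and> Q e x) \<longleftrightarrow> df (\<lambda>e. Q e (t e))"
    by (rule dfn_cong) (use dft_in[OF assms(2)] in auto)
  ultimately show ?thesis by simp
qed

lemma dfn_subst1: "df (\<lambda>e. P (e 0)) \<Longrightarrow> dt t \<Longrightarrow> df (\<lambda>e. P (t e))"
  by (rule dfn_subst[where Q = "\<lambda>e x. P x"])

lemma dfn_subst2:
  assumes "df (\<lambda>e. P (e 0) (e 1))" "dt t" "dt u" shows "df (\<lambda>e. P (t e) (u e))"
proof (rule dfn_subst[where Q = "\<lambda>e x. P x (u e)"])
  show "df (\<lambda>e. P (e 0) (u (\<lambda>i. e (Suc i))))"
    by (rule dfn_subst[where Q = "\<lambda>e x. P (e 0) x" and t = "\<lambda>e. u (\<lambda>i. e (Suc i))"])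
      (use dfn_rename[OF assms(1), of "\<lambda>i. if i = 0 then 1 else 0"] dft_shift[OF assms(3)] in simp_all)
qed fact

lemma dfn_subst3:
  assumes "df (\<lambda>e. P (e 0) (e 1) (e 2))" "dt t" "dt u" "dt v" shows "df (\<lambda>e. P (t e) (u e) (v e))"
proof (rule dfn_subst[where Q = "\<lambda>e x. P x (u e) (v e)"])
  show "df (\<lambda>e. P (e 0) (u (\<lambda>i. e (Suc i))) (v (\<lambda>i. e (Suc i))))"
  proof (rule dfn_subst[where Q = "\<lambda>e x. P (e 0) x (v (\<lambda>i. e (Suc i)))" and t = "\<lambda>e. u (\<lambda>i. e (Suc i))"])
    show "df (\<lambda>e. P (e (Suc 0)) (e 0) (v (\<lambda>i. e (Suc (Suc i)))))"
      by (rule dfn_subst[where Q = "\<lambda>e x. P (e (Suc 0)) (e 0) x" and t = "\<lambda>e. v (\<lambda>i. e (Suc (Suc i)))"])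
        (use dfn_rename[OF assms(1), of "\<lambda>i. if i = 0 then 2 else if i = 1 then 1 else 0"]
          dft_shift[OF assms(4), of "\<lambda>i. Suc (Suc i)"] in \<open>simp_all add: numeral_2_eq_2\<close>)
  qed (rule dft_shift[OF assms(3)])
qed fact

lemma dfn_elt: "dt t \<Longrightarrow> dt u \<Longrightarrow> df (\<lambda>e. t e \<in> elts (u e))"
  using dfn_subst2[OF dfn_atom(1)[of 0 1]] by simp

lemma dfn_eq: "dt t \<Longrightarrow> dt u \<Longrightarrow> df (\<lambda>e. t e = u e)"
  using dfn_subst2[of "(=)", OF dfn_atom(2)[of 0 1]] by simp

lemma transV: "x \<in> V \<Longrightarrow> y \<in> elts x \<Longrightarrow> y \<in> V"
  using trans_V unfolding transitive_class_def by blast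

lemma dfn_ball:
  assumes "dt t" "df (\<lambda>e. Q (\<lambda>i. e (Suc i)) (e 0))" shows "df (\<lambda>e. \<forall>x \<in> elts (t e). Q e x)"
proof -
  have "df (\<lambda>e. \<forall>x \<in> V. x \<in> elts (t e) \<longrightarrow> Q e x)"
    by (intro dfn_all dfn_imp dfn_elt dft_var dft_shift[OF assms(1)] assms(2))
  moreover have "df (\<lambda>e. \<forall>x \<in> V. x \<in> elts (t e) \<longrightarrow> Q e x) \<longleftrightarrow> ?thesis"
    by (rule dfn_cong) (use dft_in[OF assms(1)] transV in blast)
  ultimately show ?thesis by simp
qed

lemma dfn_bex:
  assumes "dt t" "df (\<lambda>e. Q (\<lambda>i. e (Suc i)) (e 0))" shows "df (\<lambda>e. \<exists>x \<in> elts (t e). Q e x)"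
proof -
  have "df (\<lambda>e. \<not> (\<forall>x \<in> elts (t e). \<not> Q e x))" by (intro dfn_not dfn_ball assms)
  then show ?thesis by simp
qed

lemma dfn_triv: "df (\<lambda>e. P)"
proof (cases P)
  case True
  then show ?thesis using dfn_eq[OF dft_var[of 0] dft_var[of 0]] by simp
next
  case False
  then show ?thesis using dfn_not[OF dfn_eq[OF dft_var[of 0] dft_var[of 0]]] by simp
qed

lemma dfn_subset: "dt t \<Longrightarrow> dt u \<Longrightarrow> df (\<lambda>e. elts (t e) \<subseteq> elts (u e))"
  by (rule dfn_subst2[where P = "\<lambda>x y. elts x \<subseteq> elts y"])
    (simp_all add: subset_eq dfn_ball dfn_elt dft_var del: subsetI)

lemma dfn_pair: "dt t \<Longrightarrow> dt u \<Longrightarrow> dt v \<Longrightarrow> df (\<lambda>e. is_pair (t e) (u e) (v e))"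
proof (rule dfn_subst3)
  have eq: "is_pair z a b \<longleftrightarrow> (\<exists>s \<in> elts z. \<exists>t \<in> elts z. (\<forall>x \<in> elts z. x = s \<or> x = t) \<and>
      (a \<in> elts s \<and> (\<forall>x \<in> elts s. x = a)) \<and> (a \<in> elts t \<and> b \<in> elts t \<and> (\<forall>x \<in> elts t. x = a \<or> x = b)))"
    for z a b :: 's
  proof -
    have d: "A = {s, t} \<longleftrightarrow> s \<in> A \<and> t \<in> A \<and> (\<forall>x \<in> A. x = s \<or> x = t)" for A and s t :: 's by blast
    have "A = {s} \<longleftrightarrow> s \<in> A \<and> (\<forall>x \<in> A. x = s)" for A and s :: 's by blast
    then show ?thesis unfolding is_pair_def d by (simp only: Bex_def conj_assoc simp_thms ex_simps)
  qed
  show "df (\<lambda>e. is_pair (e 0) (e 1) (e 2))" unfolding eq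
    by (intro dfn_bex dfn_ball dfn_conj dfn_disj dfn_eq dfn_elt dft_var)
qed

lemma dfn_rel: "dt t \<Longrightarrow> dt u \<Longrightarrow> dt v \<Longrightarrow> df (\<lambda>e. (t e, u e) \<in> rel_of (v e))"
proof (rule dfn_subst3[where P = "\<lambda>x y r. (x, y) \<in> rel_of r"])
  show "df (\<lambda>e. (e 0, e 1) \<in> rel_of (e 2))" unfolding rel_of_def
    by (simp, intro dfn_bex dfn_pair dft_var)
qed

lemma dfn_Ord: "dt t \<Longrightarrow> df (\<lambda>e. Ord (t e))"
proof (rule dfn_subst1)
  show "df (\<lambda>e. Ord (e 0))" unfolding Ord_def
    by (intro dfn_bex dfn_ball dfn_conj dfn_subset dft_var)
qed

text \<open>For a function on all of \<open>V\<close>, definability of its graph makes it usable in terms.\<close>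

lemma dft_fun:
  assumes "\<And>x. x \<in> V \<Longrightarrow> F x \<in> V" "df (\<lambda>e. e 0 = F (e 1))" "dt t" shows "dt (\<lambda>e. F (t e))"
  unfolding dft_def
proof
  show "\<forall>e. (\<forall>i. e i \<in> V) \<longrightarrow> F (t e) \<in> V" using assms dft_in by blast
  show "df (\<lambda>e. e 0 = F (t (\<lambda>i. e (Suc i))))"
    by (rule dfn_subst2[where P = "\<lambda>x y. x = F y"]) (use assms in \<open>auto intro: dft_var dft_shift\<close>)
qed

lemma dft_fun2:
  assumes "\<And>x y. x \<in> V \<Longrightarrow> y \<in> V \<Longrightarrow> F x y \<in> V" "df (\<lambda>e. e 0 = F (e 1) (e 2))" "dt t" "dt u"
  shows "dt (\<lambda>e. F (t e) (u e))"
  unfolding dft_def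
proof
  show "\<forall>e. (\<forall>i. e i \<in> V) \<longrightarrow> F (t e) (u e) \<in> V" using assms dft_in by blast
  show "df (\<lambda>e. e 0 = F (t (\<lambda>i. e (Suc i))) (u (\<lambda>i. e (Suc i))))"
    by (rule dfn_subst3[where P = "\<lambda>x y z. x = F y z"]) (use assms in \<open>auto intro: dft_var dft_shift\<close>)
qed

section \<open>Sets of the model\<close>

text \<open>Sets of the model are handled through their HOL sets of elements. The way back is
  \<open>mk\<close>, which is meaningful only where \<open>inV\<close> holds.\<close>

definition inV :: "'s set \<Rightarrow> bool" where
  "inV A \<longleftrightarrow> (\<exists>a \<in> V. elts a = A)"

definition mk :: "'s set \<Rightarrow> 's" where
  "mk A = (THE a. elts a = A)"

lemma mk_elts [simp]: "mk (elts a) = a"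
  unfolding mk_def by (rule the_equality) (simp_all add: elts_inject)

lemma elts_mk: "inV A \<Longrightarrow> elts (mk A) = A"
  unfolding inV_def by auto

lemma mk_in: "inV A \<Longrightarrow> mk A \<in> V"
  unfolding inV_def by auto

lemma inV_elts: "a \<in> V \<Longrightarrow> inV (elts a)"
  unfolding inV_def by blast

lemma inV_subV: "inV A \<Longrightarrow> A \<subseteq> V"
  unfolding inV_def using transV by blast

lemma inV_sep:
  assumes "inV A" "df (\<lambda>e. Q (e 0))" shows "inV {x \<in> A. Q x}"
proof -
  obtain a where a: "a \<in> V" "elts a = A" using assms unfolding inV_def by blast
  obtain \<phi> p where p: "\<forall>i. p i \<in> V"
    and sat: "\<And>e. (\<forall>i. e i \<in> V) \<Longrightarrow> (sat V (mix e p) \<phi> \<longleftrightarrow> Q (e 0))"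
    using assms(2) unfolding dfn_def by blast
  let ?m = "mix (\<lambda>_. a) p"
  have "\<forall>i. ?m i \<in> V" using p a by (simp add: mix_def)
  from separation_V[THEN spec[of _ \<phi>], THEN spec[of _ ?m], THEN bspec, OF a(1), THEN mp, OF this]
  obtain b where b: "b \<in> V" "elts b = {x \<in> elts a. sat V (?m(0 := x)) \<phi>}" by auto
  have "sat V (?m(0 := x)) \<phi> \<longleftrightarrow> Q x" if "x \<in> V" for x
  proof -
    have "?m(0 := x) = mix ((\<lambda>_. a)(0 := x)) p" by (auto simp: mix_def fun_eq_iff elim!: oddE)
    then show ?thesis using sat[of "(\<lambda>_. a)(0 := x)"] that a by simp
  qed
  then have "elts b = {x \<in> A. Q x}" using b a transV[OF a(1)] by blast
  then show ?thesis using b unfolding inV_def by blast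
qed

text \<open>The guard \<open>e 0 \<in> A\<close> confines the definability requirement to arguments
  in \<open>A\<close>, the only place where \<open>Q\<close> has to describe the graph of
  \<open>F\<close>.\<close>

lemma inV_repl:
  assumes "inV A" "df (\<lambda>e. e 0 \<in> A \<longrightarrow> Q (e 0) (e 1))"
    and F: "\<And>x. x \<in> A \<Longrightarrow> F x \<in> V" and Q: "\<And>x y. x \<in> A \<Longrightarrow> y \<in> V \<Longrightarrow> Q x y \<longleftrightarrow> y = F x"
  shows "inV (F ` A)"
proof -
  obtain a where a: "a \<in> V" "elts a = A" using assms unfolding inV_def by blast
  obtain \<phi> p where p: "\<forall>i. p i \<in> V"
    and sat: "\<And>e. (\<forall>i. e i \<in> V) \<Longrightarrow> (sat V (mix e p) \<phi> \<longleftrightarrow> (e 0 \<in> A \<longrightarrow> Q (e 0) (e 1)))"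
    using assms(2) unfolding dfn_def by blast
  \<comment> \<open>The scheme puts the value at index \<open>1\<close>, while the interleaved
    environment keeps its second variable at index \<open>2\<close>; the renaming swaps the
    two.\<close>
  let ?r = "\<lambda>i::nat. if i = 1 then 2 else if i = 2 then 1 else i"
  obtain \<psi> where psi: "\<And>e. sat V e \<psi> \<longleftrightarrow> sat V (\<lambda>i. e (?r i)) \<phi>"
    using sat_rename[of V ?r \<phi>] by blast
  let ?m = "\<lambda>i. mix (\<lambda>_. a) p (?r i)"
  have m: "\<forall>i. ?m i \<in> V" using p a by (simp add: mix_def)
  have s: "sat V (?m(0 := x, 1 := y)) \<psi> \<longleftrightarrow> y = F x" if "x \<in> A" "y \<in> V" for x y
  proof -
    have "(\<lambda>i. (?m(0 := x, 1 := y)) (?r i)) = mix ((\<lambda>_. a)(0 := x, 1 := y)) p"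
      by (auto simp: mix_def fun_eq_iff elim!: oddE evenE)
    then show ?thesis
      using sat[of "(\<lambda>_. a)(0 := x, 1 := y)"] that a transV[OF a(1)] Q[of x y] by (simp add: psi)
  qed
  have u: "\<forall>x \<in> elts a. \<exists>!y. y \<in> V \<and> sat V (?m(0 := x, 1 := y)) \<psi>"
  proof
    fix x assume "x \<in> elts a"
    then show "\<exists>!y. y \<in> V \<and> sat V (?m(0 := x, 1 := y)) \<psi>"
      using s[of x] F[of x] a(2) by (intro ex1I[of _ "F x"]) auto
  qed
  from replacement_V[THEN spec[of _ \<psi>], THEN spec[of _ ?m], THEN bspec, OF a(1), THEN mp, OF conjI, OF m u]
  obtain b where b: "b \<in> V" "elts b = {y \<in> V. \<exists>x \<in> elts a. sat V (?m(0 := x, 1 := y)) \<psi>}"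
    by auto
  have "elts b = F ` A"
  proof (intro equalityI subsetI)
    fix y assume "y \<in> elts b"
    then obtain x where "x \<in> A" "y \<in> V" "sat V (?m(0 := x, 1 := y)) \<psi>" using b a by auto
    then show "y \<in> F ` A" using s[of x y] by auto
  next
    fix y assume "y \<in> F ` A"
    then obtain x where x: "x \<in> A" "y = F x" by auto
    then have "y \<in> V" "sat V (?m(0 := x, 1 := y)) \<psi>" using F s[of x y] by auto
    then show "y \<in> elts b" using b x a by auto
  qed
  then show ?thesis using b unfolding inV_def by blast
qed

lemma inV_pair: "a \<in> V \<Longrightarrow> b \<in> V \<Longrightarrow> inV {a, b}"
  using pairing_V unfolding inV_def by blast

lemma inV_single: "a \<in> V \<Longrightarrow> inV {a}"
  using inV_pair[of a a] by simp

lemma inV_Union: "inV A \<Longrightarrow> inV (\<Union> (elts ` A))"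
  using union_V unfolding inV_def by blast

lemma inV_Pow: "inV A \<Longrightarrow> inV {x \<in> V. elts x \<subseteq> A}"
  using power_V unfolding inV_def by blast

lemma inV_Un: assumes "inV A" "inV B" shows "inV (A \<union> B)"
proof -
  obtain a b where ab: "a \<in> V" "elts a = A" "b \<in> V" "elts b = B"
    using assms unfolding inV_def by blast
  have "inV (\<Union> (elts ` {a, b}))" by (intro inV_Union inV_pair ab)
  then show ?thesis using ab by simp
qed

lemma inV_insert: "a \<in> V \<Longrightarrow> inV A \<Longrightarrow> inV (insert a A)"
  using inV_Un[OF inV_single, of a A] by simp

lemma inV_empty: "inV {}"
proof -
  obtain w where "w \<in> V" using V_ne by blast
  then show ?thesis using inV_sep[OF inV_elts dfn_triv[of False]] by simp
qed

lemma inV_finite: "finite A \<Longrightarrow> A \<subseteq> V \<Longrightarrow> inV A"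
  by (induction A rule: finite_induct) (auto intro: inV_empty inV_insert)

lemma dfn_inV: "inV A \<Longrightarrow> dt t \<Longrightarrow> df (\<lambda>e. t e \<in> A)"
  using dfn_elt[OF _ dft_const[OF mk_in, of A]] by (simp add: elts_mk)

lemma inV_mem: "inV A \<Longrightarrow> x \<in> A \<Longrightarrow> x \<in> V"
  using inV_subV by blast

definition pr :: "'s \<Rightarrow> 's \<Rightarrow> 's" where
  "pr a b = mk {mk {a}, mk {a, b}}"

lemma pr_is_pair: assumes "a \<in> V" "b \<in> V" shows "is_pair (pr a b) a b" "pr a b \<in> V"
proof -
  have 1: "inV {a}" "inV {a, b}" using assms by (auto intro: inV_pair inV_single)
  then have 2: "inV {mk {a}, mk {a, b}}" using inV_pair mk_in by blast
  show "is_pair (pr a b) a b" unfolding is_pair_def pr_def using 1 2 by (metis elts_mk)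
  show "pr a b \<in> V" unfolding pr_def using 2 by (rule mk_in)
qed

lemma is_pair_iff: "a \<in> V \<Longrightarrow> b \<in> V \<Longrightarrow> is_pair z a b \<longleftrightarrow> z = pr a b"
  using pr_is_pair is_pair_unique by metis

lemma pr_inject: "a \<in> V \<Longrightarrow> b \<in> V \<Longrightarrow> c \<in> V \<Longrightarrow> d \<in> V \<Longrightarrow> pr a b = pr c d \<longleftrightarrow> a = c \<and> b = d"
  using pr_is_pair is_pair_inj by metis

lemma is_pair_in: "is_pair z a b \<Longrightarrow> z \<in> V \<Longrightarrow> a \<in> V \<and> b \<in> V"
  using is_pair_mem transV by metis

lemma rel_in: "r \<in> V \<Longrightarrow> (a, b) \<in> rel_of r \<Longrightarrow> a \<in> V \<and> b \<in> V"
  unfolding rel_of_def using is_pair_in transV by blast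

lemma rel_iff: "a \<in> V \<Longrightarrow> b \<in> V \<Longrightarrow> (a, b) \<in> rel_of r \<longleftrightarrow> pr a b \<in> elts r"
  unfolding rel_of_def by (auto simp: is_pair_iff)

lemma dft_pr: "dt t \<Longrightarrow> dt u \<Longrightarrow> dt (\<lambda>e. pr (t e) (u e))"
proof (rule dft_fun2[where F = pr])
  have "df (\<lambda>e. e 0 = pr (e 1) (e 2)) \<longleftrightarrow> df (\<lambda>e. is_pair (e 0) (e 1) (e 2))"
    by (rule dfn_cong) (simp add: is_pair_iff)
  then show "df (\<lambda>e. e 0 = pr (e 1) (e 2))" by (simp add: dfn_pair dft_var)
qed (simp_all add: pr_is_pair)

lemmas dfn_intros = dfn_not dfn_conj dfn_disj dfn_imp dfn_iff dfn_elt dfn_eq dfn_subset dfn_Ord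
  dfn_pair dfn_rel dfn_ball dfn_bex dfn_all dfn_ex dft_var dft_const dft_pr

text \<open>Kuratowski pairs over \<open>A \<union> B\<close> lie in its double power set, which
  provides the set to separate from.\<close>

lemma inV_times:
  assumes "inV A" "inV B" shows "inV {pr x y | x y. x \<in> A \<and> y \<in> B}"
proof -
  have s: "A \<subseteq> V" "B \<subseteq> V" using assms inV_subV by auto
  let ?P = "\<lambda>A. {x \<in> V. elts x \<subseteq> A}"
  have P: "inV (?P (?P (A \<union> B)))" by (intro inV_Pow inV_Un assms)
  have "inV {z \<in> ?P (?P (A \<union> B)). \<exists>x \<in> elts (mk A). \<exists>y \<in> elts (mk B). z = pr x y}"
    by (intro inV_sep P dfn_intros mk_in assms)
  moreover have in_P: "pr x y \<in> ?P (?P (A \<union> B))" if xy: "x \<in> A" "y \<in> B" for x y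
  proof -
    have 1: "x \<in> V" "y \<in> V" using xy s by auto
    obtain s t where st: "elts (pr x y) = {s, t}" "elts s = {x}" "elts t = {x, y}"
      using pr_is_pair(1)[OF 1] unfolding is_pair_def by blast
    then have "s \<in> V" "t \<in> V" using transV pr_is_pair(2)[OF 1] by blast+
    then show ?thesis using st xy pr_is_pair(2)[OF 1] by auto
  qed
  ultimately have "inV {z \<in> ?P (?P (A \<union> B)). \<exists>x \<in> A. \<exists>y \<in> B. z = pr x y}"
    by (simp add: elts_mk assms)
  moreover have "{z \<in> ?P (?P (A \<union> B)). \<exists>x \<in> A. \<exists>y \<in> B. z = pr x y} =
      {pr x y | x y. x \<in> A \<and> y \<in> B}"
    using in_P by (intro equalityI subsetI) blast+
  ultimately show ?thesis by simp
qed

lemma rel_sep: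
  assumes "inV A" "inV B" "df (\<lambda>e. Q (e 0) (e 1))"
  obtains r where "r \<in> V" "\<And>x y. (x, y) \<in> rel_of r \<longleftrightarrow> x \<in> A \<and> y \<in> B \<and> Q x y"
    "elts r = {pr x y | x y. x \<in> A \<and> y \<in> B \<and> Q x y}"
proof -
  have s: "A \<subseteq> V" "B \<subseteq> V" using assms inV_subV by auto
  let ?R = "{z \<in> {pr x y | x y. x \<in> A \<and> y \<in> B}. \<exists>x \<in> V. \<exists>y \<in> V. is_pair z x y \<and> Q x y}"
  have "inV ?R"
    by (intro inV_sep inV_times assms dfn_intros dfn_subst2[where P = Q])
  moreover have eq: "?R = {pr x y | x y. x \<in> A \<and> y \<in> B \<and> Q x y}"
    using s is_pair_iff pr_inject by (auto simp: subset_iff) (metis pr_is_pair(1))+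
  ultimately obtain r where r: "r \<in> V" "elts r = {pr x y | x y. x \<in> A \<and> y \<in> B \<and> Q x y}"
    unfolding inV_def by auto
  have "(x, y) \<in> rel_of r \<longleftrightarrow> x \<in> A \<and> y \<in> B \<and> Q x y" for x y
  proof
    assume "(x, y) \<in> rel_of r"
    then obtain a b where "a \<in> A" "b \<in> B" "Q a b" "is_pair (pr a b) x y"
      unfolding rel_of_def r by auto
    then show "x \<in> A \<and> y \<in> B \<and> Q x y" using s is_pair_inj pr_is_pair(1) by (metis subset_iff)
  next
    assume "x \<in> A \<and> y \<in> B \<and> Q x y"
    then show "(x, y) \<in> rel_of r" using s rel_iff r(2) by (auto simp: subset_iff)
  qed
  with r that show thesis by blast
qed

end

section \<open>Functions, choice, membership recursion and injections inside the model\<close>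

context zfc_model begin

lemma inV_Domain: assumes "r \<in> V" shows "inV (Domain (rel_of r))" "inV (Range (rel_of r))"
proof -
  let ?A = "\<Union> (elts ` \<Union> (elts ` elts r))"
  have A: "inV ?A" by (intro inV_Union inV_elts assms)
  have sub: "x \<in> ?A \<and> y \<in> ?A" if "(x, y) \<in> rel_of r" for x y
    using that is_pair_mem unfolding rel_of_def by fastforce
  have "inV {x \<in> ?A. \<exists>y \<in> V. (x, y) \<in> rel_of r}"
    by (intro inV_sep A dfn_intros assms)
  moreover have "{x \<in> ?A. \<exists>y \<in> V. (x, y) \<in> rel_of r} = Domain (rel_of r)"
    using sub rel_in[OF assms] by blast
  ultimately show "inV (Domain (rel_of r))" by simp
  have "inV {x \<in> ?A. \<exists>y \<in> V. (y, x) \<in> rel_of r}"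
    by (intro inV_sep A dfn_intros assms)
  moreover have "{x \<in> ?A. \<exists>y \<in> V. (y, x) \<in> rel_of r} = Range (rel_of r)"
    using sub rel_in[OF assms] by blast
  ultimately show "inV (Range (rel_of r))" by simp
qed

lemma graph:
  assumes A: "inV A" and F: "\<And>x. x \<in> A \<Longrightarrow> F x \<in> V" and d: "df (\<lambda>e. Q (e 0) (e 1))"
    and Q: "\<And>x y. x \<in> A \<Longrightarrow> y \<in> V \<Longrightarrow> Q x y \<longleftrightarrow> y = F x"
  obtains f where "f \<in> V" "\<And>x y. (x, y) \<in> rel_of f \<longleftrightarrow> x \<in> A \<and> y = F x"
    "elts f = {pr x (F x) | x. x \<in> A}"
proof -
  have iF: "inV (F ` A)"
    by (rule inV_repl[where Q = Q]) (use assms in \<open>auto intro!: dfn_imp dfn_inV dft_var\<close>)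
  obtain f where "f \<in> V" "\<And>x y. (x, y) \<in> rel_of f \<longleftrightarrow> x \<in> A \<and> y \<in> F ` A \<and> Q x y"
    "elts f = {pr x y | x y. x \<in> A \<and> y \<in> F ` A \<and> Q x y}"
    by (rule rel_sep[OF A iF d]) (rule that)
  moreover have "y \<in> F ` A \<and> Q x y \<longleftrightarrow> y = F x" if "x \<in> A" for x y
    using that F Q by auto
  ultimately show thesis using that[of f] by (simp cong: conj_cong)
qed

text \<open>The choice axiom of the model speaks of disjoint families. The fibres of
  \<open>T\<close>, taken as sets of pairs, are disjoint because a pair determines its first
  coordinate, and the chosen pairs form the graph \<open>f\<close>.\<close>

lemma uniformize:
  assumes T: "T \<in> V"
  obtains f where "f \<in> V" "rel_of f \<subseteq> rel_of T" "single_valued (rel_of f)"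
    "Domain (rel_of f) = Domain (rel_of T)"
proof -
  define fib where "fib x = mk {z \<in> elts T. \<exists>y \<in> V. is_pair z x y}" for x
  have fin: "inV {z \<in> elts T. \<exists>y \<in> V. is_pair z x y}" if "x \<in> V" for x
    by (intro inV_sep inV_elts T dfn_intros that)
  have fib: "elts (fib x) = {z \<in> elts T. \<exists>y \<in> V. is_pair z x y}" "fib x \<in> V" if "x \<in> V" for x
    unfolding fib_def using fin[OF that] by (simp_all add: elts_mk mk_in)
  have DV: "x \<in> V" if "x \<in> Domain (rel_of T)" for x using rel_in[OF T] that by auto
  have "inV (fib ` Domain (rel_of T))"
  proof (rule inV_repl[where Q = "\<lambda>x b. \<forall>z \<in> V. z \<in> elts b \<longleftrightarrow> z \<in> elts T \<and> (\<exists>y \<in> V. is_pair z x y)"])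
    show "df (\<lambda>e. e 0 \<in> Domain (rel_of T) \<longrightarrow>
       (\<forall>z \<in> V. z \<in> elts (e 1) \<longleftrightarrow> z \<in> elts T \<and> (\<exists>y \<in> V. is_pair z (e 0) y)))"
      by (intro dfn_intros dfn_inV inV_Domain T)
    fix x y assume x: "x \<in> Domain (rel_of T)" "y \<in> V"
    have "y = fib x \<longleftrightarrow> elts y = elts (fib x)" by (simp add: elts_inject)
    also have "\<dots> \<longleftrightarrow> (\<forall>z \<in> V. z \<in> elts y \<longleftrightarrow> z \<in> elts T \<and> (\<exists>y \<in> V. is_pair z x y))"
      unfolding fib(1)[OF DV[OF x(1)]] using transV[OF x(2)] transV[OF T] by blast
    finally show "(\<forall>z \<in> V. z \<in> elts y \<longleftrightarrow> z \<in> elts T \<and> (\<exists>y \<in> V. is_pair z x y)) \<longleftrightarrow> y = fib x" by simp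
  qed (use fib DV inV_Domain T in auto)
  then obtain a where a: "a \<in> V" "elts a = fib ` Domain (rel_of T)" unfolding inV_def by auto
  have ne: "\<forall>x \<in> elts a. elts x \<noteq> {}"
  proof
    fix b assume "b \<in> elts a"
    then obtain x where x: "x \<in> Domain (rel_of T)" "b = fib x" using a by blast
    then obtain y z where "z \<in> elts T" "is_pair z x y" unfolding rel_of_def by auto
    then have "z \<in> elts b" using x fib(1)[OF DV] is_pair_in transV[OF T] by auto
    then show "elts b \<noteq> {}" by blast
  qed
  have dj: "\<forall>x \<in> elts a. \<forall>y \<in> elts a. x \<noteq> y \<longrightarrow> elts x \<inter> elts y = {}"
  proof (intro ballI impI equals0I)
    fix b b' z assume b: "b \<in> elts a" "b' \<in> elts a" "b \<noteq> b'" "z \<in> elts b \<inter> elts b'"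
    then obtain x x' where x: "x \<in> Domain (rel_of T)" "b = fib x" "x' \<in> Domain (rel_of T)" "b' = fib x'"
      using a by blast
    then obtain y y' where "is_pair z x y" "is_pair z x' y'" using b(4) fib(1)[OF DV] by auto
    then show False using x b(3) is_pair_inj by blast
  qed
  obtain c where c: "c \<in> V" "\<forall>x \<in> elts a. \<exists>z. elts c \<inter> elts x = {z}"
    using choice_V a(1) ne dj by blast
  have "inV {z \<in> elts T. z \<in> elts c}" by (intro inV_sep inV_elts T dfn_intros c)
  then obtain f where f: "f \<in> V" "elts f = {z \<in> elts T. z \<in> elts c}" unfolding inV_def by auto
  have iff: "(x, y) \<in> rel_of f \<longleftrightarrow> (\<exists>z \<in> elts c \<inter> elts (fib x). is_pair z x y)" if "x \<in> V" for x y
    unfolding rel_of_def f fib(1)[OF that] using is_pair_in transV[OF T] by blast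
  have sub: "rel_of f \<subseteq> rel_of T" unfolding rel_of_def f by auto
  show thesis
  proof (rule that[OF f(1) sub])
    have one: "\<exists>z. elts c \<inter> elts (fib x) = {z}" if "x \<in> Domain (rel_of T)" for x
      using c(2) a that by blast
    show "single_valued (rel_of f)"
    proof (rule single_valuedI)
      fix x y y' assume xy: "(x, y) \<in> rel_of f" "(x, y') \<in> rel_of f"
      then have "x \<in> V" "x \<in> Domain (rel_of T)" using rel_in[OF f(1)] sub by blast+
      then show "y = y'" using xy iff one is_pair_inj by (metis singletonD)
    qed
    show "Domain (rel_of f) = Domain (rel_of T)"
    proof
      show "Domain (rel_of T) \<subseteq> Domain (rel_of f)"
      proof
        fix x assume x: "x \<in> Domain (rel_of T)"
        then obtain z where "z \<in> elts c \<inter> elts (fib x)" using one by blast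
        then show "x \<in> Domain (rel_of f)" using iff[OF DV[OF x]] fib(1)[OF DV[OF x]] by blast
      qed
    qed (use sub in blast)
  qed
qed

text \<open>Transitive sets attached to the elements of \<open>x\<close> are collected by
  Replacement, which needs them to be unique; therefore the induction is carried out for the least
  transitive set that includes \<open>elts x\<close>.\<close>

lemma trans_superset:
  assumes "x \<in> V" obtains T where "T \<in> V" "x \<in> elts T" "\<And>u. u \<in> elts T \<Longrightarrow> elts u \<subseteq> elts T"
proof -
  define ts where "ts x T \<longleftrightarrow> (\<forall>u \<in> elts T. elts u \<subseteq> elts T) \<and> elts x \<subseteq> elts T" for x T :: 's
  define tc where "tc x T \<longleftrightarrow> ts x T \<and> (\<forall>T' \<in> V. ts x T' \<longrightarrow> elts T \<subseteq> elts T')" for x T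
  have d: "df (\<lambda>e. tc (e 0) (e 1))" unfolding tc_def ts_def by (intro dfn_intros)
  have uniq: "T = T'" if "tc x T" "tc x T'" "T \<in> V" "T' \<in> V" for x T T'
    using that unfolding tc_def elts_inject[symmetric] by blast
  have "x \<in> V \<Longrightarrow> \<exists>T \<in> V. tc x T" for x
  proof (induction x rule: mem_induct)
    case (step x)
    then have ex: "\<exists>T \<in> V. tc y T" if "y \<in> elts x" for y using that transV by blast
    define F where "F y = (SOME T. T \<in> V \<and> tc y T)" for y
    have F: "F y \<in> V \<and> tc y (F y)" if "y \<in> elts x" for y
      unfolding F_def using ex[OF that] by (metis (mono_tags, lifting) someI_ex)
    have "inV (F ` elts x)"
      by (rule inV_repl[where Q = tc])
        (use F uniq step.prems d in \<open>auto intro!: dfn_imp dfn_inV inV_elts dft_var\<close>)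
    then have "inV (elts x \<union> \<Union> (elts ` F ` elts x))"
      by (intro inV_Un inV_Union inV_elts step.prems)
    then obtain T where T: "T \<in> V" "elts T = elts x \<union> \<Union> (elts ` F ` elts x)"
      unfolding inV_def by auto
    have "elts u \<subseteq> elts T" if u: "u \<in> elts T" for u
    proof -
      consider "u \<in> elts x" | y where "y \<in> elts x" "u \<in> elts (F y)" using u T by auto
      then show ?thesis
      proof cases
        case 1
        then have "elts u \<subseteq> elts (F u)" using F by (simp add: tc_def ts_def)
        then show ?thesis using 1 T by auto
      next
        case 2
        then have "elts u \<subseteq> elts (F y)" using F by (simp add: tc_def ts_def)
        then show ?thesis using 2 T by auto
      qed
    qed
    moreover have "elts T \<subseteq> elts T'" if T': "T' \<in> V" "ts x T'" for T'
    proof -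
      have "elts (F y) \<subseteq> elts T'" if "y \<in> elts x" for y
      proof -
        have "ts y T'" using T' that unfolding ts_def by blast
        then show ?thesis using F[OF that] T' unfolding tc_def by blast
      qed
      then show ?thesis using T T' unfolding ts_def by auto
    qed
    ultimately have "tc x T" using T unfolding tc_def ts_def by auto
    then show ?case using T by blast
  qed
  then obtain T where T: "T \<in> V" "tc x T" using assms by blast
  obtain T' where T': "T' \<in> V" "elts T' = insert x (elts T)"
    using inV_insert[OF assms inV_elts[OF T(1)]] unfolding inV_def by auto
  show thesis by (rule that[OF T'(1)]) (use T T' in \<open>auto simp: tc_def ts_def\<close>)
qed

text \<open>Recursion along membership by means of approximations that are sets of the model;
  \<open>trans_superset\<close> supplies the set to which an approximation is confined.\<close>

lemma mem_rec:
  assumes H: "\<And>s. s \<in> V \<Longrightarrow> H s \<in> V" and dH: "df (\<lambda>e. e 0 = H (e 1))"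
  obtains C where "\<And>x. x \<in> V \<Longrightarrow> C x \<in> V" "\<And>x. x \<in> V \<Longrightarrow> inV (C ` elts x)"
    "\<And>x. x \<in> V \<Longrightarrow> C x = H (mk (C ` elts x))" "df (\<lambda>e. e 0 = C (e 1))"
proof -
  \<comment> \<open>An approximation has a domain closed under elements and obeys the recursion at
    each of its points. Single-valuedness is not built in; it follows by induction in
    \<open>uniq\<close>.\<close>
  define gd where "gd g \<longleftrightarrow> (\<forall>u \<in> V. \<forall>v \<in> V. (u, v) \<in> rel_of g \<longrightarrow>
      (\<forall>y \<in> elts u. \<exists>w \<in> V. (y, w) \<in> rel_of g) \<and>
      (\<exists>s \<in> V. (\<forall>w \<in> V. w \<in> elts s \<longleftrightarrow> (\<exists>y \<in> elts u. (y, w) \<in> rel_of g)) \<and> v = H s))" for g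
  have dt_H: "dt (\<lambda>e. H (t e))" if "dt t" for t by (rule dft_fun[OF H dH that])
  have dgd: "df (\<lambda>e. gd (t e))" if "dt t" for t
    by (rule dfn_subst1[OF _ that]) (unfold gd_def, intro dfn_intros dt_H)
  have gdD: "\<forall>y \<in> elts u. \<exists>w \<in> V. (y, w) \<in> rel_of g"
      "\<exists>s \<in> V. (\<forall>w \<in> V. w \<in> elts s \<longleftrightarrow> (\<exists>y \<in> elts u. (y, w) \<in> rel_of g)) \<and> v = H s"
    if "g \<in> V" "gd g" "(u, v) \<in> rel_of g" for g u v
    using that(2)[unfolded gd_def, THEN bspec, THEN bspec, THEN mp, OF _ _ that(3)]
      rel_in[OF that(1,3)] by blast+
  have uniq: "g \<in> V \<Longrightarrow> g' \<in> V \<Longrightarrow> gd g \<Longrightarrow> gd g' \<Longrightarrow> (x, v) \<in> rel_of g \<Longrightarrow> (x, v') \<in> rel_of g' \<Longrightarrow> v = v'"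
    for g g' x v v'
  proof (induction x arbitrary: v v' rule: mem_induct)
    case (step x)
    note gV = step.prems(1,2) and xv = step.prems(5,6)
    have xV: "x \<in> V" "v \<in> V" "v' \<in> V" using rel_in gV xv by blast+
    obtain s where s: "s \<in> V" "\<forall>w \<in> V. w \<in> elts s \<longleftrightarrow> (\<exists>y \<in> elts x. (y, w) \<in> rel_of g)" "v = H s"
      and dg: "\<forall>y \<in> elts x. \<exists>w \<in> V. (y, w) \<in> rel_of g"
      using gdD[OF gV(1) step.prems(3) xv(1)] by auto
    obtain s' where s': "s' \<in> V" "\<forall>w \<in> V. w \<in> elts s' \<longleftrightarrow> (\<exists>y \<in> elts x. (y, w) \<in> rel_of g')" "v' = H s'"
      and dg': "\<forall>y \<in> elts x. \<exists>w \<in> V. (y, w) \<in> rel_of g'"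
      using gdD[OF gV(2) step.prems(4) xv(2)] by auto
    have "(y, w) \<in> rel_of g \<longleftrightarrow> (y, w) \<in> rel_of g'" if "y \<in> elts x" for y w
      using step.IH[OF that gV step.prems(3,4)] dg dg' that by metis
    then have "w \<in> elts s \<longleftrightarrow> w \<in> elts s'" if "w \<in> V" for w using s s' that by blast
    then have "elts s = elts s'" using transV s s' by blast
    then show ?case using s s' by (simp add: elts_inject)
  qed
  define val where "val x v \<longleftrightarrow> (\<exists>g \<in> V. gd g \<and> (x, v) \<in> rel_of g)" for x v
  have dval: "df (\<lambda>e. val (t e) (u e))" if "dt t" "dt u" for t u
    by (rule dfn_subst2[OF _ that]) (unfold val_def, intro dfn_intros dgd)
  have valu: "v = v'" if "val x v" "val x v'" for x v v' using that uniq unfolding val_def by blast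
  have valV: "v \<in> V" "x \<in> V" if "val x v" for x v using that rel_in unfolding val_def by blast+
  define C where "C x = (THE v. val x v)" for x
  have Cv: "val x v \<longleftrightarrow> v = C x" if "\<exists>v. val x v" for x v
  proof -
    obtain v0 where v0: "val x v0" using \<open>\<exists>v. val x v\<close> by blast
    then have "C x = v0" unfolding C_def by (rule the_equality) (use v0 valu in blast)
    then show ?thesis using v0 valu by blast
  qed
  have down: "\<exists>w. val y w" if "val x v" "y \<in> elts x" for x v y
  proof -
    obtain g where g: "g \<in> V" "gd g" "(x, v) \<in> rel_of g" using \<open>val x v\<close> unfolding val_def by blast
    then obtain w where "(y, w) \<in> rel_of g" using gdD[OF g] \<open>y \<in> elts x\<close> by blast
    then show ?thesis using g unfolding val_def by blast
  qed
  have eqn: "inV (C ` elts x) \<and> C x = H (mk (C ` elts x))" if xv: "\<exists>v. val x v" for x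
  proof -
    obtain g where g: "g \<in> V" "gd g" "(x, C x) \<in> rel_of g" using Cv[OF xv] unfolding val_def by blast
    then obtain s where s: "s \<in> V" "\<forall>w \<in> V. w \<in> elts s \<longleftrightarrow> (\<exists>y \<in> elts x. (y, w) \<in> rel_of g)" "C x = H s"
      and dg: "\<forall>y \<in> elts x. \<exists>w \<in> V. (y, w) \<in> rel_of g"
      using gdD[OF g] by auto
    have iff: "(y, w) \<in> rel_of g \<longleftrightarrow> w = C y" if y: "y \<in> elts x" for y w
    proof -
      obtain w0 where w0: "(y, w0) \<in> rel_of g" using dg y by blast
      then have "val y w0" using g unfolding val_def by blast
      then have "w0 = C y" using Cv by blast
      then show ?thesis using w0 uniq[OF g(1) g(1) g(2) g(2) w0, of w] by auto
    qed
    have "elts s = C ` elts x"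
    proof (intro equalityI subsetI)
      fix w assume w: "w \<in> elts s"
      then obtain y where "y \<in> elts x" "(y, w) \<in> rel_of g" using s(2) transV[OF s(1) w] by blast
      then show "w \<in> C ` elts x" using iff by auto
    next
      fix w assume "w \<in> C ` elts x"
      then obtain y where y: "y \<in> elts x" "w = C y" by blast
      then have "(y, w) \<in> rel_of g" using iff by simp
      then show "w \<in> elts s" using s(2) rel_in[OF g(1), of y w] y(1) by blast
    qed
    then show ?thesis using s inV_elts[OF s(1)] by (metis mk_elts)
  qed
  have ex: "x \<in> V \<Longrightarrow> \<exists>v. val x v" for x
  proof (induction x rule: mem_induct)
    case (step x)
    have pre: "\<exists>v. val y v" if "y \<in> elts x" for y using step that transV by blast
    show ?case
    proof (rule ccontr)
      assume no: "\<nexists>v. val x v"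
      obtain T where T: "T \<in> V" "x \<in> elts T" "\<And>u. u \<in> elts T \<Longrightarrow> elts u \<subseteq> elts T"
        using trans_superset[OF step.prems] by metis
      \<comment> \<open>The points of \<open>T\<close> where a value already exists carry an
        approximation, the restriction of \<open>C\<close>; adjoining the value that the recursion
        dictates at \<open>x\<close> gives one that reaches \<open>x\<close>.\<close>
      let ?D = "{u \<in> elts T. \<exists>v \<in> V. val u v}"
      have D: "inV ?D" by (intro inV_sep inV_elts T dfn_intros dval)
      have DC: "val u v \<longleftrightarrow> v = C u" if "u \<in> ?D" for u v using Cv[of u v] that by auto
      have CV: "C u \<in> V" if "u \<in> ?D" for u using DC[OF that] valV by blast
      obtain c where c: "c \<in> V" "\<And>u v. (u, v) \<in> rel_of c \<longleftrightarrow> u \<in> ?D \<and> v = C u"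
        by (rule graph[OF D CV dval[OF dft_var dft_var] DC]) (assumption | rule that)+
      have xD: "elts x \<subseteq> ?D" using pre T(2,3) valV by blast
      have "inV (C ` elts x)"
      proof (rule inV_repl[where Q = val])
        show "df (\<lambda>e. e 0 \<in> elts x \<longrightarrow> val (e 0) (e 1))" by (intro dfn_intros dval step.prems)
        show "inV (elts x)" by (rule inV_elts[OF step.prems])
        show "C u \<in> V" if "u \<in> elts x" for u using CV xD that by blast
        show "val u v \<longleftrightarrow> v = C u" if "u \<in> elts x" for u v using DC xD that by blast
      qed
      note iC = this
      let ?h = "H (mk (C ` elts x))"
      have hV: "?h \<in> V" by (intro H mk_in iC)
      obtain g where g: "g \<in> V" "elts g = insert (pr x ?h) (elts c)"
        using inV_insert[OF pr_is_pair(2)[OF step.prems hV] inV_elts[OF c(1)]] unfolding inV_def by auto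
      have grel: "(u, v) \<in> rel_of g \<longleftrightarrow> u = x \<and> v = ?h \<or> u \<in> ?D \<and> v = C u" for u v
      proof -
        have "(u, v) \<in> rel_of g \<longleftrightarrow> is_pair (pr x ?h) u v \<or> (u, v) \<in> rel_of c"
          unfolding rel_of_def g by auto
        also have "is_pair (pr x ?h) u v \<longleftrightarrow> u = x \<and> v = ?h"
          using pr_is_pair(1)[OF step.prems hV] is_pair_inj by blast
        finally show ?thesis using c(2) by simp
      qed
      have xnD: "x \<notin> ?D" using no by blast
      have img: "(\<exists>y \<in> elts u. (y, w) \<in> rel_of g) \<longleftrightarrow> w \<in> C ` elts u" if "elts u \<subseteq> ?D" for u w
        using that xnD unfolding grel by blast
      have "gd g" unfolding gd_def
      proof (intro ballI impI)
        fix u v assume uv: "u \<in> V" "v \<in> V" "(u, v) \<in> rel_of g"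
        have *: "elts u \<subseteq> ?D \<and> inV (C ` elts u) \<and> v = H (mk (C ` elts u))"
        proof (cases "u = x")
          case True
          then show ?thesis using uv xnD iC xD unfolding grel by blast
        next
          case False
          then have u: "u \<in> ?D" "v = C u" using uv unfolding grel by auto
          then show ?thesis using eqn[of u] down T(3) valV by blast
        qed
        show "(\<forall>y \<in> elts u. \<exists>w \<in> V. (y, w) \<in> rel_of g) \<and>
          (\<exists>s \<in> V. (\<forall>w \<in> V. w \<in> elts s \<longleftrightarrow> (\<exists>y \<in> elts u. (y, w) \<in> rel_of g)) \<and> v = H s)"
        proof (intro conjI ballI)
          fix y assume "y \<in> elts u"
          then show "\<exists>w \<in> V. (y, w) \<in> rel_of g" using * CV unfolding grel by blast
        next
          show "\<exists>s \<in> V. (\<forall>w \<in> V. w \<in> elts s \<longleftrightarrow> (\<exists>y \<in> elts u. (y, w) \<in> rel_of g)) \<and> v = H s"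
            by (rule bexI[of _ "mk (C ` elts u)"]) (use * img mk_in elts_mk in auto)
        qed
      qed
      then have "val x ?h" using g grel unfolding val_def by blast
      then show False using no by blast
    qed
  qed
  have dC: "df (\<lambda>e. e 0 = C (e 1))"
  proof -
    have "df (\<lambda>e. e 0 = C (e 1)) \<longleftrightarrow> df (\<lambda>e. val (e 1) (e 0))" by (rule dfn_cong) (use Cv ex in auto)
    then show ?thesis using dval dft_var by simp
  qed
  have "C x \<in> V" if "x \<in> V" for x using Cv[OF ex[OF that]] valV by blast
  then show thesis using that[of C] eqn ex dC by blast
qed

text \<open>Only the restriction of \<open>F\<close> to \<open>A\<close> matters; \<open>f\<close> is its graph.\<close>

definition vinj :: "'s set \<Rightarrow> 's set \<Rightarrow> bool" where
  "vinj A B \<longleftrightarrow> (\<exists>F. \<exists>f \<in> V. inj_on F A \<and> F ` A \<subseteq> B \<and> (\<forall>x y. (x, y) \<in> rel_of f \<longleftrightarrow> x \<in> A \<and> y = F x))"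

lemma vinjE:
  assumes "vinj A B"
  obtains F f where "f \<in> V" "inj_on F A" "F ` A \<subseteq> B" "\<And>x y. (x, y) \<in> rel_of f \<longleftrightarrow> x \<in> A \<and> y = F x"
  using assms unfolding vinj_def by metis

lemma vinj_inV: "vinj A B \<Longrightarrow> inV A"
proof (erule vinjE)
  fix F f assume f: "f \<in> V" "\<And>x y. (x, y) \<in> rel_of f \<longleftrightarrow> x \<in> A \<and> y = F x"
  then have "Domain (rel_of f) = A" by auto
  then show "inV A" using inV_Domain[OF f(1)] by simp
qed

lemma vinj_trans: assumes "vinj A B" "vinj B C" shows "vinj A C"
proof -
  obtain F f where f: "f \<in> V" "inj_on F A" "F ` A \<subseteq> B" "\<And>x y. (x, y) \<in> rel_of f \<longleftrightarrow> x \<in> A \<and> y = F x"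
    using assms by (elim vinjE) blast
  obtain G g where g: "g \<in> V" "inj_on G B" "G ` B \<subseteq> C" "\<And>x y. (x, y) \<in> rel_of g \<longleftrightarrow> x \<in> B \<and> y = G x"
    using assms by (elim vinjE) blast
  have FV: "F x \<in> V" "G (F x) \<in> V" if "x \<in> A" for x
    using rel_in[OF f(1)] rel_in[OF g(1)] f g that by blast+
  obtain h where h: "h \<in> V" "\<And>x y. (x, y) \<in> rel_of h \<longleftrightarrow> x \<in> A \<and> y = G (F x)"
  proof (rule graph[where F = "\<lambda>x. G (F x)" and Q = "\<lambda>x y. \<exists>z \<in> V. (x, z) \<in> rel_of f \<and> (z, y) \<in> rel_of g"])
    show "df (\<lambda>e. \<exists>z \<in> V. (e 0, z) \<in> rel_of f \<and> (z, e 1) \<in> rel_of g)"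
      by (intro dfn_intros f g)
    fix x y assume "x \<in> A" "y \<in> V"
    then show "(\<exists>z \<in> V. (x, z) \<in> rel_of f \<and> (z, y) \<in> rel_of g) \<longleftrightarrow> y = G (F x)"
      using f g FV by auto
  qed (use assms vinj_inV FV in blast)+
  moreover have "inj_on (\<lambda>x. G (F x)) A"
    using comp_inj_on[OF f(2) inj_on_subset[OF g(2) f(3)]] by (simp add: comp_def)
  moreover have "(\<lambda>x. G (F x)) ` A \<subseteq> C" using f(3) g(3) by blast
  ultimately show ?thesis unfolding vinj_def by blast
qed

lemma vinj_sub: assumes "inV A" "A \<subseteq> B" shows "vinj A B"
proof -
  obtain f where "f \<in> V" "\<And>x y. (x, y) \<in> rel_of f \<longleftrightarrow> x \<in> A \<and> y = x"
    by (rule graph[OF assms(1), where F = "\<lambda>x. x" and Q = "\<lambda>x y. y = x"])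
      (use inV_subV assms in \<open>auto intro: dfn_intros\<close>)
  then show ?thesis unfolding vinj_def using assms by (intro exI[of _ "\<lambda>x. x"] bexI[of _ f]) auto
qed

text \<open>Choose for each element the least of the ordinals related to it.\<close>

lemma vinj_color:
  assumes A: "inV A" and r: "r \<in> V" and k: "Ord k"
    and tot: "\<And>x. x \<in> A \<Longrightarrow> \<exists>y \<in> elts k. (x, y) \<in> rel_of r"
    and inj: "\<And>x x' y. x \<in> A \<Longrightarrow> x' \<in> A \<Longrightarrow> (x, y) \<in> rel_of r \<Longrightarrow> (x', y) \<in> rel_of r \<Longrightarrow> x = x'"
    and kV: "k \<in> V"
  shows "vinj A (elts k)"
proof -
  define Q where "Q x y \<longleftrightarrow> y \<in> elts k \<and> (x, y) \<in> rel_of r \<and> (\<forall>z \<in> elts y. (x, z) \<notin> rel_of r)" for x y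
  have dQ: "df (\<lambda>e. Q (e 0) (e 1))" unfolding Q_def by (intro dfn_intros r kV)
  have ex: "\<exists>!y. Q x y" if x: "x \<in> A" for x
  proof -
    obtain y where "y \<in> elts k \<and> (x, y) \<in> rel_of r" using tot[OF x] by blast
    then obtain y where y: "y \<in> elts k \<and> (x, y) \<in> rel_of r"
      "\<And>z. z \<in> elts y \<Longrightarrow> \<not> (z \<in> elts k \<and> (x, z) \<in> rel_of r)"
      using mem_least[of "\<lambda>y. y \<in> elts k \<and> (x, y) \<in> rel_of r"] by metis
    then have "Q x y" unfolding Q_def using Ord_trans[OF k] by blast
    moreover have "y' = y" if "Q x y'" for y'
      using that \<open>Q x y\<close> Ord_linear[of y y'] Ord_elt[OF k] unfolding Q_def by blast
    ultimately show ?thesis by blast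
  qed
  define F where "F x = (THE y. Q x y)" for x
  have F: "Q x y \<longleftrightarrow> y = F x" if "x \<in> A" for x y
    using ex[OF that] unfolding F_def by (metis the_equality)
  have FQ: "Q x (F x)" if "x \<in> A" for x using F[OF that] by blast
  obtain f where "f \<in> V" "\<And>x y. (x, y) \<in> rel_of f \<longleftrightarrow> x \<in> A \<and> y = F x"
    by (rule graph[OF A _ dQ, where F = F]) (use F FQ transV[OF kV] Q_def in blast)+
  moreover have "inj_on F A" using FQ inj unfolding inj_on_def Q_def by metis
  ultimately show ?thesis unfolding vinj_def using FQ unfolding Q_def by blast
qed

text \<open>If the process did not stop, its inverse would be a replacement function from a subset of
  \<open>X\<close> onto the class of all ordinals.\<close>

lemma enumerate:
  assumes X: "inV X" and nxV: "\<And>s. s \<in> V \<Longrightarrow> nx s \<in> V" and dnx: "df (\<lambda>e. e 0 = nx (e 1))"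
    and nx: "\<And>s. s \<in> V \<Longrightarrow> \<not> X \<subseteq> elts s \<Longrightarrow> nx s \<in> X - elts s"
  obtains C \<theta> where "\<theta> \<in> V" "Ord \<theta>" "inj_on C (elts \<theta>)" "C ` elts \<theta> = X"
    "\<And>\<alpha>. \<alpha> \<in> elts \<theta> \<Longrightarrow> inV (C ` elts \<alpha>) \<and> C \<alpha> = nx (mk (C ` elts \<alpha>)) \<and> \<not> X \<subseteq> C ` elts \<alpha>"
    "\<And>x. x \<in> V \<Longrightarrow> C x \<in> V" "df (\<lambda>e. e 0 = C (e 1))"
proof -
  obtain C where C: "\<And>x. x \<in> V \<Longrightarrow> C x \<in> V" "\<And>x. x \<in> V \<Longrightarrow> inV (C ` elts x)"
    "\<And>x. x \<in> V \<Longrightarrow> C x = nx (mk (C ` elts x))" "df (\<lambda>e. e 0 = C (e 1))"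
    by (rule mem_rec[OF nxV dnx]) (assumption | rule that)+
  have step: "C \<alpha> \<in> X - C ` elts \<alpha>" if "\<alpha> \<in> V" "\<not> X \<subseteq> C ` elts \<alpha>" for \<alpha>
    using nx[of "mk (C ` elts \<alpha>)"] that C(2)[OF that(1)] C(3)[OF that(1)] by (simp add: elts_mk mk_in)
  have inj: "\<alpha> = \<beta>" if "Ord \<alpha>" "Ord \<beta>" "\<alpha> \<in> V" "\<beta> \<in> V" "\<not> X \<subseteq> C ` elts \<alpha>" "\<not> X \<subseteq> C ` elts \<beta>" "C \<alpha> = C \<beta>" for \<alpha> \<beta>
    using Ord_linear[OF that(1,2)] step[OF that(3,5)] step[OF that(4,6)] that(7)
    by (metis DiffD2 imageI)
  have "\<exists>\<alpha>. \<alpha> \<in> V \<and> Ord \<alpha> \<and> X \<subseteq> C ` elts \<alpha>"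
  proof (rule ccontr)
    assume "\<not> ?thesis"
    then have no: "\<not> X \<subseteq> C ` elts \<alpha>" if "\<alpha> \<in> V" "Ord \<alpha>" for \<alpha> using that by blast
    let ?X = "{x \<in> X. \<exists>\<alpha> \<in> V. Ord \<alpha> \<and> x = C \<alpha>}"
    have X': "inV ?X" by (intro inV_sep X dfn_intros dft_fun[OF C(1,4)])
    define F where "F x = (THE \<alpha>. \<alpha> \<in> V \<and> Ord \<alpha> \<and> x = C \<alpha>)" for x
    have F: "F (C \<alpha>) = \<alpha>" if "\<alpha> \<in> V" "Ord \<alpha>" for \<alpha>
      unfolding F_def by (rule the_equality) (use that inj no in auto)
    have "inV (F ` ?X)"
    proof (rule inV_repl[OF X', where Q = "\<lambda>x \<alpha>. Ord \<alpha> \<and> x = C \<alpha>"])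
      show "df (\<lambda>e. e 0 \<in> ?X \<longrightarrow> Ord (e 1) \<and> e 0 = C (e 1))"
        by (intro dfn_imp dfn_inV X' dfn_intros dft_fun[OF C(1,4)])
    qed (use F in auto)
    moreover have "F ` ?X = {\<alpha> \<in> V. Ord \<alpha>}"
    proof (intro equalityI subsetI)
      fix \<alpha> assume a: "\<alpha> \<in> {\<alpha> \<in> V. Ord \<alpha>}"
      then have "C \<alpha> \<in> ?X" using step[of \<alpha>] no by blast
      then show "\<alpha> \<in> F ` ?X" using F a by (metis (no_types, lifting) image_eqI mem_Collect_eq)
    qed (use F in auto)
    ultimately obtain \<omega> where o: "\<omega> \<in> V" "elts \<omega> = {\<alpha> \<in> V. Ord \<alpha>}" unfolding inV_def by metis
    have "Ord \<omega>" by (rule OrdI) (use o transV Ord_elt in blast)+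
    then show False using o mem_irrefl by blast
  qed
  then obtain \<theta> where th: "\<theta> \<in> V \<and> Ord \<theta> \<and> X \<subseteq> C ` elts \<theta>"
    "\<And>\<alpha>. \<alpha> \<in> elts \<theta> \<Longrightarrow> \<not> (\<alpha> \<in> V \<and> Ord \<alpha> \<and> X \<subseteq> C ` elts \<alpha>)"
    using mem_least[of "\<lambda>\<alpha>. \<alpha> \<in> V \<and> Ord \<alpha> \<and> X \<subseteq> C ` elts \<alpha>"] by metis
  have el: "\<alpha> \<in> V \<and> Ord \<alpha> \<and> \<not> X \<subseteq> C ` elts \<alpha>" if "\<alpha> \<in> elts \<theta>" for \<alpha>
    using th that transV Ord_elt by blast
  show thesis
  proof (rule that[of \<theta> C])
    show "inj_on C (elts \<theta>)"
    proof (rule inj_onI)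
      fix \<alpha> \<beta> assume "\<alpha> \<in> elts \<theta>" "\<beta> \<in> elts \<theta>" "C \<alpha> = C \<beta>"
      then show "\<alpha> = \<beta>" using inj[of \<alpha> \<beta>] el[of \<alpha>] el[of \<beta>] by simp
    qed
    have "C \<alpha> \<in> X" if "\<alpha> \<in> elts \<theta>" for \<alpha> using step[of \<alpha>] el[OF that] by blast
    then show "C ` elts \<theta> = X" using th(1) by (intro equalityI image_subsetI) simp_all
    show "inV (C ` elts \<alpha>) \<and> C \<alpha> = nx (mk (C ` elts \<alpha>)) \<and> \<not> X \<subseteq> C ` elts \<alpha>"
      if "\<alpha> \<in> elts \<theta>" for \<alpha> using C(2,3) el[OF that] by simp
  qed (use th(1) C(1,4) in simp_all)
qed

end

section \<open>Least fixed points, induction on names and order types\<close>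

context zfc_model begin

text \<open>Knaster-Tarski inside the model: \<open>K\<close> is the intersection of all subsets of
  \<open>A\<close> closed under \<open>\<Phi>\<close>, which is definable by a quantifier over
  \<open>V\<close>. It gives inductive definitions without a construction in stages.\<close>

lemma lfpV:
  assumes A: "inV A" and d: "df (\<lambda>e. \<Phi> (e 0) (e 1))"
    and mono: "\<And>K K' x. K \<in> V \<Longrightarrow> K' \<in> V \<Longrightarrow> elts K \<subseteq> elts K' \<Longrightarrow> x \<in> A \<Longrightarrow> \<Phi> K x \<Longrightarrow> \<Phi> K' x"
  obtains K where "K \<in> V" "elts K = {x \<in> A. \<Phi> K x}"
proof -
  have dP: "df (\<lambda>e. \<Phi> (t e) (u e))" if "dt t" "dt u" for t u by (rule dfn_subst2[OF d that])
  obtain a where a: "a \<in> V" "elts a = A" using A unfolding inV_def by blast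
  let ?cl = "\<lambda>K. elts K \<subseteq> elts a \<and> (\<forall>y \<in> elts a. \<Phi> K y \<longrightarrow> y \<in> elts K)"
  have "inV {x \<in> elts a. \<forall>K \<in> V. ?cl K \<longrightarrow> x \<in> elts K}"
    by (intro inV_sep inV_elts a dfn_intros dP)
  then obtain K where K: "K \<in> V" "elts K = {x \<in> elts a. \<forall>K \<in> V. ?cl K \<longrightarrow> x \<in> elts K}"
    unfolding inV_def by auto
  have "inV {x \<in> elts a. \<Phi> K x}" by (intro inV_sep inV_elts a dfn_intros dP K)
  then obtain F where F: "F \<in> V" "elts F = {x \<in> elts a. \<Phi> K x}" unfolding inV_def by auto
  have FK: "elts F \<subseteq> elts K"
  proof
    fix x assume x: "x \<in> elts F"
    have "x \<in> elts L" if L: "L \<in> V" "?cl L" for L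
    proof -
      have "elts K \<subseteq> elts L" using L K by blast
      then have "\<Phi> L x" using mono[OF K(1) L(1)] x F a by blast
      then show ?thesis using L x F by blast
    qed
    moreover have "x \<in> elts a" using x F(2) by simp
    ultimately show "x \<in> elts K" unfolding K(2) by simp
  qed
  have "\<Phi> K x" if "x \<in> elts a" "\<Phi> F x" for x using mono[OF F(1) K(1) FK] that a by simp
  then have "?cl F" using F(2) by simp
  then have "elts K \<subseteq> elts F" using K(2) F(1) by blast
  then show thesis using that[OF K(1)] F(2) FK a by auto
qed

lemma function_graph:
  assumes "A \<subseteq> V" "\<And>x. x \<in> A \<Longrightarrow> F x \<in> V" "elts f = {pr x (F x) | x. x \<in> A}"
  shows "is_function f A" "x \<in> A \<Longrightarrow> app f x = F x"
proof -
  have r: "(x, y) \<in> rel_of f \<longleftrightarrow> x \<in> A \<and> y = F x" for x y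
  proof
    assume "(x, y) \<in> rel_of f"
    then obtain u where "u \<in> A" "is_pair (pr u (F u)) x y" unfolding rel_of_def assms(3) by auto
    then show "x \<in> A \<and> y = F x" using is_pair_inj pr_is_pair(1)[of u "F u"] assms by blast
  next
    assume "x \<in> A \<and> y = F x"
    then show "(x, y) \<in> rel_of f" unfolding rel_of_def assms(3)
      using pr_is_pair(1)[of x "F x"] assms by blast
  qed
  have "is_pair (pr x (F x)) x (F x)" if "x \<in> A" for x using that assms(1,2) pr_is_pair(1) by blast
  then show "is_function f A" unfolding is_function_def
    using r assms(3) by (auto simp: single_valued_def)
  show "app f x = F x" if "x \<in> A" using that r unfolding app_def by auto
qed

lemma function_rel: "is_function f A \<Longrightarrow> x \<in> A \<Longrightarrow> (x, y) \<in> rel_of f \<longleftrightarrow> y = app f x"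
proof -
  assume f: "is_function f A" "x \<in> A"
  then obtain z where z: "(x, z) \<in> rel_of f" unfolding is_function_def by blast
  have sv: "u = z" if "(x, u) \<in> rel_of f" for u
    using f(1) z that unfolding is_function_def single_valued_def by blast
  have "app f x = z" unfolding app_def using z sv by (rule the_equality)
  then show ?thesis using z sv by blast
qed

text \<open>A component of a pair in \<open>w\<close> lies three membership steps below
  \<open>w\<close>, hence the transitive closure of membership.\<close>

lemma name_induct:
  assumes "\<And>w. (\<And>\<sigma> z p. z \<in> elts w \<Longrightarrow> is_pair z \<sigma> p \<Longrightarrow> Q \<sigma>) \<Longrightarrow> Q w" shows "Q (w::'s)"
proof -
  let ?R = "{(x, y). (x::'s) \<epsilon> y}"
  have "wf (?R\<^sup>+)" by (intro wf_trancl wf_mem)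
  then show ?thesis
  proof (induction w rule: wf_induct_rule)
    case (less w)
    show ?case
    proof (rule assms)
      fix \<sigma> z p assume "z \<in> elts w" "is_pair z \<sigma> p"
      then obtain t where "\<sigma> \<in> elts t" "t \<in> elts z" "z \<in> elts w" using is_pair_mem by metis
      then have "(\<sigma>, t) \<in> ?R" "(t, z) \<in> ?R" "(z, w) \<in> ?R" by auto
      then have "(\<sigma>, w) \<in> ?R\<^sup>+" by (meson trancl.simps)
      then show "Q \<sigma>" by (rule less)
    qed
  qed
qed

lemma wf_mem_elts: "wf {(x, y). (x::'s) \<in> elts y}"
  using wf_mem by simp

text \<open>The Mostowski collapse of \<open>A\<close> below \<xi>. It is computed outside the
  model, because \<open>A\<close> will be a subset of \<open>k\<close> that may exist only in the
  extension.\<close>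

definition otp :: "'s set \<Rightarrow> 's \<Rightarrow> 's" where
  "otp A = wfrec {(x, y). x \<in> elts y} (\<lambda>f \<xi>. mk (f ` (A \<inter> elts \<xi>)))"

lemma otp_unfold: "otp A \<xi> = mk (otp A ` (A \<inter> elts \<xi>))"
proof -
  have "otp A \<xi> = mk (cut (otp A) {(x, y). x \<in> elts y} \<xi> ` (A \<inter> elts \<xi>))"
    unfolding otp_def by (subst wfrec[OF wf_mem_elts]) simp
  also have "cut (otp A) {(x, y). x \<in> elts y} \<xi> ` (A \<inter> elts \<xi>) = otp A ` (A \<inter> elts \<xi>)"
    by (rule image_cong) (auto simp: cut_apply)
  finally show ?thesis .
qed

text \<open>No closure property of the universe is available, so the collapse has to be found among
  the given sets: by induction it never exceeds \<xi>, and its values form an initial segment of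
  \<xi>, to which \<open>Ord_initial\<close> applies.\<close>

lemma otp: "Ord \<xi> \<Longrightarrow> elts (otp A \<xi>) = otp A ` (A \<inter> elts \<xi>) \<and> (otp A \<xi> = \<xi> \<or> otp A \<xi> \<in> elts \<xi>)"
proof (induction \<xi> rule: mem_induct)
  case (step \<xi>)
  have IH: "elts (otp A \<eta>) = otp A ` (A \<inter> elts \<eta>)" "otp A \<eta> = \<eta> \<or> otp A \<eta> \<in> elts \<eta>" if "\<eta> \<in> elts \<xi>" for \<eta>
    using step.IH[OF that Ord_elt[OF step.prems that]] by auto
  have "\<exists>\<beta>. (\<beta> = \<xi> \<or> \<beta> \<in> elts \<xi>) \<and> elts \<beta> = otp A ` (A \<inter> elts \<xi>)"
  proof (rule Ord_initial[OF step.prems])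
    show "otp A ` (A \<inter> elts \<xi>) \<subseteq> elts \<xi>"
    proof
      fix z assume "z \<in> otp A ` (A \<inter> elts \<xi>)"
      then obtain \<eta> where "\<eta> \<in> elts \<xi>" "z = otp A \<eta>" by auto
      then show "z \<in> elts \<xi>" using IH(2)[of \<eta>] Ord_trans[OF step.prems] by auto
    qed
    fix z assume "z \<in> otp A ` (A \<inter> elts \<xi>)"
    then obtain \<eta> where "\<eta> \<in> elts \<xi>" "z = otp A \<eta>" by auto
    then show "elts z \<subseteq> otp A ` (A \<inter> elts \<xi>)" using IH(1)[of \<eta>] Ord_trans[OF step.prems] by auto
  qed
  then obtain \<beta> where "\<beta> = \<xi> \<or> \<beta> \<in> elts \<xi>" "elts \<beta> = otp A ` (A \<inter> elts \<xi>)" by blast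
  moreover from this have "otp A \<xi> = \<beta>" by (metis mk_elts otp_unfold)
  ultimately show ?case by simp
qed

lemma otp_inj: "Ord k \<Longrightarrow> A \<subseteq> elts k \<Longrightarrow> inj_on (otp A) A"
proof (rule inj_onI)
  fix x y assume k: "Ord k" "A \<subseteq> elts k" and xy: "x \<in> A" "y \<in> A" "otp A x = otp A y"
  have "otp A u \<in> elts (otp A v)" if "u \<in> A" "v \<in> A" "u \<in> elts v" for u v
    using otp[of v A] Ord_elt[OF k(1)] k(2) that by blast
  then show "x = y" using Ord_linear[of x y] Ord_elt[OF k(1)] k(2) xy mem_irrefl by (metis subsetD)
qed

end

section \<open>Generic extensions\<close>

text \<open>The order is a relation coded by a member of \<open>V\<close>, so that it can occur in
  definable predicates.\<close>

locale forcing_ext = zfc_model V for V :: "'s::set_universe set" +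
  fixes P LE :: 's and G N :: "'s set"
  assumes PV: "P \<in> V" and LEV: "LE \<in> V"
    and le_refl: "\<And>p. p \<in> elts P \<Longrightarrow> (p, p) \<in> rel_of LE"
    and le_trans: "\<And>p q r. (p, q) \<in> rel_of LE \<Longrightarrow> (q, r) \<in> rel_of LE \<Longrightarrow> (p, r) \<in> rel_of LE"
    and le_P: "\<And>p q. (p, q) \<in> rel_of LE \<Longrightarrow> p \<in> elts P \<and> q \<in> elts P"
    and G: "generic_filter V (elts P) (\<lambda>p q. (p, q) \<in> rel_of LE) G"
    and ext: "is_generic_extension V (elts P) G N"
begin

abbreviation le :: "'s \<Rightarrow> 's \<Rightarrow> bool" where "le p q \<equiv> (p, q) \<in> rel_of LE"

lemma GP: "p \<in> G \<Longrightarrow> p \<in> elts P" and G_ne: "\<exists>p. p \<in> G"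
  and G_down: "p \<in> G \<Longrightarrow> le q p \<Longrightarrow> q \<in> G"
  and G_dir: "p \<in> G \<Longrightarrow> q \<in> G \<Longrightarrow> \<exists>r \<in> G. le p r \<and> le q r"
  and G_gen: "d \<in> V \<Longrightarrow> dense_in (elts P) (\<lambda>p q. le p q) (elts d) \<Longrightarrow> G \<inter> elts d \<noteq> {}"
proof -
  have g: "G \<subseteq> elts P" "G \<noteq> {}"
    "\<forall>p \<in> G. \<forall>q \<in> elts P. le q p \<longrightarrow> q \<in> G" "\<forall>p \<in> G. \<forall>q \<in> G. \<exists>r \<in> G. le p r \<and> le q r"
    "\<forall>d \<in> V. dense_in (elts P) (\<lambda>p q. le p q) (elts d) \<longrightarrow> G \<inter> elts d \<noteq> {}"
    by (insert G[unfolded generic_filter_def]; elim conjE; assumption)+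
  show "p \<in> G \<Longrightarrow> p \<in> elts P" using g(1) by blast
  show "\<exists>p. p \<in> G" using g(2) by blast
  show "p \<in> G \<Longrightarrow> le q p \<Longrightarrow> q \<in> G" using g(3) le_P by blast
  show "p \<in> G \<Longrightarrow> q \<in> G \<Longrightarrow> \<exists>r \<in> G. le p r \<and> le q r" using g(4) by blast
  show "d \<in> V \<Longrightarrow> dense_in (elts P) (\<lambda>p q. le p q) (elts d) \<Longrightarrow> G \<inter> elts d \<noteq> {}" using g(5) by blast
qed

lemma PV': "p \<in> elts P \<Longrightarrow> p \<in> V"
  by (rule transV[OF PV])

lemma gen_meet:
  assumes "df (\<lambda>e. D (e 0))" "\<And>p. p \<in> elts P \<Longrightarrow> \<exists>q \<in> elts P. le p q \<and> D q" shows "\<exists>r \<in> G. D r"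
proof -
  have "inV {q \<in> elts P. D q}" by (intro inV_sep inV_elts PV assms(1))
  then obtain d where d: "d \<in> V" "elts d = {q \<in> elts P. D q}" unfolding inV_def by auto
  then have "dense_in (elts P) (\<lambda>p q. le p q) (elts d)" unfolding dense_in_def using assms(2) by auto
  then show ?thesis using G_gen[OF d(1)] d(2) by auto
qed

text \<open>Density below \<open>p\<close> becomes density outright once the conditions incompatible
  with \<open>p\<close> are added; directedness of \<open>G\<close> excludes those.\<close>

lemma gen_below:
  assumes d: "df (\<lambda>e. D (e 0))" and p: "p \<in> G"
    and dense: "\<And>q. le p q \<Longrightarrow> \<exists>r \<in> elts P. le q r \<and> D r"
  shows "\<exists>r \<in> G. le p r \<and> D r"
proof -
  have dD: "df (\<lambda>e. D (t e))" if "dt t" for t by (rule dfn_subst1[OF d that])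
  have pV: "p \<in> V" using p GP PV' by blast
  have "\<exists>r \<in> G. (le p r \<and> D r) \<or> \<not> (\<exists>s \<in> V. le p s \<and> le r s)"
  proof (rule gen_meet)
    show "df (\<lambda>e. (le p (e 0) \<and> D (e 0)) \<or> \<not> (\<exists>s \<in> V. le p s \<and> le (e 0) s))"
      by (intro dfn_intros dD LEV pV)
    fix q assume q: "q \<in> elts P"
    show "\<exists>r \<in> elts P. le q r \<and> ((le p r \<and> D r) \<or> \<not> (\<exists>s \<in> V. le p s \<and> le r s))"
    proof (cases "\<exists>s \<in> V. le p s \<and> le q s")
      case True
      then obtain s where "le p s" "le q s" by blast
      then show ?thesis using dense[of s] le_trans le_P by meson
    qed (use q le_refl in blast)
  qed
  then obtain r where r: "r \<in> G" "(le p r \<and> D r) \<or> \<not> (\<exists>s \<in> V. le p s \<and> le r s)" by blast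
  moreover obtain s where "s \<in> G" "le p s" "le r s" using G_dir[OF p r(1)] by blast
  ultimately show ?thesis using GP PV' by blast
qed

text \<open>The conditions that satisfy \<open>D\<close> or have no extension satisfying it are
  dense.\<close>

lemma gen_decide:
  assumes d: "df (\<lambda>e. D (e 0))"
  shows "(\<exists>r \<in> G. D r) \<or> (\<exists>r \<in> G. \<forall>q. le r q \<longrightarrow> \<not> D q)"
proof -
  have dD: "df (\<lambda>e. D (t e))" if "dt t" for t by (rule dfn_subst1[OF d that])
  have "\<exists>r \<in> G. D r \<or> (\<forall>q \<in> elts P. le r q \<longrightarrow> \<not> D q)"
  proof (rule gen_meet)
    show "df (\<lambda>e. D (e 0) \<or> (\<forall>q \<in> elts P. le (e 0) q \<longrightarrow> \<not> D q))"
      by (intro dfn_intros dD LEV PV)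
    fix p assume "p \<in> elts P"
    then show "\<exists>q \<in> elts P. le p q \<and> (D q \<or> (\<forall>r \<in> elts P. le q r \<longrightarrow> \<not> D r))"
      using le_refl by blast
  qed
  then show ?thesis using le_P by blast
qed

text \<open>\<open>S\<close> plays the role of a name for \<open>X\<close>; that it is closed under strengthening the condition makes
  \<open>(r, x) \<in> rel_of S\<close> behave like \<open>r\<close> forcing \<open>x \<in> X\<close>.\<close>

definition named :: "'s \<Rightarrow> 's set \<Rightarrow> bool" where
  "named S X \<longleftrightarrow> S \<in> V \<and> (\<forall>r x. (r, x) \<in> rel_of S \<longrightarrow> r \<in> elts P) \<and>
     (\<forall>r q x. (r, x) \<in> rel_of S \<longrightarrow> le r q \<longrightarrow> (q, x) \<in> rel_of S) \<and>
     (\<forall>x. x \<in> X \<longleftrightarrow> (\<exists>r \<in> G. (r, x) \<in> rel_of S))"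

definition nameable :: "'s set \<Rightarrow> bool" where
  "nameable X \<longleftrightarrow> (\<exists>S. named S X)"

lemma namedD:
  assumes "named S X"
  shows "S \<in> V" "(r, x) \<in> rel_of S \<Longrightarrow> r \<in> elts P"
    "(r, x) \<in> rel_of S \<Longrightarrow> le r q \<Longrightarrow> (q, x) \<in> rel_of S"
    "x \<in> X \<Longrightarrow> \<exists>r \<in> G. (r, x) \<in> rel_of S" "r \<in> G \<Longrightarrow> (r, x) \<in> rel_of S \<Longrightarrow> x \<in> X"
  using assms unfolding named_def by blast+

lemma named_above:
  assumes "named S X" "x \<in> X" "p \<in> G" shows "\<exists>r \<in> G. le p r \<and> (r, x) \<in> rel_of S"
  using namedD(3,4)[OF assms(1)] assms(2) G_dir[OF assms(3)] by blast

lemma nameableI: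
  assumes B: "inV B" and d: "df (\<lambda>e. Q (e 0) (e 1))"
    and up: "\<And>r q x. Q r x \<Longrightarrow> le r q \<Longrightarrow> x \<in> B \<Longrightarrow> Q q x"
    and X: "\<And>x. x \<in> X \<longleftrightarrow> x \<in> B \<and> (\<exists>r \<in> G. Q r x)"
  shows "nameable X"
proof -
  obtain S where S: "S \<in> V" "\<And>r x. (r, x) \<in> rel_of S \<longleftrightarrow> r \<in> elts P \<and> x \<in> B \<and> Q r x"
    by (rule rel_sep[OF inV_elts[OF PV] B d]) (rule that)
  have "named S X" unfolding named_def
  proof (intro conjI allI impI iffI)
    fix x assume "x \<in> X"
    then show "\<exists>r \<in> G. (r, x) \<in> rel_of S" using X S GP by blast
  qed (use S up X le_P in blast)+
  then show ?thesis unfolding nameable_def by blast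
qed

lemma nameable_inV: "inV A \<Longrightarrow> nameable A"
  by (rule nameableI[where B = A and Q = "\<lambda>r x. True"]) (use G_ne dfn_triv in auto)

text \<open>The forcing relation for \<open>z = c w\<close> is a least fixed point, which exists as a set of \<open>V\<close>; this
  avoids a recursion on names inside \<open>V\<close>.\<close>

lemma nameable_collapse:
  assumes W: "inV W" and Z: "inV Z" "\<And>z. z \<in> Z \<Longrightarrow> elts z \<subseteq> Z" and E: "nameable E"
    and wf: "wf {(w', w). w' \<in> W \<and> w \<in> W \<and> pr w' w \<in> E}"
    and c: "\<And>w. w \<in> W \<Longrightarrow> elts (c w) = c ` {w' \<in> W. pr w' w \<in> E}"
  obtains J where "named J {pr (c w) w | w. w \<in> W \<and> c w \<in> Z}"
proof -
  obtain S where S: "named S E" using E unfolding nameable_def by blast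
  note SD = namedD[OF S]
  let ?P = "elts P"
  obtain w0 z0 where wz: "w0 \<in> V" "elts w0 = W" "z0 \<in> V" "elts z0 = Z" using W Z unfolding inV_def by blast
  \<comment> \<open>\<open>\<Psi> K r z w\<close> says that \<open>r\<close> forces
    \<open>z = c w\<close>, granted that \<open>K\<close> is this relation for the \<open>w'\<close>
    below \<open>w\<close>: one clause for each inclusion. Both use density above \<open>r\<close>,
    and \<open>K\<close> occurs only positively, which keeps the operator monotone.\<close>
  define \<Psi> where "\<Psi> K r z w \<longleftrightarrow>
      (\<forall>y \<in> elts z. \<forall>r1 \<in> ?P. le r r1 \<longrightarrow> (\<exists>r2 \<in> ?P. le r1 r2 \<and>
          (\<exists>w' \<in> elts w0. (r2, pr w' w) \<in> rel_of S \<and> (r2, pr y w') \<in> rel_of K))) \<and>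
      (\<forall>w' \<in> elts w0. \<forall>r1 \<in> ?P. le r r1 \<longrightarrow> (r1, pr w' w) \<in> rel_of S \<longrightarrow>
          (\<exists>r2 \<in> ?P. le r1 r2 \<and> (\<exists>y \<in> elts z. (r2, pr y w') \<in> rel_of K)))" for K r z w
  let ?A = "{pr r x | r x. r \<in> ?P \<and> x \<in> {pr z w | z w. z \<in> Z \<and> w \<in> W}}"
  have A: "inV ?A" by (intro inV_times inV_elts PV W Z)
  let ?\<Phi> = "\<lambda>K x. \<exists>r \<in> ?P. \<exists>z \<in> elts z0. \<exists>w \<in> elts w0. x = pr r (pr z w) \<and> \<Psi> K r z w"
  have d\<Phi>: "df (\<lambda>e. ?\<Phi> (e 0) (e 1))"
    unfolding \<Psi>_def by (intro dfn_intros PV LEV SD(1) wz)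
  have mono: "\<Psi> K' r z w" if "K \<in> V" "K' \<in> V" "elts K \<subseteq> elts K'" "\<Psi> K r z w" for K K' r z w
  proof -
    have "rel_of K \<subseteq> rel_of K'" using that(3) unfolding rel_of_def by auto
    then show ?thesis using that(4) unfolding \<Psi>_def by (meson subsetD)
  qed
  obtain K where K: "K \<in> V" "elts K = {x \<in> ?A. ?\<Phi> K x}"
  proof (rule lfpV[OF A d\<Phi>])
    fix K K' x assume k: "K \<in> V" "K' \<in> V" "elts K \<subseteq> elts K'" "?\<Phi> K x"
    show "?\<Phi> K' x" using k(4) mono[OF k(1-3)] by (elim bexE conjE) (intro bexI conjI; assumption | simp)
  qed (rule that)
  have WV: "w \<in> V" if "w \<in> W" for w using inV_mem[OF W that] .
  have ZV: "z \<in> V" if "z \<in> Z" for z using inV_mem[OF Z(1) that] .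
  have Kiff: "(r, pr z w) \<in> rel_of K \<longleftrightarrow> \<Psi> K r z w" if "r \<in> ?P" "z \<in> Z" "w \<in> W" for r z w
  proof -
    have v: "r \<in> V" "z \<in> V" "w \<in> V" "pr z w \<in> V" using that PV' WV ZV pr_is_pair by auto
    have "(r, pr z w) \<in> rel_of K \<longleftrightarrow> pr r (pr z w) \<in> elts K" using rel_iff v by blast
    also have "\<dots> \<longleftrightarrow> ?\<Phi> K (pr r (pr z w))" unfolding K(2) using that by blast
    also have "\<dots> \<longleftrightarrow> \<Psi> K r z w"
    proof
      assume "?\<Phi> K (pr r (pr z w))"
      then obtain r' z' w' where e: "r' \<in> ?P" "z' \<in> Z" "w' \<in> W" "pr r (pr z w) = pr r' (pr z' w')"
          "\<Psi> K r' z' w'" using wz by blast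
      have "r' \<in> V" "z' \<in> V" "w' \<in> V" "pr z' w' \<in> V" using e PV' WV ZV pr_is_pair by auto
      then show "\<Psi> K r z w" using e v by (simp add: pr_inject)
    qed (use that wz in blast)
    finally show ?thesis .
  qed
  have Kup: "(q, pr z w) \<in> rel_of K" if "(r, pr z w) \<in> rel_of K" "le r q" "z \<in> Z" "w \<in> W" for r q z w
    using that Kiff[of r z w] Kiff[of q z w] le_P[OF that(2)] le_trans[OF that(2)] unfolding \<Psi>_def by blast
  \<comment> \<open>The truth lemma for this relation, by induction along \<open>E\<close>, which is
    well-founded although it is given only in the extension.\<close>
  have truth: "w \<in> W \<Longrightarrow> \<forall>z \<in> Z. (\<exists>r \<in> G. (r, pr z w) \<in> rel_of K) \<longleftrightarrow> z = c w" for w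
  proof (induction w rule: wf_induct_rule[OF wf])
    case (1 w)
    have IH: "(\<exists>r \<in> G. (r, pr z w') \<in> rel_of K) \<longleftrightarrow> z = c w'"
      if "w' \<in> W" "pr w' w \<in> E" "z \<in> Z" for w' z using 1 that by blast
    show ?case
    proof (intro ballI iffI)
      fix z assume z: "z \<in> Z" and "\<exists>r \<in> G. (r, pr z w) \<in> rel_of K"
      then obtain r where r: "r \<in> G" "(r, pr z w) \<in> rel_of K" by blast
      then have Psi: "\<Psi> K r z w" using Kiff GP z 1 by blast
      have zV: "z \<in> V" "w \<in> V" using ZV WV z 1 by auto
      have "elts z = elts (c w)"
      proof (intro equalityI subsetI)
        fix y assume y: "y \<in> elts z"
        have "\<exists>r2 \<in> G. le r r2 \<and> (\<exists>w' \<in> elts w0. (r2, pr w' w) \<in> rel_of S \<and> (r2, pr y w') \<in> rel_of K)"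
        proof (rule gen_below[OF _ r(1)])
          show "df (\<lambda>e. \<exists>w' \<in> elts w0. (e 0, pr w' w) \<in> rel_of S \<and> (e 0, pr y w') \<in> rel_of K)"
            by (intro dfn_intros wz SD(1) K zV transV[OF zV(1) y])
          fix q assume "le r q"
          then show "\<exists>r2 \<in> ?P. le q r2 \<and> (\<exists>w' \<in> elts w0. (r2, pr w' w) \<in> rel_of S \<and> (r2, pr y w') \<in> rel_of K)"
            using Psi y le_P[of r q] unfolding \<Psi>_def by simp
        qed
        then obtain r2 w' where w': "r2 \<in> G" "w' \<in> W" "(r2, pr w' w) \<in> rel_of S" "(r2, pr y w') \<in> rel_of K"
          using wz by blast
        then have "pr w' w \<in> E" using SD(5) by blast
        moreover from this have "y = c w'" using IH[OF w'(2), of y] w' Z(2)[OF z] y by blast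
        ultimately show "y \<in> elts (c w)" using c[OF 1(2)] w'(2) by blast
      next
        fix y assume "y \<in> elts (c w)"
        then obtain w' where w': "w' \<in> W" "pr w' w \<in> E" "y = c w'" using c[OF 1(2)] by blast
        obtain r1 where r1: "r1 \<in> G" "le r r1" "(r1, pr w' w) \<in> rel_of S"
          using named_above[OF S w'(2) r(1)] by blast
        have "\<exists>r2 \<in> G. le r1 r2 \<and> (\<exists>y \<in> elts z. (r2, pr y w') \<in> rel_of K)"
        proof (rule gen_below[OF _ r1(1)])
          show "df (\<lambda>e. \<exists>y \<in> elts z. (e 0, pr y w') \<in> rel_of K)"
            by (intro dfn_intros K zV WV w')
          fix q assume q: "le r1 q"
          then have "le r q" "q \<in> ?P" "(q, pr w' w) \<in> rel_of S" using le_trans[OF r1(2)] le_P SD(3)[OF r1(3)] by auto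
          then show "\<exists>r2 \<in> ?P. le q r2 \<and> (\<exists>y \<in> elts z. (r2, pr y w') \<in> rel_of K)"
            using Psi w'(1) wz(2) unfolding \<Psi>_def by blast
        qed
        then obtain r2 y' where "r2 \<in> G" "y' \<in> elts z" "(r2, pr y' w') \<in> rel_of K" by blast
        then show "y \<in> elts z" using IH[OF w'(1,2), of y'] Z(2)[OF z] w'(3) by blast
      qed
      then show "z = c w" by (simp add: elts_inject)
    next
      fix z assume z: "z \<in> Z" "z = c w"
      have zV: "z \<in> V" "w \<in> V" using ZV WV z 1 by auto
      let ?B1 = "\<lambda>r. \<exists>y \<in> elts z. \<not> (\<exists>r2 \<in> ?P. le r r2 \<and>
          (\<exists>w' \<in> elts w0. (r2, pr w' w) \<in> rel_of S \<and> (r2, pr y w') \<in> rel_of K))"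
      let ?B2 = "\<lambda>r. \<exists>w' \<in> elts w0. (r, pr w' w) \<in> rel_of S \<and>
          \<not> (\<exists>r2 \<in> ?P. le r r2 \<and> (\<exists>y \<in> elts z. (r2, pr y w') \<in> rel_of K))"
      \<comment> \<open>A condition outside \<open>K\<close> violates a clause of
        \<open>\<Psi>\<close>, and an extension of it witnesses the violation. So densely many
        conditions lie in \<open>K\<close> or refute \<open>z = c w\<close>; the induction
        hypothesis and directedness of \<open>G\<close> exclude both kinds of refutation.\<close>
      have "\<exists>r \<in> G. (r, pr z w) \<in> rel_of K \<or> ?B1 r \<or> ?B2 r"
      proof (rule gen_meet)
        show "df (\<lambda>e. (e 0, pr z w) \<in> rel_of K \<or> ?B1 (e 0) \<or> ?B2 (e 0))"
          by (intro dfn_intros wz SD(1) K zV PV LEV)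
        fix p assume p: "p \<in> ?P"
        show "\<exists>r \<in> ?P. le p r \<and> ((r, pr z w) \<in> rel_of K \<or> ?B1 r \<or> ?B2 r)"
        proof (cases "(p, pr z w) \<in> rel_of K")
          case True
          then show ?thesis using p le_refl by blast
        next
          case False
          then have "\<not> \<Psi> K p z w" using Kiff p z 1 by blast
          then obtain r where "le p r" "r \<in> ?P" "?B1 r \<or> ?B2 r" unfolding \<Psi>_def by blast
          then show ?thesis by blast
        qed
      qed
      then obtain r where r: "r \<in> G" "(r, pr z w) \<in> rel_of K \<or> ?B1 r \<or> ?B2 r" by blast
      have "\<not> ?B1 r"
      proof
        assume "?B1 r"
        then obtain y where y: "y \<in> elts z" "\<not> (\<exists>r2 \<in> ?P. le r r2 \<and>
          (\<exists>w' \<in> elts w0. (r2, pr w' w) \<in> rel_of S \<and> (r2, pr y w') \<in> rel_of K))" by blast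
        then obtain w' where w': "w' \<in> W" "pr w' w \<in> E" "y = c w'" using c[OF 1(2)] z by blast
        have yZ: "y \<in> Z" using Z(2)[OF z(1)] y by blast
        obtain q where q: "q \<in> G" "(q, pr y w') \<in> rel_of K" using IH[OF w'(1,2) yZ] w'(3) by blast
        obtain q1 where q1: "q1 \<in> G" "le q q1" "(q1, pr w' w) \<in> rel_of S"
          using named_above[OF S w'(2) q(1)] by blast
        obtain q2 where q2: "q2 \<in> G" "le r q2" "le q1 q2" using G_dir[OF r(1) q1(1)] by blast
        have "(q2, pr w' w) \<in> rel_of S" "(q2, pr y w') \<in> rel_of K"
          using SD(3)[OF q1(3) q2(3)] Kup[OF q(2) le_trans[OF q1(2) q2(3)] yZ w'(1)] by auto
        then show False using y(2) q2 GP w'(1) wz(2) by blast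
      qed
      moreover have "\<not> ?B2 r"
      proof
        assume "?B2 r"
        then obtain w' where w': "w' \<in> W" "(r, pr w' w) \<in> rel_of S"
          "\<not> (\<exists>r2 \<in> ?P. le r r2 \<and> (\<exists>y \<in> elts z. (r2, pr y w') \<in> rel_of K))" using wz by blast
        then have e: "pr w' w \<in> E" using SD(5) r(1) by blast
        then have cz: "c w' \<in> elts z" using c[OF 1(2)] z w'(1) by blast
        then have cZ: "c w' \<in> Z" using Z(2)[OF z(1)] by blast
        obtain q where q: "q \<in> G" "(q, pr (c w') w') \<in> rel_of K" using IH[OF w'(1) e cZ] by blast
        obtain q2 where q2: "q2 \<in> G" "le r q2" "le q q2" using G_dir[OF r(1) q(1)] by blast
        have "(q2, pr (c w') w') \<in> rel_of K" using Kup[OF q(2) q2(3) cZ w'(1)] .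
        then show False using w'(3) q2 GP cz by blast
      qed
      ultimately show "\<exists>r \<in> G. (r, pr z w) \<in> rel_of K" using r by blast
    qed
  qed
  have sub: "r \<in> ?P \<and> (\<exists>z w. x = pr z w \<and> z \<in> Z \<and> w \<in> W)" if rx: "(r, x) \<in> rel_of K" for r x
  proof -
    have "r \<in> V" "x \<in> V" using rel_in[OF K(1) rx] by auto
    then have "pr r x \<in> ?A" using rel_iff[of r x K] rx K(2) by blast
    then obtain r' z w where *: "pr r x = pr r' (pr z w)" "r' \<in> ?P" "z \<in> Z" "w \<in> W" by blast
    moreover have "r' \<in> V" "pr z w \<in> V" using * PV' ZV WV pr_is_pair by auto
    ultimately show ?thesis using pr_inject[of r x r' "pr z w"] \<open>r \<in> V\<close> \<open>x \<in> V\<close> by blast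
  qed
  have "named K {pr (c w) w | w. w \<in> W \<and> c w \<in> Z}" unfolding named_def
  proof (intro conjI allI impI K(1))
    show "r \<in> ?P" if "(r, x) \<in> rel_of K" for r x using sub[OF that] by blast
    show "(q, x) \<in> rel_of K" if rx: "(r, x) \<in> rel_of K" "le r q" for r q x
      using sub[OF rx(1)] Kup rx by blast
    show "x \<in> {pr (c w) w | w. w \<in> W \<and> c w \<in> Z} \<longleftrightarrow> (\<exists>r \<in> G. (r, x) \<in> rel_of K)" for x
    proof
      assume "\<exists>r \<in> G. (r, x) \<in> rel_of K"
      then obtain r z w where "r \<in> G" "(r, pr z w) \<in> rel_of K" "x = pr z w" "z \<in> Z" "w \<in> W"
        using sub by blast
      moreover from this have "z = c w" using truth[of w] by blast
      ultimately show "x \<in> {pr (c w) w | w. w \<in> W \<and> c w \<in> Z}" by blast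
    next
      assume "x \<in> {pr (c w) w | w. w \<in> W \<and> c w \<in> Z}"
      then obtain w where "x = pr (c w) w" "w \<in> W" "c w \<in> Z" by blast
      then show "\<exists>r \<in> G. (r, x) \<in> rel_of K" using truth[of w] by blast
    qed
  qed
  then show thesis by (rule that)
qed

section \<open>Names and the members of the generic extension\<close>

lemma G_el: obtains p0 where "p0 \<in> G" "p0 \<in> V" "p0 \<in> elts P"
  using G_ne GP PV' by blast

text \<open>The check names of ground model sets. As a general forcing has no distinguished weakest
  condition, one fixed \<open>p0\<close> in \<open>G\<close> is attached to every element.\<close>

definition check_fun :: "('s \<Rightarrow> 's) \<Rightarrow> 's \<Rightarrow> bool" where
  "check_fun C p0 \<longleftrightarrow> (\<forall>x \<in> V. C x \<in> V) \<and> (\<forall>x \<in> V. elts (C x) = {pr (C y) p0 | y. y \<in> elts x}) \<and>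
     df (\<lambda>e. e 0 = C (e 1)) \<and> p0 \<in> G"

lemma check_fun_exists: obtains C p0 where "check_fun C p0"
proof -
  obtain p0 where p0: "p0 \<in> G" "p0 \<in> V" "p0 \<in> elts P" by (rule G_el)
  have iH: "inV {pr y p0 | y. y \<in> elts s}" if "s \<in> V" for s
  proof -
    have "inV ((\<lambda>y. pr y p0) ` elts s)"
    proof (rule inV_repl[OF inV_elts[OF that], where Q = "\<lambda>y z. z = pr y p0"])
      show "df (\<lambda>e. e 0 \<in> elts s \<longrightarrow> e 1 = pr (e 0) p0)" by (intro dfn_intros that p0)
      show "pr y p0 \<in> V" if "y \<in> elts s" for y using that transV[OF \<open>s \<in> V\<close>] pr_is_pair p0 by blast
    qed simp
    moreover have "{pr y p0 | y. y \<in> elts s} = (\<lambda>y. pr y p0) ` elts s" by auto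
    ultimately show ?thesis by simp
  qed
  let ?H = "\<lambda>s. mk {pr y p0 | y. y \<in> elts s}"
  have dH: "df (\<lambda>e. e 0 = ?H (e 1))"
  proof -
    have "df (\<lambda>e. e 0 = ?H (e 1)) \<longleftrightarrow> df (\<lambda>e. \<forall>z \<in> V. z \<in> elts (e 0) \<longleftrightarrow> (\<exists>y \<in> elts (e 1). z = pr y p0))"
    proof (rule dfn_cong)
      fix e :: "nat \<Rightarrow> 's" assume e: "\<And>i. e i \<in> V"
      have "e 0 = ?H (e 1) \<longleftrightarrow> elts (e 0) = {pr y p0 | y. y \<in> elts (e 1)}"
        using elts_mk[OF iH[OF e[of 1]]] elts_inject[of "e 0" "?H (e 1)"] by simp
      also have "\<dots> \<longleftrightarrow> (\<forall>z \<in> V. z \<in> elts (e 0) \<longleftrightarrow> (\<exists>y \<in> elts (e 1). z = pr y p0))"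
        using transV[OF e[of 0]] inV_subV[OF iH[OF e[of 1]]] by blast
      finally show "e 0 = ?H (e 1) \<longleftrightarrow> (\<forall>z \<in> V. z \<in> elts (e 0) \<longleftrightarrow> (\<exists>y \<in> elts (e 1). z = pr y p0))" .
    qed
    moreover have "df (\<lambda>e. \<forall>z \<in> V. z \<in> elts (e 0) \<longleftrightarrow> (\<exists>y \<in> elts (e 1). z = pr y p0))"
      by (intro dfn_intros p0)
    ultimately show ?thesis by simp
  qed
  obtain C where C: "\<And>x. x \<in> V \<Longrightarrow> C x \<in> V" "\<And>x. x \<in> V \<Longrightarrow> inV (C ` elts x)"
    "\<And>x. x \<in> V \<Longrightarrow> C x = ?H (mk (C ` elts x))" "df (\<lambda>e. e 0 = C (e 1))"
    by (rule mem_rec[OF mk_in[OF iH] dH]) (assumption | rule that)+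
  have "elts (C x) = {pr (C y) p0 | y. y \<in> elts x}" if x: "x \<in> V" for x
  proof -
    have "elts (C x) = {pr y p0 | y. y \<in> elts (mk (C ` elts x))}"
      by (subst C(3)[OF x]) (rule elts_mk[OF iH[OF mk_in[OF C(2)[OF x]]]])
    then show ?thesis by (auto simp: elts_mk[OF C(2)[OF x]])
  qed
  then have "check_fun C p0" unfolding check_fun_def using C p0 by blast
  then show thesis by (rule that)
qed

lemma check_fun_name: assumes "check_fun C p0" shows "x \<in> V \<Longrightarrow> is_name (elts P) (C x)"
proof (induction x rule: mem_induct)
  case (step x)
  note c = assms[unfolded check_fun_def]
  have p0: "p0 \<in> V" "p0 \<in> elts P" using c GP PV' by blast+
  have xV: "y \<in> V" if "y \<in> elts x" for y using transV[OF step.prems that] .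
  show ?case
  proof (rule is_name.intros, rule ballI)
    fix z assume "z \<in> elts (C x)"
    then obtain y where y: "y \<in> elts x" "z = pr (C y) p0" using c step.prems by blast
    then have "is_pair z (C y) p0" using pr_is_pair c xV p0 by blast
    then show "\<exists>\<sigma> p. is_pair z \<sigma> p \<and> is_name (elts P) \<sigma> \<and> p \<in> elts P"
      using step.IH[OF y(1) xV[OF y(1)]] p0 by blast
  qed
qed

lemma val_exists:
  obtains val where "\<And>\<tau>. \<tau> \<in> V \<Longrightarrow> is_name (elts P) \<tau> \<Longrightarrow>
      elts (val \<tau>) = {val \<sigma> | \<sigma>. \<exists>p \<in> G. (\<sigma>, p) \<in> rel_of \<tau>}"
    "N = {val \<tau> | \<tau>. \<tau> \<in> V \<and> is_name (elts P) \<tau>}"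
  using ext unfolding is_generic_extension_def by blast

lemma check_fun_val:
  assumes "check_fun C p0" and val: "\<And>\<tau>. \<tau> \<in> V \<Longrightarrow> is_name (elts P) \<tau> \<Longrightarrow>
      elts (val \<tau>) = {val \<sigma> | \<sigma>. \<exists>p \<in> G. (\<sigma>, p) \<in> rel_of \<tau>}"
  shows "x \<in> V \<Longrightarrow> val (C x) = x"
proof (induction x rule: mem_induct)
  case (step x)
  note c = assms(1)[unfolded check_fun_def]
  have p0: "p0 \<in> V" "p0 \<in> G" using c GP PV' by blast+
  have xV: "y \<in> V" if "y \<in> elts x" for y using transV[OF step.prems that] .
  have r: "(\<sigma>, p) \<in> rel_of (C x) \<longleftrightarrow> p = p0 \<and> (\<exists>y \<in> elts x. \<sigma> = C y)" for \<sigma> p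
  proof
    assume "(\<sigma>, p) \<in> rel_of (C x)"
    then obtain y where y: "y \<in> elts x" "is_pair (pr (C y) p0) \<sigma> p"
      using c step.prems unfolding rel_of_def by auto
    then show "p = p0 \<and> (\<exists>y \<in> elts x. \<sigma> = C y)"
      using is_pair_inj[OF y(2) pr_is_pair(1)] c xV p0 by blast
  next
    assume a: "p = p0 \<and> (\<exists>y \<in> elts x. \<sigma> = C y)"
    then obtain y where y: "y \<in> elts x" "\<sigma> = C y" by blast
    then have "is_pair (pr (C y) p0) \<sigma> p" using a pr_is_pair c xV p0 by blast
    then show "(\<sigma>, p) \<in> rel_of (C x)" using y c step.prems unfolding rel_of_def by blast
  qed
  have "elts (val (C x)) = {val \<sigma> | \<sigma>. \<exists>p \<in> G. (\<sigma>, p) \<in> rel_of (C x)}"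
    using val check_fun_name[OF assms(1)] c step.prems by blast
  also have "\<dots> = (\<lambda>y. val (C y)) ` elts x" unfolding r using p0 by blast
  also have "\<dots> = elts x" using step.IH xV by simp
  finally show ?case by (simp add: elts_inject)
qed

text \<open>The relation \<open>S\<close> turns into a genuine name when each \<open>x\<close> is
  replaced by its check name.\<close>

lemma nameable_in_N:
  assumes X: "nameable X" and Z: "inV Z" "X \<subseteq> Z" obtains x where "x \<in> N" "elts x = X"
proof -
  obtain S where S: "named S X" using X unfolding nameable_def by blast
  obtain C p0 where C: "check_fun C p0" by (rule check_fun_exists)
  note c = C[unfolded check_fun_def]
  obtain val where val: "\<And>\<tau>. \<tau> \<in> V \<Longrightarrow> is_name (elts P) \<tau> \<Longrightarrow>
      elts (val \<tau>) = {val \<sigma> | \<sigma>. \<exists>p \<in> G. (\<sigma>, p) \<in> rel_of \<tau>}"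
    "N = {val \<tau> | \<tau>. \<tau> \<in> V \<and> is_name (elts P) \<tau>}" by (rule val_exists) (rule that)
  have CV: "\<And>x. x \<in> V \<Longrightarrow> C x \<in> V" and dC: "df (\<lambda>e. e 0 = C (e 1))" using c by blast+
  have zV: "z \<in> V" if "z \<in> Z" for z using inV_mem[OF Z(1) that] .
  have CZ: "inV (C ` Z)"
  proof (rule inV_repl[OF Z(1), where Q = "\<lambda>z y. y = C z"])
    show "df (\<lambda>e. e 0 \<in> Z \<longrightarrow> e 1 = C (e 0))"
      by (intro dfn_imp dfn_inV Z dfn_intros dft_fun[OF CV dC])
  qed (use CV zV in auto)
  obtain z0 where z0: "z0 \<in> V" "elts z0 = Z" using Z unfolding inV_def by blast
  obtain \<tau> where t: "\<tau> \<in> V" "\<And>u r. (u, r) \<in> rel_of \<tau> \<longleftrightarrow> u \<in> C ` Z \<and> r \<in> elts P \<and>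
      (\<exists>z \<in> elts z0. u = C z \<and> (r, z) \<in> rel_of S)"
    "elts \<tau> = {pr u r | u r. u \<in> C ` Z \<and> r \<in> elts P \<and> (\<exists>z \<in> elts z0. u = C z \<and> (r, z) \<in> rel_of S)}"
  proof (rule rel_sep[OF CZ inV_elts[OF PV]])
    show "df (\<lambda>e. \<exists>z \<in> elts z0. e 0 = C z \<and> (e 1, z) \<in> rel_of S)"
      by (intro dfn_intros z0 dft_fun[OF CV dC] namedD(1)[OF S])
  qed (rule that)
  have nt: "is_name (elts P) \<tau>"
  proof (rule is_name.intros, rule ballI)
    fix x assume "x \<in> elts \<tau>"
    then obtain z r where "x = pr (C z) r" "z \<in> Z" "r \<in> elts P" using t(3) by blast
    then show "\<exists>\<sigma> p. is_pair x \<sigma> p \<and> is_name (elts P) \<sigma> \<and> p \<in> elts P"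
      using pr_is_pair(1)[of "C z" r] check_fun_name[OF C] zV CV PV' by blast
  qed
  have "elts (val \<tau>) = {val \<sigma> | \<sigma>. \<exists>p \<in> G. (\<sigma>, p) \<in> rel_of \<tau>}" by (rule val(1)[OF t(1) nt])
  also have "\<dots> = {val (C z) | z. z \<in> Z \<and> (\<exists>r \<in> G. (r, z) \<in> rel_of S)}"
  proof (intro equalityI subsetI)
    fix u assume "u \<in> {val \<sigma> | \<sigma>. \<exists>p \<in> G. (\<sigma>, p) \<in> rel_of \<tau>}"
    then obtain \<sigma> p where "u = val \<sigma>" "p \<in> G" "(\<sigma>, p) \<in> rel_of \<tau>" by blast
    then show "u \<in> {val (C z) | z. z \<in> Z \<and> (\<exists>r \<in> G. (r, z) \<in> rel_of S)}"
      using t(2) z0(2) by auto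
  next
    fix u assume "u \<in> {val (C z) | z. z \<in> Z \<and> (\<exists>r \<in> G. (r, z) \<in> rel_of S)}"
    then obtain z r where z: "u = val (C z)" "z \<in> Z" "r \<in> G" "(r, z) \<in> rel_of S" by blast
    then have "(C z, r) \<in> rel_of \<tau>" using t(2) z0(2) GP by auto
    then show "u \<in> {val \<sigma> | \<sigma>. \<exists>p \<in> G. (\<sigma>, p) \<in> rel_of \<tau>}" using z by blast
  qed
  also have "\<dots> = {z. z \<in> Z \<and> (\<exists>r \<in> G. (r, z) \<in> rel_of S)}"
  proof -
    have "val (C z) = z" if "z \<in> Z" for z using check_fun_val[OF C val(1)] zV[OF that] by blast
    then show ?thesis by (metis (no_types, lifting))
  qed
  also have "\<dots> = X" using S Z unfolding named_def by blast
  finally show thesis using that val(2) t(1) nt by blast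
qed

lemma V_sub_N: "x \<in> V \<Longrightarrow> x \<in> N"
  using nameable_in_N[OF nameable_inV[OF inV_elts] inV_elts] by (metis elts_inject subset_refl)

text \<open>\<open>is_name\<close> is an inductive predicate of the ambient logic. On a transitive
  set of \<open>V\<close> it agrees with a fixed point formed in \<open>V\<close>, since both obey
  the same recursion along membership; one inclusion is \<open>name_induct\<close>, the other rule
  induction.\<close>

lemma inV_names:
  assumes T: "inV T" and tr: "\<And>x. x \<in> T \<Longrightarrow> elts x \<subseteq> T"
  shows "inV {w \<in> T. is_name (elts P) w}"
proof -
  let ?\<Phi> = "\<lambda>K w. \<forall>z \<in> elts w. \<exists>\<sigma> \<in> V. \<exists>p \<in> elts P. is_pair z \<sigma> p \<and> \<sigma> \<in> elts K"
  have d: "df (\<lambda>e. ?\<Phi> (e 0) (e 1))" by (intro dfn_intros PV)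
  obtain K where K: "K \<in> V" "elts K = {w \<in> T. ?\<Phi> K w}"
  proof (rule lfpV[OF T d])
    fix K K' w assume "elts K \<subseteq> elts K'" "?\<Phi> K w"
    then show "?\<Phi> K' w" by (meson subsetD)
  qed (rule that)
  have "w \<in> elts K \<longrightarrow> is_name (elts P) w" for w
  proof (induction w rule: name_induct)
    case (1 w)
    show ?case
    proof
      assume "w \<in> elts K"
      then show "is_name (elts P) w" using K(2) 1 by (intro is_name.intros) blast
    qed
  qed
  moreover have "is_name (elts P) w \<Longrightarrow> w \<in> T \<longrightarrow> w \<in> elts K" for w
  proof (induction w rule: is_name.induct)
    case (1 w)
    show ?case
    proof
      assume w: "w \<in> T"
      have "\<exists>\<sigma> \<in> V. \<exists>p \<in> elts P. is_pair z \<sigma> p \<and> \<sigma> \<in> elts K" if z: "z \<in> elts w" for z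
      proof -
        obtain \<sigma> p where sp: "is_pair z \<sigma> p" "\<sigma> \<in> T \<longrightarrow> \<sigma> \<in> elts K" "p \<in> elts P" using 1 z by blast
        have "z \<in> T" using tr w z by blast
        moreover obtain t where "t \<in> elts z" "\<sigma> \<in> elts t" using is_pair_mem[OF sp(1)] by blast
        ultimately have "\<sigma> \<in> T" using tr by blast
        then show ?thesis using sp inV_mem[OF T] by blast
      qed
      then show "w \<in> elts K" using K(2) w by blast
    qed
  qed
  ultimately have "elts K = {w \<in> T. is_name (elts P) w}" using K(2) by blast
  then show ?thesis using K(1) unfolding inV_def by blast
qed

text \<open>Evaluation of names is the collapse of the relation that holds between
  \<open>\<sigma>'\<close> and \<open>\<sigma>\<close> when \<open>(\<sigma>', p)\<close> is in
  \<open>\<sigma>\<close> for some \<open>p\<close> in \<open>G\<close>. On the names inside a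
  transitive set, \<open>nameable_collapse\<close> therefore names the evaluation, as far as its
  values lie in a given set of \<open>V\<close>.\<close>

lemma N_nameable:
  assumes a: "a \<in> N" and Z: "inV Z" "elts a \<subseteq> Z" shows "nameable (elts a)"
proof -
  obtain val where val: "\<And>\<tau>. \<tau> \<in> V \<Longrightarrow> is_name (elts P) \<tau> \<Longrightarrow>
      elts (val \<tau>) = {val \<sigma> | \<sigma>. \<exists>p \<in> G. (\<sigma>, p) \<in> rel_of \<tau>}"
    "N = {val \<tau> | \<tau>. \<tau> \<in> V \<and> is_name (elts P) \<tau>}" by (rule val_exists) (rule that)
  obtain \<tau> where t: "a = val \<tau>" "\<tau> \<in> V" "is_name (elts P) \<tau>" using a val by blast
  obtain T where T: "T \<in> V" "\<tau> \<in> elts T" "\<And>u. u \<in> elts T \<Longrightarrow> elts u \<subseteq> elts T"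
    using trans_superset[OF t(2)] by metis
  obtain z0 where z0: "z0 \<in> V" "elts z0 = Z" using Z unfolding inV_def by blast
  \<comment> \<open>\<open>nameable_collapse\<close> tracks values in a transitive set, and
    \<open>Z\<close> itself need not be transitive.\<close>
  obtain Z' where Z': "Z' \<in> V" "z0 \<in> elts Z'" "\<And>u. u \<in> elts Z' \<Longrightarrow> elts u \<subseteq> elts Z'"
    using trans_superset[OF z0(1)] by metis
  let ?W = "{w \<in> elts T. is_name (elts P) w}"
  have W: "inV ?W" by (rule inV_names[OF inV_elts[OF T(1)] T(3)])
  have WV: "w \<in> V" if "w \<in> ?W" for w using inV_mem[OF W that] .
  obtain w0 where w0: "w0 \<in> V" "elts w0 = ?W" using W unfolding inV_def by blast
  let ?E = "{pr \<sigma>' \<sigma> | \<sigma>' \<sigma>. \<sigma>' \<in> ?W \<and> \<sigma> \<in> ?W \<and> (\<exists>p \<in> G. (\<sigma>', p) \<in> rel_of \<sigma>)}"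
  have Eiff: "pr \<sigma>' \<sigma> \<in> ?E \<longleftrightarrow> (\<exists>p \<in> G. (\<sigma>', p) \<in> rel_of \<sigma>)" if w: "\<sigma>' \<in> ?W" "\<sigma> \<in> ?W" for \<sigma>' \<sigma>
  proof
    assume "pr \<sigma>' \<sigma> \<in> ?E"
    then obtain u v where uv: "pr \<sigma>' \<sigma> = pr u v" "u \<in> ?W" "v \<in> ?W" "\<exists>p \<in> G. (u, p) \<in> rel_of v" by blast
    then have "u = \<sigma>'" "v = \<sigma>" using pr_inject WV w by metis+
    then show "\<exists>p \<in> G. (\<sigma>', p) \<in> rel_of \<sigma>" using uv by blast
  qed (use w in blast)
  \<comment> \<open>A condition forces an edge as soon as it extends some \<open>p\<close> attached
    to that edge; this describes the edges correctly because \<open>G\<close> is closed under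
    weakening.\<close>
  have E: "nameable ?E"
  proof (rule nameableI[OF inV_times[OF W W], where
        Q = "\<lambda>r x. \<exists>\<sigma>' \<in> elts w0. \<exists>\<sigma> \<in> elts w0. x = pr \<sigma>' \<sigma> \<and> (\<exists>p \<in> elts P. le p r \<and> (\<sigma>', p) \<in> rel_of \<sigma>)"])
    show "df (\<lambda>e. \<exists>\<sigma>' \<in> elts w0. \<exists>\<sigma> \<in> elts w0. e 1 = pr \<sigma>' \<sigma> \<and>
        (\<exists>p \<in> elts P. le p (e 0) \<and> (\<sigma>', p) \<in> rel_of \<sigma>))"
      by (intro dfn_intros w0 PV LEV)
    fix x
    show "x \<in> ?E \<longleftrightarrow> x \<in> {pr x y | x y. x \<in> ?W \<and> y \<in> ?W} \<and> (\<exists>r \<in> G. \<exists>\<sigma>' \<in> elts w0. \<exists>\<sigma> \<in> elts w0.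
        x = pr \<sigma>' \<sigma> \<and> (\<exists>p \<in> elts P. le p r \<and> (\<sigma>', p) \<in> rel_of \<sigma>))" (is "_ \<longleftrightarrow> ?R")
    proof
      assume "x \<in> ?E"
      then obtain \<sigma>' \<sigma> p where s: "x = pr \<sigma>' \<sigma>" "\<sigma>' \<in> ?W" "\<sigma> \<in> ?W" "p \<in> G" "(\<sigma>', p) \<in> rel_of \<sigma>" by blast
      then have "p \<in> elts P" "le p p" using GP le_refl by auto
      then show ?R using s w0(2) by blast
    next
      assume ?R
      then obtain r \<sigma>' \<sigma> p where s: "x = pr \<sigma>' \<sigma>" "\<sigma>' \<in> ?W" "\<sigma> \<in> ?W" "r \<in> G" "le p r"
        "(\<sigma>', p) \<in> rel_of \<sigma>" using w0(2) by blast
      then have "p \<in> G" using G_down by blast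
      then show "x \<in> ?E" using s by blast
    qed
  next
    fix r q x
    assume "\<exists>\<sigma>' \<in> elts w0. \<exists>\<sigma> \<in> elts w0. x = pr \<sigma>' \<sigma> \<and> (\<exists>p \<in> elts P. le p r \<and> (\<sigma>', p) \<in> rel_of \<sigma>)" "le r q"
    then show "\<exists>\<sigma>' \<in> elts w0. \<exists>\<sigma> \<in> elts w0. x = pr \<sigma>' \<sigma> \<and> (\<exists>p \<in> elts P. le p q \<and> (\<sigma>', p) \<in> rel_of \<sigma>)"
      using le_trans by blast
  qed
  have val': "elts (val w) = val ` {w' \<in> ?W. pr w' w \<in> ?E}" if w: "w \<in> ?W" for w
  proof -
    have "elts (val w) = {val \<sigma> | \<sigma>. \<exists>p \<in> G. (\<sigma>, p) \<in> rel_of w}" using val WV w by blast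
    moreover have "\<sigma> \<in> ?W" if sp: "(\<sigma>, p) \<in> rel_of w" for \<sigma> p
    proof -
      obtain z where z: "z \<in> elts w" "is_pair z \<sigma> p" using sp unfolding rel_of_def by auto
      then have "z \<in> elts T" using T(3) w by blast
      moreover obtain u where "u \<in> elts z" "\<sigma> \<in> elts u" using is_pair_mem[OF z(2)] by blast
      ultimately have "\<sigma> \<in> elts T" using T(3) by blast
      moreover have "is_name (elts P) \<sigma>"
      proof -
        have "is_name (elts P) w" using w by blast
        then have "\<forall>z \<in> elts w. \<exists>\<sigma> p. is_pair z \<sigma> p \<and> is_name (elts P) \<sigma> \<and> p \<in> elts P"
          using is_name.simps[of "elts P" w] by simp
        then obtain \<sigma>' p' where "is_pair z \<sigma>' p'" "is_name (elts P) \<sigma>'" using z(1) by blast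
        then show ?thesis using is_pair_inj z by blast
      qed
      ultimately show ?thesis by blast
    qed
    ultimately show ?thesis using Eiff[OF _ w] by blast
  qed
  have wf: "wf {(w', w). w' \<in> ?W \<and> w \<in> ?W \<and> pr w' w \<in> ?E}" (is "wf ?R")
  proof (rule wfUNIVI)
    fix Q x assume IH: "\<forall>x. (\<forall>y. (y, x) \<in> ?R \<longrightarrow> Q y) \<longrightarrow> Q x"
    show "Q x"
    proof (induction x rule: name_induct)
      case (1 w)
      have "Q y" if "(y, w) \<in> ?R" for y
      proof -
        have "y \<in> ?W" "w \<in> ?W" "pr y w \<in> ?E" using that by auto
        then obtain p where "(y, p) \<in> rel_of w" using Eiff by blast
        then show "Q y" using 1 unfolding rel_of_def by auto
      qed
      then show ?case using IH by blast
    qed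
  qed
  obtain J where J: "named J {pr (val w) w | w. w \<in> ?W \<and> val w \<in> elts Z'}"
    by (rule nameable_collapse[OF W inV_elts[OF Z'(1)] Z'(3) E wf val']) (assumption | rule that)+
  obtain S where S: "named S ?E" using E unfolding nameable_def by blast
  have tW: "\<tau> \<in> ?W" using t T by blast
  have ZZ: "Z \<subseteq> elts Z'" using Z' z0 by blast
  show ?thesis
  proof (rule nameableI[OF Z(1), where Q = "\<lambda>r z. \<exists>\<sigma> \<in> elts w0. (r, pr z \<sigma>) \<in> rel_of J \<and> (r, pr \<sigma> \<tau>) \<in> rel_of S"])
    show "df (\<lambda>e. \<exists>\<sigma> \<in> elts w0. (e 0, pr (e 1) \<sigma>) \<in> rel_of J \<and> (e 0, pr \<sigma> \<tau>) \<in> rel_of S)"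
      by (intro dfn_intros w0 namedD(1)[OF J] namedD(1)[OF S] t)
    show "\<exists>\<sigma> \<in> elts w0. (q, pr z \<sigma>) \<in> rel_of J \<and> (q, pr \<sigma> \<tau>) \<in> rel_of S"
      if "\<exists>\<sigma> \<in> elts w0. (r, pr z \<sigma>) \<in> rel_of J \<and> (r, pr \<sigma> \<tau>) \<in> rel_of S" "le r q" for r q z
      using that namedD(3)[OF J] namedD(3)[OF S] by blast
    fix z
    show "z \<in> elts a \<longleftrightarrow> z \<in> Z \<and> (\<exists>r \<in> G. \<exists>\<sigma> \<in> elts w0. (r, pr z \<sigma>) \<in> rel_of J \<and> (r, pr \<sigma> \<tau>) \<in> rel_of S)"
    proof
      assume z: "z \<in> elts a"
      then obtain \<sigma> where s: "\<sigma> \<in> ?W" "pr \<sigma> \<tau> \<in> ?E" "z = val \<sigma>" using val'[OF tW] t(1) by blast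
      have zZ: "z \<in> Z" using z Z by blast
      then have "pr z \<sigma> \<in> {pr (val w) w | w. w \<in> ?W \<and> val w \<in> elts Z'}" using s ZZ by blast
      then obtain r where r: "r \<in> G" "(r, pr z \<sigma>) \<in> rel_of J" using namedD(4)[OF J] by blast
      then obtain q where q: "q \<in> G" "le r q" "(q, pr \<sigma> \<tau>) \<in> rel_of S"
        using named_above[OF S s(2) r(1)] by blast
      then show "z \<in> Z \<and> (\<exists>r \<in> G. \<exists>\<sigma> \<in> elts w0. (r, pr z \<sigma>) \<in> rel_of J \<and> (r, pr \<sigma> \<tau>) \<in> rel_of S)"
        using namedD(3)[OF J r(2) q(2)] zZ s(1) w0(2) by blast
    next
      assume "z \<in> Z \<and> (\<exists>r \<in> G. \<exists>\<sigma> \<in> elts w0. (r, pr z \<sigma>) \<in> rel_of J \<and> (r, pr \<sigma> \<tau>) \<in> rel_of S)"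
      then obtain r \<sigma> where r: "z \<in> Z" "r \<in> G" "\<sigma> \<in> ?W" "(r, pr z \<sigma>) \<in> rel_of J" "(r, pr \<sigma> \<tau>) \<in> rel_of S"
        using w0(2) by blast
      then obtain w where w: "pr z \<sigma> = pr (val w) w" "w \<in> ?W" "val w \<in> elts Z'"
        using namedD(5)[OF J] by blast
      have "z = val w \<and> \<sigma> = w"
        using pr_inject[THEN iffD1, OF _ _ _ _ w(1)] inV_mem[OF Z(1) r(1)] WV r(3) w transV[OF Z'(1)] by blast
      moreover have "pr \<sigma> \<tau> \<in> ?E" using namedD(5)[OF S r(2,5)] .
      ultimately show "z \<in> elts a" using val'[OF tW] t(1) r(3) by blast
    qed
  qed
qed

lemma vinj_equipotent:
  assumes Y: "vinj Y (elts k)" and k: "Ord k" "k \<in> V" and a: "a \<in> N" "elts a \<subseteq> Y"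
  obtains \<beta> where "\<beta> = k \<or> \<beta> \<in> elts k" "equipotent N a \<beta>"
proof -
  obtain F g where g: "g \<in> V" "inj_on F Y" "F ` Y \<subseteq> elts k" "\<And>x y. (x, y) \<in> rel_of g \<longleftrightarrow> x \<in> Y \<and> y = F x"
    using Y by (rule vinjE) (rule that)
  have iY: "inV Y" by (rule vinj_inV[OF Y])
  have YV: "x \<in> V" if "x \<in> Y" for x using inV_mem[OF iY that] .
  have kV: "x \<in> V" if "x \<in> elts k" for x using transV[OF k(2) that] .
  have FV: "F x \<in> elts k" if "x \<in> Y" for x using g that by blast
  obtain Sa where Sa: "named Sa (elts a)" using N_nameable[OF a(1) iY a(2)] unfolding nameable_def by blast
  define A where "A = F ` elts a"
  define c where "c = otp A"
  have Ak: "A \<subseteq> elts k" unfolding A_def using a FV by blast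
  have c: "elts (c \<xi>) = c ` (A \<inter> elts \<xi>)" "c \<xi> = \<xi> \<or> c \<xi> \<in> elts \<xi>" if "Ord \<xi>" for \<xi>
    using otp[OF that, of A] unfolding c_def by auto
  \<comment> \<open>Only the points of \<open>A\<close> count as predecessors, so the collapse of
    this relation on \<open>k\<close> is \<open>c\<close>.\<close>
  let ?E = "{pr \<eta> \<xi> | \<eta> \<xi>. \<eta> \<in> A \<and> \<eta> \<in> elts \<xi> \<and> \<xi> \<in> elts k}"
  have Eiff: "pr \<eta> \<xi> \<in> ?E \<longleftrightarrow> \<eta> \<in> A \<and> \<eta> \<in> elts \<xi>" if "\<eta> \<in> elts k" "\<xi> \<in> elts k" for \<eta> \<xi>
  proof
    assume "pr \<eta> \<xi> \<in> ?E"
    then obtain u v where uv: "pr \<eta> \<xi> = pr u v" "u \<in> A" "u \<in> elts v" "v \<in> elts k" by blast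
    moreover have "u \<in> V" "v \<in> V" "\<eta> \<in> V" "\<xi> \<in> V" using uv Ak that kV by auto
    ultimately show "\<eta> \<in> A \<and> \<eta> \<in> elts \<xi>" using pr_inject by metis
  qed (use that in blast)
  obtain y0 where y0: "y0 \<in> V" "elts y0 = Y" using iY unfolding inV_def by blast
  have E: "nameable ?E"
  proof (rule nameableI[OF inV_times[OF inV_elts[OF k(2)] inV_elts[OF k(2)]], where
        Q = "\<lambda>r z. \<exists>x \<in> elts y0. \<exists>\<eta> \<in> elts k. \<exists>\<xi> \<in> elts k. z = pr \<eta> \<xi> \<and> \<eta> \<in> elts \<xi> \<and>
          (x, \<eta>) \<in> rel_of g \<and> (r, x) \<in> rel_of Sa"])
    show "df (\<lambda>e. \<exists>x \<in> elts y0. \<exists>\<eta> \<in> elts k. \<exists>\<xi> \<in> elts k. e 1 = pr \<eta> \<xi> \<and> \<eta> \<in> elts \<xi> \<and>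
          (x, \<eta>) \<in> rel_of g \<and> (e 0, x) \<in> rel_of Sa)"
      by (intro dfn_intros y0 k g(1) namedD(1)[OF Sa])
    fix z
    show "z \<in> ?E \<longleftrightarrow> z \<in> {pr x y | x y. x \<in> elts k \<and> y \<in> elts k} \<and> (\<exists>r \<in> G. \<exists>x \<in> elts y0.
        \<exists>\<eta> \<in> elts k. \<exists>\<xi> \<in> elts k. z = pr \<eta> \<xi> \<and> \<eta> \<in> elts \<xi> \<and> (x, \<eta>) \<in> rel_of g \<and> (r, x) \<in> rel_of Sa)"
      (is "_ \<longleftrightarrow> ?R")
    proof
      assume "z \<in> ?E"
      then obtain x \<xi> where x: "x \<in> elts a" "z = pr (F x) \<xi>" "F x \<in> elts \<xi>" "\<xi> \<in> elts k"
        unfolding A_def by blast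
      then have "x \<in> Y" "F x \<in> elts k" using a FV by auto
      moreover obtain r where "r \<in> G" "(r, x) \<in> rel_of Sa" using namedD(4)[OF Sa x(1)] by blast
      moreover have "(x, F x) \<in> rel_of g" using g(4) \<open>x \<in> Y\<close> by blast
      ultimately show ?R using x y0(2) by blast
    next
      assume ?R
      then obtain r x \<eta> \<xi> where *: "r \<in> G" "\<xi> \<in> elts k" "z = pr \<eta> \<xi>" "\<eta> \<in> elts \<xi>" "(x, \<eta>) \<in> rel_of g"
        "(r, x) \<in> rel_of Sa" by blast
      then have "\<eta> \<in> A" unfolding A_def using g(4) namedD(5)[OF Sa] by blast
      then show "z \<in> ?E" using * by blast
    qed
  next
    fix r q z
    assume "\<exists>x \<in> elts y0. \<exists>\<eta> \<in> elts k. \<exists>\<xi> \<in> elts k. z = pr \<eta> \<xi> \<and> \<eta> \<in> elts \<xi> \<and>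
          (x, \<eta>) \<in> rel_of g \<and> (r, x) \<in> rel_of Sa" "le r q"
    then show "\<exists>x \<in> elts y0. \<exists>\<eta> \<in> elts k. \<exists>\<xi> \<in> elts k. z = pr \<eta> \<xi> \<and> \<eta> \<in> elts \<xi> \<and>
          (x, \<eta>) \<in> rel_of g \<and> (q, x) \<in> rel_of Sa"
      using namedD(3)[OF Sa] by blast
  qed
  let ?Z = "insert k (elts k)"
  have iZ: "inV ?Z" by (intro inV_insert inV_elts k)
  have ZV: "z \<in> V" if "z \<in> ?Z" for z using inV_mem[OF iZ that] .
  have ctop: "c \<xi> \<in> ?Z" if "\<xi> \<in> ?Z" for \<xi>
    using c(2)[of \<xi>] that Ord_elt[OF k(1), of \<xi>] k(1) Ord_trans[OF k(1), of "c \<xi>" \<xi>] by auto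
  have wf: "wf {(w', w). w' \<in> elts k \<and> w \<in> elts k \<and> pr w' w \<in> ?E}"
    by (rule wf_subset[OF wf_mem_elts]) (use Eiff in blast)
  obtain J where J: "named J {pr (c w) w | w. w \<in> elts k \<and> c w \<in> ?Z}"
  proof (rule nameable_collapse[OF inV_elts[OF k(2)] iZ _ E wf])
    show "elts (c w) = c ` {w' \<in> elts k. pr w' w \<in> ?E}" if w: "w \<in> elts k" for w
    proof -
      have "{w' \<in> elts k. pr w' w \<in> ?E} = A \<inter> elts w"
        using Eiff[OF _ w] Ak by blast
      then show ?thesis using c(1)[OF Ord_elt[OF k(1) w]] by simp
    qed
    show "elts z \<subseteq> ?Z" if "z \<in> ?Z" for z using that Ord_trans[OF k(1)] by blast
  qed (rule that)
  let ?f = "{pr x (c (F x)) | x. x \<in> elts a}"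
  obtain y1 where y1: "y1 \<in> V" "elts y1 = ?Z" using iZ unfolding inV_def by blast
  have cF: "c (F x) \<in> ?Z" if "x \<in> elts a" for x using that a FV ctop by blast
  have f: "nameable ?f"
  proof (rule nameableI[OF inV_times[OF iY iZ], where
        Q = "\<lambda>r u. \<exists>x \<in> elts y0. \<exists>z \<in> elts y1. \<exists>\<xi> \<in> elts k. u = pr x z \<and> (r, x) \<in> rel_of Sa \<and>
          (x, \<xi>) \<in> rel_of g \<and> (r, pr z \<xi>) \<in> rel_of J"])
    show "df (\<lambda>e. \<exists>x \<in> elts y0. \<exists>z \<in> elts y1. \<exists>\<xi> \<in> elts k. e 1 = pr x z \<and> (e 0, x) \<in> rel_of Sa \<and>
          (x, \<xi>) \<in> rel_of g \<and> (e 0, pr z \<xi>) \<in> rel_of J)"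
      by (intro dfn_intros y0 y1 k g(1) namedD(1)[OF Sa] namedD(1)[OF J])
    fix u
    show "u \<in> ?f \<longleftrightarrow> u \<in> {pr x y | x y. x \<in> Y \<and> y \<in> ?Z} \<and> (\<exists>r \<in> G. \<exists>x \<in> elts y0. \<exists>z \<in> elts y1. \<exists>\<xi> \<in> elts k.
        u = pr x z \<and> (r, x) \<in> rel_of Sa \<and> (x, \<xi>) \<in> rel_of g \<and> (r, pr z \<xi>) \<in> rel_of J)" (is "_ \<longleftrightarrow> ?R")
    proof
      assume "u \<in> ?f"
      then obtain x where x: "x \<in> elts a" "u = pr x (c (F x))" by blast
      then have xY: "x \<in> Y" "F x \<in> elts k" "(x, F x) \<in> rel_of g" using a FV g(4) by auto
      obtain r where r: "r \<in> G" "(r, x) \<in> rel_of Sa" using namedD(4)[OF Sa x(1)] by blast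
      have "pr (c (F x)) (F x) \<in> {pr (c w) w | w. w \<in> elts k \<and> c w \<in> ?Z}" using xY cF x by blast
      then obtain q where q: "q \<in> G" "le r q" "(q, pr (c (F x)) (F x)) \<in> rel_of J"
        using named_above[OF J _ r(1)] by blast
      have "(q, x) \<in> rel_of Sa" using namedD(3)[OF Sa r(2) q(2)] .
      then show ?R using q xY x cF[OF x(1)] y0(2) y1(2) by blast
    next
      assume ?R
      then obtain r x z \<xi> where *: "r \<in> G" "x \<in> Y" "z \<in> ?Z" "\<xi> \<in> elts k" "u = pr x z" "(r, x) \<in> rel_of Sa"
        "(x, \<xi>) \<in> rel_of g" "(r, pr z \<xi>) \<in> rel_of J" using y0(2) y1(2) by blast
      have x: "x \<in> elts a" "\<xi> = F x" using namedD(5)[OF Sa *(1,6)] g(4) *(7) by auto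
      have "pr z \<xi> \<in> {pr (c w) w | w. w \<in> elts k \<and> c w \<in> ?Z}" using namedD(5)[OF J *(1,8)] .
      then obtain w where w: "pr z \<xi> = pr (c w) w" "w \<in> elts k" "c w \<in> ?Z" by blast
      then have "z = c w \<and> \<xi> = w" using pr_inject[of z \<xi> "c w" w] ZV *(3,4) kV by blast
      then show "u \<in> ?f" using x * by blast
    qed
  next
    fix r q u
    assume "\<exists>x \<in> elts y0. \<exists>z \<in> elts y1. \<exists>\<xi> \<in> elts k. u = pr x z \<and> (r, x) \<in> rel_of Sa \<and>
          (x, \<xi>) \<in> rel_of g \<and> (r, pr z \<xi>) \<in> rel_of J" "le r q"
    then show "\<exists>x \<in> elts y0. \<exists>z \<in> elts y1. \<exists>\<xi> \<in> elts k. u = pr x z \<and> (q, x) \<in> rel_of Sa \<and>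
          (x, \<xi>) \<in> rel_of g \<and> (q, pr z \<xi>) \<in> rel_of J"
      using namedD(3)[OF Sa] namedD(3)[OF J] by blast
  qed
  have "?f \<subseteq> {pr x y | x y. x \<in> Y \<and> y \<in> ?Z}" using a(2) cF by blast
  then obtain h where h: "h \<in> N" "elts h = ?f" using nameable_in_N[OF f inV_times[OF iY iZ]] by blast
  have aV: "elts a \<subseteq> V" using a(2) YV by blast
  have fn: "is_function h (elts a)" "\<And>x. x \<in> elts a \<Longrightarrow> app h x = c (F x)"
    using function_graph[OF aV _ h(2)] cF ZV by blast+
  have "bij_betw (app h) (elts a) (elts (c k))"
  proof -
    have "inj_on F (elts a)" using inj_on_subset[OF g(2) a(2)] .
    moreover have "inj_on c (F ` elts a)" using otp_inj[OF k(1) Ak] unfolding c_def A_def .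
    ultimately have "inj_on (\<lambda>x. c (F x)) (elts a)" using comp_inj_on[of F "elts a" c] by (simp add: comp_def)
    moreover have "(\<lambda>x. c (F x)) ` elts a = elts (c k)" using c(1)[OF k(1)] Ak unfolding A_def by auto
    ultimately have "bij_betw (\<lambda>x. c (F x)) (elts a) (elts (c k))" unfolding bij_betw_def by blast
    then show ?thesis using bij_betw_cong[of "elts a" "app h" "\<lambda>x. c (F x)"] fn(2) by blast
  qed
  then have "equipotent N a (c k)" unfolding equipotent_def using h fn by blast
  then show thesis using that c(2)[OF k(1)] by blast
qed

end

section \<open>Enumerations by choice, an ordinal too long for \<open>k\<close>, and iterated power
  sets\<close>

context zfc_model begin

text \<open>\<open>enumerate\<close> asks for a definable next element. Here a choice function on
  the nonempty subsets of \<open>X\<close>, obtained from \<open>uniformize\<close>, picks one from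
  the set of candidates \<open>{y \<in> X. B s y}\<close>.\<close>

lemma enumerate_choice:
  assumes X: "inV X" and dB: "df (\<lambda>e. B (e 0) (e 1))"
    and B: "\<And>s x. s \<in> V \<Longrightarrow> B s x \<Longrightarrow> x \<in> X - elts s"
    and ex: "\<And>s. s \<in> V \<Longrightarrow> \<not> X \<subseteq> elts s \<Longrightarrow> \<exists>x. B s x"
  obtains C \<theta> where "\<theta> \<in> V" "Ord \<theta>" "inj_on C (elts \<theta>)" "C ` elts \<theta> = X"
    "\<And>\<alpha>. \<alpha> \<in> elts \<theta> \<Longrightarrow> inV (C ` elts \<alpha>) \<and> B (mk (C ` elts \<alpha>)) (C \<alpha>)"
    "\<And>x. x \<in> V \<Longrightarrow> C x \<in> V" "df (\<lambda>e. e 0 = C (e 1))"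
proof -
  have dB': "df (\<lambda>e. B (t e) (u e))" if "dt t" "dt u" for t u by (rule dfn_subst2[OF dB that])
  obtain x0 where x0: "x0 \<in> V" "elts x0 = X" using X unfolding inV_def by blast
  have XV: "x \<in> V" if "x \<in> X" for x using inV_mem[OF X that] .
  obtain T where T: "T \<in> V" "\<And>A x. (A, x) \<in> rel_of T \<longleftrightarrow> A \<in> {a \<in> V. elts a \<subseteq> X} \<and> x \<in> X \<and> x \<in> elts A"
  proof (rule rel_sep[OF inV_Pow[OF X] X])
    show "df (\<lambda>e. e 1 \<in> elts (e 0))" by (intro dfn_intros)
  qed (rule that)
  obtain ch where ch: "ch \<in> V" "rel_of ch \<subseteq> rel_of T" "single_valued (rel_of ch)"
    "Domain (rel_of ch) = Domain (rel_of T)" by (rule uniformize[OF T(1)]) (rule that)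
  define nxr where "nxr s x \<longleftrightarrow> (\<exists>A \<in> V. (\<forall>y \<in> V. y \<in> elts A \<longleftrightarrow> B s y) \<and> (A, x) \<in> rel_of ch)" for s x
  \<comment> \<open>The default value \<open>s\<close> keeps \<open>nx\<close> inside
    \<open>V\<close> and definable when \<open>X\<close> is exhausted.\<close>
  define nx where "nx s = (if X \<subseteq> elts s then s else (THE x. nxr s x))" for s
  have nxr: "\<exists>x. nxr s x \<and> B s x \<and> (\<forall>y. nxr s y \<longrightarrow> y = x)" if s: "s \<in> V" "\<not> X \<subseteq> elts s" for s
  proof -
    have "inV {y \<in> X. B s y}" by (intro inV_sep X dB' dfn_intros s)
    then obtain A where A: "A \<in> V" "elts A = {y \<in> X. B s y}" unfolding inV_def by auto
    have A': "y \<in> elts A \<longleftrightarrow> B s y" for y using A(2) B[OF s(1)] by blast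
    obtain x1 where "B s x1" using ex[OF s] by blast
    then have "(A, x1) \<in> rel_of T" using T(2) A A' by blast
    then obtain x where x: "(A, x) \<in> rel_of ch" using ch(4) by blast
    then have "B s x" using ch(2) T(2) A' by blast
    moreover have "nxr s x" unfolding nxr_def using A(1) A' x by blast
    moreover have "y = x" if "nxr s y" for y
    proof -
      obtain A2 where A2: "A2 \<in> V" "\<forall>y \<in> V. y \<in> elts A2 \<longleftrightarrow> B s y" "(A2, y) \<in> rel_of ch"
        using \<open>nxr s y\<close> unfolding nxr_def by blast
      have "elts A2 = elts A"
        using A2(2) A' transV[OF A2(1)] transV[OF A(1)] by blast
      then have "A2 = A" by (simp add: elts_inject)
      then show ?thesis using A2(3) x ch(3) unfolding single_valued_def by blast
    qed
    ultimately show ?thesis by blast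
  qed
  have nx: "nxr s (nx s)" "B s (nx s)" "nxr s y \<longleftrightarrow> y = nx s" if s: "s \<in> V" "\<not> X \<subseteq> elts s" for s y
  proof -
    obtain x where x: "nxr s x" "B s x" "\<And>y. nxr s y \<Longrightarrow> y = x" using nxr[OF s] by blast
    have "(THE x. nxr s x) = x" using x(1,3) by (rule the_equality)
    then have "nx s = x" unfolding nx_def using s(2) by simp
    then show "nxr s (nx s)" "B s (nx s)" using x(1,2) by simp_all
    show "nxr s y \<longleftrightarrow> y = nx s" using x(1) x(3)[of y] \<open>nx s = x\<close> by blast
  qed
  have nxV: "nx s \<in> V" if s: "s \<in> V" for s
  proof (cases "X \<subseteq> elts s")
    case True
    then show ?thesis using s unfolding nx_def by simp
  next
    case False
    then show ?thesis using nx(2)[OF s] B[OF s] XV by blast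
  qed
  have dnx: "df (\<lambda>e. e 0 = nx (e 1))"
  proof -
    have "df (\<lambda>e. e 0 = nx (e 1)) \<longleftrightarrow> df (\<lambda>e. (elts x0 \<subseteq> elts (e 1) \<and> e 0 = e 1) \<or> (\<not> elts x0 \<subseteq> elts (e 1) \<and> nxr (e 1) (e 0)))"
    proof (rule dfn_cong)
      fix e :: "nat \<Rightarrow> 's" assume e: "\<And>i. e i \<in> V"
      show "e 0 = nx (e 1) \<longleftrightarrow> (elts x0 \<subseteq> elts (e 1) \<and> e 0 = e 1) \<or> (\<not> elts x0 \<subseteq> elts (e 1) \<and> nxr (e 1) (e 0))"
        using nx(3)[OF e[of 1], of "e 0"] unfolding x0(2) by (cases "X \<subseteq> elts (e 1)") (auto simp: nx_def)
    qed
    moreover have "df (\<lambda>e. (elts x0 \<subseteq> elts (e 1) \<and> e 0 = e 1) \<or> (\<not> elts x0 \<subseteq> elts (e 1) \<and> nxr (e 1) (e 0)))"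
      unfolding nxr_def by (intro dfn_intros dB' x0 ch)
    ultimately show ?thesis by simp
  qed
  have nxd: "nx s \<in> X - elts s" if "s \<in> V" "\<not> X \<subseteq> elts s" for s using nx(2)[OF that] B[OF that(1)] by blast
  obtain C \<theta> where C: "\<theta> \<in> V" "Ord \<theta>" "inj_on C (elts \<theta>)" "C ` elts \<theta> = X"
    "\<And>\<alpha>. \<alpha> \<in> elts \<theta> \<Longrightarrow> inV (C ` elts \<alpha>) \<and> C \<alpha> = nx (mk (C ` elts \<alpha>)) \<and> \<not> X \<subseteq> C ` elts \<alpha>"
    "\<And>x. x \<in> V \<Longrightarrow> C x \<in> V" "df (\<lambda>e. e 0 = C (e 1))"
    by (rule enumerate[OF X nxV dnx nxd]) (assumption | rule that)+
  have "inV (C ` elts \<alpha>) \<and> B (mk (C ` elts \<alpha>)) (C \<alpha>)" if a: "\<alpha> \<in> elts \<theta>" for \<alpha>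
  proof -
    have c: "inV (C ` elts \<alpha>)" "C \<alpha> = nx (mk (C ` elts \<alpha>))" "\<not> X \<subseteq> C ` elts \<alpha>" using C(5)[OF a] by auto
    have "B (mk (C ` elts \<alpha>)) (nx (mk (C ` elts \<alpha>)))"
      by (rule nx(2)) (use c in \<open>simp_all add: mk_in elts_mk\<close>)
    then show ?thesis using c by simp
  qed
  then show thesis using that[of \<theta> C] C by blast
qed

lemma vinj_mono: "vinj A B \<Longrightarrow> B \<subseteq> B' \<Longrightarrow> vinj A B'"
  unfolding vinj_def by (meson order_trans)

lemma vinj_enum:
  assumes "\<theta> \<in> V" "Ord \<theta>" "inj_on C (elts \<theta>)" "C ` elts \<theta> = X" "inV X"
    "\<And>x. x \<in> V \<Longrightarrow> C x \<in> V" "df (\<lambda>e. e 0 = C (e 1))"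
  shows "vinj X (elts \<theta>)"
proof -
  obtain r where r: "r \<in> V" "\<And>x y. (x, y) \<in> rel_of r \<longleftrightarrow> x \<in> X \<and> y \<in> elts \<theta> \<and> x = C y"
  proof (rule rel_sep[OF assms(5) inV_elts[OF assms(1)]])
    show "df (\<lambda>e. e 0 = C (e 1))" by fact
  qed (rule that)
  show ?thesis by (rule vinj_color[OF assms(5) r(1) assms(2)]) (use r(2) assms in auto)
qed

text \<open>An ordinal that enumerates the power set of \<open>k\<close> has this property, as an
  injection of it into \<open>k\<close> would contradict Cantor's theorem.\<close>

lemma no_vinj_ordinal:
  assumes k: "k \<in> V" obtains \<theta> where "\<theta> \<in> V" "Ord \<theta>" "\<not> vinj (elts \<theta>) (elts k)"
proof -
  let ?X = "{x \<in> V. elts x \<subseteq> elts k}"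
  have X: "inV ?X" by (intro inV_Pow inV_elts k)
  obtain C \<theta> where C: "\<theta> \<in> V" "Ord \<theta>" "inj_on C (elts \<theta>)" "C ` elts \<theta> = ?X"
    "\<And>x. x \<in> V \<Longrightarrow> C x \<in> V" "df (\<lambda>e. e 0 = C (e 1))"
  proof (rule enumerate_choice[OF X, where B = "\<lambda>s x. x \<in> V \<and> elts x \<subseteq> elts k \<and> x \<notin> elts s"])
    have "df (\<lambda>e. e 1 \<in> V \<and> elts (e 1) \<subseteq> elts k \<and> e 1 \<notin> elts (e 0)) \<longleftrightarrow>
        df (\<lambda>e. elts (e 1) \<subseteq> elts k \<and> e 1 \<notin> elts (e 0))" by (rule dfn_cong) auto
    moreover have "df (\<lambda>e. elts (e 1) \<subseteq> elts k \<and> e 1 \<notin> elts (e 0))" by (intro dfn_intros k)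
    ultimately show "df (\<lambda>e. e 1 \<in> V \<and> elts (e 1) \<subseteq> elts k \<and> e 1 \<notin> elts (e 0))" by simp
  next
    fix C \<theta> assume "\<theta> \<in> V" "Ord \<theta>" "inj_on C (elts \<theta>)" "C ` elts \<theta> = ?X"
      "\<And>x. x \<in> V \<Longrightarrow> C x \<in> V" "df (\<lambda>e. e 0 = C (e 1))"
    then show thesis using that by metis
  qed auto
  have "\<not> vinj (elts \<theta>) (elts k)"
  proof
    assume "vinj (elts \<theta>) (elts k)"
    with vinj_enum[OF C(1-4) X C(5,6)] have "vinj ?X (elts k)" by (rule vinj_trans)
    then obtain F f where f: "f \<in> V" "inj_on F ?X" "F ` ?X \<subseteq> elts k"
      "\<And>x y. (x, y) \<in> rel_of f \<longleftrightarrow> x \<in> ?X \<and> y = F x" by (rule vinjE) (rule that)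
    have "inV {\<alpha> \<in> elts k. \<exists>x \<in> V. (x, \<alpha>) \<in> rel_of f \<and> \<alpha> \<notin> elts x}"
      by (intro inV_sep inV_elts k dfn_intros f)
    then obtain d where d: "d \<in> V" "elts d = {\<alpha> \<in> elts k. \<exists>x \<in> V. (x, \<alpha>) \<in> rel_of f \<and> \<alpha> \<notin> elts x}"
      unfolding inV_def by auto
    have dX: "d \<in> ?X" using d by auto
    have "F d \<in> elts d \<longleftrightarrow> F d \<notin> elts d"
    proof
      assume "F d \<in> elts d"
      then obtain x where "(x, F d) \<in> rel_of f" "F d \<notin> elts x" using d(2) by blast
      moreover from this have "d = x" using f(4)[of x "F d"] dX inj_onD[OF f(2), of d x] by blast
      ultimately show "F d \<notin> elts d" by blast
    next
      assume "F d \<notin> elts d"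
      moreover have "(d, F d) \<in> rel_of f" using f(4) dX by simp
      moreover have "F d \<in> elts k" using f(3) dX by blast
      ultimately show "F d \<in> elts d" using d by blast
    qed
    then show False by blast
  qed
  then show thesis using that C by blast
qed

text \<open>Membership in the \<open>n\<close>-fold power set of \<open>S\<close>. The number
  \<open>n\<close> belongs to HOL, and each level costs one bounded quantifier, so definability
  follows by induction on \<open>n\<close>.\<close>

primrec in_power :: "nat \<Rightarrow> 's set \<Rightarrow> 's \<Rightarrow> bool" where
  "in_power 0 S x \<longleftrightarrow> x \<in> S"
| "in_power (Suc n) S x \<longleftrightarrow> (\<forall>y \<in> elts x. in_power n S y)"

lemma in_power_mono: "S \<subseteq> S' \<Longrightarrow> in_power n S x \<Longrightarrow> in_power n S' x"
  by (induction n arbitrary: x) auto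

lemma in_power_Suc: "(\<And>x. x \<in> S \<Longrightarrow> elts x \<subseteq> S) \<Longrightarrow> in_power n S x \<Longrightarrow> in_power (Suc n) S x"
  by (induction n arbitrary: x) auto

lemma in_power_le:
  assumes "\<And>x. x \<in> S \<Longrightarrow> elts x \<subseteq> S" "m \<le> n" "in_power m S x" shows "in_power n S x"
  using assms(2)
proof (induction n rule: dec_induct)
  case (step n)
  show ?case by (rule in_power_Suc[OF assms(1) step.IH])
qed (rule assms(3))

text \<open>The sets \<open>{a}\<close> and \<open>{a, b}\<close> are one level above
  \<open>a\<close> and \<open>b\<close>, and the pair itself is two levels above.\<close>

lemma in_power_pr: "a \<in> V \<Longrightarrow> b \<in> V \<Longrightarrow> in_power n S a \<Longrightarrow> in_power n S b \<Longrightarrow> in_power (Suc (Suc n)) S (pr a b)"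
  using pr_is_pair(1)[of a b] unfolding is_pair_def by fastforce

abbreviation succ_set :: "'s \<Rightarrow> 's set" where "succ_set d \<equiv> insert d (elts d)"

lemma dfn_in_power: "dt t \<Longrightarrow> dt u \<Longrightarrow> df (\<lambda>e. in_power n (succ_set (t e)) (u e))"
proof (rule dfn_subst2[where P = "\<lambda>d x. in_power n (succ_set d) x"])
  show "df (\<lambda>e. in_power n (succ_set (e 0)) (e 1))"
  proof (induction n)
    case 0
    then show ?case by simp (intro dfn_intros)
  next
    case (Suc n)
    have "df (\<lambda>e. \<forall>y \<in> elts (e 1). in_power n (succ_set (e 0)) y)"
    proof (rule dfn_ball[OF dft_var])
      show "df (\<lambda>e. in_power n (succ_set (e (Suc 0))) (e 0))"
        using dfn_rename[OF Suc, of "\<lambda>i. if i = 0 then 1 else 0"] by simp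
    qed
    then show ?case by simp
  qed
qed

lemma inV_in_power: "inV S \<Longrightarrow> inV {x \<in> V. in_power n S x}"
proof (induction n)
  case 0
  have "{x \<in> V. in_power 0 S x} = S" using inV_subV[OF 0] by auto
  then show ?case using 0 by simp
next
  case (Suc n)
  have "{x \<in> V. in_power (Suc n) S x} = {x \<in> V. elts x \<subseteq> {x \<in> V. in_power n S x}}"
    using transV by auto
  then show ?case using inV_Pow[OF Suc.IH[OF Suc.prems]] by simp
qed

end

section \<open>Normal measures\<close>

locale nmeasure = zfc_model V for V :: "'s::set_universe set" +
  fixes k W :: 's
  assumes nmeas: "normal_measure V k W"
begin

definition large :: "'s set \<Rightarrow> bool" where
  "large A \<longleftrightarrow> (\<exists>X \<in> elts W. elts X = A)"

lemma kO: "Ord k" "k \<in> V" and k_inf: "\<exists>w \<in> elts k. infinite (elts w)" and WV: "W \<in> V"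
  and W_sub: "\<forall>X \<in> elts W. elts X \<subseteq> elts k \<and> elts X \<noteq> {}"
  and W_up: "\<forall>X \<in> elts W. \<forall>Y \<in> V. elts X \<subseteq> elts Y \<and> elts Y \<subseteq> elts k \<longrightarrow> Y \<epsilon> W"
  and W_ultra: "\<forall>X \<in> V. \<forall>Y \<in> V. elts X \<subseteq> elts k \<and> elts Y = elts k - elts X \<longrightarrow> X \<epsilon> W \<or> Y \<epsilon> W"
  and W_np: "\<forall>\<xi> \<in> elts k. \<forall>X \<in> elts W. elts X \<noteq> {\<xi>}"
  and W_complete: "\<forall>\<delta> \<in> elts k. \<forall>f \<in> V. is_function f (elts \<delta>) \<and> (\<forall>\<xi> \<in> elts \<delta>. app f \<xi> \<epsilon> W) \<longrightarrow>
        (\<exists>X \<in> elts W. elts X = {\<eta> \<in> elts k. \<forall>\<xi> \<in> elts \<delta>. \<eta> \<epsilon> app f \<xi>})"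
  and W_normal: "\<forall>f \<in> V. is_function f (elts k) \<and> (\<forall>\<xi> \<in> elts k. app f \<xi> \<epsilon> W) \<longrightarrow>
        (\<exists>X \<in> elts W. elts X = {\<eta> \<in> elts k. \<forall>\<xi> \<in> elts \<eta>. \<eta> \<epsilon> app f \<xi>})"
  by (insert nmeas[unfolded normal_measure_def is_cardinal_def]; elim conjE; assumption)+

lemma large_sub: "large A \<Longrightarrow> A \<subseteq> elts k" "\<not> large {}"
  using W_sub unfolding large_def by blast+

lemma large_ne: "large A \<Longrightarrow> \<exists>x. x \<in> A"
  using large_sub(2) by (metis equals0I)

lemma large_inV: "large A \<Longrightarrow> inV A"
  unfolding large_def inV_def using transV[OF WV] by blast

lemma large_up: "large A \<Longrightarrow> inV B \<Longrightarrow> A \<subseteq> B \<Longrightarrow> B \<subseteq> elts k \<Longrightarrow> large B"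
  using W_up unfolding large_def inV_def by (metis mem_iff_elts)

lemma inV_compl: "inV A \<Longrightarrow> inV (elts k - A)"
proof -
  assume A: "inV A"
  have "inV {x \<in> elts k. \<not> x \<in> A}" by (intro inV_sep inV_elts kO dfn_not dfn_inV A dft_var)
  then show ?thesis by (simp add: set_diff_eq)
qed

lemma large_ultra: assumes A: "inV A" "A \<subseteq> elts k" shows "large A \<or> large (elts k - A)"
proof -
  obtain a b where "a \<in> V" "elts a = A" "b \<in> V" "elts b = elts k - A"
    using A(1) inV_compl[OF A(1)] unfolding inV_def by blast
  then show ?thesis using W_ultra A(2) unfolding large_def by (metis mem_iff_elts)
qed

lemma large_k: "large (elts k)"
  using large_ultra[OF inV_elts[OF kO(2)]] large_sub(2) by auto

lemma large_np: "\<not> large {\<xi>}"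
  using W_np large_sub(1)[of "{\<xi>}"] unfolding large_def by blast

text \<open>Turns a relation of the model into a sequence of sets, the form in which completeness
  and normality of the measure are stated.\<close>

lemma family:
  assumes A: "inV A" and R: "R \<in> V"
  obtains f where "f \<in> V" "is_function f A" "\<And>\<xi>. \<xi> \<in> A \<Longrightarrow> elts (app f \<xi>) = {\<eta> \<in> elts k. (\<xi>, \<eta>) \<in> rel_of R}"
proof -
  have i: "inV {\<eta> \<in> elts k. (\<xi>, \<eta>) \<in> rel_of R}" if "\<xi> \<in> A" for \<xi>
    by (intro inV_sep inV_elts kO dfn_intros R inV_mem[OF A that])
  let ?F = "\<lambda>\<xi>. mk {\<eta> \<in> elts k. (\<xi>, \<eta>) \<in> rel_of R}"
  have FV: "?F x \<in> V" if "x \<in> A" for x using mk_in[OF i[OF that]] .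
  obtain f where f: "f \<in> V" "\<And>x y. (x, y) \<in> rel_of f \<longleftrightarrow> x \<in> A \<and> y = ?F x"
    "elts f = {pr x (?F x) | x. x \<in> A}"
  proof (rule graph[OF A FV])
    show "df (\<lambda>e. \<forall>\<eta> \<in> V. \<eta> \<in> elts (e 1) \<longleftrightarrow> \<eta> \<in> elts k \<and> (e 0, \<eta>) \<in> rel_of R)"
      by (intro dfn_intros kO R)
    fix x y assume x: "x \<in> A" "y \<in> V"
    have "y = ?F x \<longleftrightarrow> elts y = {\<eta> \<in> elts k. (x, \<eta>) \<in> rel_of R}"
      using elts_mk[OF i[OF x(1)]] elts_inject[of y "?F x"] by simp
    also have "\<dots> \<longleftrightarrow> (\<forall>\<eta> \<in> V. \<eta> \<in> elts y \<longleftrightarrow> \<eta> \<in> elts k \<and> (x, \<eta>) \<in> rel_of R)"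
      using transV[OF x(2)] transV[OF kO(2)] by blast
    finally show "(\<forall>\<eta> \<in> V. \<eta> \<in> elts y \<longleftrightarrow> \<eta> \<in> elts k \<and> (x, \<eta>) \<in> rel_of R) \<longleftrightarrow> y = ?F x" by simp
  qed (assumption | rule that)+
  show thesis
  proof (rule that[OF f(1)])
    show "is_function f A" by (rule function_graph(1)[OF inV_subV[OF A] FV f(3)])
    show "elts (app f \<xi>) = {\<eta> \<in> elts k. (\<xi>, \<eta>) \<in> rel_of R}" if "\<xi> \<in> A" for \<xi>
      using function_graph(2)[OF inV_subV[OF A] FV f(3) that] elts_mk[OF i[OF that]] by simp
  qed
qed

lemma large_iff: "elts X = A \<Longrightarrow> X \<epsilon> W \<longleftrightarrow> large A"
  unfolding large_def by (metis elts_inject mem_iff_elts)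

lemma complete_rel:
  assumes d: "\<delta> \<in> elts k" and R: "R \<in> V" and m: "\<And>\<xi>. \<xi> \<in> elts \<delta> \<Longrightarrow> large {\<eta> \<in> elts k. (\<xi>, \<eta>) \<in> rel_of R}"
  shows "large {\<eta> \<in> elts k. \<forall>\<xi> \<in> elts \<delta>. (\<xi>, \<eta>) \<in> rel_of R}"
proof -
  obtain f where f: "f \<in> V" "is_function f (elts \<delta>)"
    "\<And>\<xi>. \<xi> \<in> elts \<delta> \<Longrightarrow> elts (app f \<xi>) = {\<eta> \<in> elts k. (\<xi>, \<eta>) \<in> rel_of R}"
    by (rule family[OF inV_elts[OF transV[OF kO(2) d]] R]) (rule that)
  have "\<forall>\<xi> \<in> elts \<delta>. app f \<xi> \<epsilon> W" using large_iff[OF f(3)] m by blast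
  then have "large {\<eta> \<in> elts k. \<forall>\<xi> \<in> elts \<delta>. \<eta> \<epsilon> app f \<xi>}" using W_complete d f unfolding large_def by blast
  moreover have "{\<eta> \<in> elts k. \<forall>\<xi> \<in> elts \<delta>. \<eta> \<epsilon> app f \<xi>} = {\<eta> \<in> elts k. \<forall>\<xi> \<in> elts \<delta>. (\<xi>, \<eta>) \<in> rel_of R}"
    using f(3) by auto
  ultimately show ?thesis by simp
qed

lemma normal_rel:
  assumes R: "R \<in> V" and m: "\<And>\<xi>. \<xi> \<in> elts k \<Longrightarrow> large {\<eta> \<in> elts k. (\<xi>, \<eta>) \<in> rel_of R}"
  shows "large {\<eta> \<in> elts k. \<forall>\<xi> \<in> elts \<eta>. (\<xi>, \<eta>) \<in> rel_of R}"
proof -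
  obtain f where f: "f \<in> V" "is_function f (elts k)"
    "\<And>\<xi>. \<xi> \<in> elts k \<Longrightarrow> elts (app f \<xi>) = {\<eta> \<in> elts k. (\<xi>, \<eta>) \<in> rel_of R}"
    by (rule family[OF inV_elts[OF kO(2)] R]) (rule that)
  have "\<forall>\<xi> \<in> elts k. app f \<xi> \<epsilon> W" using large_iff[OF f(3)] m by blast
  then have "large {\<eta> \<in> elts k. \<forall>\<xi> \<in> elts \<eta>. \<eta> \<epsilon> app f \<xi>}" using W_normal f unfolding large_def by blast
  moreover have "{\<eta> \<in> elts k. \<forall>\<xi> \<in> elts \<eta>. \<eta> \<epsilon> app f \<xi>} = {\<eta> \<in> elts k. \<forall>\<xi> \<in> elts \<eta>. (\<xi>, \<eta>) \<in> rel_of R}"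
    using f(3) Ord_trans[OF kO(1)] by auto
  ultimately show ?thesis by simp
qed

lemma large_Int: assumes A: "large A" and B: "large B" shows "large (A \<inter> B)"
proof -
  \<comment> \<open>Any \<open>w\<close> below \<open>k\<close> with two distinct elements serves as
    the index set for \<open>\<alpha>\<close>-completeness: \<open>A\<close> is placed at the index
    \<open>a\<close> and \<open>B\<close> at all others.\<close>
  obtain w where w: "w \<in> elts k" "infinite (elts w)" using k_inf by blast
  obtain a where a: "a \<in> elts w" using w(2) by (metis ex_in_conv finite.emptyI)
  obtain b where b: "b \<in> elts w" "b \<noteq> a"
    using w(2) by (metis finite.emptyI finite_insert infinite_super insertI1 subsetI)
  have wV: "w \<in> V" using transV[OF kO(2) w(1)] .
  obtain X Y where XY: "X \<in> V" "elts X = A" "Y \<in> V" "elts Y = B"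
    using large_inV[OF A] large_inV[OF B] unfolding inV_def by blast
  obtain R where R: "R \<in> V" "\<And>\<xi> \<eta>. (\<xi>, \<eta>) \<in> rel_of R \<longleftrightarrow> \<xi> \<in> elts w \<and> \<eta> \<in> elts k \<and>
      ((\<xi> = a \<and> \<eta> \<in> elts X) \<or> (\<xi> \<noteq> a \<and> \<eta> \<in> elts Y))"
  proof (rule rel_sep[OF inV_elts[OF wV] inV_elts[OF kO(2)]])
    show "df (\<lambda>e. (e 0 = a \<and> e 1 \<in> elts X) \<or> (e 0 \<noteq> a \<and> e 1 \<in> elts Y))"
      by (intro dfn_intros XY transV[OF wV a])
  qed (rule that)
  have "large {\<eta> \<in> elts k. \<forall>\<xi> \<in> elts w. (\<xi>, \<eta>) \<in> rel_of R}"
  proof (rule complete_rel[OF w(1) R(1)])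
    fix \<xi> assume x: "\<xi> \<in> elts w"
    have "{\<eta> \<in> elts k. (\<xi>, \<eta>) \<in> rel_of R} = (if \<xi> = a then A else B)"
      using x R(2) XY large_sub(1)[OF A] large_sub(1)[OF B] by auto
    then show "large {\<eta> \<in> elts k. (\<xi>, \<eta>) \<in> rel_of R}" using A B by simp
  qed
  moreover have "{\<eta> \<in> elts k. \<forall>\<xi> \<in> elts w. (\<xi>, \<eta>) \<in> rel_of R} = A \<inter> B"
    using R(2) a b XY large_sub(1)[OF A] by auto
  ultimately show ?thesis by simp
qed

text \<open>Completeness of the measure for families indexed by an arbitrary set of the model. In
  this form it passes from ordinals to their iterated power sets before these have been
  well-ordered.\<close>

definition complete_over :: "'s set \<Rightarrow> bool" where
  "complete_over C \<longleftrightarrow> inV C \<and> (\<forall>R \<in> V. (\<forall>x \<in> C. large {\<eta> \<in> elts k. (x, \<eta>) \<in> rel_of R}) \<longrightarrow>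
     large {\<eta> \<in> elts k. \<forall>x \<in> C. (x, \<eta>) \<in> rel_of R})"

lemma complete_overD: "complete_over C \<Longrightarrow> inV C" "complete_over C \<Longrightarrow> R \<in> V \<Longrightarrow> (\<And>x. x \<in> C \<Longrightarrow> large {\<eta> \<in> elts k. (x, \<eta>) \<in> rel_of R}) \<Longrightarrow>
     large {\<eta> \<in> elts k. \<forall>x \<in> C. (x, \<eta>) \<in> rel_of R}"
  unfolding complete_over_def by blast+

lemma complete_ordinal: "\<delta> \<in> elts k \<Longrightarrow> complete_over (elts \<delta>)"
  unfolding complete_over_def using complete_rel inV_elts transV[OF kO(2)] by blast

lemma complete_insert: assumes "complete_over C" "x \<in> V" shows "complete_over (insert x C)"
  unfolding complete_over_def
proof (intro conjI ballI impI)
  show "inV (insert x C)" by (rule inV_insert[OF assms(2) complete_overD(1)[OF assms(1)]])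
  fix R assume R: "R \<in> V" "\<forall>x \<in> insert x C. large {\<eta> \<in> elts k. (x, \<eta>) \<in> rel_of R}"
  have "large ({\<eta> \<in> elts k. (x, \<eta>) \<in> rel_of R} \<inter> {\<eta> \<in> elts k. \<forall>x \<in> C. (x, \<eta>) \<in> rel_of R})"
    by (intro large_Int complete_overD(2)[OF assms(1) R(1)]) (use R(2) in auto)
  moreover have "{\<eta> \<in> elts k. (x, \<eta>) \<in> rel_of R} \<inter> {\<eta> \<in> elts k. \<forall>x \<in> C. (x, \<eta>) \<in> rel_of R} =
      {\<eta> \<in> elts k. \<forall>x \<in> insert x C. (x, \<eta>) \<in> rel_of R}" by auto
  ultimately show "large {\<eta> \<in> elts k. \<forall>x \<in> insert x C. (x, \<eta>) \<in> rel_of R}" by simp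
qed

text \<open>If no \<open>x\<close> in \<open>C\<close> had a large section, the complements would be
  large, and their intersection over \<open>C\<close> would miss \<open>Y\<close>.\<close>

lemma complete_const:
  assumes C: "complete_over C" and F: "F \<in> V" and Y: "large Y" and tot: "\<And>\<eta>. \<eta> \<in> Y \<Longrightarrow> \<exists>x \<in> C. (\<eta>, x) \<in> rel_of F"
  obtains x where "x \<in> C" "large {\<eta> \<in> Y. (\<eta>, x) \<in> rel_of F}"
proof (rule ccontr)
  assume no: "\<not> thesis"
  note iC = complete_overD(1)[OF C]
  obtain y where y: "y \<in> V" "elts y = Y" using large_inV[OF Y] unfolding inV_def by blast
  have Yk: "Y \<subseteq> elts k" using large_sub(1)[OF Y] .
  obtain R where R: "R \<in> V" "\<And>x \<eta>. (x, \<eta>) \<in> rel_of R \<longleftrightarrow> x \<in> C \<and> \<eta> \<in> elts k \<and>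
      \<not> (\<eta> \<in> elts y \<and> (\<eta>, x) \<in> rel_of F)"
  proof (rule rel_sep[OF iC inV_elts[OF kO(2)]])
    show "df (\<lambda>e. \<not> (e 1 \<in> elts y \<and> (e 1, e 0) \<in> rel_of F))" by (intro dfn_intros y F)
  qed (rule that)
  have "large {\<eta> \<in> elts k. \<forall>x \<in> C. (x, \<eta>) \<in> rel_of R}"
  proof (rule complete_overD(2)[OF C R(1)])
    fix x assume x: "x \<in> C"
    have "inV {\<eta> \<in> elts y. (\<eta>, x) \<in> rel_of F}" by (intro inV_sep inV_elts dfn_intros y F inV_mem[OF iC x])
    then have i: "inV {\<eta> \<in> Y. (\<eta>, x) \<in> rel_of F}" using y by simp
    have "\<not> large {\<eta> \<in> Y. (\<eta>, x) \<in> rel_of F}" using no that x by blast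
    then have "large (elts k - {\<eta> \<in> Y. (\<eta>, x) \<in> rel_of F})" using large_ultra[OF i] Yk by blast
    moreover have "elts k - {\<eta> \<in> Y. (\<eta>, x) \<in> rel_of F} = {\<eta> \<in> elts k. (x, \<eta>) \<in> rel_of R}"
      using R(2) x y by auto
    ultimately show "large {\<eta> \<in> elts k. (x, \<eta>) \<in> rel_of R}" by simp
  qed
  then have "large ({\<eta> \<in> elts k. \<forall>x \<in> C. (x, \<eta>) \<in> rel_of R} \<inter> Y)" by (rule large_Int[OF _ Y])
  moreover have "{\<eta> \<in> elts k. \<forall>x \<in> C. (x, \<eta>) \<in> rel_of R} \<inter> Y = {}"
    using tot R(2) y by fastforce
  ultimately show False using large_sub(2) by simp
qed

text \<open>The proof that a measurable cardinal is a strong limit. If the intersection were not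
  large, then for measure-one many \<open>\<eta>\<close> some set \<open>x\<close> could be picked
  whose member of the family omits \<open>\<eta>\<close>. For each \<open>c\<close> in
  \<open>C\<close> the measure decides whether \<open>c\<close> belongs to the picked set;
  completeness over \<open>C\<close> then makes the picked set constant, equal to \<open>x0\<close>,
  on a large set, although the member of the family at \<open>x0\<close> is large.\<close>

lemma complete_Pow: assumes C: "complete_over C" shows "complete_over {x \<in> V. elts x \<subseteq> C}"
  unfolding complete_over_def
proof (intro conjI ballI impI)
  let ?D = "{x \<in> V. elts x \<subseteq> C}"
  note iC = complete_overD(1)[OF C]
  show D: "inV ?D" by (rule inV_Pow[OF iC])
  fix R assume R: "R \<in> V" "\<forall>x \<in> ?D. large {\<eta> \<in> elts k. (x, \<eta>) \<in> rel_of R}"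
  obtain d where d: "d \<in> V" "elts d = ?D" using D unfolding inV_def by blast
  obtain c0 where c0: "c0 \<in> V" "elts c0 = C" using iC unfolding inV_def by blast
  let ?L = "{\<eta> \<in> elts k. \<forall>x \<in> elts d. (x, \<eta>) \<in> rel_of R}"
  have L: "inV ?L" by (intro inV_sep inV_elts kO dfn_intros d R)
  have "large ?L"
  proof (rule ccontr)
    assume "\<not> large ?L"
    then have Y: "large (elts k - ?L)" using large_ultra[OF L] by blast
    obtain T where T: "T \<in> V" "\<And>\<eta> x. (\<eta>, x) \<in> rel_of T \<longleftrightarrow> \<eta> \<in> elts k - ?L \<and> x \<in> elts d \<and> (x, \<eta>) \<notin> rel_of R"
    proof (rule rel_sep[OF large_inV[OF Y] inV_elts[OF d(1)]])
      show "df (\<lambda>e. (e 1, e 0) \<notin> rel_of R)" by (intro dfn_intros R)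
    qed (rule that)
    obtain f where f: "f \<in> V" "rel_of f \<subseteq> rel_of T" "single_valued (rel_of f)"
      "Domain (rel_of f) = Domain (rel_of T)" by (rule uniformize[OF T(1)]) (rule that)
    let ?Z = "\<lambda>c. {\<eta> \<in> elts k. \<exists>x \<in> V. (\<eta>, x) \<in> rel_of f \<and> c \<in> elts x}"
    have Z: "inV (?Z c)" if "c \<in> C" for c
      by (intro inV_sep inV_elts kO dfn_intros f inV_mem[OF iC that])
    have "inV {c \<in> C. \<exists>X \<in> elts W. \<forall>\<eta> \<in> V. \<eta> \<in> elts X \<longleftrightarrow> \<eta> \<in> elts k \<and> (\<exists>x \<in> V. (\<eta>, x) \<in> rel_of f \<and> c \<in> elts x)}"
      by (intro inV_sep iC dfn_intros WV kO f)
    then obtain x0 where x0: "x0 \<in> V" "elts x0 = {c \<in> C. \<exists>X \<in> elts W. \<forall>\<eta> \<in> V. \<eta> \<in> elts X \<longleftrightarrow>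
        \<eta> \<in> elts k \<and> (\<exists>x \<in> V. (\<eta>, x) \<in> rel_of f \<and> c \<in> elts x)}" unfolding inV_def by auto
    have x0': "c \<in> elts x0 \<longleftrightarrow> large (?Z c)" if c: "c \<in> C" for c
    proof -
      have "elts X = ?Z c \<longleftrightarrow> (\<forall>\<eta> \<in> V. \<eta> \<in> elts X \<longleftrightarrow> \<eta> \<in> elts k \<and> (\<exists>x \<in> V. (\<eta>, x) \<in> rel_of f \<and> c \<in> elts x))"
        if "X \<in> elts W" for X
        using transV[OF transV[OF WV that]] transV[OF kO(2)] by blast
      then show ?thesis unfolding large_def x0(2) using c by auto
    qed
    obtain R' where R': "R' \<in> V" "\<And>c \<eta>. (c, \<eta>) \<in> rel_of R' \<longleftrightarrow> c \<in> C \<and> \<eta> \<in> elts k \<and>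
        (\<exists>x \<in> V. (\<eta>, x) \<in> rel_of f \<and> (c \<in> elts x \<longleftrightarrow> c \<in> elts x0))"
    proof (rule rel_sep[OF iC inV_elts[OF kO(2)]])
      show "df (\<lambda>e. \<exists>x \<in> V. (e 1, x) \<in> rel_of f \<and> (e 0 \<in> elts x \<longleftrightarrow> e 0 \<in> elts x0))"
        by (intro dfn_intros f x0)
    qed (rule that)
    have dom: "\<exists>x. x \<in> V \<and> (\<eta>, x) \<in> rel_of f" if "\<eta> \<in> elts k - ?L" for \<eta>
    proof -
      have "\<eta> \<in> Domain (rel_of T)" using T(2) that by blast
      then show ?thesis using f(4) rel_in[OF f(1)] by blast
    qed
    have 1: "large {\<eta> \<in> elts k. \<forall>c \<in> C. (c, \<eta>) \<in> rel_of R'}"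
    proof (rule complete_overD(2)[OF C R'(1)])
      fix c assume c: "c \<in> C"
      have "inV {\<eta> \<in> elts k. (c, \<eta>) \<in> rel_of R'}"
        by (intro inV_sep inV_elts kO dfn_intros R' inV_mem[OF iC c])
      note up = large_up[OF _ this]
      show "large {\<eta> \<in> elts k. (c, \<eta>) \<in> rel_of R'}"
      proof (cases "c \<in> elts x0")
        case True
        then have "large (?Z c)" using x0'[OF c] by simp
        then show ?thesis by (rule up) (use R'(2) c True in auto)
      next
        case False
        then have "large (elts k - ?Z c)" using x0'[OF c] large_ultra[OF Z[OF c]] by auto
        then have m: "large ((elts k - ?Z c) \<inter> (elts k - ?L))" by (rule large_Int[OF _ Y])
        show ?thesis
        proof (rule up[OF m])
          show "(elts k - ?Z c) \<inter> (elts k - ?L) \<subseteq> {\<eta> \<in> elts k. (c, \<eta>) \<in> rel_of R'}"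
          proof
            fix \<eta> assume e: "\<eta> \<in> (elts k - ?Z c) \<inter> (elts k - ?L)"
            then obtain x where x: "x \<in> V" "(\<eta>, x) \<in> rel_of f" using dom by blast
            then have "c \<notin> elts x" using e by blast
            then show "\<eta> \<in> {\<eta> \<in> elts k. (c, \<eta>) \<in> rel_of R'}" using R'(2) c False x e by blast
          qed
        qed blast
      qed
    qed
    have x0D: "x0 \<in> ?D" using x0 by auto
    have m3: "large ({\<eta> \<in> elts k. \<forall>c \<in> C. (c, \<eta>) \<in> rel_of R'} \<inter> (elts k - ?L) \<inter> {\<eta> \<in> elts k. (x0, \<eta>) \<in> rel_of R})"
      by (intro large_Int 1 Y) (use R(2) x0D in blast)
    obtain \<eta> where e: "\<eta> \<in> elts k" "\<forall>c \<in> C. (c, \<eta>) \<in> rel_of R'" "\<eta> \<in> elts k - ?L" "(x0, \<eta>) \<in> rel_of R"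
      using large_ne[OF m3] by blast
    obtain x where x: "x \<in> V" "(\<eta>, x) \<in> rel_of f" using dom[OF e(3)] by blast
    then have xT: "x \<in> ?D" "(x, \<eta>) \<notin> rel_of R" using f(2) T(2) d by blast+
    have "c \<in> elts x \<longleftrightarrow> c \<in> elts x0" if c: "c \<in> C" for c
    proof -
      obtain x' where "(\<eta>, x') \<in> rel_of f" "c \<in> elts x' \<longleftrightarrow> c \<in> elts x0" using e(2) c R'(2) by blast
      then show ?thesis using x(2) f(3) unfolding single_valued_def by blast
    qed
    then have "elts x = elts x0" using xT x0D by blast
    then show False using xT e(4) by (simp add: elts_inject)
  qed
  then show "large {\<eta> \<in> elts k. \<forall>x \<in> ?D. (x, \<eta>) \<in> rel_of R}" unfolding d(2) .
qed

lemma complete_in_power: "complete_over S \<Longrightarrow> complete_over {x \<in> V. in_power n S x}"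
proof (induction n)
  case 0
  have "{x \<in> V. in_power 0 S x} = S" using inV_subV[OF complete_overD(1)[OF 0]] by auto
  then show ?case using 0 by simp
next
  case (Suc n)
  have "{x \<in> V. in_power (Suc n) S x} = {x \<in> V. elts x \<subseteq> {x \<in> V. in_power n S x}}"
    using transV by auto
  then show ?case using complete_Pow[OF Suc.IH[OF Suc.prems]] by simp
qed

lemma complete_succ_set: "\<delta> \<in> elts k \<Longrightarrow> complete_over (succ_set \<delta>)"
  by (intro complete_insert complete_ordinal transV[OF kO(2)])

text \<open>By \<open>complete_const\<close> an injection would be constant on a large set, which
  would then be a singleton.\<close>

lemma complete_no_vinj: assumes "complete_over C" shows "\<not> vinj (elts k) C"
proof
  assume "vinj (elts k) C"
  then obtain F f where f: "f \<in> V" "inj_on F (elts k)" "F ` elts k \<subseteq> C"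
    "\<And>x y. (x, y) \<in> rel_of f \<longleftrightarrow> x \<in> elts k \<and> y = F x" by (rule vinjE) (rule that)
  obtain x where x: "x \<in> C" "large {\<eta> \<in> elts k. (\<eta>, x) \<in> rel_of f}"
  proof (rule complete_const[OF assms f(1) large_k])
    show "\<exists>x \<in> C. (\<eta>, x) \<in> rel_of f" if "\<eta> \<in> elts k" for \<eta> using that f(3,4) by blast
  qed (rule that)
  then obtain \<xi> where xi: "\<xi> \<in> elts k" "x = F \<xi>" using f(4) large_ne[OF x(2)] by blast
  have "{\<eta> \<in> elts k. (\<eta>, x) \<in> rel_of f} = {\<xi>}" using f(2,4) xi unfolding inj_on_def by auto
  then show False using x(2) large_np by simp
qed

text \<open>The sets of level \<open>n\<close> over a bounded part of \<open>k\<close>; stems and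
  pairs of stems are of this kind.\<close>

definition low_rank :: "nat \<Rightarrow> 's set" where
  "low_rank n = {x \<in> V. \<exists>\<delta> \<in> elts k. in_power n (succ_set \<delta>) x}"

lemma inV_low_rank: "inV (low_rank n)"
proof -
  have "inV {x \<in> {x \<in> V. in_power n (elts k) x}. \<exists>\<delta> \<in> elts k. in_power n (succ_set \<delta>) x}"
    by (intro inV_sep inV_in_power inV_elts kO dfn_intros dfn_in_power)
  moreover have "in_power n (elts k) x" if "\<delta> \<in> elts k" "in_power n (succ_set \<delta>) x" for \<delta> x
    by (rule in_power_mono[OF _ that(2)]) (use that(1) Ord_trans[OF kO(1)] in blast)
  then have "{x \<in> {x \<in> V. in_power n (elts k) x}. \<exists>\<delta> \<in> elts k. in_power n (succ_set \<delta>) x} = low_rank n"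
    unfolding low_rank_def by blast
  ultimately show ?thesis by simp
qed

text \<open>Enumerate by increasing rank \<open>\<delta>\<close>: an enumeration longer than \<open>k\<close> would inject \<open>k\<close>
  into a single one of the small sets.\<close>

lemma vinj_low_rank: "vinj (low_rank n) (elts k)"
proof -
  obtain q where q: "q \<in> V" "elts q = low_rank n" using inV_low_rank unfolding inV_def by blast
  define B where "B s x \<longleftrightarrow> x \<in> elts q \<and> x \<notin> elts s \<and> (\<exists>\<delta> \<in> elts k. in_power n (succ_set \<delta>) x \<and>
      (\<forall>\<gamma> \<in> elts \<delta>. \<forall>y \<in> elts q. y \<notin> elts s \<longrightarrow> \<not> in_power n (succ_set \<gamma>) y))" for s x
  have dB: "df (\<lambda>e. B (e 0) (e 1))" unfolding B_def by (intro dfn_intros dfn_in_power q kO)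
  have Bx: "x \<in> low_rank n - elts s" if "B s x" for s x using that q unfolding B_def by blast
  have ex: "\<exists>x. B s x" if ns: "\<not> low_rank n \<subseteq> elts s" for s
  proof -
    obtain x where x: "x \<in> low_rank n" "x \<notin> elts s" using ns by blast
    then have "\<exists>\<delta>. \<delta> \<in> elts k \<and> (\<exists>x \<in> elts q. x \<notin> elts s \<and> in_power n (succ_set \<delta>) x)"
      unfolding q(2) low_rank_def by blast
    then obtain \<delta> where d: "\<delta> \<in> elts k \<and> (\<exists>x \<in> elts q. x \<notin> elts s \<and> in_power n (succ_set \<delta>) x)"
      "\<And>\<gamma>. \<gamma> \<in> elts \<delta> \<Longrightarrow> \<not> (\<gamma> \<in> elts k \<and> (\<exists>x \<in> elts q. x \<notin> elts s \<and> in_power n (succ_set \<gamma>) x))"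
      using mem_least[of "\<lambda>\<delta>. \<delta> \<in> elts k \<and> (\<exists>x \<in> elts q. x \<notin> elts s \<and> in_power n (succ_set \<delta>) x)"] by metis
    then show ?thesis unfolding B_def using Ord_trans[OF kO(1)] by blast
  qed
  obtain C \<theta> where C: "\<theta> \<in> V" "Ord \<theta>" "inj_on C (elts \<theta>)" "C ` elts \<theta> = low_rank n"
    "\<And>\<alpha>. \<alpha> \<in> elts \<theta> \<Longrightarrow> inV (C ` elts \<alpha>) \<and> B (mk (C ` elts \<alpha>)) (C \<alpha>)"
    "\<And>x. x \<in> V \<Longrightarrow> C x \<in> V" "df (\<lambda>e. e 0 = C (e 1))"
    by (rule enumerate_choice[OF inV_low_rank dB Bx ex]) (assumption | rule that)+
  have BC: "B (mk (C ` elts \<alpha>)) x \<longleftrightarrow> x \<in> low_rank n \<and> x \<notin> C ` elts \<alpha> \<and> (\<exists>\<delta> \<in> elts k. in_power n (succ_set \<delta>) x \<and>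
      (\<forall>\<gamma> \<in> elts \<delta>. \<forall>y \<in> low_rank n. y \<notin> C ` elts \<alpha> \<longrightarrow> \<not> in_power n (succ_set \<gamma>) y))" if "\<alpha> \<in> elts \<theta>" for \<alpha> x
    using C(5)[OF that] unfolding B_def q(2) by (simp add: elts_mk)
  have "k \<notin> elts \<theta>"
  proof
    assume k: "k \<in> elts \<theta>"
    then have "B (mk (C ` elts k)) (C k)" using C(5) by blast
    then obtain \<delta> where d: "\<delta> \<in> elts k" "in_power n (succ_set \<delta>) (C k)" "C k \<in> low_rank n" "C k \<notin> C ` elts k"
      unfolding BC[OF k] by blast
    \<comment> \<open>When \<open>C \<alpha>\<close> was chosen, \<open>C k\<close> was still
      available, so the least rank used at that stage is at most \<open>\<delta>\<close>.\<close>
    have in_d: "in_power n (succ_set \<delta>) (C \<alpha>)" if a: "\<alpha> \<in> elts k" for \<alpha>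
    proof -
      have at: "\<alpha> \<in> elts \<theta>" using Ord_trans[OF C(2) a k] .
      then have "B (mk (C ` elts \<alpha>)) (C \<alpha>)" using C(5) by blast
      then obtain \<gamma> where g: "\<gamma> \<in> elts k" "in_power n (succ_set \<gamma>) (C \<alpha>)"
        "\<forall>\<gamma>' \<in> elts \<gamma>. \<forall>y \<in> low_rank n. y \<notin> C ` elts \<alpha> \<longrightarrow> \<not> in_power n (succ_set \<gamma>') y" unfolding BC[OF at] by blast
      have "C k \<notin> C ` elts \<alpha>" using d(4) Ord_trans[OF kO(1) _ a] by blast
      then have "\<delta> \<notin> elts \<gamma>" using g(3) d by blast
      then have "\<gamma> = \<delta> \<or> \<gamma> \<in> elts \<delta>" using Ord_linear[of \<delta> \<gamma>] Ord_elt[OF kO(1)] d(1) g(1) by blast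
      then have "succ_set \<gamma> \<subseteq> succ_set \<delta>" using Ord_trans[OF Ord_elt[OF kO(1) d(1)]] by blast
      then show ?thesis using in_power_mono g(2) by blast
    qed
    let ?D = "{x \<in> V. in_power n (succ_set \<delta>) x}"
    obtain f where f: "f \<in> V" "\<And>x y. (x, y) \<in> rel_of f \<longleftrightarrow> x \<in> elts k \<and> y = C x"
    proof (rule graph[OF inV_elts[OF kO(2)], where F = C and Q = "\<lambda>x y. y = C x"])
      show "df (\<lambda>e. e 1 = C (e 0))" by (intro dfn_eq dft_var dft_fun[OF C(6,7)])
      show "C x \<in> V" if "x \<in> elts k" for x using C(6) transV[OF kO(2) that] .
    qed (rule refl, rule that)
    have "inj_on C (elts k)" by (rule inj_on_subset[OF C(3)]) (use Ord_trans[OF C(2) _ k] in blast)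
    moreover have "C ` elts k \<subseteq> ?D" using in_d C(6) transV[OF kO(2)] by blast
    ultimately have "vinj (elts k) ?D" unfolding vinj_def using f by blast
    then show False using complete_no_vinj[OF complete_in_power[OF complete_succ_set[OF d(1)]]] by blast
  qed
  then have "\<theta> = k \<or> \<theta> \<in> elts k" using Ord_linear[OF C(2) kO(1)] by blast
  then have "elts \<theta> \<subseteq> elts k" using Ord_trans[OF kO(1)] by blast
  then show ?thesis using vinj_mono[OF vinj_enum[OF C(1-4) inV_low_rank C(6,7)]] by blast
qed

text \<open>Normality diagonalises over ordinals. The indices of level \<open>n\<close> over
  \<open>\<delta> + 1\<close> are first combined into one large set by completeness, and these sets
  are then diagonalised over \<open>\<delta>\<close>.\<close>

lemma large_diagonal:
  assumes X: "inV X" and R: "R \<in> V"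
    and m: "\<And>x. x \<in> X \<Longrightarrow> large {\<eta> \<in> elts k. (x, \<eta>) \<in> rel_of R}"
  shows "large {\<eta> \<in> elts k. \<forall>\<delta> \<in> elts \<eta>. \<forall>x \<in> X. in_power n (succ_set \<delta>) x \<longrightarrow> (x, \<eta>) \<in> rel_of R}"
proof -
  obtain x0 where x0: "x0 \<in> V" "elts x0 = X" using X unfolding inV_def by blast
  obtain R' where R': "R' \<in> V" "\<And>\<delta> \<eta>. (\<delta>, \<eta>) \<in> rel_of R' \<longleftrightarrow> \<delta> \<in> elts k \<and> \<eta> \<in> elts k \<and>
      (\<forall>x \<in> elts x0. in_power n (succ_set \<delta>) x \<longrightarrow> (x, \<eta>) \<in> rel_of R)"
  proof (rule rel_sep[OF inV_elts[OF kO(2)] inV_elts[OF kO(2)]])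
    show "df (\<lambda>e. \<forall>x \<in> elts x0. in_power n (succ_set (e 0)) x \<longrightarrow> (x, e 1) \<in> rel_of R)"
      by (intro dfn_intros dfn_in_power x0 R)
  qed (rule that)
  have "large {\<eta> \<in> elts k. \<forall>\<delta> \<in> elts \<eta>. (\<delta>, \<eta>) \<in> rel_of R'}"
  proof (rule normal_rel[OF R'(1)])
    fix \<delta> assume d: "\<delta> \<in> elts k"
    let ?C = "{x \<in> V. in_power n (succ_set \<delta>) x}"
    have C: "complete_over ?C" by (rule complete_in_power[OF complete_succ_set[OF d]])
    obtain R2 where R2: "R2 \<in> V" "\<And>x \<eta>. (x, \<eta>) \<in> rel_of R2 \<longleftrightarrow> x \<in> ?C \<and> \<eta> \<in> elts k \<and>
        (x \<in> elts x0 \<longrightarrow> (x, \<eta>) \<in> rel_of R)"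
    proof (rule rel_sep[OF complete_overD(1)[OF C] inV_elts[OF kO(2)]])
      show "df (\<lambda>e. e 0 \<in> elts x0 \<longrightarrow> (e 0, e 1) \<in> rel_of R)" by (intro dfn_intros x0 R)
    qed (rule that)
    have "large {\<eta> \<in> elts k. \<forall>x \<in> ?C. (x, \<eta>) \<in> rel_of R2}"
    proof (rule complete_overD(2)[OF C R2(1)])
      fix x assume x: "x \<in> ?C"
      show "large {\<eta> \<in> elts k. (x, \<eta>) \<in> rel_of R2}"
      proof (cases "x \<in> X")
        case True
        then have "{\<eta> \<in> elts k. (x, \<eta>) \<in> rel_of R2} = {\<eta> \<in> elts k. (x, \<eta>) \<in> rel_of R}"
          using R2(2) x x0 by auto
        then show ?thesis using m[OF True] by simp
      next
        case False
        then have "{\<eta> \<in> elts k. (x, \<eta>) \<in> rel_of R2} = elts k" using R2(2) x x0 by auto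
        then show ?thesis using large_k by simp
      qed
    qed
    moreover have "{\<eta> \<in> elts k. \<forall>x \<in> ?C. (x, \<eta>) \<in> rel_of R2} = {\<eta> \<in> elts k. (\<delta>, \<eta>) \<in> rel_of R'}"
      using R2(2) R'(2) d transV[OF x0(1)] by auto
    ultimately show "large {\<eta> \<in> elts k. (\<delta>, \<eta>) \<in> rel_of R'}" by simp
  qed
  moreover have "{\<eta> \<in> elts k. \<forall>\<delta> \<in> elts \<eta>. (\<delta>, \<eta>) \<in> rel_of R'} =
      {\<eta> \<in> elts k. \<forall>\<delta> \<in> elts \<eta>. \<forall>x \<in> X. in_power n (succ_set \<delta>) x \<longrightarrow> (x, \<eta>) \<in> rel_of R}"
    using R'(2) x0 Ord_trans[OF kO(1)] by blast
  ultimately show ?thesis by simp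
qed

text \<open>Complements of singletons are large, so completeness over \<open>d + 1\<close> removes
  all ordinals up to \<open>d\<close> at once.\<close>

lemma large_above: assumes "d \<in> elts k" shows "large {\<eta> \<in> elts k. d \<in> elts \<eta>}"
proof -
  obtain R where R: "R \<in> V" "\<And>\<xi> \<eta>. (\<xi>, \<eta>) \<in> rel_of R \<longleftrightarrow> \<xi> \<in> succ_set d \<and> \<eta> \<in> elts k \<and> \<eta> \<noteq> \<xi>"
  proof (rule rel_sep[OF complete_overD(1)[OF complete_succ_set[OF assms]] inV_elts[OF kO(2)]])
    show "df (\<lambda>e. e 1 \<noteq> e 0)" by (intro dfn_intros)
  qed (rule that)
  have "large {\<eta> \<in> elts k. \<forall>\<xi> \<in> succ_set d. (\<xi>, \<eta>) \<in> rel_of R}"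
  proof (rule complete_overD(2)[OF complete_succ_set[OF assms] R(1)])
    fix \<xi> assume x: "\<xi> \<in> succ_set d"
    then have xk: "\<xi> \<in> elts k" using assms Ord_trans[OF kO(1)] by blast
    have "large (elts k - {\<xi>})"
      using large_ultra[OF inV_single[OF transV[OF kO(2) xk]]] xk large_np by blast
    moreover have "elts k - {\<xi>} = {\<eta> \<in> elts k. (\<xi>, \<eta>) \<in> rel_of R}" using R(2) x by auto
    ultimately show "large {\<eta> \<in> elts k. (\<xi>, \<eta>) \<in> rel_of R}" by simp
  qed
  moreover have "{\<eta> \<in> elts k. \<forall>\<xi> \<in> succ_set d. (\<xi>, \<eta>) \<in> rel_of R} = {\<eta> \<in> elts k. d \<in> elts \<eta>}"
  proof (intro equalityI subsetI)
    fix \<eta> assume e: "\<eta> \<in> {\<eta> \<in> elts k. \<forall>\<xi> \<in> succ_set d. (\<xi>, \<eta>) \<in> rel_of R}"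
    then have "\<eta> \<notin> succ_set d" using R(2) by blast
    then show "\<eta> \<in> {\<eta> \<in> elts k. d \<in> elts \<eta>}"
      using e Ord_linear[of \<eta> d] Ord_elt[OF kO(1)] assms by blast
  next
    fix \<eta> assume e: "\<eta> \<in> {\<eta> \<in> elts k. d \<in> elts \<eta>}"
    then have "\<eta> \<notin> succ_set d" using mem_asym mem_irrefl by blast
    then show "\<eta> \<in> {\<eta> \<in> elts k. \<forall>\<xi> \<in> succ_set d. (\<xi>, \<eta>) \<in> rel_of R}" using R(2) e by blast
  qed
  ultimately show ?thesis by simp
qed

end

section \<open>Conditions of Magidor forcing as finite sets of entries\<close>

lemma kap_pair: "is_pair t a B \<Longrightarrow> kap t = a"
proof -
  assume p: "is_pair t a B"
  have "(THE a. \<exists>B. is_pair t a B) = a"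
    by (rule the_equality) (use p is_pair_inj in blast)+
  then show ?thesis using pair_not_Ord[OF p] unfolding kap_def by simp
qed

lemma bset_pair: "is_pair t a B \<Longrightarrow> bset t = elts B"
proof -
  assume p: "is_pair t a B"
  have "(THE B. \<exists>k. is_pair t k B) = B"
    by (rule the_equality) (use p is_pair_inj in blast)+
  then show ?thesis using pair_not_Ord[OF p] unfolding bset_def by simp
qed

lemma kap_Ord: "Ord t \<Longrightarrow> kap t = t" "Ord t \<Longrightarrow> bset t = {}"
  unfolding kap_def bset_def by auto

text \<open>Counting elements recovers an index from its numeral, which makes the positions of a
  sequence well defined.\<close>

lemma numeral_card: "is_numeral n x \<Longrightarrow> finite (elts x) \<and> card (elts x) = n"
proof (induction n arbitrary: x)
  case (Suc n)
  then obtain y where "is_numeral n y" "elts x = insert y (elts y)" by auto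
  then show ?case using Suc.IH[of y] mem_irrefl[of y] by simp
qed simp

definition ents :: "'s::set_universe \<Rightarrow> 's set" where
  "ents p = {t. \<exists>z \<in> elts p. \<exists>i. is_pair z i t}"

lemma seq_ents: assumes "is_seq p ts" shows "ents p = set ts"
proof (intro equalityI subsetI)
  fix t assume "t \<in> ents p"
  then obtain z i where z: "z \<in> elts p" "is_pair z i t" unfolding ents_def by blast
  then obtain j kk where "j < length ts" "is_pair z kk (ts ! j)" using assms unfolding is_seq_def by blast
  then show "t \<in> set ts" using is_pair_inj[OF z(2)] by auto
next
  fix t assume "t \<in> set ts"
  then obtain i where "i < length ts" "t = ts ! i" by (metis in_set_conv_nth)
  then show "t \<in> ents p" using assms unfolding is_seq_def ents_def by blast
qed

lemma seq_sub: assumes "is_seq p ts" "is_seq p ss" "i < length ts" shows "i < length ss \<and> ts ! i = ss ! i"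
proof -
  obtain z kk where z: "z \<in> elts p" "is_numeral i kk" "is_pair z kk (ts ! i)"
    using assms unfolding is_seq_def by blast
  then obtain j k' where j: "j < length ss" "is_numeral j k'" "is_pair z k' (ss ! j)"
    using assms unfolding is_seq_def by blast
  have "kk = k'" "ts ! i = ss ! j" using is_pair_inj[OF z(3) j(3)] by auto
  then have "i = j" using numeral_card[OF z(2)] numeral_card[OF j(2)] by simp
  then show ?thesis using j \<open>ts ! i = ss ! j\<close> by simp
qed

lemma seq_unique: assumes "is_seq p ts" "is_seq p ss" shows "ts = ss"
proof (rule nth_equalityI)
  show "length ts = length ss"
    using seq_sub[OF assms] seq_sub[OF assms(2,1)] by (meson linorder_neqE_nat order_less_irrefl)
qed (use seq_sub[OF assms] in blast)

lemma (in zfc_model) numeral_exists: "\<exists>x \<in> V. is_numeral n x"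
proof (induction n)
  case 0
  then show ?case using inV_empty unfolding inV_def by simp
next
  case (Suc n)
  then obtain x where x: "x \<in> V" "is_numeral n x" by blast
  obtain y where "y \<in> V" "elts y = insert x (elts x)"
    using inV_insert[OF x(1) inV_elts[OF x(1)]] unfolding inV_def by blast
  then show ?case using x by auto
qed

lemma (in zfc_model) seq_exists: assumes "set ts \<subseteq> V" shows "\<exists>p \<in> V. is_seq p ts"
proof -
  define num where "num n = (SOME x. x \<in> V \<and> is_numeral n x)" for n
  have num: "num n \<in> V" "is_numeral n (num n)" for n
    using someI_ex[of "\<lambda>x. x \<in> V \<and> is_numeral n x"] numeral_exists unfolding num_def by blast+
  have tV: "ts ! i \<in> V" if "i < length ts" for i using assms that by auto
  have "inV ((\<lambda>i. pr (num i) (ts ! i)) ` {..<length ts})"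
    by (rule inV_finite) (use num tV pr_is_pair in auto)
  then obtain p where p: "p \<in> V" "elts p = (\<lambda>i. pr (num i) (ts ! i)) ` {..<length ts}"
    unfolding inV_def by blast
  have "is_seq p ts" unfolding is_seq_def p(2) using num tV pr_is_pair(1) by blast
  then show ?thesis using p by blast
qed

text \<open>The order of conditions in terms of their sets of entries.  The interval of \<open>E\<close> in which a new
  entry \<open>s\<close> falls need not be mentioned: since \<open>min B\<^sub>i > \<kappa>\<^sub>i\<^sub>-\<^sub>1\<close>, it is determined by \<open>kap s \<in> bset t\<close>.\<close>

definition ents_le :: "'s::set_universe set \<Rightarrow> 's set \<Rightarrow> bool" where
  "ents_le E F \<longleftrightarrow> (\<forall>t \<in> E. \<exists>s \<in> F. kap s = kap t \<and> bset s \<subseteq> bset t) \<and>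
     (\<forall>s \<in> F. (\<exists>t \<in> E. kap t = kap s) \<or> (\<exists>t \<in> E. kap s \<in> bset t \<and> bset s \<subseteq> bset t \<inter> elts (kap s)))"

section \<open>Measures of the coherent sequence and entries of conditions\<close>

locale magidor = zfc_model V for V :: "'s::set_universe set" +
  fixes k U :: 's
  assumes coh: "coherent_sequence V k U"
begin

lemma kO: "Ord k" "k \<in> V" and shape: "index_shape V k U" and ok: "elts (o_len U k) \<noteq> {}"
  and coh_entries: "\<forall>\<alpha> \<beta> W. ((\<alpha>, \<beta>), W) \<in> entries U \<longrightarrow>
        normal_measure V \<alpha> W \<and>
        (\<exists>j. ultrapower_embedding V \<alpha> W j \<and>
           {((\<alpha>', \<beta>'), X) \<in> entries (j U). \<alpha>' \<epsilon> \<alpha> \<or> \<alpha>' = \<alpha>} =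
           {((\<alpha>', \<beta>'), X) \<in> entries U. \<alpha>' \<epsilon> \<alpha> \<or> \<alpha>' = \<alpha> \<and> \<beta>' \<epsilon> \<beta>})"
  by (insert coh[unfolded coherent_sequence_def]; elim conjE; assumption)+

lemma entry_measure: "((\<alpha>, \<beta>), W) \<in> entries U \<Longrightarrow> nmeasure V \<alpha> W"
  using coh_entries zfc_model_axioms unfolding nmeasure_def nmeasure_axioms_def by blast

lemma o_len: assumes "\<alpha> \<in> elts k \<or> \<alpha> = k" shows "elts (o_len U \<alpha>) = {\<beta>. \<exists>X. ((\<alpha>, \<beta>), X) \<in> entries U}"
proof -
  have "\<forall>\<alpha>. \<alpha> \<epsilon> k \<or> \<alpha> = k \<longrightarrow> (\<exists>\<gamma> \<in> V. Ord \<gamma> \<and> elts \<gamma> = {\<beta>. \<exists>X. ((\<alpha>, \<beta>), X) \<in> entries U})"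
    by (insert shape[unfolded index_shape_def]; elim conjE; assumption)
  then obtain \<gamma> where g: "Ord \<gamma>" "elts \<gamma> = {\<beta>. \<exists>X. ((\<alpha>, \<beta>), X) \<in> entries U}" using assms by auto
  have "o_len U \<alpha> = \<gamma>" unfolding o_len_def
    by (rule the_equality) (use g in \<open>simp_all flip: elts_inject\<close>)
  then show ?thesis using g by simp
qed

lemma o_entry: "\<alpha> \<in> elts k \<or> \<alpha> = k \<Longrightarrow> elts (o_len U \<alpha>) \<noteq> {} \<Longrightarrow> \<exists>\<beta> W. ((\<alpha>, \<beta>), W) \<in> entries U"
  using o_len by auto

abbreviation "allm \<equiv> in_all_measures U"

lemma allm_iff: "allm \<alpha> B \<longleftrightarrow> (\<forall>\<beta> W. ((\<alpha>, \<beta>), W) \<in> entries U \<longrightarrow> nmeasure.large W (elts B))"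
  unfolding in_all_measures_def using nmeasure.large_iff[OF entry_measure refl] by blast

lemma allm_sub:
  assumes "\<alpha> \<in> elts k \<or> \<alpha> = k" "elts (o_len U \<alpha>) \<noteq> {}" "allm \<alpha> B"
  shows "B \<in> V" "elts B \<subseteq> elts \<alpha>"
proof -
  obtain \<beta> W where e: "((\<alpha>, \<beta>), W) \<in> entries U" using o_entry[OF assms(1,2)] by blast
  then interpret n: nmeasure V \<alpha> W by (rule entry_measure)
  have m: "n.large (elts B)" using assms(3) e allm_iff by blast
  show "elts B \<subseteq> elts \<alpha>" using n.large_sub(1)[OF m] .
  show "B \<in> V" using mk_in[OF n.large_inV[OF m]] by simp
qed

lemma allm_Int: "allm \<alpha> B \<Longrightarrow> allm \<alpha> C \<Longrightarrow> elts D = elts B \<inter> elts C \<Longrightarrow> allm \<alpha> D"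
  unfolding allm_iff using nmeasure.large_Int[OF entry_measure] by metis

lemma allm_above:
  assumes "allm \<alpha> B" "\<delta> \<in> elts \<alpha>" "elts D = elts B \<inter> {\<eta>. \<delta> \<in> elts \<eta>}" shows "allm \<alpha> D"
  unfolding allm_iff
proof (intro allI impI)
  fix \<beta> W assume e: "((\<alpha>, \<beta>), W) \<in> entries U"
  then interpret n: nmeasure V \<alpha> W by (rule entry_measure)
  have m: "n.large (elts B)" using assms(1) e allm_iff by blast
  have "n.large (elts B \<inter> {\<eta> \<in> elts \<alpha>. \<delta> \<in> elts \<eta>})" by (rule n.large_Int[OF m n.large_above[OF assms(2)]])
  moreover have "elts B \<inter> {\<eta> \<in> elts \<alpha>. \<delta> \<in> elts \<eta>} = elts D" using n.large_sub(1)[OF m] assms(3) by blast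
  ultimately show "n.large (elts D)" by simp
qed

text \<open>Unlike the clause for lower entries in \<open>magidor_list\<close>, this admits the top
  pair as well, so that all entries can be treated alike.\<close>

definition ent :: "'s \<Rightarrow> bool" where
  "ent t \<longleftrightarrow> (Ord t \<and> t \<in> elts k \<and> elts (o_len U t) = {}) \<or>
     (\<exists>a B. is_pair t a B \<and> (a \<in> elts k \<or> a = k) \<and> elts (o_len U a) \<noteq> {} \<and> allm a B)"

lemma ent_pair: "is_pair t a B \<Longrightarrow> a \<in> elts k \<or> a = k \<Longrightarrow> elts (o_len U a) \<noteq> {} \<Longrightarrow> allm a B \<Longrightarrow> ent t"
  unfolding ent_def by blast

lemma ent_cases:
  assumes "ent t"
  obtains "Ord t" "t \<in> elts k" "kap t = t" "bset t = {}"
  | B where "is_pair t (kap t) B" "elts (o_len U (kap t)) \<noteq> {}" "allm (kap t) B" "bset t = elts B" "B \<in> V"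
      "elts B \<subseteq> elts (kap t)" "kap t \<in> elts k \<or> kap t = k"
  using assms unfolding ent_def
proof (elim disjE exE conjE, goal_cases)
  case 1
  then show ?case using kap_Ord by blast
next
  case (2 a B)
  then show ?case using kap_pair bset_pair allm_sub by metis
next
  case (3 a B)
  then show ?case using kap_pair bset_pair allm_sub by metis
qed

lemma ent_kap: assumes "ent t" shows "kap t \<in> elts k \<or> kap t = k" "Ord (kap t)" "kap t \<in> V" "bset t \<subseteq> elts (kap t)"
proof -
  show 1: "kap t \<in> elts k \<or> kap t = k" using assms by (cases rule: ent_cases) auto
  show "Ord (kap t)" using 1 kO Ord_elt by blast
  show "kap t \<in> V" using 1 kO transV by blast
  show "bset t \<subseteq> elts (kap t)" using assms by (cases rule: ent_cases) auto
qed

lemma ent_top: assumes "ent t" "kap t = k" obtains B where "is_pair t k B" "allm k B" "bset t = elts B" "B \<in> V"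
  using assms(1)
proof (cases rule: ent_cases)
  case 1
  then show ?thesis using assms(2) mem_irrefl[of k] by simp
next
  case (2 B)
  then show ?thesis using assms(2) that by simp
qed

text \<open>The set of entries determines the list, which is recovered by sorting along
  \<open>kap\<close>. The requirement on neighbours in a list is imposed here on all pairs;
  transitivity makes this equivalent.\<close>

definition cond :: "'s set \<Rightarrow> bool" where
  "cond E \<longleftrightarrow> finite E \<and> E \<subseteq> V \<and> (\<forall>t \<in> E. ent t) \<and> (\<exists>t \<in> E. kap t = k) \<and>
     (\<forall>s \<in> E. \<forall>t \<in> E. s \<noteq> t \<longrightarrow> kap s \<in> elts (kap t) \<or> kap t \<in> elts (kap s)) \<and>
     (\<forall>s \<in> E. \<forall>t \<in> E. kap s \<in> elts (kap t) \<longrightarrow> (\<forall>\<xi> \<in> bset t. kap s \<in> elts \<xi>))"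

lemma condD:
  assumes "cond E"
  shows "finite E" "E \<subseteq> V" "t \<in> E \<Longrightarrow> ent t" "\<exists>t \<in> E. kap t = k"
    "s \<in> E \<Longrightarrow> t \<in> E \<Longrightarrow> s \<noteq> t \<Longrightarrow> kap s \<in> elts (kap t) \<or> kap t \<in> elts (kap s)"
    "s \<in> E \<Longrightarrow> t \<in> E \<Longrightarrow> kap s \<in> elts (kap t) \<Longrightarrow> \<xi> \<in> bset t \<Longrightarrow> kap s \<in> elts \<xi>"
  using assms unfolding cond_def by blast+

lemma cond_kap_inj: "cond E \<Longrightarrow> s \<in> E \<Longrightarrow> t \<in> E \<Longrightarrow> kap s = kap t \<Longrightarrow> s = t"
  using condD(5) mem_irrefl by metis

text \<open>The conjuncts about ordinals make the relation transitive, which membership alone is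
  not. A requirement on neighbours in a list thereby extends to all pairs.\<close>

definition prec :: "'s \<Rightarrow> 's \<Rightarrow> bool" where
  "prec s t \<longleftrightarrow> (kap s \<in> elts (kap t) \<and> (\<forall>\<xi> \<in> bset t. kap s \<in> elts \<xi>)) \<and> Ord (kap t) \<and> (\<forall>\<xi> \<in> bset t. Ord \<xi>)"

lemma transp_prec: "transp prec"
  unfolding transp_def prec_def using Ord_trans by blast

lemma magidor_list_iff:
  "magidor_list U k ts \<longleftrightarrow> ts \<noteq> [] \<and> kap (last ts) = k \<and> (\<forall>t \<in> set ts. ent t) \<and>
     (\<forall>t \<in> set (butlast ts). kap t \<in> elts k) \<and> sorted_wrt prec ts" (is "?L \<longleftrightarrow> ?R")
proof
  assume L: ?L
  then have ne: "ts \<noteq> []" and l: "\<exists>B. is_pair (last ts) k B \<and> allm k B"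
    and b: "\<forall>t \<in> set (butlast ts). (Ord t \<and> t \<epsilon> k \<and> elts (o_len U t) = {}) \<or>
        (\<exists>a B. is_pair t a B \<and> a \<epsilon> k \<and> elts (o_len U a) \<noteq> {} \<and> allm a B)"
    and s: "\<forall>i. Suc i < length ts \<longrightarrow> kap (ts ! i) \<epsilon> kap (ts ! Suc i) \<and>
        (\<forall>\<xi> \<in> bset (ts ! Suc i). kap (ts ! i) \<epsilon> \<xi>)"
    unfolding magidor_list_def by blast+
  have set: "set ts = insert (last ts) (set (butlast ts))"
    using ne by (metis append_butlast_last_id list.simps(15) rotate1.simps(2) set_rotate1)
  have lk: "kap (last ts) = k" "ent (last ts)" using l kap_pair ent_pair ok by blast+
  have bk: "ent t \<and> kap t \<in> elts k" if t: "t \<in> set (butlast ts)" for t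
    using b[rule_format, OF t]
  proof (elim disjE exE conjE)
    assume "Ord t" "t \<epsilon> k" "elts (o_len U t) = {}"
    then show ?thesis using kap_Ord(1)[OF \<open>Ord t\<close>] unfolding ent_def by simp
  next
    fix a B assume "is_pair t a B" "a \<epsilon> k" "elts (o_len U a) \<noteq> {}" "allm a B"
    then show ?thesis using kap_pair[of t a B] ent_pair[of t a B] by simp
  qed
  with lk(2) have e: "\<forall>t \<in> set ts. ent t" unfolding set by simp
  have "sorted_wrt prec ts" unfolding sorted_wrt_iff_nth_Suc_transp[OF transp_prec]
  proof (intro allI impI)
    fix i assume i: "Suc i < length ts"
    then have "ent (ts ! Suc i)" using e by simp
    note K = ent_kap(2,4)[OF this]
    have "\<forall>\<xi> \<in> bset (ts ! Suc i). Ord \<xi>" using K Ord_elt[OF K(1)] by blast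
    then show "prec (ts ! i) (ts ! Suc i)" using s i K(1) unfolding prec_def by simp
  qed
  then show ?R using ne lk e bk by blast
next
  assume R: ?R
  have R': "ts \<noteq> []" "kap (last ts) = k" "\<forall>t \<in> set ts. ent t" "\<forall>t \<in> set (butlast ts). kap t \<in> elts k"
    "sorted_wrt prec ts" by (insert R; elim conjE; assumption)+
  have last: "ent (last ts)" using R'(1,3) by simp
  obtain B where B: "is_pair (last ts) k B" "allm k B" by (rule ent_top[OF last R'(2)]) (rule that)
  show ?L unfolding magidor_list_def
  proof (intro conjI ballI allI impI)
    show "\<exists>B. is_pair (last ts) k B \<and> allm k B" using B by blast
    fix t assume t: "t \<in> set (butlast ts)"
    then have tk: "ent t" "kap t \<in> elts k" using R'(3,4) in_set_butlastD[OF t] by blast+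
    from tk(1) show "(Ord t \<and> t \<epsilon> k \<and> elts (o_len U t) = {}) \<or>
        (\<exists>a B. is_pair t a B \<and> a \<epsilon> k \<and> elts (o_len U a) \<noteq> {} \<and> allm a B)"
      unfolding ent_def
    proof (elim disjE exE conjE)
      fix a B assume "is_pair t a B" "a = k"
      then show ?thesis using tk(2) kap_pair[of t a B] mem_irrefl[of k] by simp
    qed auto
  next
    fix i assume i: "Suc i < length ts"
    then have p: "prec (ts ! i) (ts ! Suc i)" using R'(5) sorted_wrt_iff_nth_Suc_transp[OF transp_prec] by blast
    then show "kap (ts ! i) \<epsilon> kap (ts ! Suc i)" unfolding prec_def by simp
    fix \<xi> assume "\<xi> \<in> bset (ts ! Suc i)"
    then show "kap (ts ! i) \<epsilon> \<xi>" using p unfolding prec_def by simp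
  qed (rule R')
qed

lemma prec_iff:
  assumes "cond E" "s \<in> E" "t \<in> E" shows "prec s t \<longleftrightarrow> kap s \<in> elts (kap t)"
  using condD(3)[OF assms(1,3)] condD(6)[OF assms] ent_kap Ord_elt unfolding prec_def by blast

lemma list_cond: assumes "magidor_list U k ts" "set ts \<subseteq> V" shows "cond (set ts)"
proof -
  have m: "ts \<noteq> []" "kap (last ts) = k" "\<forall>t \<in> set ts. ent t" "sorted_wrt prec ts"
    using assms(1) unfolding magidor_list_iff by blast+
  have o: "prec s t \<or> prec t s" if st: "s \<in> set ts" "t \<in> set ts" "s \<noteq> t" for s t
  proof -
    obtain i j where ij: "i < length ts" "s = ts ! i" "j < length ts" "t = ts ! j"
      using st by (metis in_set_conv_nth)
    then have "i \<noteq> j" using st(3) by blast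
    then show ?thesis using ij m(4) sorted_wrt_nth_less by (metis linorder_neqE_nat)
  qed
  show ?thesis unfolding cond_def
  proof (intro conjI ballI impI)
    fix s t assume st: "s \<in> set ts" "t \<in> set ts"
    show "kap s \<in> elts (kap t) \<or> kap t \<in> elts (kap s)" if "s \<noteq> t"
      using o[OF st that] unfolding prec_def by blast
    fix \<xi> assume "kap s \<in> elts (kap t)" "\<xi> \<in> bset t"
    then show "kap s \<in> elts \<xi>" using o[OF st] mem_irrefl mem_asym unfolding prec_def by metis
  next
    show "\<exists>t \<in> set ts. kap t = k" using m(1,2) last_in_set by blast
  qed (use m assms in auto)
qed

text \<open>Insertion sort. It runs over subsets \<open>F\<close> because a proper subset of a
  condition need not be a condition.\<close>

lemma cond_sorted: assumes "cond E" "F \<subseteq> E" shows "\<exists>ts. set ts = F \<and> sorted_wrt prec ts"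
proof -
  have "finite F" using condD(1)[OF assms(1)] assms(2) finite_subset by blast
  then show ?thesis using assms(2)
  proof (induction F rule: finite_induct)
    case (insert x F)
    then obtain ts where ts: "set ts = F" "sorted_wrt prec ts" by auto
    let ?l = "filter (\<lambda>t. prec t x) ts" and ?r = "filter (\<lambda>t. \<not> prec t x) ts"
    have "prec x t" if "t \<in> set ?r" for t
      using that ts(1) insert.prems insert.hyps condD(5)[OF assms(1), of x t] prec_iff[OF assms(1)] by auto
    then have "sorted_wrt prec (?l @ [x] @ ?r)"
      using ts(2) transp_prec unfolding sorted_wrt_append
      by (auto simp: sorted_wrt_filter transp_def)
    moreover have "set (?l @ [x] @ ?r) = insert x F" using ts by auto
    ultimately show ?case by blast
  qed simp
qed

section \<open>Passing between conditions and their sets of entries\<close>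

abbreviation "Mg \<equiv> Magidor V k U"

lemma Mg_cond: assumes "p \<in> Mg" shows "cond (ents p)"
proof -
  obtain ts where ts: "p \<in> V" "is_seq p ts" "magidor_list U k ts" using assms unfolding Magidor_def by blast
  have e: "ents p = set ts" using seq_ents ts by blast
  have "set ts \<subseteq> V" unfolding e[symmetric] ents_def using is_pair_in transV[OF ts(1)] by blast
  then show ?thesis using list_cond[OF ts(3)] e by simp
qed

lemma Mg_exists: assumes "cond E" shows "\<exists>p \<in> Mg. ents p = E"
proof -
  obtain ts where ts: "set ts = E" "sorted_wrt prec ts" using cond_sorted[OF assms] by blast
  have ne: "ts \<noteq> []" using ts condD(4)[OF assms] by auto
  have kE: "kap t \<in> elts k \<or> kap t = k" if "t \<in> E" for t using ent_kap(1) condD(3)[OF assms that] .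
  obtain t where t: "t \<in> E" "kap t = k" using condD(4)[OF assms] by blast
  have before: "prec s (last ts)" if s: "s \<in> set (butlast ts)" for s
    using ts(2) ne s sorted_wrt_append[of prec "butlast ts" "[last ts]"] by simp
  have set: "set ts = insert (last ts) (set (butlast ts))"
    using ne by (metis append_butlast_last_id list.simps(15) rotate1.simps(2) set_rotate1)
  have lk: "kap (last ts) = k"
  proof (rule ccontr)
    assume l: "kap (last ts) \<noteq> k"
    then have "t \<noteq> last ts" using t(2) by blast
    then have "t \<in> set (butlast ts)" using t set ts(1) by blast
    then have "k \<in> elts (kap (last ts))" using before t(2) unfolding prec_def by blast
    then show False using kE[of "last ts"] l ts(1) ne mem_asym by (metis last_in_set)
  qed
  have "magidor_list U k ts" unfolding magidor_list_iff
    using ne lk condD(3)[OF assms] ts before unfolding prec_def by blast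
  moreover obtain p where "p \<in> V" "is_seq p ts" using seq_exists ts(1) condD(2)[OF assms] by blast
  ultimately show ?thesis using seq_ents ts(1) unfolding Magidor_def by blast
qed

lemma list_le_iff:
  assumes t: "magidor_list U k ts" "set ts \<subseteq> V" and s: "magidor_list U k ss" "set ss \<subseteq> V"
  shows "magidor_list_le ts ss \<longleftrightarrow> ents_le (set ts) (set ss)"
proof -
  let ?n = "length ts" and ?m = "length ss"
  have T: "ts \<noteq> []" "kap (last ts) = k" "\<forall>t \<in> set ts. ent t" "sorted_wrt prec ts"
    using t(1) unfolding magidor_list_iff by blast+
  have S: "ss \<noteq> []" "kap (last ss) = k" "\<forall>t \<in> set ss. ent t" "sorted_wrt prec ss"
    using s(1) unfolding magidor_list_iff by blast+
  have Tlt: "kap (ts ! i) \<in> elts (kap (ts ! j)) \<and> (\<forall>\<xi> \<in> bset (ts ! j). kap (ts ! i) \<in> elts \<xi>)"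
    if "i < j" "j < ?n" for i j
    using sorted_wrt_nth_less[OF T(4) that] unfolding prec_def by blast
  have Slt: "kap (ss ! i) \<in> elts (kap (ss ! j))" if "i < j" "j < ?m" for i j
    using sorted_wrt_nth_less[OF S(4) that] unfolding prec_def by blast
  have Sinj: "i = j" if "kap (ss ! i) = kap (ss ! j)" "i < ?m" "j < ?m" for i j
    using Slt[of i j] Slt[of j i] that mem_irrefl by (metis linorder_neqE_nat)
  show ?thesis
  proof
    assume "magidor_list_le ts ss"
    then obtain h where h12: "strict_mono_on {..<?n} h" "h (?n - 1) = ?m - 1"
      and h34: "\<forall>r < ?n. h r < ?m \<and> kap (ss ! h r) = kap (ts ! r) \<and> bset (ss ! h r) \<subseteq> bset (ts ! r) \<and>
        (\<forall>j < h r. (r = 0 \<or> h (r - 1) < j) \<longrightarrow> kap (ss ! j) \<in> bset (ts ! r) \<and>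
          bset (ss ! j) \<subseteq> bset (ts ! r) \<inter> elts (kap (ss ! j)))"
      unfolding magidor_list_le_def by (elim exE conjE) (rule that)
    have h3: "h r < ?m \<and> kap (ss ! h r) = kap (ts ! r) \<and> bset (ss ! h r) \<subseteq> bset (ts ! r)" if "r < ?n" for r
      using h34 that by simp
    have h4: "kap (ss ! j) \<in> bset (ts ! r) \<and> bset (ss ! j) \<subseteq> bset (ts ! r) \<inter> elts (kap (ss ! j))"
      if "r < ?n" "j < h r" "r = 0 \<or> h (r - 1) < j" for r j
      using h34[rule_format, OF that(1)] that(2,3) by blast
    note h = h12 h3 h4
    show "ents_le (set ts) (set ss)" unfolding ents_le_def
    proof (intro conjI ballI)
      fix t assume "t \<in> set ts"
      then obtain r where "r < ?n" "t = ts ! r" by (metis in_set_conv_nth)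
      then show "\<exists>s \<in> set ss. kap s = kap t \<and> bset s \<subseteq> bset t" using h(3)[of r] nth_mem by blast
    next
      fix s assume "s \<in> set ss"
      then obtain j where j: "j < ?m" "s = ss ! j" by (metis in_set_conv_nth)
      show "(\<exists>t \<in> set ts. kap t = kap s) \<or> (\<exists>t \<in> set ts. kap s \<in> bset t \<and> bset s \<subseteq> bset t \<inter> elts (kap s))"
      proof (cases "\<exists>r < ?n. h r = j")
        case True
        then show ?thesis using h(3) j nth_mem by metis
      next
        case False
        have "?n - 1 < ?n" using T(1) by simp
        then have ex: "\<exists>r. r < ?n \<and> j < h r" using False h(2) j(1)
          by (metis Suc_pred' diff_Suc_1 gr_zeroI less_Suc_eq less_nat_zero_code)
        \<comment> \<open>A new entry belongs to the block that ends at the first old entry placed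
          beyond it.\<close>
        define r where "r = (LEAST r. r < ?n \<and> j < h r)"
        have r: "r < ?n" "j < h r" using LeastI_ex[OF ex] unfolding r_def by blast+
        have "r = 0 \<or> h (r - 1) < j"
        proof (cases r)
          case (Suc r')
          then have "r' < r" by simp
          then have "\<not> (r' < ?n \<and> j < h r')" using not_less_Least unfolding r_def by blast
          moreover have "h r' \<noteq> j" using False r(1) \<open>r' < r\<close> by auto
          ultimately show ?thesis using Suc r(1) by auto
        qed simp
        then show ?thesis using h(4)[OF r] j(2) r(1) nth_mem by blast
      qed
    qed
  next
    assume le: "ents_le (set ts) (set ss)"
    have "\<exists>j. j < ?m \<and> kap (ss ! j) = kap (ts ! r) \<and> bset (ss ! j) \<subseteq> bset (ts ! r)" if rn: "r < ?n" for r
    proof -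
      obtain s where "s \<in> set ss" "kap s = kap (ts ! r) \<and> bset s \<subseteq> bset (ts ! r)"
        using le nth_mem[OF rn] unfolding ents_le_def by blast
      then show ?thesis by (metis in_set_conv_nth)
    qed
    then obtain h where h: "\<And>r. r < ?n \<Longrightarrow> h r < ?m \<and> kap (ss ! h r) = kap (ts ! r) \<and> bset (ss ! h r) \<subseteq> bset (ts ! r)"
      by metis
    have mono: "h r < h r'" if "r < r'" "r' < ?n" for r r'
    proof (rule ccontr)
      assume "\<not> h r < h r'"
      moreover have "kap (ss ! h r) \<in> elts (kap (ss ! h r'))" using Tlt[OF that] h[of r] h[of r'] that by simp
      moreover have "h r < ?m" "h r' < ?m" using h[of r] h[of r'] that by simp_all
      ultimately show False using Slt[of "h r'" "h r"] mem_irrefl mem_asym by (metis linorder_neqE_nat)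
    qed
    show "magidor_list_le ts ss" unfolding magidor_list_le_def
    proof (intro exI[of _ h] conjI allI impI)
      show "strict_mono_on {..<?n} h" using mono by (auto intro: strict_mono_onI)
      have n: "?n - 1 < ?n" using T(1) by simp
      have "kap (ss ! h (?n - 1)) = k" using h[OF n] T(1,2) by (simp add: last_conv_nth)
      moreover have "kap (ss ! (?m - 1)) = k" using S(1,2) by (simp add: last_conv_nth)
      ultimately show "h (?n - 1) = ?m - 1" using Sinj[of "h (?n - 1)" "?m - 1"] h[OF n] S(1) by simp
    next
      fix r assume r: "r < ?n"
      show "h r < ?m" "kap (ss ! h r) = kap (ts ! r)" "bset (ss ! h r) \<subseteq> bset (ts ! r)" using h[OF r] by auto
      fix j assume j: "j < h r" "r = 0 \<or> h (r - 1) < j"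
      have jm: "j < ?m" using j(1) h[OF r] by simp
      have Oj: "Ord (kap (ss ! j))" using ent_kap(2) S(3) nth_mem[OF jm] by blast
      have no: "\<not> (\<exists>t \<in> set ts. kap t = kap (ss ! j))"
      proof
        assume "\<exists>t \<in> set ts. kap t = kap (ss ! j)"
        then obtain r' where r': "r' < ?n" "kap (ts ! r') = kap (ss ! j)" by (metis in_set_conv_nth)
        then have hj: "h r' = j" using Sinj[of "h r'" j] h[OF r'(1)] jm by simp
        then have "r' < r" using mono[of r r'] r'(1) j(1) by (metis linorder_neqE_nat order_less_asym)
        then have r0: "r' \<le> r - 1" "r \<noteq> 0" by auto
        have "r - 1 < ?n" using r by simp
        moreover have "r' = r - 1 \<or> r' < r - 1" using r0 by linarith
        ultimately have "h r' \<le> h (r - 1)" using mono[of r' "r - 1"] less_imp_le by blast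
        then show False using j(2) hj \<open>r \<noteq> 0\<close> by simp
      qed
      then obtain r' where r': "r' < ?n" "kap (ss ! j) \<in> bset (ts ! r')"
        "bset (ss ! j) \<subseteq> bset (ts ! r') \<inter> elts (kap (ss ! j))"
        using le nth_mem[OF jm] unfolding ents_le_def by (metis in_set_conv_nth)
      have kap_rel: "kap (ss ! j) \<in> elts (kap (ts ! r))" using Slt[OF j(1)] h[OF r] by simp
      \<comment> \<open>For \<open>r'\<close> above \<open>r\<close> the new entry, an element of
        \<open>bset (ts ! r')\<close>, would exceed \<open>kap (ts ! r)\<close>. For
        \<open>r'\<close> below \<open>r\<close> it would lie below \<open>kap (ts ! r')\<close>,
        hence below the old entry that precedes it.\<close>
      have "r' = r"
      proof (rule ccontr)
        assume "r' \<noteq> r"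
        then consider "r < r'" | "r' < r" by linarith
        then show False
        proof cases
          case 1
          then have "kap (ts ! r) \<in> elts (kap (ss ! j))" using Tlt[OF 1 r'(1)] r'(2) by blast
          then show False using kap_rel mem_asym by blast
        next
          case 2
          then have r0: "r \<noteq> 0" "r' \<le> r - 1" "r - 1 < ?n" using r by auto
          have a: "kap (ss ! j) \<in> elts (kap (ts ! r'))"
            using r'(2) ent_kap(4) T(3) nth_mem[OF r'(1)] by blast
          have "kap (ss ! h (r - 1)) \<in> elts (kap (ss ! j))" using Slt[of "h (r - 1)" j] j(2) r0 jm by simp
          then have b: "kap (ts ! (r - 1)) \<in> elts (kap (ss ! j))" using h[OF r0(3)] by simp
          have "kap (ts ! r') = kap (ts ! (r - 1)) \<or> kap (ts ! r') \<in> elts (kap (ts ! (r - 1)))"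
            using Tlt[of r' "r - 1"] r0 by (cases "r' = r - 1") auto
          then have "kap (ts ! r') \<in> elts (kap (ss ! j))" using b Ord_trans[OF Oj] by auto
          then show False using a mem_asym by blast
        qed
      qed
      then show "kap (ss ! j) \<in> bset (ts ! r)" "bset (ss ! j) \<subseteq> bset (ts ! r) \<inter> elts (kap (ss ! j))"
        using r' by auto
    qed
  qed
qed

lemma le_iff: assumes "p \<in> Mg" "q \<in> Mg" shows "magidor_le p q \<longleftrightarrow> ents_le (ents p) (ents q)"
proof -
  obtain ts where ts: "p \<in> V" "is_seq p ts" "magidor_list U k ts" using assms unfolding Magidor_def by blast
  obtain ss where ss: "q \<in> V" "is_seq q ss" "magidor_list U k ss" using assms unfolding Magidor_def by blast
  have e: "ents p = set ts" "ents q = set ss" using seq_ents ts ss by blast+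
  have "magidor_le p q \<longleftrightarrow> magidor_list_le ts ss"
    unfolding magidor_le_def using ts(2) ss(2) seq_unique by blast
  also have "\<dots> \<longleftrightarrow> ents_le (ents p) (ents q)"
    using list_le_iff[OF ts(3) _ ss(3)] condD(2)[OF Mg_cond[OF assms(1)]] condD(2)[OF Mg_cond[OF assms(2)]] e by simp
  finally show ?thesis .
qed

lemma ents_le_refl: "ents_le E E"
  unfolding ents_le_def by blast

lemma ents_le_trans: assumes "cond F" "cond D" "ents_le E F" "ents_le F D" shows "ents_le E D"
  unfolding ents_le_def
proof (intro conjI ballI)
  fix t assume "t \<in> E"
  then obtain s where s: "s \<in> F" "kap s = kap t" "bset s \<subseteq> bset t" using assms(3) unfolding ents_le_def by blast
  then obtain d where "d \<in> D" "kap d = kap s" "bset d \<subseteq> bset s" using assms(4) unfolding ents_le_def by blast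
  then show "\<exists>s \<in> D. kap s = kap t \<and> bset s \<subseteq> bset t" using s by auto
next
  \<comment> \<open>In a condition an entry is determined by its \<open>kap\<close>, so the
    inclusion holds for every matching pair of entries and not just for the witness in
    \<open>ents_le\<close>.\<close>
  have sub: "bset g \<subseteq> bset f" if fg: "f \<in> A" "g \<in> B" "kap g = kap f" "ents_le A B" "cond B" for A B f g
  proof -
    obtain g' where "g' \<in> B" "kap g' = kap f" "bset g' \<subseteq> bset f" using fg unfolding ents_le_def by blast
    then show ?thesis using cond_kap_inj[OF fg(5)] fg by metis
  qed
  fix d assume d: "d \<in> D"
  have "(\<exists>t \<in> F. kap t = kap d) \<or> (\<exists>t \<in> F. kap d \<in> bset t \<and> bset d \<subseteq> bset t \<inter> elts (kap d))"
    using assms(4) d unfolding ents_le_def by blast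
  then obtain f where f: "f \<in> F" "kap f = kap d \<or> kap d \<in> bset f \<and> bset d \<subseteq> bset f \<inter> elts (kap d)" by blast
  have bd: "bset d \<subseteq> bset f" using f sub[OF f(1) d _ assms(4,2)] by auto
  have "(\<exists>t \<in> E. kap t = kap f) \<or> (\<exists>t \<in> E. kap f \<in> bset t \<and> bset f \<subseteq> bset t \<inter> elts (kap f))"
    using assms(3) f(1) unfolding ents_le_def by blast
  then obtain t where t: "t \<in> E" "kap t = kap f \<or> kap f \<in> bset t \<and> bset f \<subseteq> bset t \<inter> elts (kap f)" by blast
  have bf: "bset f \<subseteq> bset t" using t sub[OF t(1) f(1) _ assms(3,1)] by auto
  show "(\<exists>t \<in> E. kap t = kap d) \<or> (\<exists>t \<in> E. kap d \<in> bset t \<and> bset d \<subseteq> bset t \<inter> elts (kap d))"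
  proof (cases "kap f = kap d")
    case True
    then show ?thesis using t bd by (metis Int_subset_iff subset_trans)
  next
    case False
    then have "kap d \<in> bset t" "bset d \<subseteq> bset t \<inter> elts (kap d)" using f(2) bf by auto
    then show ?thesis using t(1) by blast
  qed
qed

section \<open>Stems and top sets\<close>

definition stem :: "'s set \<Rightarrow> 's set" where "stem E = {t \<in> E. kap t \<noteq> k}"

definition top_set :: "'s set \<Rightarrow> 's set" where "top_set E = {\<eta>. \<exists>t \<in> E. kap t = k \<and> \<eta> \<in> bset t}"

lemma top_set_entry:
  assumes "cond E" obtains B where "pr k B \<in> E" "kap (pr k B) = k" "bset (pr k B) = elts B" "top_set E = elts B"
    "B \<in> V" "allm k B" "E = insert (pr k B) (stem E)"
proof -
  obtain t where t: "t \<in> E" "kap t = k" using condD(4)[OF assms] by blast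
  obtain B where B: "is_pair t k B" "allm k B" "bset t = elts B" "B \<in> V"
    using ent_top[OF condD(3)[OF assms t(1)] t(2)] by blast
  have "t = pr k B" using is_pair_iff[OF kO(2) B(4)] B(1) by blast
  moreover have "s = t" if "s \<in> E" "kap s = k" for s using cond_kap_inj[OF assms that(1) t(1)] that t by simp
  then have "top_set E = elts B" "E = insert t (stem E)" using t B unfolding top_set_def stem_def by blast+
  ultimately show thesis using that t B by blast
qed

lemma kap_pr: "a \<in> V \<Longrightarrow> B \<in> V \<Longrightarrow> kap (pr a B) = a" "a \<in> V \<Longrightarrow> B \<in> V \<Longrightarrow> bset (pr a B) = elts B"
  using pr_is_pair(1) kap_pair bset_pair by blast+

lemma stem_kap: "cond E \<Longrightarrow> t \<in> stem E \<Longrightarrow> kap t \<in> elts k"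
  using condD(3) ent_kap(1) unfolding stem_def by blast

text \<open>A part \<open>S\<close> of the stem is allowed besides the whole stem, because
  \<open>key\<close> discards the entries above a bound.\<close>

lemma cond_retop:
  assumes E: "cond E" and S: "S \<subseteq> stem E" and C: "C \<in> V" "allm k C"
    and above: "\<And>t \<xi>. t \<in> S \<Longrightarrow> \<xi> \<in> elts C \<Longrightarrow> kap t \<in> elts \<xi>"
  shows "cond (insert (pr k C) S)" "stem (insert (pr k C) S) = S" "top_set (insert (pr k C) S) = elts C"
proof -
  note K = kap_pr[OF kO(2) C(1)]
  have SE: "S \<subseteq> E" using S unfolding stem_def by blast
  have Sk: "kap t \<in> elts k" "kap t \<noteq> k" if "t \<in> S" for t
    using stem_kap[OF E] S that unfolding stem_def by blast+
  show "stem (insert (pr k C) S) = S" using K Sk unfolding stem_def by auto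
  show "top_set (insert (pr k C) S) = elts C" using K Sk unfolding top_set_def by auto
  have e: "ent (pr k C)" by (rule ent_pair[OF pr_is_pair(1)[OF kO(2) C(1)] _ ok C(2)]) simp
  show "cond (insert (pr k C) S)" unfolding cond_def
  proof (intro conjI ballI impI)
    show "finite (insert (pr k C) S)" using condD(1)[OF E] SE finite_subset by blast
    show "insert (pr k C) S \<subseteq> V" using condD(2)[OF E] SE pr_is_pair(2)[OF kO(2) C(1)] by blast
    show "ent t" if "t \<in> insert (pr k C) S" for t using that e condD(3)[OF E] SE by blast
    show "\<exists>t \<in> insert (pr k C) S. kap t = k" using K by blast
    fix s t assume st: "s \<in> insert (pr k C) S" "t \<in> insert (pr k C) S"
    show "kap s \<in> elts (kap t) \<or> kap t \<in> elts (kap s)" if "s \<noteq> t"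
      using st that condD(5)[OF E, of s t] SE K Sk by auto
    fix \<xi> assume x: "kap s \<in> elts (kap t)" "\<xi> \<in> bset t"
    show "kap s \<in> elts \<xi>"
    proof (cases "t \<in> S")
      case True
      then have "s \<noteq> pr k C" using x(1) K Sk[of t] mem_asym[of k "kap t"] by auto
      then show ?thesis using condD(6)[OF E, of s t] st SE True x by blast
    next
      case False
      then have "t = pr k C" using st by blast
      then show ?thesis using above x st K mem_irrefl[of k] by auto
    qed
  qed
qed

lemma retop:
  assumes p: "p \<in> Mg" and C: "C \<in> V" "allm k C" "elts C \<subseteq> top_set (ents p)"
  obtains r where "r \<in> Mg" "stem (ents r) = stem (ents p)" "top_set (ents r) = elts C"
proof -
  note E = Mg_cond[OF p]
  have "kap t \<in> elts \<xi>" if t: "t \<in> stem (ents p)" "\<xi> \<in> elts C" for t \<xi>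
  proof -
    obtain s where s: "s \<in> ents p" "kap s = k" "\<xi> \<in> bset s" using t(2) C(3) unfolding top_set_def by blast
    then show ?thesis using condD(6)[OF E, of t s] stem_kap[OF E t(1)] t(1) unfolding stem_def by simp
  qed
  note c = cond_retop[OF E subset_refl C(1,2) this]
  obtain r where "r \<in> Mg" "ents r = insert (pr k C) (stem (ents p))" using Mg_exists[OF c(1)] by blast
  then show thesis using that[of r] c by simp
qed

lemma le_same_stem:
  assumes E: "cond E" and F: "cond F" and s: "stem E = stem F" and t: "top_set F \<subseteq> top_set E" shows "ents_le E F"
proof -
  obtain B where B: "kap (pr k B) = k" "bset (pr k B) = elts B" "top_set E = elts B" "E = insert (pr k B) (stem E)"
    using top_set_entry[OF E] by metis
  obtain C where C: "kap (pr k C) = k" "bset (pr k C) = elts C" "top_set F = elts C" "F = insert (pr k C) (stem F)"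
    using top_set_entry[OF F] by metis
  have Bt: "pr k B \<in> E" "pr k C \<in> F" "stem E \<subseteq> E" "stem E \<subseteq> F" using B C s by auto
  have 1: "\<exists>s \<in> F. kap s = kap t' \<and> bset s \<subseteq> bset t'" if "t' \<in> E" for t'
  proof -
    from that consider "t' = pr k B" | "t' \<in> stem E" using B(4) by blast
    then show ?thesis
    proof cases
      case 1
      then show ?thesis using Bt(2) B C t by (intro bexI[of _ "pr k C"]) simp_all
    qed (use Bt in blast)
  qed
  have 2: "\<exists>t \<in> E. kap t = kap s'" if "s' \<in> F" for s'
  proof -
    from that consider "s' = pr k C" | "s' \<in> stem E" using C(4) s by blast
    then show ?thesis
    proof cases
      case 1
      then show ?thesis using Bt(1) B C by (intro bexI[of _ "pr k B"]) simp_all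
    qed (use Bt in blast)
  qed
  show ?thesis unfolding ents_le_def using 1 2 by blast
qed

text \<open>Equal stems leave only the top sets to be intersected. This is the source of the chain
  condition of Magidor forcing itself, and it is applied to each coordinate of a colour
  separately.\<close>

lemma join:
  assumes "p \<in> Mg" "q \<in> Mg" "stem (ents p) = stem (ents q)"
  obtains r where "r \<in> Mg" "magidor_le p r" "magidor_le q r" "stem (ents r) = stem (ents p)"
proof -
  obtain B where B: "top_set (ents p) = elts B" "B \<in> V" "allm k B" using top_set_entry[OF Mg_cond[OF assms(1)]] by metis
  obtain C where C: "top_set (ents q) = elts C" "C \<in> V" "allm k C" using top_set_entry[OF Mg_cond[OF assms(2)]] by metis
  have "inV {x \<in> elts B. x \<in> elts C}" by (intro inV_sep inV_elts B dfn_intros C)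
  then obtain D where D: "D \<in> V" "elts D = {x \<in> elts B. x \<in> elts C}" unfolding inV_def by auto
  have "elts D = elts B \<inter> elts C" using D(2) by blast
  then have "allm k D" using allm_Int[OF B(3) C(3)] by blast
  then obtain r where r: "r \<in> Mg" "stem (ents r) = stem (ents p)" "top_set (ents r) = elts D"
    using retop[OF assms(1) D(1)] D(2) B(1) by (metis (no_types, lifting) mem_Collect_eq subsetI)
  have "magidor_le p r" "magidor_le q r"
  proof -
    have "ents_le (ents p) (ents r)"
      by (rule le_same_stem[OF Mg_cond[OF assms(1)] Mg_cond[OF r(1)]]) (use r B D in auto)
    then show "magidor_le p r" using le_iff[OF assms(1) r(1)] by simp
    have "ents_le (ents q) (ents r)"
      by (rule le_same_stem[OF Mg_cond[OF assms(2)] Mg_cond[OF r(1)]]) (use r C D assms(3) in auto)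
    then show "magidor_le q r" using le_iff[OF assms(2) r(1)] by simp
  qed
  then show thesis using that r by blast
qed

lemma stem_bound: assumes "cond E" obtains \<delta> where "\<delta> \<in> elts k" "\<And>t. t \<in> stem E \<Longrightarrow> kap t \<in> succ_set \<delta>"
proof -
  \<comment> \<open>The empty stem also needs a bound below \<open>k\<close>.\<close>
  have "\<exists>w. w \<in> elts k"
  proof -
    obtain \<beta> W where "((k, \<beta>), W) \<in> entries U" using o_entry ok by blast
    then interpret n: nmeasure V k W by (rule entry_measure)
    show ?thesis using n.large_ne[OF n.large_k] .
  qed
  have fin: "finite A \<Longrightarrow> A \<subseteq> elts k \<Longrightarrow> \<exists>\<delta> \<in> elts k. A \<subseteq> succ_set \<delta>" for A
  proof (induction A rule: finite_induct)
    case empty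
    then show ?case using \<open>\<exists>w. w \<in> elts k\<close> by blast
  next
    case (insert x A)
    then obtain \<delta> where d: "\<delta> \<in> elts k" "A \<subseteq> succ_set \<delta>" by auto
    have o: "Ord x" "Ord \<delta>" "x \<in> elts k" using insert.prems d Ord_elt[OF kO(1)] by auto
    consider "x \<in> succ_set \<delta>" | "\<delta> \<in> elts x" using Ord_linear[OF o(1,2)] by blast
    then show ?case
    proof cases
      case 1
      then show ?thesis using d by blast
    next
      case 2
      then have "succ_set \<delta> \<subseteq> succ_set x" using Ord_trans[OF o(1)] by blast
      then show ?thesis using d o(3) by blast
    qed
  qed
  have "finite (kap ` stem E)" using condD(1)[OF assms] unfolding stem_def by simp
  moreover have "kap ` stem E \<subseteq> elts k" using stem_kap[OF assms] by blast
  ultimately obtain \<delta> where "\<delta> \<in> elts k" "kap ` stem E \<subseteq> succ_set \<delta>" using fin by blast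
  then show thesis using that by blast
qed

lemma stem_inV: "cond E \<Longrightarrow> inV (stem E)"
  using condD(1,2)[of E] unfolding stem_def by (intro inV_finite) auto

text \<open>Counting levels over \<open>\<delta> + 1\<close>: an ordinal up to
  \<open>\<delta>\<close> has level 0, a set of such ordinals level 1, an entry that is a pair level
  3, and a set of entries level 4.\<close>

lemma stem_in_power:
  assumes E: "cond E" and S: "S \<subseteq> stem E" and d: "Ord \<delta>" and b: "\<And>t. t \<in> S \<Longrightarrow> kap t \<in> succ_set \<delta>" and x: "elts x = S"
  shows "in_power 4 (succ_set \<delta>) x"
proof -
  have tr: "elts x \<subseteq> succ_set \<delta>" if "x \<in> succ_set \<delta>" for x using that Ord_trans[OF d] by blast
  have "in_power 3 (succ_set \<delta>) t" if t: "t \<in> S" for t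
  proof -
    have "ent t" using condD(3)[OF E] S t unfolding stem_def by blast
    then show ?thesis
    proof (cases rule: ent_cases)
      case 1
      have "in_power 0 (succ_set \<delta>) t" using b[OF t] 1 by simp
      then show ?thesis using in_power_le[of "succ_set \<delta>" 0 3 t] tr by blast
    next
      case (2 B)
      have kV: "kap t \<in> V" using ent_kap(3)[OF \<open>ent t\<close>] .
      have "in_power (Suc 0) (succ_set \<delta>) B" "in_power (Suc 0) (succ_set \<delta>) (kap t)" using tr[OF b[OF t]] 2 by auto
      then have "in_power (Suc (Suc (Suc 0))) (succ_set \<delta>) (pr (kap t) B)" using in_power_pr[OF kV 2(5)] by blast
      then show ?thesis using is_pair_iff[OF kV 2(5)] 2(1) by (simp add: eval_nat_numeral)
    qed
  qed
  then have "in_power (Suc 3) (succ_set \<delta>) x" unfolding in_power.simps(2) x by blast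
  then show ?thesis by (simp add: eval_nat_numeral)
qed

text \<open>For an entry whose \<open>kap\<close> exceeds \<open>\<delta>\<close>, its set still
  belongs to all measures after the ordinals up to \<open>\<delta>\<close> have been removed. The
  other entries are kept unchanged, since the lower part of the stem must be preserved
  exactly.\<close>

lemma shrink:
  assumes p: "p \<in> Mg" and d: "\<delta> \<in> elts k"
  obtains r where "r \<in> Mg" "magidor_le p r"
    "{t \<in> ents r. kap t \<in> succ_set \<delta>} = {t \<in> ents p. kap t \<in> succ_set \<delta>}"
    "\<And>s. s \<in> ents r \<Longrightarrow> kap s \<notin> succ_set \<delta> \<Longrightarrow>
      \<exists>t \<in> ents p. kap t = kap s \<and> bset s = bset t \<inter> {\<eta>. \<delta> \<in> elts \<eta>}"
proof -
  note E = Mg_cond[OF p]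
  have dO: "Ord \<delta>" "\<delta> \<in> V" using d Ord_elt[OF kO(1)] transV[OF kO(2)] by blast+
  have ex: "\<exists>s. s \<in> V \<and> ent s \<and> kap s = kap t \<and> (if kap t \<in> succ_set \<delta> then s = t else bset s = bset t \<inter> {\<eta>. \<delta> \<in> elts \<eta>})"
    if t: "t \<in> ents p" for t
  proof (cases "kap t \<in> succ_set \<delta>")
    case True
    then show ?thesis using condD(2,3)[OF E] t by auto
  next
    case False
    have et: "ent t" using condD(3)[OF E t] .
    then have dk: "\<delta> \<in> elts (kap t)" using False Ord_linear[of \<delta> "kap t"] ent_kap(2) dO by blast
    show ?thesis using et
    proof (cases rule: ent_cases)
      case 1
      then show ?thesis using et t condD(2)[OF E] False by (intro exI[of _ t]) auto
    next
      case (2 B)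
      have "inV {\<eta> \<in> elts B. \<delta> \<in> elts \<eta>}" by (intro inV_sep inV_elts 2 dfn_intros dO)
      then obtain C where C: "C \<in> V" "elts C = {\<eta> \<in> elts B. \<delta> \<in> elts \<eta>}" unfolding inV_def by auto
      have eC: "elts C = elts B \<inter> {\<eta>. \<delta> \<in> elts \<eta>}" using C(2) by blast
      have kV: "kap t \<in> V" using ent_kap(3)[OF et] .
      have "ent (pr (kap t) C)"
        by (rule ent_pair[OF pr_is_pair(1)[OF kV C(1)] 2(7,2) allm_above[OF 2(3) dk eC]])
      then show ?thesis using kap_pr[OF kV C(1)] pr_is_pair(2)[OF kV C(1)] False eC 2(4)
        by (intro exI[of _ "pr (kap t) C"]) simp
    qed
  qed
  then obtain f where f: "\<And>t. t \<in> ents p \<Longrightarrow> f t \<in> V \<and> ent (f t) \<and> kap (f t) = kap t \<and>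
      (if kap t \<in> succ_set \<delta> then f t = t else bset (f t) = bset t \<inter> {\<eta>. \<delta> \<in> elts \<eta>})"
    by metis
  have bsub: "bset (f t) \<subseteq> bset t" if "t \<in> ents p" for t using f[OF that] by (auto split: if_splits)
  have kf: "kap (f t) = kap t" if "t \<in> ents p" for t using f[OF that] by blast
  have c: "cond (f ` ents p)" unfolding cond_def
  proof (intro conjI ballI impI)
    show "finite (f ` ents p)" using condD(1)[OF E] by simp
    show "f ` ents p \<subseteq> V" using f by blast
    show "ent t" if "t \<in> f ` ents p" for t using that f by blast
    show "\<exists>t \<in> f ` ents p. kap t = k" using condD(4)[OF E] kf by auto
    fix s t assume st: "s \<in> f ` ents p" "t \<in> f ` ents p"
    then obtain s' t' where s': "s' \<in> ents p" "s = f s'" "t' \<in> ents p" "t = f t'" by blast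
    show "kap s \<in> elts (kap t) \<or> kap t \<in> elts (kap s)" if "s \<noteq> t"
      using condD(5)[OF E s'(1,3)] s' kf that by auto
    fix \<xi> assume "kap s \<in> elts (kap t)" "\<xi> \<in> bset t"
    then show "kap s \<in> elts \<xi>" using condD(6)[OF E s'(1,3)] s' kf bsub by auto
  qed
  obtain r where r: "r \<in> Mg" "ents r = f ` ents p" using Mg_exists[OF c] by blast
  have le: "magidor_le p r"
  proof -
    have 1: "\<exists>s \<in> f ` ents p. kap s = kap t \<and> bset s \<subseteq> bset t" if "t \<in> ents p" for t
      using that kf bsub by blast
    have 2: "\<exists>t \<in> ents p. kap t = kap s" if "s \<in> f ` ents p" for s
      using that kf by force
    show ?thesis using le_iff[OF p r(1)] 1 2 unfolding r(2) ents_le_def by blast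
  qed
  show thesis
  proof (rule that[OF r(1) le])
    have id: "f t = t" if "t \<in> ents p" "kap t \<in> succ_set \<delta>" for t using f[OF that(1)] that(2) by simp
    show "{t \<in> ents r. kap t \<in> succ_set \<delta>} = {t \<in> ents p. kap t \<in> succ_set \<delta>}"
    proof (intro equalityI subsetI)
      fix s assume "s \<in> {t \<in> ents r. kap t \<in> succ_set \<delta>}"
      then obtain t where t: "t \<in> ents p" "s = f t" "kap s \<in> succ_set \<delta>" unfolding r(2) by blast
      then have "kap t \<in> succ_set \<delta>" using kf by simp
      then show "s \<in> {t \<in> ents p. kap t \<in> succ_set \<delta>}" using id[OF t(1)] t by simp
    next
      fix s assume s: "s \<in> {t \<in> ents p. kap t \<in> succ_set \<delta>}"
      then have "s = f s" using id by simp
      then show "s \<in> {t \<in> ents r. kap t \<in> succ_set \<delta>}" unfolding r(2) using s by blast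
    qed
    fix s assume s: "s \<in> ents r" "kap s \<notin> succ_set \<delta>"
    then obtain t where t: "t \<in> ents p" "s = f t" unfolding r(2) by blast
    then have "kap t \<notin> succ_set \<delta>" using kf s(2) by simp
    then show "\<exists>t \<in> ents p. kap t = kap s \<and> bset s = bset t \<inter> {\<eta>. \<delta> \<in> elts \<eta>}"
      using f[OF t(1)] t by (intro bexI[of _ t]) auto
  qed
qed

end

section \<open>The quotient forcing\<close>

locale magidor_projection = magidor V k U for V :: "'s::set_universe set" and k U :: 's +
  fixes P R \<pi> :: 's and G N H :: "'s set"
  assumes PinV: "P \<in> V" and RV: "R \<in> V"
    and preP: "preorder_forcing (elts P) (\<lambda>x y. (x, y) \<in> rel_of R)"
    and piV: "\<pi> \<in> V" and pif: "is_function \<pi> (Magidor V k U)"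
    and proj: "is_projection (Magidor V k U) magidor_le (elts P) (\<lambda>x y. (x, y) \<in> rel_of R) (app \<pi>)"
    and gen: "generic_filter V (Magidor V k U) magidor_le G"
    and Hdef: "H = induced_filter (elts P) (\<lambda>x y. (x, y) \<in> rel_of R) (app \<pi>) G"
    and ext: "is_generic_extension V (Magidor V k U) G N"
begin

abbreviation leP :: "'s \<Rightarrow> 's \<Rightarrow> bool" where "leP x y \<equiv> (x, y) \<in> rel_of R"

lemma leP_trans: "x \<in> elts P \<Longrightarrow> y \<in> elts P \<Longrightarrow> z \<in> elts P \<Longrightarrow> leP x y \<Longrightarrow> leP y z \<Longrightarrow> leP x z"
  using preP unfolding preorder_forcing_def by blast

lemma pi_P: "p \<in> Mg \<Longrightarrow> app \<pi> p \<in> elts P"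
  and pi_mono: "p \<in> Mg \<Longrightarrow> q \<in> Mg \<Longrightarrow> magidor_le p q \<Longrightarrow> leP (app \<pi> p) (app \<pi> q)"
  and pi_lift: "p \<in> Mg \<Longrightarrow> y \<in> elts P \<Longrightarrow> leP (app \<pi> p) y \<Longrightarrow> \<exists>q \<in> Mg. magidor_le p q \<and> leP y (app \<pi> q)"
  using proj unfolding is_projection_def by blast+

lemma inV_Mg: "inV Mg"
proof -
  have "Domain (rel_of \<pi>) = Mg" using pif unfolding is_function_def by blast
  then show ?thesis using inV_Domain(1)[OF piV] by simp
qed

definition Mset :: 's where "Mset = mk Mg"

lemma Mset: "Mset \<in> V" "elts Mset = Mg"
  unfolding Mset_def using mk_in[OF inV_Mg] elts_mk[OF inV_Mg] by auto

lemma MgV: "p \<in> Mg \<Longrightarrow> p \<in> V"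
  using transV[OF Mset(1)] Mset(2) by blast

lemma magidor_le_refl: "p \<in> Mg \<Longrightarrow> magidor_le p p"
  using le_iff ents_le_refl by blast

lemma magidor_le_trans: "p \<in> Mg \<Longrightarrow> q \<in> Mg \<Longrightarrow> r \<in> Mg \<Longrightarrow> magidor_le p q \<Longrightarrow> magidor_le q r \<Longrightarrow> magidor_le p r"
  using le_iff ents_le_trans Mg_cond by blast

text \<open>Definable forms of \<open>ents\<close>, \<open>kap\<close> and \<open>bset\<close>, correct on entries of conditions.\<close>

definition entry_in :: "'s \<Rightarrow> 's \<Rightarrow> bool" where "entry_in t p \<longleftrightarrow> (\<exists>z \<in> elts p. \<exists>i \<in> V. is_pair z i t)"
definition kap_rel :: "'s \<Rightarrow> 's \<Rightarrow> bool" where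
  "kap_rel t a \<longleftrightarrow> (Ord t \<and> a = t) \<or> (\<not> Ord t \<and> (\<exists>B \<in> V. is_pair t a B))"
definition bset_rel :: "'s \<Rightarrow> 's \<Rightarrow> bool" where
  "bset_rel t \<xi> \<longleftrightarrow> \<not> Ord t \<and> (\<exists>a \<in> V. \<exists>B \<in> V. is_pair t a B \<and> \<xi> \<in> elts B)"

lemma entry_in_iff: "p \<in> Mg \<Longrightarrow> entry_in t p \<longleftrightarrow> t \<in> ents p"
  unfolding entry_in_def ents_def using is_pair_in transV MgV by blast

lemma kap_rel_iff: assumes "ent t" shows "kap_rel t a \<longleftrightarrow> a = kap t" "bset_rel t \<xi> \<longleftrightarrow> \<xi> \<in> bset t"
proof -
  show "kap_rel t a \<longleftrightarrow> a = kap t" using assms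
  proof (cases rule: ent_cases)
    case 1
    then show ?thesis unfolding kap_rel_def by auto
  next
    case (2 B)
    then show ?thesis unfolding kap_rel_def using pair_not_Ord[OF 2(1)] is_pair_inj[OF 2(1)] by blast
  qed
  show "bset_rel t \<xi> \<longleftrightarrow> \<xi> \<in> bset t" using assms
  proof (cases rule: ent_cases)
    case 1
    then show ?thesis unfolding bset_rel_def by simp
  next
    case (2 B)
    then show ?thesis unfolding bset_rel_def
      using pair_not_Ord[OF 2(1)] is_pair_inj[OF 2(1)] ent_kap(3)[OF assms] by blast
  qed
qed

lemma dfn_entry_in: "dt t \<Longrightarrow> dt u \<Longrightarrow> df (\<lambda>e. entry_in (t e) (u e))"
  by (rule dfn_subst2[where P = entry_in]) (unfold entry_in_def, intro dfn_intros)

lemma dfn_kap_rel: "dt t \<Longrightarrow> dt u \<Longrightarrow> df (\<lambda>e. kap_rel (t e) (u e))"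
  by (rule dfn_subst2[where P = kap_rel]) (unfold kap_rel_def, intro dfn_intros)

lemma dfn_bset_rel: "dt t \<Longrightarrow> dt u \<Longrightarrow> df (\<lambda>e. bset_rel (t e) (u e))"
  by (rule dfn_subst2[where P = bset_rel]) (unfold bset_rel_def, intro dfn_intros)

text \<open>The order is needed as a set of \<open>V\<close>, but \<open>magidor_le\<close> speaks
  of HOL lists. The set is separated by a definable form of \<open>ents_le\<close>, to which
  \<open>le_iff\<close> reduces the order.\<close>

lemma LE_exists: "\<exists>r \<in> V. \<forall>p q. (p, q) \<in> rel_of r \<longleftrightarrow> p \<in> Mg \<and> q \<in> Mg \<and> magidor_le p q"
proof -
  let ?Q = "\<lambda>p q. (\<forall>t \<in> V. entry_in t p \<longrightarrow> (\<exists>s \<in> V. entry_in s q \<and> (\<exists>a \<in> V. kap_rel s a \<and> kap_rel t a) \<and> (\<forall>\<xi> \<in> V. bset_rel s \<xi> \<longrightarrow> bset_rel t \<xi>))) \<and>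
    (\<forall>s \<in> V. entry_in s q \<longrightarrow> (\<exists>t \<in> V. entry_in t p \<and> (\<exists>a \<in> V. kap_rel t a \<and> kap_rel s a)) \<or>
      (\<exists>t \<in> V. entry_in t p \<and> (\<exists>a \<in> V. kap_rel s a \<and> bset_rel t a \<and> (\<forall>\<xi> \<in> V. bset_rel s \<xi> \<longrightarrow> bset_rel t \<xi> \<and> \<xi> \<in> elts a))))"
  obtain r where r: "r \<in> V" "\<And>p q. (p, q) \<in> rel_of r \<longleftrightarrow> p \<in> Mg \<and> q \<in> Mg \<and> ?Q p q"
  proof (rule rel_sep[OF inV_Mg inV_Mg])
    show "df (\<lambda>e. ?Q (e 0) (e 1))" by (intro dfn_intros dfn_entry_in dfn_kap_rel dfn_bset_rel)
  qed (rule that)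
  have eq: "?Q p q \<longleftrightarrow> magidor_le p q" if pq: "p \<in> Mg" "q \<in> Mg" for p q
  proof -
    have eV: "s \<in> V" "ent s" "kap s \<in> V" "\<And>\<xi>. \<xi> \<in> bset s \<Longrightarrow> \<xi> \<in> V" if "s \<in> ents x" "x \<in> Mg" for s x
      using condD(2,3)[OF Mg_cond[OF that(2)]] that(1) ent_kap transV by blast+
    have kk: "(\<exists>a \<in> V. kap_rel s a \<and> kap_rel t a) \<longleftrightarrow> kap s = kap t" if "s \<in> ents x" "x \<in> Mg" "t \<in> ents y" "y \<in> Mg" for s t x y
      using kap_rel_iff(1) eV(2,3)[OF that(1,2)] eV(2,3)[OF that(3,4)] by auto
    have bb: "(\<forall>\<xi> \<in> V. bset_rel s \<xi> \<longrightarrow> bset_rel t \<xi>) \<longleftrightarrow> bset s \<subseteq> bset t" if "s \<in> ents x" "x \<in> Mg" "t \<in> ents y" "y \<in> Mg" for s t x y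
      using kap_rel_iff(2) eV(2,4)[OF that(1,2)] eV(2,4)[OF that(3,4)] by auto
    have kb: "(\<exists>a \<in> V. kap_rel s a \<and> bset_rel t a \<and> (\<forall>\<xi> \<in> V. bset_rel s \<xi> \<longrightarrow> bset_rel t \<xi> \<and> \<xi> \<in> elts a)) \<longleftrightarrow>
        kap s \<in> bset t \<and> bset s \<subseteq> bset t \<inter> elts (kap s)" if "s \<in> ents x" "x \<in> Mg" "t \<in> ents y" "y \<in> Mg" for s t x y
      using kap_rel_iff eV(2-4)[OF that(1,2)] eV(2,4)[OF that(3,4)] by auto
    have EV: "ents x \<subseteq> V" if "x \<in> Mg" for x using condD(2)[OF Mg_cond[OF that]] .
    have ball: "(\<forall>t \<in> V. t \<in> E \<longrightarrow> A t) \<longleftrightarrow> (\<forall>t \<in> E. A t)" if "E \<subseteq> V" for E A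
      using that by blast
    have bex: "(\<exists>t \<in> V. t \<in> E \<and> A t) \<longleftrightarrow> (\<exists>t \<in> E. A t)" if "E \<subseteq> V" for E A
      using that by blast
    have "?Q p q \<longleftrightarrow> (\<forall>t \<in> ents p. \<exists>s \<in> ents q. (\<exists>a \<in> V. kap_rel s a \<and> kap_rel t a) \<and> (\<forall>\<xi> \<in> V. bset_rel s \<xi> \<longrightarrow> bset_rel t \<xi>)) \<and>
      (\<forall>s \<in> ents q. (\<exists>t \<in> ents p. \<exists>a \<in> V. kap_rel t a \<and> kap_rel s a) \<or>
      (\<exists>t \<in> ents p. \<exists>a \<in> V. kap_rel s a \<and> bset_rel t a \<and> (\<forall>\<xi> \<in> V. bset_rel s \<xi> \<longrightarrow> bset_rel t \<xi> \<and> \<xi> \<in> elts a)))"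
      unfolding entry_in_iff[OF pq(1)] entry_in_iff[OF pq(2)] ball[OF EV[OF pq(1)]] ball[OF EV[OF pq(2)]]
        bex[OF EV[OF pq(1)]] bex[OF EV[OF pq(2)]] by (rule refl)
    also have "\<dots> \<longleftrightarrow> ents_le (ents p) (ents q)" unfolding ents_le_def
      using kk[OF _ pq(2) _ pq(1)] kk[OF _ pq(1) _ pq(2)] bb[OF _ pq(2) _ pq(1)] kb[OF _ pq(2) _ pq(1)]
      by (simp cong: ball_cong bex_cong)
    finally show ?thesis using le_iff[OF pq] by simp
  qed
  show ?thesis
  proof (intro bexI[of _ r] allI)
    show "(p, q) \<in> rel_of r \<longleftrightarrow> p \<in> Mg \<and> q \<in> Mg \<and> magidor_le p q" for p q
      unfolding r(2) by (intro conj_cong refl eq; assumption)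
  qed (rule r(1))
qed

definition LE :: 's where "LE = (SOME r. r \<in> V \<and> (\<forall>p q. (p, q) \<in> rel_of r \<longleftrightarrow> p \<in> Mg \<and> q \<in> Mg \<and> magidor_le p q))"

lemma LE: "LE \<in> V" "(p, q) \<in> rel_of LE \<longleftrightarrow> p \<in> Mg \<and> q \<in> Mg \<and> magidor_le p q"
proof -
  have "\<exists>r. r \<in> V \<and> (\<forall>p q. (p, q) \<in> rel_of r \<longleftrightarrow> p \<in> Mg \<and> q \<in> Mg \<and> magidor_le p q)" using LE_exists by blast
  from someI_ex[OF this] show "LE \<in> V" "(p, q) \<in> rel_of LE \<longleftrightarrow> p \<in> Mg \<and> q \<in> Mg \<and> magidor_le p q"
    unfolding LE_def by blast+
qed

sublocale forcing_ext V Mset LE G N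
proof
  show "Mset \<in> V" "LE \<in> V" by (rule Mset LE)+
  show "\<And>p. p \<in> elts Mset \<Longrightarrow> (p, p) \<in> rel_of LE" using Mset LE magidor_le_refl by simp
  show "(p, r) \<in> rel_of LE" if "(p, q) \<in> rel_of LE" "(q, r) \<in> rel_of LE" for p q r
    using that magidor_le_trans[of p q r] unfolding LE(2) by blast
  show "\<And>p q. (p, q) \<in> rel_of LE \<Longrightarrow> p \<in> elts Mset \<and> q \<in> elts Mset" using Mset LE by simp
  show "is_generic_extension V (elts Mset) G N" using ext Mset by simp
  have g: "G \<subseteq> Mg" "G \<noteq> {}" "\<forall>p \<in> G. \<forall>q \<in> Mg. magidor_le q p \<longrightarrow> q \<in> G"
    "\<forall>p \<in> G. \<forall>q \<in> G. \<exists>r \<in> G. magidor_le p r \<and> magidor_le q r"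
    "\<forall>d \<in> V. dense_in Mg magidor_le (elts d) \<longrightarrow> G \<inter> elts d \<noteq> {}"
    by (insert gen[unfolded generic_filter_def]; elim conjE; assumption)+
  have "dense_in Mg magidor_le D" if "dense_in (elts Mset) (\<lambda>p q. (p, q) \<in> rel_of LE) D" for D
    using that unfolding dense_in_def Mset LE by blast
  then show "generic_filter V (elts Mset) (\<lambda>p q. (p, q) \<in> rel_of LE) G"
    using g unfolding generic_filter_def Mset LE(2) by (intro conjI) (assumption | blast)+
qed

section \<open>Stems, top sets and compatibility as relations of the ground model\<close>

definition stem_of :: "'s \<Rightarrow> 's" where "stem_of p = mk (stem (ents p))"

lemma stem_of: "p \<in> Mg \<Longrightarrow> stem_of p \<in> V" "p \<in> Mg \<Longrightarrow> elts (stem_of p) = stem (ents p)"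
  unfolding stem_of_def using stem_inV[OF Mg_cond] mk_in elts_mk by blast+

lemma stem_of_eq: "p \<in> Mg \<Longrightarrow> q \<in> Mg \<Longrightarrow> stem_of p = stem_of q \<longleftrightarrow> stem (ents p) = stem (ents q)"
  using stem_of(2) elts_inject by metis

lemma ST_exists: "\<exists>r \<in> V. \<forall>p l. (p, l) \<in> rel_of r \<longleftrightarrow> p \<in> Mg \<and> l = stem_of p"
proof -
  obtain r where "r \<in> V" "\<And>p l. (p, l) \<in> rel_of r \<longleftrightarrow> p \<in> Mg \<and> l = stem_of p"
  proof (rule graph[OF inV_Mg stem_of(1)])
    show "df (\<lambda>e. \<forall>t \<in> V. t \<in> elts (e 1) \<longleftrightarrow> entry_in t (e 0) \<and> \<not> kap_rel t k)" by (intro dfn_intros dfn_entry_in dfn_kap_rel kO)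
    fix p l assume p: "p \<in> Mg" "l \<in> V"
    have "l = stem_of p \<longleftrightarrow> elts l = {t \<in> ents p. kap t \<noteq> k}" using stem_of(2)[OF p(1)] elts_inject unfolding stem_def by metis
    also have "\<dots> \<longleftrightarrow> (\<forall>t \<in> V. t \<in> elts l \<longleftrightarrow> t \<in> ents p \<and> kap t \<noteq> k)"
      using transV[OF p(2)] condD(2)[OF Mg_cond[OF p(1)]] by blast
    also have "\<dots> \<longleftrightarrow> (\<forall>t \<in> V. t \<in> elts l \<longleftrightarrow> entry_in t p \<and> \<not> kap_rel t k)"
      using entry_in_iff[OF p(1)] kap_rel_iff(1)[OF condD(3)[OF Mg_cond[OF p(1)]]] by (auto cong: conj_cong)
    finally show "(\<forall>t \<in> V. t \<in> elts l \<longleftrightarrow> entry_in t p \<and> \<not> kap_rel t k) \<longleftrightarrow> l = stem_of p" by simp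
  qed (assumption | rule that)+
  then show ?thesis by blast
qed

lemma TP_exists: "\<exists>r \<in> V. \<forall>p \<eta>. (p, \<eta>) \<in> rel_of r \<longleftrightarrow> p \<in> Mg \<and> \<eta> \<in> elts k \<and> \<eta> \<in> top_set (ents p)"
proof -
  obtain r where r: "r \<in> V" "\<And>p \<eta>. (p, \<eta>) \<in> rel_of r \<longleftrightarrow> p \<in> Mg \<and> \<eta> \<in> elts k \<and> (\<exists>t \<in> V. entry_in t p \<and> kap_rel t k \<and> bset_rel t \<eta>)"
  proof (rule rel_sep[OF inV_Mg inV_elts[OF kO(2)]])
    show "df (\<lambda>e. \<exists>t \<in> V. entry_in t (e 0) \<and> kap_rel t k \<and> bset_rel t (e 1))" by (intro dfn_intros dfn_entry_in dfn_kap_rel dfn_bset_rel kO)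
  qed (rule that)
  have "(\<exists>t \<in> V. entry_in t p \<and> kap_rel t k \<and> bset_rel t \<eta>) \<longleftrightarrow> \<eta> \<in> top_set (ents p)" if p: "p \<in> Mg" for p \<eta>
  proof -
    have "t \<in> V \<and> entry_in t p \<and> kap_rel t k \<and> bset_rel t \<eta> \<longleftrightarrow> t \<in> ents p \<and> kap t = k \<and> \<eta> \<in> bset t" for t
    proof (cases "t \<in> ents p")
      case True
      then have "t \<in> V" "ent t" using condD(2,3)[OF Mg_cond[OF p]] by blast+
      then show ?thesis using True entry_in_iff[OF p] kap_rel_iff[of t] by auto
    qed (use entry_in_iff[OF p] in blast)
    then show ?thesis unfolding top_set_def Bex_def by blast
  qed
  then show ?thesis using r by (intro bexI[of _ r]) auto
qed

lemma PL_exists: "\<exists>r \<in> V. \<forall>\<zeta> p. (\<zeta>, p) \<in> rel_of r \<longleftrightarrow> \<zeta> \<in> Mg \<and> p \<in> Mg \<and> leP (app \<pi> \<zeta>) (app \<pi> p)"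
proof -
  obtain r where r: "r \<in> V" "\<And>\<zeta> p. (\<zeta>, p) \<in> rel_of r \<longleftrightarrow> \<zeta> \<in> Mg \<and> p \<in> Mg \<and>
      (\<exists>a \<in> V. \<exists>b \<in> V. (\<zeta>, a) \<in> rel_of \<pi> \<and> (p, b) \<in> rel_of \<pi> \<and> leP a b)"
  proof (rule rel_sep[OF inV_Mg inV_Mg])
    show "df (\<lambda>e. \<exists>a \<in> V. \<exists>b \<in> V. (e 0, a) \<in> rel_of \<pi> \<and> (e 1, b) \<in> rel_of \<pi> \<and> leP a b)"
      by (intro dfn_intros piV RV)
  qed (rule that)
  have "(\<exists>a \<in> V. \<exists>b \<in> V. (\<zeta>, a) \<in> rel_of \<pi> \<and> (p, b) \<in> rel_of \<pi> \<and> leP a b) \<longleftrightarrow> leP (app \<pi> \<zeta>) (app \<pi> p)"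
    if "\<zeta> \<in> Mg" "p \<in> Mg" for \<zeta> p
    using function_rel[OF pif that(1)] function_rel[OF pif that(2)] pi_P that transV[OF PinV] by auto
  then show ?thesis using r by (intro bexI[of _ r]) auto
qed

definition compat :: "'s \<Rightarrow> 's \<Rightarrow> bool" where
  "compat r \<zeta> \<longleftrightarrow> (\<exists>r' \<in> Mg. \<exists>\<zeta>' \<in> Mg. magidor_le r r' \<and> magidor_le \<zeta> \<zeta>' \<and> leP (app \<pi> \<zeta>') (app \<pi> r'))"

lemma CM_exists: "\<exists>c \<in> V. \<forall>r \<zeta>. (r, \<zeta>) \<in> rel_of c \<longleftrightarrow> r \<in> Mg \<and> \<zeta> \<in> Mg \<and> compat r \<zeta>"
proof -
  obtain PL where PL: "PL \<in> V" "\<And>\<zeta> p. (\<zeta>, p) \<in> rel_of PL \<longleftrightarrow> \<zeta> \<in> Mg \<and> p \<in> Mg \<and> leP (app \<pi> \<zeta>) (app \<pi> p)"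
    using PL_exists by blast
  obtain c where c: "c \<in> V" "\<And>r \<zeta>. (r, \<zeta>) \<in> rel_of c \<longleftrightarrow> r \<in> Mg \<and> \<zeta> \<in> Mg \<and>
      (\<exists>r' \<in> elts Mset. \<exists>\<zeta>' \<in> elts Mset. le r r' \<and> le \<zeta> \<zeta>' \<and> (\<zeta>', r') \<in> rel_of PL)"
  proof (rule rel_sep[OF inV_Mg inV_Mg])
    show "df (\<lambda>e. \<exists>r' \<in> elts Mset. \<exists>\<zeta>' \<in> elts Mset. le (e 0) r' \<and> le (e 1) \<zeta>' \<and> (\<zeta>', r') \<in> rel_of PL)"
      by (intro dfn_intros Mset LE PL)
  qed (rule that)
  have "(\<exists>r' \<in> elts Mset. \<exists>\<zeta>' \<in> elts Mset. le r r' \<and> le \<zeta> \<zeta>' \<and> (\<zeta>', r') \<in> rel_of PL) \<longleftrightarrow> compat r \<zeta>"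
    if "r \<in> Mg" "\<zeta> \<in> Mg" for r \<zeta> unfolding compat_def Mset(2) LE(2) PL(2) using that by blast
  then show ?thesis using c by (intro bexI[of _ c]) auto
qed

definition good :: "'s \<Rightarrow> 's \<Rightarrow> bool" where
  "good l m \<longleftrightarrow> (\<forall>r \<in> Mg. \<forall>\<zeta> \<in> Mg. stem_of r = l \<and> stem_of \<zeta> = m \<longrightarrow> compat r \<zeta>)"

lemma k_measure: obtains W where "nmeasure V k W"
  using o_entry ok entry_measure by blast

text \<open>One bad witness is chosen for each pair of stems that is not good; \<open>A\<close> is the diagonal
  intersection of all their tops.\<close>

lemma bad_diagonal:
  obtains A where "A \<in> V" "allm k A"
    "\<And>r0 \<zeta>0. r0 \<in> Mg \<Longrightarrow> \<zeta>0 \<in> Mg \<Longrightarrow> \<not> good (stem_of r0) (stem_of \<zeta>0) \<Longrightarrow>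
      \<exists>r \<in> Mg. \<exists>\<zeta> \<in> Mg. stem_of r = stem_of r0 \<and> stem_of \<zeta> = stem_of \<zeta>0 \<and> \<not> compat r \<zeta> \<and>
      (\<forall>\<eta> \<in> elts A. \<forall>\<delta> \<in> elts \<eta>. in_power 6 (succ_set \<delta>) (pr (stem_of r0) (stem_of \<zeta>0)) \<longrightarrow> \<eta> \<in> top_set (ents r) \<and> \<eta> \<in> top_set (ents \<zeta>))"
proof -
  obtain ST where ST: "ST \<in> V" "\<And>p l. (p, l) \<in> rel_of ST \<longleftrightarrow> p \<in> Mg \<and> l = stem_of p" using ST_exists by blast
  obtain TP where TP: "TP \<in> V" "\<And>p \<eta>. (p, \<eta>) \<in> rel_of TP \<longleftrightarrow> p \<in> Mg \<and> \<eta> \<in> elts k \<and> \<eta> \<in> top_set (ents p)"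
    using TP_exists by blast
  obtain CM where CM: "CM \<in> V" "\<And>r \<zeta>. (r, \<zeta>) \<in> rel_of CM \<longleftrightarrow> r \<in> Mg \<and> \<zeta> \<in> Mg \<and> compat r \<zeta>" using CM_exists by blast
  have L: "inV (Range (rel_of ST))" by (rule inV_Domain(2)[OF ST(1)])
  let ?A = "{pr x y | x y. x \<in> Range (rel_of ST) \<and> y \<in> Range (rel_of ST)}"
  let ?B = "{pr x y | x y. x \<in> Mg \<and> y \<in> Mg}"
  let ?bad = "\<lambda>x y. \<exists>r \<in> elts Mset. \<exists>\<zeta> \<in> elts Mset. \<exists>l \<in> V. \<exists>m \<in> V. y = pr r \<zeta> \<and> (r, l) \<in> rel_of ST \<and>
      (\<zeta>, m) \<in> rel_of ST \<and> x = pr l m \<and> (r, \<zeta>) \<notin> rel_of CM"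
  obtain T where T: "T \<in> V" "\<And>x y. (x, y) \<in> rel_of T \<longleftrightarrow> x \<in> ?A \<and> y \<in> ?B \<and> ?bad x y"
  proof (rule rel_sep[OF inV_times[OF L L] inV_times[OF inV_Mg inV_Mg]])
    show "df (\<lambda>e. ?bad (e 0) (e 1))" by (intro dfn_intros Mset ST CM)
  qed (rule that)
  have Tpr: "(x, y) \<in> rel_of T \<longleftrightarrow> (\<exists>r \<in> Mg. \<exists>\<zeta> \<in> Mg. x = pr (stem_of r) (stem_of \<zeta>) \<and> y = pr r \<zeta> \<and> \<not> compat r \<zeta>)" for x y
  proof
    assume "(x, y) \<in> rel_of T"
    then have "?bad x y" using T(2) by blast
    then show "\<exists>r \<in> Mg. \<exists>\<zeta> \<in> Mg. x = pr (stem_of r) (stem_of \<zeta>) \<and> y = pr r \<zeta> \<and> \<not> compat r \<zeta>"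
      unfolding Mset(2) ST(2) CM(2) by blast
  next
    assume "\<exists>r \<in> Mg. \<exists>\<zeta> \<in> Mg. x = pr (stem_of r) (stem_of \<zeta>) \<and> y = pr r \<zeta> \<and> \<not> compat r \<zeta>"
    then obtain r \<zeta> where r: "r \<in> Mg" "\<zeta> \<in> Mg" "x = pr (stem_of r) (stem_of \<zeta>)" "y = pr r \<zeta>" "\<not> compat r \<zeta>" by blast
    have s: "(r, stem_of r) \<in> rel_of ST" "(\<zeta>, stem_of \<zeta>) \<in> rel_of ST" using ST(2) r by blast+
    then have "x \<in> ?A" "y \<in> ?B" using r by blast+
    moreover have "?bad x y" using r s CM(2) stem_of(1) Mset(2) by blast
    ultimately show "(x, y) \<in> rel_of T" using T(2) by blast
  qed
  obtain f where f: "f \<in> V" "rel_of f \<subseteq> rel_of T" "single_valued (rel_of f)"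
      "Domain (rel_of f) = Domain (rel_of T)" by (rule uniformize[OF T(1)]) (rule that)
  let ?X = "Domain (rel_of f)"
  have X: "inV ?X" by (rule inV_Domain(1)[OF f(1)])
  obtain Rr where Rr: "Rr \<in> V" "\<And>x \<eta>. (x, \<eta>) \<in> rel_of Rr \<longleftrightarrow> x \<in> ?X \<and> \<eta> \<in> elts k \<and>
      (\<exists>r \<in> elts Mset. \<exists>\<zeta> \<in> elts Mset. (x, pr r \<zeta>) \<in> rel_of f \<and> (r, \<eta>) \<in> rel_of TP \<and> (\<zeta>, \<eta>) \<in> rel_of TP)"
  proof (rule rel_sep[OF X inV_elts[OF kO(2)]])
    show "df (\<lambda>e. \<exists>r \<in> elts Mset. \<exists>\<zeta> \<in> elts Mset. (e 0, pr r \<zeta>) \<in> rel_of f \<and> (r, e 1) \<in> rel_of TP \<and> (\<zeta>, e 1) \<in> rel_of TP)"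
      by (intro dfn_intros Mset f TP)
  qed (rule that)
  have Rr': "(x, \<eta>) \<in> rel_of Rr \<longleftrightarrow> \<eta> \<in> elts k \<and> \<eta> \<in> top_set (ents r) \<and> \<eta> \<in> top_set (ents \<zeta>)"
    if rz: "(x, pr r \<zeta>) \<in> rel_of f" "r \<in> Mg" "\<zeta> \<in> Mg" for x r \<zeta> \<eta>
  proof -
    have "r' = r \<and> \<zeta>' = \<zeta>" if "(x, pr r' \<zeta>') \<in> rel_of f" "r' \<in> Mg" "\<zeta>' \<in> Mg" for r' \<zeta>'
      using that rz f(3) pr_inject MgV unfolding single_valued_def by metis
    then show ?thesis unfolding Rr(2) Mset(2) TP(2) using rz by blast
  qed
  have fX: "\<exists>r \<in> Mg. \<exists>\<zeta> \<in> Mg. (x, pr r \<zeta>) \<in> rel_of f \<and> x = pr (stem_of r) (stem_of \<zeta>) \<and> \<not> compat r \<zeta>" if "x \<in> ?X" for x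
  proof -
    obtain y where y: "(x, y) \<in> rel_of f" using \<open>x \<in> ?X\<close> by blast
    then have "(x, y) \<in> rel_of T" using f(2) by blast
    then show ?thesis using y unfolding Tpr by blast
  qed
  \<comment> \<open>Level 6 is that of a pair of stems: 4 for a stem, and 2 more for the
    pair.\<close>
  let ?D = "{\<eta> \<in> elts k. \<forall>\<delta> \<in> elts \<eta>. \<forall>x \<in> ?X. in_power 6 (succ_set \<delta>) x \<longrightarrow> (x, \<eta>) \<in> rel_of Rr}"
  have D: "nmeasure.large W ?D" if e: "((k, \<beta>), W) \<in> entries U" for \<beta> W
  proof -
    interpret n: nmeasure V k W by (rule entry_measure[OF e])
    show ?thesis
    proof (rule n.large_diagonal[OF X Rr(1)])
      fix x assume "x \<in> ?X"
      then obtain r \<zeta> where r: "r \<in> Mg" "\<zeta> \<in> Mg" "(x, pr r \<zeta>) \<in> rel_of f" using fX by blast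
      obtain B where B: "top_set (ents r) = elts B" "allm k B" using top_set_entry[OF Mg_cond[OF r(1)]] by metis
      obtain C where C: "top_set (ents \<zeta>) = elts C" "allm k C" using top_set_entry[OF Mg_cond[OF r(2)]] by metis
      have m: "n.large (elts B)" "n.large (elts C)" using B C e allm_iff by blast+
      have "{\<eta> \<in> elts k. (x, \<eta>) \<in> rel_of Rr} = elts B \<inter> elts C"
        using Rr'[OF r(3,1,2)] B(1) C(1) n.large_sub(1)[OF m(1)] by auto
      then show "n.large {\<eta> \<in> elts k. (x, \<eta>) \<in> rel_of Rr}" using n.large_Int[OF m] by simp
    qed
  qed
  obtain \<beta> W where e: "((k, \<beta>), W) \<in> entries U" using o_entry ok by blast
  have "inV ?D" using nmeasure.large_inV[OF entry_measure[OF e] D[OF e]] .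
  then obtain A where A: "A \<in> V" "elts A = ?D" unfolding inV_def by auto
  show thesis
  proof (rule that[OF A(1)])
    show "allm k A" unfolding allm_iff A(2) using D by blast
    fix r0 \<zeta>0 assume r0: "r0 \<in> Mg" "\<zeta>0 \<in> Mg" "\<not> good (stem_of r0) (stem_of \<zeta>0)"
    let ?x = "pr (stem_of r0) (stem_of \<zeta>0)"
    obtain r1 \<zeta>1 where "r1 \<in> Mg" "\<zeta>1 \<in> Mg" "stem_of r1 = stem_of r0" "stem_of \<zeta>1 = stem_of \<zeta>0" "\<not> compat r1 \<zeta>1"
      using r0(3) unfolding good_def by blast
    then have "(?x, pr r1 \<zeta>1) \<in> rel_of T" using Tpr by metis
    then have x: "?x \<in> ?X" using f(4) by blast
    then obtain r \<zeta> where r: "r \<in> Mg" "\<zeta> \<in> Mg" "(?x, pr r \<zeta>) \<in> rel_of f" "?x = pr (stem_of r) (stem_of \<zeta>)" "\<not> compat r \<zeta>"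
      using fX by blast
    have "stem_of r0 = stem_of r \<and> stem_of \<zeta>0 = stem_of \<zeta>" using pr_inject[of "stem_of r0" "stem_of \<zeta>0" "stem_of r" "stem_of \<zeta>"] stem_of(1) r r0 by blast
    moreover have "\<eta> \<in> top_set (ents r) \<and> \<eta> \<in> top_set (ents \<zeta>)"
      if "\<eta> \<in> elts A" "\<delta> \<in> elts \<eta>" "in_power 6 (succ_set \<delta>) ?x" for \<eta> \<delta>
      using that x Rr'[OF r(3,1,2)] unfolding A(2) by blast
    ultimately show "\<exists>r \<in> Mg. \<exists>\<zeta> \<in> Mg. stem_of r = stem_of r0 \<and> stem_of \<zeta> = stem_of \<zeta>0 \<and> \<not> compat r \<zeta> \<and>
      (\<forall>\<eta> \<in> elts A. \<forall>\<delta> \<in> elts \<eta>. in_power 6 (succ_set \<delta>) ?x \<longrightarrow> \<eta> \<in> top_set (ents r) \<and> \<eta> \<in> top_set (ents \<zeta>))"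
      using r(1,2,5) by (intro bexI[of _ r] bexI[of _ \<zeta>]) auto
  qed
qed

lemma retop_Int:
  assumes "p \<in> Mg" "A \<in> V" "allm k A"
  obtains r where "r \<in> Mg" "stem (ents r) = stem (ents p)" "top_set (ents r) = top_set (ents p) \<inter> elts A" "magidor_le p r"
proof -
  obtain B where B: "top_set (ents p) = elts B" "B \<in> V" "allm k B" using top_set_entry[OF Mg_cond[OF assms(1)]] by metis
  have "inV {x \<in> elts B. x \<in> elts A}" by (intro inV_sep inV_elts B dfn_intros assms)
  then obtain D where D: "D \<in> V" "elts D = {x \<in> elts B. x \<in> elts A}" unfolding inV_def by auto
  have eD: "elts D = elts B \<inter> elts A" using D(2) by blast
  have aD: "allm k D" by (rule allm_Int[OF B(3) assms(3) eD])
  have sD: "elts D \<subseteq> top_set (ents p)" using eD B by blast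
  obtain r where r: "r \<in> Mg" "stem (ents r) = stem (ents p)" "top_set (ents r) = elts D"
    by (rule retop[OF assms(1) D(1) aD sD]) (rule that)
  have "ents_le (ents p) (ents r)" by (rule le_same_stem[OF Mg_cond Mg_cond]) (use r assms sD in auto)
  then have "magidor_le p r" using le_iff assms r by blast
  then show thesis using that r B eD by metis
qed

lemma above_exists:
  assumes "\<delta> \<in> elts k" obtains A where "A \<in> V" "allm k A" "elts A \<subseteq> elts k" "\<And>\<eta>. \<eta> \<in> elts A \<Longrightarrow> \<delta> \<in> elts \<eta>"
proof -
  have "inV {\<eta> \<in> elts k. \<delta> \<in> elts \<eta>}" by (intro inV_sep inV_elts kO dfn_intros transV[OF kO(2) assms])
  then obtain A where A: "A \<in> V" "elts A = {\<eta> \<in> elts k. \<delta> \<in> elts \<eta>}" unfolding inV_def by auto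
  have "allm k A" unfolding allm_iff A(2) using nmeasure.large_above[OF entry_measure assms] by blast
  then show thesis using that A by blast
qed

lemma key:
  assumes r: "r \<in> Mg" and x: "\<xi> \<in> Mg" and forced: "\<And>r'. r' \<in> Mg \<Longrightarrow> magidor_le r r' \<Longrightarrow> compat r' \<xi>"
  shows "\<exists>r' \<in> Mg. \<exists>\<zeta>' \<in> Mg. magidor_le r r' \<and> magidor_le \<xi> \<zeta>' \<and> good (stem_of r') (stem_of \<zeta>')"
proof -
  obtain A where A: "A \<in> V" "allm k A"
    "\<And>r0 \<zeta>0. r0 \<in> Mg \<Longrightarrow> \<zeta>0 \<in> Mg \<Longrightarrow> \<not> good (stem_of r0) (stem_of \<zeta>0) \<Longrightarrow>
      \<exists>r \<in> Mg. \<exists>\<zeta> \<in> Mg. stem_of r = stem_of r0 \<and> stem_of \<zeta> = stem_of \<zeta>0 \<and> \<not> compat r \<zeta> \<and>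
      (\<forall>\<eta> \<in> elts A. \<forall>\<delta> \<in> elts \<eta>. in_power 6 (succ_set \<delta>) (pr (stem_of r0) (stem_of \<zeta>0)) \<longrightarrow> \<eta> \<in> top_set (ents r) \<and> \<eta> \<in> top_set (ents \<zeta>))"
    by (rule bad_diagonal) (rule that)
  obtain rs where rs: "rs \<in> Mg" "stem (ents rs) = stem (ents r)" "top_set (ents rs) = top_set (ents r) \<inter> elts A" "magidor_le r rs"
    by (rule retop_Int[OF r A(1,2)]) (rule that)
  obtain r1 \<zeta>0 where r1: "r1 \<in> Mg" "\<zeta>0 \<in> Mg" "magidor_le rs r1" "magidor_le \<xi> \<zeta>0" "leP (app \<pi> \<zeta>0) (app \<pi> r1)"
    using forced[OF rs(1,4)] unfolding compat_def by blast
  obtain \<zeta>1 where z1: "\<zeta>1 \<in> Mg" "magidor_le \<zeta>0 \<zeta>1" "leP (app \<pi> r1) (app \<pi> \<zeta>1)"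
    using pi_lift[OF r1(2) pi_P[OF r1(1)] r1(5)] by blast
  obtain \<delta> where d: "\<delta> \<in> elts k" "\<And>t. t \<in> stem (ents rs) \<Longrightarrow> kap t \<in> succ_set \<delta>" "\<And>t. t \<in> stem (ents \<zeta>1) \<Longrightarrow> kap t \<in> succ_set \<delta>"
  proof -
    obtain d1 where d1: "d1 \<in> elts k" "\<And>t. t \<in> stem (ents rs) \<Longrightarrow> kap t \<in> succ_set d1"
      by (rule stem_bound[OF Mg_cond[OF rs(1)]]) (rule that)
    obtain d2 where d2: "d2 \<in> elts k" "\<And>t. t \<in> stem (ents \<zeta>1) \<Longrightarrow> kap t \<in> succ_set d2"
      by (rule stem_bound[OF Mg_cond[OF z1(1)]]) (rule that)
    have o: "Ord d1" "Ord d2" using d1 d2 Ord_elt[OF kO(1)] by blast+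
    consider "succ_set d1 \<subseteq> succ_set d2" | "succ_set d2 \<subseteq> succ_set d1"
      using Ord_linear[OF o] Ord_trans[OF o(1)] Ord_trans[OF o(2)] by blast
    then show thesis
    proof cases
      case 1
      then show thesis using that[of d2] d1 d2 by blast
    next
      case 2
      then show thesis using that[of d1] d1 d2 by blast
    qed
  qed
  have dO: "Ord \<delta>" using d(1) Ord_elt[OF kO(1)] by blast
  have kS: "k \<notin> succ_set \<delta>" using d(1) mem_irrefl mem_asym by blast
  have above: "\<delta> \<in> elts \<eta>" if "\<eta> \<notin> succ_set \<delta>" "Ord \<eta>" for \<eta> using Ord_linear[OF that(2) dO] that(1) by blast
  obtain Ad where Ad: "Ad \<in> V" "allm k Ad" "elts Ad \<subseteq> elts k" "\<And>\<eta>. \<eta> \<in> elts Ad \<Longrightarrow> \<delta> \<in> elts \<eta>"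
    by (rule above_exists[OF d(1)]) (rule that)
  obtain \<zeta>a where za: "\<zeta>a \<in> Mg" "stem (ents \<zeta>a) = stem (ents \<zeta>1)" "top_set (ents \<zeta>a) = top_set (ents \<zeta>1) \<inter> elts A" "magidor_le \<zeta>1 \<zeta>a"
    by (rule retop_Int[OF z1(1) A(1,2)]) (rule that)
  obtain \<zeta>2 where z2: "\<zeta>2 \<in> Mg" "stem (ents \<zeta>2) = stem (ents \<zeta>a)" "top_set (ents \<zeta>2) = top_set (ents \<zeta>a) \<inter> elts Ad" "magidor_le \<zeta>a \<zeta>2"
    by (rule retop_Int[OF za(1) Ad(1,2)]) (rule that)
  have z12: "magidor_le \<zeta>1 \<zeta>2" by (rule magidor_le_trans[OF z1(1) za(1) z2(1) za(4) z2(4)])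
  have "leP (app \<pi> r1) (app \<pi> \<zeta>2)"
    by (rule leP_trans[OF pi_P[OF r1(1)] pi_P[OF z1(1)] pi_P[OF z2(1)] z1(3) pi_mono[OF z1(1) z2(1) z12]])
  then obtain r2 where r2: "r2 \<in> Mg" "magidor_le r1 r2" "leP (app \<pi> \<zeta>2) (app \<pi> r2)"
    using pi_lift[OF r1(1) pi_P[OF z2(1)]] by blast
  \<comment> \<open>The diagonal set \<open>A\<close> controls the top sets of a bad witness only
    above \<open>\<delta>\<close>, so the sets of the entries beyond \<open>\<delta>\<close> have to
    avoid the smaller ordinals.\<close>
  obtain r3 where r3: "r3 \<in> Mg" "magidor_le r2 r3"
    "{t \<in> ents r3. kap t \<in> succ_set \<delta>} = {t \<in> ents r2. kap t \<in> succ_set \<delta>}"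
    "\<And>s. s \<in> ents r3 \<Longrightarrow> kap s \<notin> succ_set \<delta> \<Longrightarrow> \<exists>t \<in> ents r2. kap t = kap s \<and> bset s = bset t \<inter> {\<eta>. \<delta> \<in> elts \<eta>}"
    by (rule shrink[OF r2(1) d(1)]) (rule that)
  have p3: "leP (app \<pi> \<zeta>2) (app \<pi> r3)"
    by (rule leP_trans[OF pi_P[OF z2(1)] pi_P[OF r2(1)] pi_P[OF r3(1)] r2(3) pi_mono[OF r2(1) r3(1) r3(2)]])
  have rs3: "magidor_le rs r3"
    using magidor_le_trans[OF rs(1) r1(1) r2(1) r1(3) r2(2)] magidor_le_trans[OF rs(1) r2(1) r3(1) _ r3(2)] by blast
  have rr3: "magidor_le r r3" by (rule magidor_le_trans[OF r rs(1) r3(1) rs(4) rs3])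
  note E3 = Mg_cond[OF r3(1)]
  let ?S = "{t \<in> ents r3. kap t \<in> succ_set \<delta>}"
  have SS: "?S \<subseteq> stem (ents r3)" using kS unfolding stem_def by auto
  obtain B where B: "pr k B \<in> ents r" "kap (pr k B) = k" "bset (pr k B) = elts B" "top_set (ents r) = elts B"
    "B \<in> V" "allm k B" "ents r = insert (pr k B) (stem (ents r))" by (rule top_set_entry[OF Mg_cond[OF r]]) (rule that)
  have "inV {x \<in> elts B. x \<in> elts Ad}" by (intro inV_sep inV_elts B dfn_intros Ad)
  then obtain D where D: "D \<in> V" "elts D = {x \<in> elts B. x \<in> elts Ad}" unfolding inV_def by auto
  have eD: "elts D = elts B \<inter> elts Ad" using D(2) by blast
  have aD: "allm k D" by (rule allm_Int[OF B(6) Ad(2) eD])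
  have "kap t \<in> elts \<eta>" if t: "t \<in> ?S" "\<eta> \<in> elts D" for t \<eta>
  proof -
    have "\<delta> \<in> elts \<eta>" "\<eta> \<in> elts k" using t(2) eD Ad(3,4) by blast+
    then show ?thesis using t(1) Ord_trans[OF Ord_elt[OF kO(1)]] by blast
  qed
  note C = cond_retop[OF E3 SS D(1) aD this]
  \<comment> \<open>The stem of \<open>r'\<close> is the part of \<open>r3\<close> up to
    \<open>\<delta>\<close>; its top set comes from \<open>r\<close>, cut above
    \<open>\<delta>\<close>. For goodness only the stem counts.\<close>
  obtain r' where r': "r' \<in> Mg" "ents r' = insert (pr k D) ?S" using Mg_exists[OF C(1)] by blast
  have sr': "stem (ents r') = ?S" using C(2) r'(2) by simp
  have kD: "kap (pr k D) = k" "bset (pr k D) = elts D" using kap_pr[OF kO(2) D(1)] by auto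
  have le3: "ents_le (ents r) (ents r3)" using le_iff[OF r r3(1)] rr3 by simp
  have rr': "magidor_le r r'"
  proof -
    have 1: "\<exists>s \<in> ents r'. kap s = kap t \<and> bset s \<subseteq> bset t" if t: "t \<in> ents r" for t
    proof -
      from t consider "t = pr k B" | "t \<in> stem (ents r)" using B(7) by blast
      then show ?thesis
      proof cases
        case 1
        then show ?thesis using kD B eD r'(2) by (intro bexI[of _ "pr k D"]) auto
      next
        case 2
        obtain s where s: "s \<in> ents r3" "kap s = kap t" "bset s \<subseteq> bset t" using le3 t unfolding ents_le_def by blast
        then have "s \<in> ?S" using d(2) 2 rs(2) by auto
        then show ?thesis using s r'(2) by blast
      qed
    qed
    have 2: "(\<exists>t \<in> ents r. kap t = kap s) \<or> (\<exists>t \<in> ents r. kap s \<in> bset t \<and> bset s \<subseteq> bset t \<inter> elts (kap s))"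
      if "s \<in> ents r'" for s
    proof (cases "s = pr k D")
      case True
      then show ?thesis using kD B(1,2) by auto
    next
      case False
      then have "s \<in> ents r3" using that r'(2) by blast
      then show ?thesis using le3 unfolding ents_le_def by blast
    qed
    have "ents_le (ents r) (ents r')" unfolding ents_le_def using 1 2 by blast
    then show ?thesis using le_iff[OF r r'(1)] by simp
  qed
  have xz: "magidor_le \<xi> \<zeta>2"
    using magidor_le_trans[OF x r1(2) z1(1) r1(4) z1(2)] magidor_le_trans[OF x z1(1) z2(1) _ z12] by blast
  have "good (stem_of r') (stem_of \<zeta>2)"
  proof (rule ccontr)
    assume "\<not> good (stem_of r') (stem_of \<zeta>2)"
    from A(3)[OF r'(1) z2(1) this] obtain a b where ab: "a \<in> Mg" "b \<in> Mg" "stem_of a = stem_of r'" "stem_of b = stem_of \<zeta>2" "\<not> compat a b"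
      and tops: "\<forall>\<eta> \<in> elts A. \<forall>\<delta> \<in> elts \<eta>. in_power 6 (succ_set \<delta>) (pr (stem_of r') (stem_of \<zeta>2)) \<longrightarrow>
        \<eta> \<in> top_set (ents a) \<and> \<eta> \<in> top_set (ents b)" by blast
    have "in_power 4 (succ_set \<delta>) (stem_of r')"
    proof (rule stem_in_power[OF E3 SS dO])
      show "elts (stem_of r') = ?S" using stem_of(2)[OF r'(1)] sr' by simp
    qed blast
    moreover have "in_power 4 (succ_set \<delta>) (stem_of \<zeta>2)"
    proof (rule stem_in_power[OF Mg_cond[OF z2(1)] subset_refl dO])
      show "elts (stem_of \<zeta>2) = stem (ents \<zeta>2)" by (rule stem_of(2)[OF z2(1)])
      show "kap t \<in> succ_set \<delta>" if "t \<in> stem (ents \<zeta>2)" for t using d(3) that z2(2) za(2) by simp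
    qed
    ultimately have "in_power (Suc (Suc 4)) (succ_set \<delta>) (pr (stem_of r') (stem_of \<zeta>2))" using in_power_pr stem_of(1) r'(1) z2(1) by blast
    then have "in_power 6 (succ_set \<delta>) (pr (stem_of r') (stem_of \<zeta>2))" by (simp add: eval_nat_numeral)
    then have tops': "\<eta> \<in> top_set (ents a)" "\<eta> \<in> top_set (ents b)" if "\<eta> \<in> elts A" "\<delta> \<in> elts \<eta>" for \<eta>
      using tops that by blast+
    have sa: "stem (ents a) = ?S" using ab(3) stem_of_eq[OF ab(1) r'(1)] sr' by simp
    have sb: "stem (ents b) = stem (ents \<zeta>2)" using ab(4) stem_of_eq[OF ab(2) z2(1)] by simp
    \<comment> \<open>No stem entry of \<open>rs\<close> can be responsible for an entry of
      \<open>r3\<close> beyond \<open>\<delta>\<close>, so the top entry of \<open>rs\<close> is,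
      and its set lies in \<open>A\<close>.\<close>
    have Z: "bset s \<subseteq> top_set (ents a) \<and> (kap s = k \<or> kap s \<in> top_set (ents a))"
      if s: "s \<in> ents r3" "kap s \<notin> succ_set \<delta>" for s
    proof -
      have les: "ents_le (ents rs) (ents r3)" using le_iff[OF rs(1) r3(1)] rs3 by simp
      have Os: "Ord (kap s)" "bset s \<subseteq> elts (kap s)" using ent_kap condD(3)[OF E3 s(1)] by blast+
      have down: "bset s \<subseteq> {\<eta>. \<delta> \<in> elts \<eta>}" using r3(4)[OF s] by blast
      have top_rs: "bset t = top_set (ents rs) \<and> kap t = k" if t: "t \<in> ents rs" "kap t \<notin> succ_set \<delta>" for t
      proof -
        have "kap t = k" using t d(2) unfolding stem_def by blast
        moreover have "t' = t" if "t' \<in> ents rs" "kap t' = k" for t'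
          using cond_kap_inj[OF Mg_cond[OF rs(1)] that(1) t(1)] that(2) \<open>kap t = k\<close> by simp
        ultimately show ?thesis using t(1) unfolding top_set_def by blast
      qed
      have subA: "top_set (ents rs) \<subseteq> elts A" using rs(3) by blast
      from les s(1) consider t where "t \<in> ents rs" "kap t = kap s"
        | t where "t \<in> ents rs" "kap s \<in> bset t" "bset s \<subseteq> bset t \<inter> elts (kap s)" unfolding ents_le_def by blast
      then show ?thesis
      proof cases
        case (1 t)
        then have t: "bset t = top_set (ents rs)" "kap s = k" using top_rs[of t] s(2) by auto
        obtain s' where "s' \<in> ents r3" "kap s' = kap t" "bset s' \<subseteq> bset t" using les 1(1) unfolding ents_le_def by blast
        then have "bset s \<subseteq> bset t" using cond_kap_inj[OF E3 _ s(1)] 1(2) by metis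
        then show ?thesis using t subA down tops' by blast
      next
        case (2 t)
        have "kap t \<notin> succ_set \<delta>"
        proof
          assume kt: "kap t \<in> succ_set \<delta>"
          have "kap s \<in> elts (kap t)" using 2(2) ent_kap(4) condD(3)[OF Mg_cond[OF rs(1)] 2(1)] by blast
          then show False using kt s(2) Ord_trans[OF dO] by blast
        qed
        then have t: "bset t = top_set (ents rs)" using top_rs[OF 2(1)] by blast
        have "kap s \<in> top_set (ents a)" using tops'(1)[of "kap s"] 2(2) t subA above[OF s(2) Os(1)] by blast
        then show ?thesis using 2(3) t subA down tops' by blast
      qed
    qed
    obtain Ba where Ba: "pr k Ba \<in> ents a" "kap (pr k Ba) = k" "bset (pr k Ba) = elts Ba" "top_set (ents a) = elts Ba"
      "ents a = insert (pr k Ba) (stem (ents a))" using top_set_entry[OF Mg_cond[OF ab(1)]] by metis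
    have ar3: "magidor_le a r3"
    proof -
      have 1: "\<exists>s \<in> ents r3. kap s = kap t \<and> bset s \<subseteq> bset t" if t: "t \<in> ents a" for t
      proof -
        from t consider "t = pr k Ba" | "t \<in> ?S" using Ba(5) sa by blast
        then show ?thesis
        proof cases
          case 1
          obtain s where s: "s \<in> ents r3" "kap s = k" using condD(4)[OF E3] by blast
          then have "bset s \<subseteq> top_set (ents a)" using Z[OF s(1)] kS by simp
          then show ?thesis using 1 s Ba by (intro bexI[of _ s]) auto
        qed blast
      qed
      have 2: "(\<exists>t \<in> ents a. kap t = kap s) \<or> (\<exists>t \<in> ents a. kap s \<in> bset t \<and> bset s \<subseteq> bset t \<inter> elts (kap s))"
        if s: "s \<in> ents r3" for s
      proof (cases "kap s \<in> succ_set \<delta>")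
        case True
        then have "s \<in> ents a" using s sa unfolding stem_def by blast
        then show ?thesis by blast
      next
        case False
        have bs: "bset s \<subseteq> elts (kap s)" using ent_kap(4) condD(3)[OF E3 s] by blast
        show ?thesis using Z[OF s False] bs Ba(1-4) by (metis Int_subset_iff)
      qed
      have "ents_le (ents a) (ents r3)" unfolding ents_le_def using 1 2 by blast
      then show ?thesis using le_iff[OF ab(1) r3(1)] by simp
    qed
    have "top_set (ents \<zeta>2) \<subseteq> top_set (ents b)" using z2(3) za(3) tops'(2) Ad(4) by blast
    then have "ents_le (ents b) (ents \<zeta>2)" by (rule le_same_stem[OF Mg_cond[OF ab(2)] Mg_cond[OF z2(1)] sb])
    then have "magidor_le b \<zeta>2" using le_iff[OF ab(2) z2(1)] by simp
    then have "compat a b" unfolding compat_def using ar3 p3 r3(1) z2(1) by blast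
    then show False using ab(5) by blast
  qed
  then show ?thesis using r'(1) z2(1) rr' xz by blast
qed

text \<open>Equally coloured pairs would force \<open>D\<close>; below a condition of \<open>G\<close> deciding against \<open>D\<close>
  the colours therefore inject.\<close>

lemma cover:
  assumes S: "named S X" and dD: "df (\<lambda>e. D (e 0))" and noD: "\<not> (\<exists>r \<in> G. D r)"
    and dK: "df (\<lambda>e. K (e 0) (e 1) (e 2))" and Q: "vinj (elts qq) (elts k)" "qq \<in> V"
    and col: "\<And>x p. x \<in> X \<Longrightarrow> p \<in> G \<Longrightarrow> \<exists>r \<in> G. le p r \<and> (r, x) \<in> rel_of S \<and> (\<exists>q \<in> elts qq. K r x q)"
    and same: "\<And>r r' x x' q. (r, x) \<in> rel_of S \<Longrightarrow> (r', x') \<in> rel_of S \<Longrightarrow> K r x q \<Longrightarrow> K r' x' q \<Longrightarrow> x \<noteq> x' \<Longrightarrow>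
        \<exists>r''. le r r'' \<and> le r' r'' \<and> D r''"
  obtains Y where "X \<subseteq> Y" "Y \<subseteq> Range (rel_of S)" "vinj Y (elts k)"
proof -
  obtain r0 where r0: "r0 \<in> G" "\<And>q. le r0 q \<Longrightarrow> \<not> D q" using gen_decide[OF dD] noD by blast
  have r0V: "r0 \<in> V" using GP[OF r0(1)] Mset(2) MgV by blast
  have dK': "df (\<lambda>e. K (t e) (u e) (v e))" if "dt t" "dt u" "dt v" for t u v by (rule dfn_subst3[OF dK that])
  note SV = namedD(1)[OF S]
  let ?y = "\<lambda>x. \<exists>r \<in> elts Mset. le r0 r \<and> (r, x) \<in> rel_of S \<and> (\<exists>q \<in> elts qq. K r x q)"
  let ?Y = "{x \<in> Range (rel_of S). ?y x}"
  have Y: "inV ?Y" by (intro inV_sep inV_Domain SV dfn_intros dK' Mset LE r0V Q)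
  obtain F g where g: "g \<in> V" "inj_on F (elts qq)" "F ` elts qq \<subseteq> elts k"
    "\<And>x y. (x, y) \<in> rel_of g \<longleftrightarrow> x \<in> elts qq \<and> y = F x" by (rule vinjE[OF Q(1)]) (rule that)
  obtain \<rho> where rho: "\<rho> \<in> V" "\<And>x y. (x, y) \<in> rel_of \<rho> \<longleftrightarrow> x \<in> ?Y \<and> y \<in> elts k \<and>
      (\<exists>r \<in> elts Mset. le r0 r \<and> (r, x) \<in> rel_of S \<and> (\<exists>q \<in> elts qq. K r x q \<and> (q, y) \<in> rel_of g))"
  proof (rule rel_sep[OF Y inV_elts[OF kO(2)]])
    show "df (\<lambda>e. \<exists>r \<in> elts Mset. le r0 r \<and> (r, e 0) \<in> rel_of S \<and> (\<exists>q \<in> elts qq. K r (e 0) q \<and> (q, e 1) \<in> rel_of g))"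
      by (intro dfn_intros dK' Mset LE r0V Q SV g)
  qed (rule that)
  have "vinj ?Y (elts k)"
  proof (rule vinj_color[OF Y rho(1) kO(1) _ _ kO(2)])
    fix x assume x: "x \<in> ?Y"
    then obtain r q where r: "r \<in> elts Mset" "le r0 r" "(r, x) \<in> rel_of S" "q \<in> elts qq" "K r x q" by blast
    then have "(q, F q) \<in> rel_of g" "F q \<in> elts k" using g by blast+
    then show "\<exists>y \<in> elts k. (x, y) \<in> rel_of \<rho>" using rho(2) r x by blast
  next
    fix x x' y assume xy: "(x, y) \<in> rel_of \<rho>" "(x', y) \<in> rel_of \<rho>"
    obtain r q where r: "le r0 r" "(r, x) \<in> rel_of S" "K r x q" "(q, y) \<in> rel_of g" using xy(1) rho(2) by blast
    obtain r' q' where r': "le r0 r'" "(r', x') \<in> rel_of S" "K r' x' q'" "(q', y) \<in> rel_of g" using xy(2) rho(2) by blast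
    have "q \<in> elts qq" "q' \<in> elts qq" "F q = F q'" using r(4) r'(4) g(4) by auto
    then have "q = q'" using inj_onD[OF g(2)] by blast
    show "x = x'"
    proof (rule ccontr)
      assume "x \<noteq> x'"
      then obtain r'' where "le r r''" "D r''" using same[OF r(2) r'(2) r(3)] r'(3) \<open>q = q'\<close> by blast
      then show False using r0(2) le_trans[OF r(1)] by blast
    qed
  qed
  moreover have "X \<subseteq> ?Y"
  proof
    fix x assume x: "x \<in> X"
    obtain r where "r \<in> G" "le r0 r" "(r, x) \<in> rel_of S" "\<exists>q \<in> elts qq. K r x q" using col[OF x r0(1)] by blast
    then show "x \<in> ?Y" using GP by blast
  qed
  ultimately show thesis using that by blast
qed

section \<open>Codes for colours, covers of antichains and preservation of the successor
  cardinal\<close>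

lemma stem_of_in_power: assumes "p \<in> Mg" obtains \<delta> where "\<delta> \<in> elts k" "in_power 4 (succ_set \<delta>) (stem_of p)"
proof -
  obtain \<delta> where d: "\<delta> \<in> elts k" "\<And>t. t \<in> stem (ents p) \<Longrightarrow> kap t \<in> succ_set \<delta>"
    by (rule stem_bound[OF Mg_cond[OF assms]]) (rule that)
  then have "in_power 4 (succ_set \<delta>) (stem_of p)"
    using stem_in_power[OF Mg_cond[OF assms] subset_refl Ord_elt[OF kO(1)] _ stem_of(2)[OF assms]] by blast
  then show thesis using that d by blast
qed

lemma in_power_pair_bound:
  assumes "a \<in> V" "b \<in> V" "\<delta> \<in> elts k" "in_power n (succ_set \<delta>) a" "\<gamma> \<in> elts k" "in_power n (succ_set \<gamma>) b"
  shows "\<exists>\<delta> \<in> elts k. in_power (Suc (Suc n)) (succ_set \<delta>) (pr a b)"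
proof -
  have o: "Ord \<delta>" "Ord \<gamma>" using assms Ord_elt[OF kO(1)] by blast+
  consider "succ_set \<delta> \<subseteq> succ_set \<gamma>" | "succ_set \<gamma> \<subseteq> succ_set \<delta>"
    using Ord_linear[OF o] Ord_trans[OF o(1)] Ord_trans[OF o(2)] by blast
  then show ?thesis
  proof cases
    case 1
    then show ?thesis using in_power_pr[OF assms(1,2) in_power_mono[OF 1 assms(4)] assms(6)] assms(5) by blast
  next
    case 2
    then show ?thesis using in_power_pr[OF assms(1,2,4) in_power_mono[OF 2 assms(6)]] assms(3) by blast
  qed
qed

text \<open>Both colourings share one set of colours: level 6 contains the pairs of stems and, by
  cumulativity, the pairs of a stem and an ordinal.\<close>

lemma codes: obtains qq where "qq \<in> V" "vinj (elts qq) (elts k)"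
  "\<And>x \<delta>. x \<in> V \<Longrightarrow> \<delta> \<in> elts k \<Longrightarrow> in_power 6 (succ_set \<delta>) x \<Longrightarrow> x \<in> elts qq"
proof -
  obtain W where W: "nmeasure V k W" by (rule k_measure)
  interpret n: nmeasure V k W by (rule W)
  obtain qq where qq: "qq \<in> V" "elts qq = n.low_rank 6" using n.inV_low_rank[of 6] unfolding inV_def by blast
  show thesis
  proof (rule that[OF qq(1)])
    show "vinj (elts qq) (elts k)" unfolding qq(2) by (rule n.vinj_low_rank)
    show "x \<in> elts qq" if "x \<in> V" "\<delta> \<in> elts k" "in_power 6 (succ_set \<delta>) x" for x \<delta>
      unfolding qq(2) n.low_rank_def using that by blast
  qed
qed

abbreviation "Qf \<equiv> quotient_forcing Mg (app \<pi>) H"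

text \<open>\<open>?D r\<close> says that \<open>r\<close> forces two distinct members into the
  antichain and a common extension of them into the quotient, which no condition of \<open>G\<close>
  can do. The colours \<open>?K\<close> of \<open>x\<close> at \<open>r\<close> are the good pairs
  of stems of extensions of \<open>r\<close> and of \<open>x\<close>; two members with a common
  colour lead to a condition satisfying \<open>?D\<close>.\<close>

lemma antichain_cover:
  assumes a: "a \<in> N" "antichain Qf magidor_le (elts a)"
  obtains Y where "elts a \<subseteq> Y" "vinj Y (elts k)"
proof -
  have aQ: "elts a \<subseteq> Qf" using a(2) unfolding antichain_def by blast
  then have aM: "elts a \<subseteq> Mg" unfolding quotient_forcing_def by blast
  obtain S where S: "named S (elts a)" using N_nameable[OF a(1) inV_Mg aM] unfolding nameable_def by blast
  note SV = namedD(1)[OF S]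
  obtain ST where ST: "ST \<in> V" "\<And>p l. (p, l) \<in> rel_of ST \<longleftrightarrow> p \<in> Mg \<and> l = stem_of p" using ST_exists by blast
  obtain CM where CM: "CM \<in> V" "\<And>r \<zeta>. (r, \<zeta>) \<in> rel_of CM \<longleftrightarrow> r \<in> Mg \<and> \<zeta> \<in> Mg \<and> compat r \<zeta>" using CM_exists by blast
  obtain PL where PL: "PL \<in> V" "\<And>\<zeta> p. (\<zeta>, p) \<in> rel_of PL \<longleftrightarrow> \<zeta> \<in> Mg \<and> p \<in> Mg \<and> leP (app \<pi> \<zeta>) (app \<pi> p)"
    using PL_exists by blast
  obtain qq where qq: "qq \<in> V" "vinj (elts qq) (elts k)"
    "\<And>x \<delta>. x \<in> V \<Longrightarrow> \<delta> \<in> elts k \<Longrightarrow> in_power 6 (succ_set \<delta>) x \<Longrightarrow> x \<in> elts qq" by (rule codes) (rule that)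
  let ?D = "\<lambda>r. \<exists>x \<in> elts Mset. \<exists>x' \<in> elts Mset. x \<noteq> x' \<and> (r, x) \<in> rel_of S \<and> (r, x') \<in> rel_of S \<and>
      (\<exists>z \<in> elts Mset. le x z \<and> le x' z \<and> (z, r) \<in> rel_of PL)"
  let ?K = "\<lambda>r x q. \<exists>r' \<in> elts Mset. \<exists>\<zeta>' \<in> elts Mset. le r r' \<and> le x \<zeta>' \<and> (\<exists>l \<in> V. \<exists>m \<in> V. (r', l) \<in> rel_of ST \<and>
      (\<zeta>', m) \<in> rel_of ST \<and> q = pr l m \<and> (\<forall>c \<in> elts Mset. \<forall>d \<in> elts Mset. (c, l) \<in> rel_of ST \<longrightarrow> (d, m) \<in> rel_of ST \<longrightarrow>
      (c, d) \<in> rel_of CM))"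
  have K: "?K r x q \<longleftrightarrow> (\<exists>r' \<in> Mg. \<exists>\<zeta>' \<in> Mg. le r r' \<and> le x \<zeta>' \<and> q = pr (stem_of r') (stem_of \<zeta>') \<and> good (stem_of r') (stem_of \<zeta>'))" for r x q
  proof -
    have 1: "(\<forall>c \<in> Mg. \<forall>d \<in> Mg. c \<in> Mg \<and> l = stem_of c \<longrightarrow> d \<in> Mg \<and> m = stem_of d \<longrightarrow> c \<in> Mg \<and> d \<in> Mg \<and> compat c d) \<longleftrightarrow> good l m"
      for l m unfolding good_def by auto
    have 2: "(\<exists>l \<in> V. \<exists>m \<in> V. (r' \<in> Mg \<and> l = stem_of r') \<and> (\<zeta>' \<in> Mg \<and> m = stem_of \<zeta>') \<and> q = pr l m \<and> good l m) \<longleftrightarrow>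
        q = pr (stem_of r') (stem_of \<zeta>') \<and> good (stem_of r') (stem_of \<zeta>')" if "r' \<in> Mg" "\<zeta>' \<in> Mg" for r' \<zeta>'
      using that stem_of(1) by auto
    show ?thesis unfolding Mset(2) ST(2) CM(2) 1 by (intro bex_cong refl conj_cong 2; assumption)
  qed
  show thesis
  proof (rule cover[OF S, where D = ?D and K = ?K and qq = qq])
    show "df (\<lambda>e. ?D (e 0))" by (intro dfn_intros Mset SV LE PL)
    show "df (\<lambda>e. ?K (e 0) (e 1) (e 2))" by (intro dfn_intros Mset ST LE CM)
    show "\<not> (\<exists>r \<in> G. ?D r)"
    proof
      assume "\<exists>r \<in> G. ?D r"
      then obtain r x x' z where r: "r \<in> G" "x \<noteq> x'" "(r, x) \<in> rel_of S" "(r, x') \<in> rel_of S" "z \<in> Mg"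
        "le x z" "le x' z" "(z, r) \<in> rel_of PL" unfolding Mset(2) by blast
      have xa: "x \<in> elts a" "x' \<in> elts a" using namedD(5)[OF S r(1)] r(3,4) by blast+
      have "app \<pi> z \<in> H" unfolding Hdef induced_filter_def using r(1,8) PL(2) pi_P by blast
      then have "z \<in> Qf" using r(5) unfolding quotient_forcing_def by blast
      then show False using a(2) xa r(2,6,7) LE(2) unfolding antichain_def by blast
    qed
    show "vinj (elts qq) (elts k)" "qq \<in> V" by (rule qq)+
  next
    fix x p assume x: "x \<in> elts a" and p: "p \<in> G"
    have xM: "x \<in> Mg" "app \<pi> x \<in> H" using x aQ unfolding quotient_forcing_def by blast+
    then obtain g where g: "g \<in> G" "leP (app \<pi> x) (app \<pi> g)" unfolding Hdef induced_filter_def by blast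
    obtain p1 where p1: "p1 \<in> G" "le p p1" "le g p1" using G_dir[OF p g(1)] by blast
    obtain r where r: "r \<in> G" "le p1 r" "(r, x) \<in> rel_of S" using named_above[OF S x p1(1)] by blast
    have M: "g \<in> Mg" "r \<in> Mg" using GP g(1) r(1) Mset(2) by blast+
    have gr: "magidor_le g r" using le_trans[OF p1(3) r(2)] LE(2) by blast
    \<comment> \<open>As \<open>g\<close> lies below \<open>r'\<close> and projects above
      \<open>x\<close>, the conditions \<open>r'\<close> and \<open>x\<close> are themselves the
      required extensions.\<close>
    have "compat r' x" if r': "r' \<in> Mg" "magidor_le r r'" for r'
    proof -
      have "magidor_le g r'" by (rule magidor_le_trans[OF M r'(1) gr r'(2)])
      then have "leP (app \<pi> x) (app \<pi> r')"
        using leP_trans[OF pi_P[OF xM(1)] pi_P[OF M(1)] pi_P[OF r'(1)] g(2) pi_mono[OF M(1) r'(1)]] by blast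
      then show ?thesis unfolding compat_def using magidor_le_refl r'(1) xM(1) by blast
    qed
    from key[OF M(2) xM(1) this] obtain r' \<zeta>' where k': "r' \<in> Mg" "\<zeta>' \<in> Mg" "magidor_le r r'" "magidor_le x \<zeta>'"
      "good (stem_of r') (stem_of \<zeta>')" by blast
    let ?q = "pr (stem_of r') (stem_of \<zeta>')"
    have "?K r x ?q" unfolding K using k' M(2) xM(1) LE(2) by blast
    moreover have "?q \<in> elts qq"
    proof -
      obtain d1 where d1: "d1 \<in> elts k" "in_power 4 (succ_set d1) (stem_of r')" by (rule stem_of_in_power[OF k'(1)]) (rule that)
      obtain d2 where d2: "d2 \<in> elts k" "in_power 4 (succ_set d2) (stem_of \<zeta>')" by (rule stem_of_in_power[OF k'(2)]) (rule that)
      have v: "stem_of r' \<in> V" "stem_of \<zeta>' \<in> V" using stem_of(1) k' by blast+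
      obtain d where "d \<in> elts k" "in_power (Suc (Suc 4)) (succ_set d) ?q" using in_power_pair_bound[OF v d1 d2] by blast
      then show ?thesis using qq(3)[of ?q d] pr_is_pair(2)[OF v] by (simp add: eval_nat_numeral)
    qed
    ultimately show "\<exists>r \<in> G. le p r \<and> (r, x) \<in> rel_of S \<and> (\<exists>q \<in> elts qq. ?K r x q)"
      using r le_trans[OF p1(2) r(2)] by blast
  next
    fix r r' x x' q assume s: "(r, x) \<in> rel_of S" "(r', x') \<in> rel_of S" "?K r x q" "?K r' x' q" "x \<noteq> x'"
    obtain r1 z1 where 1: "r1 \<in> Mg" "z1 \<in> Mg" "le r r1" "le x z1" "q = pr (stem_of r1) (stem_of z1)" "good (stem_of r1) (stem_of z1)"
      using s(3) unfolding K by blast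
    obtain r2 z2 where 2: "r2 \<in> Mg" "z2 \<in> Mg" "le r' r2" "le x' z2" "q = pr (stem_of r2) (stem_of z2)"
      using s(4) unfolding K by blast
    have "stem_of r1 = stem_of r2 \<and> stem_of z1 = stem_of z2"
      using pr_inject[OF stem_of(1)[OF 1(1)] stem_of(1)[OF 1(2)] stem_of(1)[OF 2(1)] stem_of(1)[OF 2(2)]] 1(5) 2(5) by simp
    then have eq: "stem (ents r1) = stem (ents r2)" "stem (ents z1) = stem (ents z2)"
      using stem_of_eq 1 2 by blast+
    obtain r3 where r3: "r3 \<in> Mg" "magidor_le r1 r3" "magidor_le r2 r3" "stem (ents r3) = stem (ents r1)"
      by (rule join[OF 1(1) 2(1) eq(1)]) (rule that)
    obtain z3 where z3: "z3 \<in> Mg" "magidor_le z1 z3" "magidor_le z2 z3" "stem (ents z3) = stem (ents z1)"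
      by (rule join[OF 1(2) 2(2) eq(2)]) (rule that)
    have "stem_of r3 = stem_of r1" "stem_of z3 = stem_of z1" using stem_of_eq r3(1,4) z3(1,4) 1(1,2) by blast+
    then have "compat r3 z3" using 1(6) r3(1) z3(1) unfolding good_def by blast
    \<comment> \<open>\<open>z4\<close> is a common extension of both members of the antichain, and
      \<open>r4\<close> forces it into the quotient.\<close>
    then obtain r4 z4 where 4: "r4 \<in> Mg" "z4 \<in> Mg" "magidor_le r3 r4" "magidor_le z3 z4" "leP (app \<pi> z4) (app \<pi> r4)"
      unfolding compat_def by blast
    have L: "le r1 r3" "le r2 r3" "le z1 z3" "le z2 z3" "le r3 r4" "le z3 z4" using LE(2) r3 z3 1 2 4 by blast+
    have rr: "le r r4" "le r' r4" "le x z4" "le x' z4"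
      using le_trans[OF 1(3) le_trans[OF L(1,5)]] le_trans[OF 2(3) le_trans[OF L(2,5)]]
        le_trans[OF 1(4) le_trans[OF L(3,6)]] le_trans[OF 2(4) le_trans[OF L(4,6)]] by blast+
    have "(r4, x) \<in> rel_of S" "(r4, x') \<in> rel_of S" using namedD(3)[OF S] s(1,2) rr by blast+
    moreover have "x \<in> Mg" "x' \<in> Mg" using rr LE(2) by blast+
    moreover have "(z4, r4) \<in> rel_of PL" using PL(2) 4 by blast
    ultimately have "?D r4" using s(5) rr 4(2) Mset(2) by blast
    then show "\<exists>r''. le r r'' \<and> le r' r'' \<and> ?D r''" using rr by blast
  next
    fix Y assume "elts a \<subseteq> Y" "vinj Y (elts k)"
    then show thesis by (rule that)
  qed
qed

text \<open>A pair \<open>(x, y)\<close> in the graph of the bijection is coloured by the stem of a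
  condition forcing it together with the code of \<open>y\<close>. Different pairs with equal
  colours share \<open>y\<close> and differ in \<open>x\<close>; the join of their two conditions
  forces both, against injectivity. So a small set of \<open>V\<close> covers the graph, and hence
  \<open>\<nu>\<close>.\<close>

lemma function_cover:
  assumes n: "\<nu> \<in> V" "\<mu> \<in> V" "vinj (elts \<mu>) (elts k)" and eq: "equipotent N \<nu> \<mu>"
  shows "vinj (elts \<nu>) (elts k)"
proof -
  obtain f where f: "f \<in> N" "is_function f (elts \<nu>)" "bij_betw (app f) (elts \<nu>) (elts \<mu>)"
    using eq unfolding equipotent_def by blast
  have nV: "x \<in> V" if "x \<in> elts \<nu>" for x using transV[OF n(1) that] .
  have mV: "y \<in> V" if "y \<in> elts \<mu>" for y using transV[OF n(2) that] .
  have fm: "app f x \<in> elts \<mu>" if "x \<in> elts \<nu>" for x using f(3) that unfolding bij_betw_def by blast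
  have fe: "z \<in> elts f \<longleftrightarrow> (\<exists>x \<in> elts \<nu>. z = pr x (app f x))" for z
  proof
    assume z: "z \<in> elts f"
    then obtain x y where xy: "is_pair z x y" using f(2) unfolding is_function_def by blast
    then have r: "(x, y) \<in> rel_of f" using z unfolding rel_of_def by blast
    then have x: "x \<in> elts \<nu>" using f(2) unfolding is_function_def by blast
    then have "y = app f x" using function_rel[OF f(2) x] r by blast
    then show "\<exists>x \<in> elts \<nu>. z = pr x (app f x)" using is_pair_iff[OF nV mV] x fm xy by blast
  next
    assume "\<exists>x \<in> elts \<nu>. z = pr x (app f x)"
    then obtain x where x: "x \<in> elts \<nu>" "z = pr x (app f x)" by blast
    then have "(x, app f x) \<in> rel_of f" using function_rel[OF f(2)] by blast
    then show "z \<in> elts f" using rel_iff[OF nV mV] x fm by blast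
  qed
  let ?Z = "{pr x y | x y. x \<in> elts \<nu> \<and> y \<in> elts \<mu>}"
  have Z: "inV ?Z" by (intro inV_times inV_elts n)
  have fZ: "elts f \<subseteq> ?Z" using fe fm by blast
  obtain S where S: "named S (elts f)" using N_nameable[OF f(1) Z fZ] unfolding nameable_def by blast
  note SV = namedD(1)[OF S]
  obtain ST where ST: "ST \<in> V" "\<And>p l. (p, l) \<in> rel_of ST \<longleftrightarrow> p \<in> Mg \<and> l = stem_of p" using ST_exists by blast
  obtain qq where qq: "qq \<in> V" "vinj (elts qq) (elts k)"
    "\<And>x \<delta>. x \<in> V \<Longrightarrow> \<delta> \<in> elts k \<Longrightarrow> in_power 6 (succ_set \<delta>) x \<Longrightarrow> x \<in> elts qq" by (rule codes) (rule that)
  obtain J j where j: "j \<in> V" "inj_on J (elts \<mu>)" "J ` elts \<mu> \<subseteq> elts k"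
    "\<And>x y. (x, y) \<in> rel_of j \<longleftrightarrow> x \<in> elts \<mu> \<and> y = J x" by (rule vinjE[OF n(3)]) (rule that)
  let ?D = "\<lambda>r. \<exists>x \<in> V. \<exists>y \<in> V. \<exists>x' \<in> V. \<exists>y' \<in> V. (r, pr x y) \<in> rel_of S \<and> (r, pr x' y') \<in> rel_of S \<and> x \<noteq> x' \<and> y = y'"
  let ?K = "\<lambda>r z q. \<exists>x \<in> V. \<exists>y \<in> V. \<exists>c \<in> V. \<exists>l \<in> V. z = pr x y \<and> (y, c) \<in> rel_of j \<and> (r, l) \<in> rel_of ST \<and> q = pr l c"
  obtain Y where Y: "elts f \<subseteq> Y" "vinj Y (elts k)"
  proof (rule cover[OF S, where D = ?D and K = ?K and qq = qq])
    show "df (\<lambda>e. ?D (e 0))" by (intro dfn_intros SV)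
    show "df (\<lambda>e. ?K (e 0) (e 1) (e 2))" by (intro dfn_intros ST j)
    show "\<not> (\<exists>r \<in> G. ?D r)"
    proof
      assume "\<exists>r \<in> G. ?D r"
      then obtain r x y x' where r: "r \<in> G" "x \<in> V" "y \<in> V" "x' \<in> V" "(r, pr x y) \<in> rel_of S"
        "(r, pr x' y) \<in> rel_of S" "x \<noteq> x'" by blast
      have "pr x y \<in> elts f" "pr x' y \<in> elts f" using namedD(5)[OF S r(1)] r(5,6) by blast+
      then obtain u u' where u: "u \<in> elts \<nu>" "pr x y = pr u (app f u)" "u' \<in> elts \<nu>" "pr x' y = pr u' (app f u')"
        using fe by blast
      then have "x = u \<and> y = app f u" "x' = u' \<and> y = app f u'" using pr_inject r(2-4) nV mV fm by metis+
      then show False using u f(3) r(7) unfolding bij_betw_def inj_on_def by metis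
    qed
    show "vinj (elts qq) (elts k)" "qq \<in> V" by (rule qq)+
  next
    fix z p assume z: "z \<in> elts f" and p: "p \<in> G"
    obtain r where r: "r \<in> G" "le p r" "(r, z) \<in> rel_of S" using named_above[OF S z p] by blast
    have rM: "r \<in> Mg" using GP[OF r(1)] Mset(2) by blast
    obtain x where x: "x \<in> elts \<nu>" "z = pr x (app f x)" using fe z by blast
    let ?y = "app f x"
    have y: "?y \<in> elts \<mu>" "J ?y \<in> elts k" using fm[OF x(1)] j(3) by blast+
    have v: "stem_of r \<in> V" "J ?y \<in> V" using stem_of(1)[OF rM] y(2) transV[OF kO(2)] by blast+
    let ?q = "pr (stem_of r) (J ?y)"
    have "?K r z ?q" using x nV mV[OF y(1)] v j(4) y(1) ST(2) rM by blast
    moreover have "?q \<in> elts qq"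
    proof -
      obtain d1 where d1: "d1 \<in> elts k" "in_power 4 (succ_set d1) (stem_of r)" by (rule stem_of_in_power[OF rM]) (rule that)
      have tr: "elts u \<subseteq> succ_set (J ?y)" if "u \<in> succ_set (J ?y)" for u
        using that Ord_trans[OF Ord_elt[OF kO(1) y(2)]] by blast
      \<comment> \<open>The ordinal \<open>J ?y\<close> has level 0 over its successor; it is raised
        to level 4 to match the stem.\<close>
      have "in_power 4 (succ_set (J ?y)) (J ?y)" using in_power_le[of "succ_set (J ?y)" 0 4 "J ?y"] tr by simp
      then obtain d where "d \<in> elts k" "in_power (Suc (Suc 4)) (succ_set d) ?q" using in_power_pair_bound[OF v d1 y(2)] by blast
      then show ?thesis using qq(3)[of ?q d] pr_is_pair(2)[OF v] by (simp add: eval_nat_numeral)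
    qed
    ultimately show "\<exists>r \<in> G. le p r \<and> (r, z) \<in> rel_of S \<and> (\<exists>q \<in> elts qq. ?K r z q)" using r by blast
  next
    fix r r' z z' q assume s: "(r, z) \<in> rel_of S" "(r', z') \<in> rel_of S" "?K r z q" "?K r' z' q" "z \<noteq> z'"
    obtain x y c l where 1: "x \<in> V" "y \<in> V" "c \<in> V" "l \<in> V" "z = pr x y" "(y, c) \<in> rel_of j" "(r, l) \<in> rel_of ST" "q = pr l c"
      using s(3) by blast
    obtain x' y' c' l' where 2: "x' \<in> V" "y' \<in> V" "c' \<in> V" "l' \<in> V" "z' = pr x' y'" "(y', c') \<in> rel_of j"
      "(r', l') \<in> rel_of ST" "q = pr l' c'" using s(4) by blast
    have lc: "l = l'" "c = c'" using pr_inject[OF 1(4,3) 2(4,3)] 1(8) 2(8) by simp_all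
    have "J y = J y'" "y \<in> elts \<mu>" "y' \<in> elts \<mu>" using 1(6) 2(6) lc(2) j(4) by auto
    then have yy: "y = y'" using inj_onD[OF j(2)] by blast
    then have xx: "x \<noteq> x'" using s(5) 1(5) 2(5) by blast
    have M: "r \<in> Mg" "r' \<in> Mg" "stem_of r = stem_of r'" using 1(7) 2(7) lc(1) ST(2) by auto
    obtain r3 where r3: "r3 \<in> Mg" "magidor_le r r3" "magidor_le r' r3"
      by (rule join[OF M(1,2)]) (use M stem_of_eq that in blast)+
    have L: "le r r3" "le r' r3" using LE(2) M r3 by blast+
    have "(r3, pr x y) \<in> rel_of S" "(r3, pr x' y) \<in> rel_of S"
      using namedD(3)[OF S s(1) L(1)] namedD(3)[OF S s(2) L(2)] 1(5) 2(5) yy by simp_all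
    then have "?D r3" using xx 1(1,2) 2(1) by blast
    then show "\<exists>r''. le r r'' \<and> le r' r'' \<and> ?D r''" using L by blast
  next
    fix Y assume "elts f \<subseteq> Y" "vinj Y (elts k)"
    then show thesis by (rule that)
  qed
  obtain F g where g: "g \<in> V" "inj_on F Y" "F ` Y \<subseteq> elts k" "\<And>x y. (x, y) \<in> rel_of g \<longleftrightarrow> x \<in> Y \<and> y = F x"
    by (rule vinjE[OF Y(2)]) (rule that)
  \<comment> \<open>\<open>Y\<close> may contain several pairs with first coordinate
    \<open>x\<close>, so \<open>x\<close> can have several codes; \<open>vinj_color\<close> takes
    the least, and different \<open>x\<close> have no code in common.\<close>
  obtain \<rho> where rho: "\<rho> \<in> V" "\<And>x c. (x, c) \<in> rel_of \<rho> \<longleftrightarrow> x \<in> elts \<nu> \<and> c \<in> elts k \<and>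
      (\<exists>y \<in> V. (pr x y, c) \<in> rel_of g)"
  proof (rule rel_sep[OF inV_elts[OF n(1)] inV_elts[OF kO(2)]])
    show "df (\<lambda>e. \<exists>y \<in> V. (pr (e 0) y, e 1) \<in> rel_of g)" by (intro dfn_intros g)
  qed (rule that)
  show ?thesis
  proof (rule vinj_color[OF inV_elts[OF n(1)] rho(1) kO(1) _ _ kO(2)])
    fix x assume x: "x \<in> elts \<nu>"
    then have "pr x (app f x) \<in> Y" using Y(1) fe by blast
    then have "(pr x (app f x), F (pr x (app f x))) \<in> rel_of g" "F (pr x (app f x)) \<in> elts k" using g(3,4) by blast+
    then show "\<exists>c \<in> elts k. (x, c) \<in> rel_of \<rho>" using rho(2) x mV[OF fm[OF x]] by blast
  next
    fix x x' c assume xx: "x \<in> elts \<nu>" "x' \<in> elts \<nu>" "(x, c) \<in> rel_of \<rho>" "(x', c) \<in> rel_of \<rho>"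
    obtain y where y: "y \<in> V" "pr x y \<in> Y" "c = F (pr x y)" using xx(3) rho(2) g(4) by blast
    obtain y' where y': "y' \<in> V" "pr x' y' \<in> Y" "c = F (pr x' y')" using xx(4) rho(2) g(4) by blast
    have "pr x y = pr x' y'" using inj_onD[OF g(2)] y y' by simp
    then show "x = x'" using pr_inject[of x y x' y'] nV xx(1,2) y(1) y'(1) by simp
  qed
qed

text \<open>The witness for \<kappa>^+ is the least ordinal of \<open>V\<close> that has no
  injection of \<open>V\<close> into \<open>k\<close>. By \<open>function_cover\<close> it remains a
  cardinal in \<open>N\<close>, and by \<open>vinj_equipotent\<close> each smaller ordinal is
  equipotent in \<open>N\<close> to one that is at most \<open>k\<close>; the latter also measures
  the antichains.\<close>

lemma quotient_succ_cc: "succ_cc_in N k Qf magidor_le"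
proof -
  obtain \<theta> where th: "\<theta> \<in> V" "Ord \<theta>" "\<not> vinj (elts \<theta>) (elts k)" by (rule no_vinj_ordinal[OF kO(2)]) (rule that)
  obtain \<nu> where nu: "\<nu> \<in> V \<and> Ord \<nu> \<and> \<not> vinj (elts \<nu>) (elts k)"
    "\<And>c. c \<in> elts \<nu> \<Longrightarrow> \<not> (c \<in> V \<and> Ord c \<and> \<not> vinj (elts c) (elts k))"
    using mem_least[of "\<lambda>\<nu>. \<nu> \<in> V \<and> Ord \<nu> \<and> \<not> vinj (elts \<nu>) (elts k)" \<theta>] th by metis
  have nV: "\<nu> \<in> V" "Ord \<nu>" using nu(1) by auto
  have below: "vinj (elts c) (elts k)" "c \<in> V" if "c \<in> elts \<nu>" for c
    using nu(2)[OF that] transV[OF nV(1) that] Ord_elt[OF nV(2) that] by blast+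
  have card: "is_cardinal N \<nu>" unfolding is_cardinal_def
    using V_sub_N[OF nV(1)] nV(2) function_cover[OF nV(1)] below nu(1) by blast
  have kn: "k \<in> elts \<nu>"
  proof (rule ccontr)
    assume "k \<notin> elts \<nu>"
    then have "elts \<nu> \<subseteq> elts k" using Ord_linear[OF kO(1) nV(2)] Ord_trans[OF kO(1)] by blast
    then show False using vinj_sub[OF inV_elts[OF nV(1)]] nu(1) by blast
  qed
  have small: "\<exists>\<mu>. has_card N a \<mu> \<and> (\<mu> = k \<or> \<mu> \<in> elts k)" if a: "a \<in> N" "elts a \<subseteq> Y" "vinj Y (elts k)" for a Y
  proof -
    obtain \<beta> where b: "\<beta> = k \<or> \<beta> \<in> elts k" "equipotent N a \<beta>"
      by (rule vinj_equipotent[OF a(3) kO a(1,2)]) (rule that)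
    obtain \<mu> where m: "(\<mu> = k \<or> \<mu> \<in> elts k) \<and> equipotent N a \<mu>"
      "\<And>c. c \<in> elts \<mu> \<Longrightarrow> \<not> ((c = k \<or> c \<in> elts k) \<and> equipotent N a c)"
      using mem_least[of "\<lambda>\<mu>. (\<mu> = k \<or> \<mu> \<in> elts k) \<and> equipotent N a \<mu>" \<beta>] b by metis
    have "\<mu> \<in> V" "Ord \<mu>" using m(1) kO transV[OF kO(2)] Ord_elt[OF kO(1)] by blast+
    moreover have "\<not> equipotent N a c" if "c \<in> elts \<mu>" for c using m that Ord_trans[OF kO(1)] by blast
    ultimately have "has_card N a \<mu>" unfolding has_card_def using V_sub_N m(1) by blast
    then show ?thesis using m(1) by blast
  qed
  have "is_succ_card N k \<nu>" unfolding is_succ_card_def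
  proof (intro conjI allI impI)
    show "k \<epsilon> \<nu>" using kn by simp
    fix \<mu> assume m: "is_cardinal N \<mu> \<and> k \<epsilon> \<mu>"
    then have mu: "\<mu> \<in> N" "Ord \<mu>" "\<forall>c \<in> elts \<mu>. \<not> equipotent N \<mu> c" "k \<in> elts \<mu>" unfolding is_cardinal_def by auto
    show "\<nu> = \<mu> \<or> \<nu> \<epsilon> \<mu>"
    proof (rule ccontr)
      assume "\<not> ?thesis"
      then have "\<mu> \<in> elts \<nu>" using Ord_linear[OF nV(2) mu(2)] by simp
      then obtain \<beta> where "has_card N \<mu> \<beta>" "\<beta> = k \<or> \<beta> \<in> elts k"
        using small[OF mu(1) subset_refl] below(1) by blast
      then have "equipotent N \<mu> \<beta>" "\<beta> \<in> elts \<mu>" unfolding has_card_def using mu(4) Ord_trans[OF mu(2)] by blast+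
      then show False using mu(3) by blast
    qed
  qed (rule card)
  moreover have "\<exists>\<mu>. has_card N a \<mu> \<and> \<mu> \<epsilon> \<nu>" if a: "a \<in> N" "antichain Qf magidor_le (elts a)" for a
  proof -
    obtain Y where "elts a \<subseteq> Y" "vinj Y (elts k)" by (rule antichain_cover[OF a]) (rule that)
    then obtain \<mu> where "has_card N a \<mu>" "\<mu> = k \<or> \<mu> \<in> elts k" using small[OF a(1)] by blast
    then show ?thesis using kn Ord_trans[OF nV(2)] by auto
  qed
  ultimately show ?thesis unfolding succ_cc_in_def by blast
qed

end

theorem theorem5p14:
  fixes V N G H :: "'s::set_universe set"
    and \<kappa> U P R \<pi> :: 's
  assumes "model_ZFC V"
    and "coherent_sequence V \<kappa> U"
    and "P \<in> V" and "R \<in> V"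
    and "preorder_forcing (elts P) (\<lambda>x y. (x, y) \<in> rel_of R)"
    and "\<pi> \<in> V" and "is_function \<pi> (Magidor V \<kappa> U)"
    and "is_projection (Magidor V \<kappa> U) magidor_le (elts P) (\<lambda>x y. (x, y) \<in> rel_of R) (app \<pi>)"
    and "generic_filter V (Magidor V \<kappa> U) magidor_le G"
    and "H = induced_filter (elts P) (\<lambda>x y. (x, y) \<in> rel_of R) (app \<pi>) G"
    and "is_generic_extension V (Magidor V \<kappa> U) G N"
  shows "succ_cc_in N \<kappa> (quotient_forcing (Magidor V \<kappa> U) (app \<pi>) H) magidor_le"
proof -
  interpret magidor_projection V \<kappa> U P R \<pi> G N H by unfold_locales (fact assms)+
  show ?thesis by (rule quotient_succ_cc)
qed

end
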